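(* Consider the one-dimensional wave equation $$ \begin{cases} z_{tt}(t,x)=z_{xx}(t,x)-a(x)\sigma(z_t(t,x)), & (t,x)\in\mathbb{R}_+\times[0,1],\\ z(t,0)=z(t,1)=0, & t\in\mathbb{R}_+,\\ z(0,x)=z_0(x),\quad z_t(0,x)=z_1(x), & x\in[0,1], \end{cases} \qquad (\mathrm{W}) $$ where $a:[0,1]\to\mathbb{R}_+$ is continuous, not identically zero, and bounded by a positive constant $a_\infty$, and $\sigma$ is a nonlinear damping function. Then the following statements hold. 1. Let $R>0$. For any $p\in[2,\infty)$, there exist two positive constants $K:=K(R)$ and $\beta:=\beta(R)$ such that, for all initial conditions $(z_0,z_1)\in H_\infty(0,1)$ satisfying $\|(z_0,z_1)\|_{H_\infty(0,1)}\le R$, the solution of (W) satisfies $$\|(z(t,\cdot),z_t(t,\cdot))\|_{H_p(0,1)}\le Ke^{-\beta t}\|(z_0,z_1)\|_{H_p(0,1)},\quad\forall t\ge 0.$$ 2. Let $p\in(2,\infty)$ and $R>0$. Suppose moreover that $\sigma$ is monotone and linearly bounded, i.e., there exists a positive constant $m$ such that $|\sigma(s)|\le m|s|$ for all $s\in\mathbb{R}$. Then, for any $q$ satisfying $2\le q<p$, there exist two positive constants $K:=K(R)$ and $\beta:=\beta(R)$ such that, for all initial conditions $(z_0,z_1)\in H_p(0,1)\cap D_2(0,1)$ satisfying $\|(z_0,z_1)\|_{D_2(0,1)}\le R$, the solution of (W) satisfies $$\|(z(t,\cdot),z_t(t,\cdot))\|_{H_q(0,1)}\le Ke^{-\beta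 t}\|(z_0,z_1)\|_{H_q(0,1)},\quad\forall t\ge 0.$$
   Context: A function $\sigma:\mathbb{R}\to\mathbb{R}$ is called a nonlinear damping function if: (1) it is locally Lipschitz and odd; (2) $\sigma(s)s>0$ for every $s\in\mathbb{R}\setminus\{0\}$; (3) $\sigma$ is differentiable at $0$ with $\sigma'(0)=C_1$ for some $C_1>0$. Monotone means $(\sigma(s_1)-\sigma(s_2))(s_1-s_2)\ge 0$ for all $s_1,s_2\in\mathbb{R}$. For $p\in[2,\infty]$, $H_p(0,1):=W_0^{1,p}(0,1)\times L^p(0,1)$ and $D_p(0,1):=\left(W^{2,p}(0,1)\cap W_0^{1,p}(0,1)\right)\times W_0^{1,p}(0,1)$, where $W^{1,p}_0(0,1)$ consists of the functions in $W^{1,p}(0,1)$ vanishing at $0$ and $1$. Norms: $\|(f,g)\|_{H_p(0,1)}:=\|f'\|_{L^p(0,1)}+\|g\|_{L^p(0,1)}$ and $\|(f,g)\|_{D_p(0,1)}:=\|f''\|_{L^p(0,1)}+\|g'\|_{L^p(0,1)}$. The solution of (W) is the unique (weak) solution: for $(z_0,z_1)\in H_\infty(0,1)$ it is unique in $L^\infty(\mathbb{R}_+;W^{1,\infty}(0,1))\cap W^{1,\infty}(\mathbb{R}_+;L^\infty(0,1))$; for $\sigma$ linearly bounded and $(z_0,z_1)\in H_p(0,1)$ with $p\in[2,\infty)$ it is unique in $C(\mathbb{R}_+;W^{1,p}(0,1))\cap C^1(\mathbb{R}_+;L^p(0,1))$. *)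

theory Defs
  imports "HOL-Analysis.Analysis" "HOL-Probability.Essential_Supremum"
begin

text \<open>
  Functions on the interval are total functions on the reals of which only the values on
  \<open>(0,1)\<close> (on \<open>[0,1]\<close> for continuous representatives) matter. The values of a function of time
  at negative times are irrelevant as well.
\<close>

definition nonlinear_damping :: "(real \<Rightarrow> real) \<Rightarrow> bool" where
  "nonlinear_damping \<sigma> \<longleftrightarrow>
     (\<forall>x. \<exists>u>0. \<exists>L. L-lipschitz_on (cball x u) \<sigma>) \<and>
     (\<forall>s. \<sigma> (- s) = - \<sigma> s) \<and>
     (\<forall>s. s \<noteq> 0 \<longrightarrow> \<sigma> s * s > 0) \<and>
     (\<exists>C1>0. (\<sigma> has_real_derivative C1) (at 0))"


section \<open>Lebesgue and Sobolev spaces on the unit interval\<close>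

abbreviation leb01 :: "real measure" where
  "leb01 \<equiv> lebesgue_on {0<..<1}"

definition Lp_space :: "ereal \<Rightarrow> (real \<Rightarrow> real) set" where
  "Lp_space p = {f \<in> borel_measurable leb01.
     if p = \<infinity> then esssup leb01 (\<lambda>x. ereal \<bar>f x\<bar>) < \<infinity>
     else integrable leb01 (\<lambda>x. \<bar>f x\<bar> powr real_of_ereal p)}"

text \<open>The norm is meaningful only on \<^const>\<open>Lp_space\<close> (elsewhere it may take a default value).\<close>

definition Lp_norm :: "ereal \<Rightarrow> (real \<Rightarrow> real) \<Rightarrow> real" where
  "Lp_norm p f =
     (if p = \<infinity> then real_of_ereal (esssup leb01 (\<lambda>x. ereal \<bar>f x\<bar>))
      else (LINT x|leb01. \<bar>f x\<bar> powr real_of_ereal p) powr (1 / real_of_ereal p))"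

definition pairing :: "(real \<Rightarrow> real) \<Rightarrow> (real \<Rightarrow> real) \<Rightarrow> real" where
  "pairing f g = (LINT x|leb01. f x * g x)"

text \<open>Smooth functions with compact support in the open interval.\<close>

definition test_functions :: "(real \<Rightarrow> real) set" where
  "test_functions = {\<phi>. (\<forall>k. (deriv ^^ k) \<phi> differentiable_on UNIV) \<and>
                        closure {x. \<phi> x \<noteq> 0} \<subseteq> {0<..<1}}"

definition is_weak_deriv :: "(real \<Rightarrow> real) \<Rightarrow> (real \<Rightarrow> real) \<Rightarrow> bool" where
  "is_weak_deriv f g \<longleftrightarrow> (\<forall>\<phi>\<in>test_functions. pairing f (deriv \<phi>) = - pairing g \<phi>)"

text \<open>
  A weak derivative is unique up to null sets, and none of the notions below depends on the
  chosen representative.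
\<close>

definition wderiv :: "(real \<Rightarrow> real) \<Rightarrow> real \<Rightarrow> real" where
  "wderiv f = (SOME g. g \<in> Lp_space 1 \<and> is_weak_deriv f g)"

definition W1p :: "ereal \<Rightarrow> (real \<Rightarrow> real) set" where
  "W1p p = {f \<in> Lp_space p. \<exists>g\<in>Lp_space p. is_weak_deriv f g}"

definition W1p_norm :: "ereal \<Rightarrow> (real \<Rightarrow> real) \<Rightarrow> real" where
  "W1p_norm p f = Lp_norm p f + Lp_norm p (wderiv f)"

definition W2p :: "ereal \<Rightarrow> (real \<Rightarrow> real) set" where
  "W2p p = {f \<in> W1p p. wderiv f \<in> W1p p}"

text \<open>
  Elements of the space with zero boundary values are given by their continuous representative,
  for which the values at the end points make sense.
\<close>

definition W01p :: "ereal \<Rightarrow> (real \<Rightarrow> real) set" where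
  "W01p p = {f \<in> W1p p. continuous_on {0..1} f \<and> f 0 = 0 \<and> f 1 = 0}"

definition H_space :: "ereal \<Rightarrow> ((real \<Rightarrow> real) \<times> (real \<Rightarrow> real)) set" where
  "H_space p = W01p p \<times> Lp_space p"

definition D_space :: "ereal \<Rightarrow> ((real \<Rightarrow> real) \<times> (real \<Rightarrow> real)) set" where
  "D_space p = (W2p p \<inter> W01p p) \<times> W01p p"

definition H_norm :: "ereal \<Rightarrow> (real \<Rightarrow> real) \<times> (real \<Rightarrow> real) \<Rightarrow> real" where
  "H_norm p u = Lp_norm p (wderiv (fst u)) + Lp_norm p (snd u)"

definition D_norm :: "ereal \<Rightarrow> (real \<Rightarrow> real) \<times> (real \<Rightarrow> real) \<Rightarrow> real" where
  "D_norm p u = Lp_norm p (wderiv (wderiv (fst u))) + Lp_norm p (wderiv (snd u))"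


section \<open>Functions of time with values in spaces of functions on the interval\<close>

text \<open>
  The space of essentially bounded functions of time with values in \<open>L\<^sup>\<infinity>(0,1)\<close> is understood, as
  usual for the wave equation, as the space of jointly measurable essentially bounded functions.
  Strong measurability into \<open>L\<^sup>\<infinity>(0,1)\<close> would be too restrictive: it already fails for travelling
  waves with discontinuous profile.
\<close>

definition Linf_Linf :: "(real \<Rightarrow> real \<Rightarrow> real) set" where
  "Linf_Linf = {u. (\<lambda>(t, x). u t x) \<in> borel_measurable (lebesgue_on ({0..} \<times> {0<..<1})) \<and>
     (\<exists>M. AE t in lebesgue_on {0..}. u t \<in> Lp_space \<infinity> \<and> Lp_norm \<infinity> (u t) \<le> M)}"

definition Linf_W1inf :: "(real \<Rightarrow> real \<Rightarrow> real) set" where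
  "Linf_W1inf = {u \<in> Linf_Linf.
     \<exists>M. AE t in lebesgue_on {0..}. u t \<in> W1p \<infinity> \<and> W1p_norm \<infinity> (u t) \<le> M}"

text \<open>
  \<open>v\<close> is the derivative of \<open>u\<close> in \<open>W\<^sup>1\<^sup>,\<^sup>\<infinity>(\<real>\<^sub>+; L\<^sup>\<infinity>(0,1))\<close>: \<open>u\<close> is the (Lipschitz continuous)
  primitive \<open>u(t) = u(0) + \<integral>\<^sub>0\<^sup>t v(s) ds\<close>, the integral being taken in the weak sense.
\<close>

definition W1inf_Linf_deriv :: "(real \<Rightarrow> real \<Rightarrow> real) \<Rightarrow> (real \<Rightarrow> real \<Rightarrow> real) \<Rightarrow> bool" where
  "W1inf_Linf_deriv u v \<longleftrightarrow> u \<in> Linf_Linf \<and> v \<in> Linf_Linf \<and>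
     (\<forall>\<phi>\<in>test_functions. \<forall>t\<ge>0.
        pairing (u t) \<phi> = pairing (u 0) \<phi> + (LINT s|lebesgue_on {0..t}. pairing (v s) \<phi>))"

definition C0_Lp :: "ereal \<Rightarrow> (real \<Rightarrow> real \<Rightarrow> real) set" where
  "C0_Lp p = {u. \<forall>t\<ge>0. u t \<in> Lp_space p \<and>
     ((\<lambda>s. Lp_norm p (\<lambda>x. u s x - u t x)) \<longlongrightarrow> 0) (at t within {0..})}"

definition C0_W1p :: "ereal \<Rightarrow> (real \<Rightarrow> real \<Rightarrow> real) set" where
  "C0_W1p p = {u. \<forall>t\<ge>0. u t \<in> W1p p \<and>
     ((\<lambda>s. W1p_norm p (\<lambda>x. u s x - u t x)) \<longlongrightarrow> 0) (at t within {0..})}"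

text \<open>\<open>v\<close> is the derivative of \<open>u\<close> in \<open>C\<^sup>1(\<real>\<^sub>+; L\<^sup>p(0,1))\<close>.\<close>

definition C1_Lp_deriv :: "ereal \<Rightarrow> (real \<Rightarrow> real \<Rightarrow> real) \<Rightarrow> (real \<Rightarrow> real \<Rightarrow> real) \<Rightarrow> bool" where
  "C1_Lp_deriv p u v \<longleftrightarrow> u \<in> C0_Lp p \<and> v \<in> C0_Lp p \<and>
     (\<forall>t\<ge>0. ((\<lambda>s. Lp_norm p (\<lambda>x. (u s x - u t x) / (s - t) - v t x)) \<longlongrightarrow> 0) (at t within {0..}))"


section \<open>Weak solutions of the damped wave equation\<close>

text \<open>
  \<open>z\<^sub>t\<^sub>t = z\<^sub>x\<^sub>x - a \<sigma>(z\<^sub>t)\<close> in the sense of distributions on the interval, integrated from time \<open>0\<close>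
  to \<open>t\<close>. Since the identity is required for every \<open>t\<close>, it determines \<open>zt t\<close> up to a null set for
  every (and not only almost every) time.
\<close>

definition weak_wave_eq ::
  "(real \<Rightarrow> real) \<Rightarrow> (real \<Rightarrow> real) \<Rightarrow> (real \<Rightarrow> real \<Rightarrow> real) \<Rightarrow> (real \<Rightarrow> real \<Rightarrow> real) \<Rightarrow> bool" where
  "weak_wave_eq a \<sigma> z zt \<longleftrightarrow>
     (\<forall>\<phi>\<in>test_functions. \<forall>t\<ge>0.
        pairing (zt t) \<phi> = pairing (zt 0) \<phi> +
          (LINT s|lebesgue_on {0..t}.
             pairing (z s) (deriv (deriv \<phi>)) - pairing (\<lambda>x. a x * \<sigma> (zt s x)) \<phi>))"

text \<open>
  \<open>z\<close> is a weak solution with time derivative \<open>zt\<close>; membership of the state in \<^const>\<open>H_space\<close>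
  contains the Dirichlet boundary conditions.
\<close>

definition wave_solution ::
  "ereal \<Rightarrow> (real \<Rightarrow> real) \<Rightarrow> (real \<Rightarrow> real) \<Rightarrow> (real \<Rightarrow> real) \<Rightarrow> (real \<Rightarrow> real) \<Rightarrow>
   (real \<Rightarrow> real \<Rightarrow> real) \<Rightarrow> (real \<Rightarrow> real \<Rightarrow> real) \<Rightarrow> bool" where
  "wave_solution p a \<sigma> z0 z1 z zt \<longleftrightarrow>
     (if p = \<infinity> then z \<in> Linf_W1inf \<and> W1inf_Linf_deriv z zt
      else z \<in> C0_W1p p \<and> C1_Lp_deriv p z zt) \<and>
     (\<forall>t\<ge>0. (z t, zt t) \<in> H_space p) \<and>
     (\<forall>x\<in>{0..1}. z 0 x = z0 x) \<and>
     (AE x in leb01. zt 0 x = z1 x) \<and>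
     weak_wave_eq a \<sigma> z zt"

end

theory Submission
  imports Defs "HOL-Real_Asymp.Real_Asymp"
begin

text \<open>
  Put \<open>U(t,y) = z\<^sub>x(t,y) - z\<^sub>t(t,y)\<close> and \<open>U(t,-y) = z\<^sub>x(t,y) + z\<^sub>t(t,y)\<close> for \<open>0 < y < 1\<close>. The boundary conditions
  make \<open>U\<close> a solution of the transport equation \<open>U\<^sub>t + U\<^sub>y = F\<close> on the circle of length \<open>2\<close>, where
  \<open>F\<close> is the odd extension of \<open>a \<sigma>(z\<^sub>t)\<close> and \<open>z\<^sub>t = (U(-y) - U(y)) / 2\<close>. For weak solutions this is
  read off the Fourier coefficients. For convex \<open>\<Phi>\<close> the integral of \<open>\<Phi>(U)\<close> does not increase.
  With \<open>\<Phi>\<close> vanishing on \<open>[-R,R]\<close> this is a maximum principle, so that \<open>\<sigma>(s)/s\<close> may be taken to be bounded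
  above and below by positive constants.

  With \<open>\<Phi>(u) = |u|\<^sup>p\<close>, the energy \<open>E\<close> loses over one period at least a multiple of \<open>D\<close>, the integral of \<open>a |z\<^sub>t|\<^sup>p\<close>.
  Conversely, up to an error controlled by \<open>D\<close>, the solution is the free wave \<open>U(0,y-t)\<close>, hence the
  \<open>L\<^sup>p\<close> distance of \<open>U(0,\<cdot>)\<close> to its translates by \<open>2y\<close> is controlled by \<open>D\<close> in the mean over \<open>y\<close> in the
  damping region. Differences and multiples of such translations reach all translations, and as
  \<open>U(0,\<cdot>)\<close> has mean zero its norm is bounded by the average distance to its translates. So \<open>E(0) \<le> C D\<close>, and \<open>E\<close>
  contracts by a fixed factor over each period.

  For data in \<open>D\<^sub>2\<close> the functions \<open>z\<^sub>x(0,\<cdot>)\<close> and \<open>z\<^sub>t(0,\<cdot>)\<close> are bounded, and the same argument applies.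
\<close>

section \<open>Integrals over intervals\<close>

text \<open>Convex functionals of \<open>U\<close> and translations act alike for all exponents, and
  all constants come out explicitly: they depend on the initial data only through the bounds for the
  damping on [-R,R]. The translations have length \<open>2 * y\<close> because \<open>V s y\<close>
  compares \<open>U\<close> at the mirror points \<open>- y\<close> and \<open>y\<close>; both
  characteristics traced back to time 0 end at \<open>- y - s\<close> and \<open>y - s\<close>, and
  \<open>s\<close> running over a full period sweeps the circle. Constants are invisible to
  translations, so a nonzero mean of \<open>U\<close> could not be observed; the mean is a multiple
  of the integral of z_x and vanishes by the boundary conditions. The main obstacle is that the
  equation may be tested only with functions supported inside the interval, while the unfolding to
  the circle requires sines. A second one is measurability in time: integrals over time need a
  version of z_t that is jointly measurable.\<close>

definition ivl :: "real \<Rightarrow> real \<Rightarrow> real measure" where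
  "ivl a b = density lborel (indicator {a..b})"

text \<open>A density keeps the Borel sets of the whole line for every interval, so one
  measurability fact about a function serves all intervals and their products.\<close>

lemma sets_ivl [simp, measurable_cong]: "sets (ivl a b) = sets borel"
  by (simp add: ivl_def)

lemma space_ivl [simp]: "space (ivl a b) = UNIV"
  by (simp add: ivl_def)

lemma AE_ivl: "(AE x in ivl a b. P x) \<longleftrightarrow> (AE x in lborel. a \<le> x \<and> x \<le> b \<longrightarrow> P x)"
  unfolding ivl_def by (subst AE_density) (auto simp: indicator_def cong: conj_cong)

lemma nn_integral_ivl:
  "f \<in> borel_measurable borel \<Longrightarrow> (\<integral>\<^sup>+x. f x \<partial>ivl a b) = (\<integral>\<^sup>+x. f x * indicator {a..b} x \<partial>lborel)"
  unfolding ivl_def by (subst nn_integral_density) (auto simp: mult.commute)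

lemma ivl_ennreal: "ivl a b = density lborel (\<lambda>x. ennreal (indicator {a..b} x))"
  unfolding ivl_def by (rule density_cong) (auto simp: indicator_def)

lemma integrable_ivl:
  fixes f :: "real \<Rightarrow> real"
  assumes "f \<in> borel_measurable borel"
  shows "integrable (ivl a b) f \<longleftrightarrow> integrable lborel (\<lambda>x. indicator {a..b} x * f x)"
  unfolding ivl_ennreal using assms by (subst integrable_density) auto

lemma integral_ivl:
  fixes f :: "real \<Rightarrow> real"
  assumes "f \<in> borel_measurable borel"
  shows "integral\<^sup>L (ivl a b) f = (\<integral>x. indicator {a..b} x * f x \<partial>lborel)"
  unfolding ivl_ennreal using assms by (subst integral_density) auto

lemma emeasure_ivl: "emeasure (ivl a b) A = emeasure lborel (A \<inter> {a..b})" if "A \<in> sets borel"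
  unfolding ivl_def using that
  by (subst emeasure_density) (auto simp: indicator_inter_arith[symmetric] Int_commute
      nn_integral_indicator[symmetric] simp del: nn_integral_indicator)

lemma finite_measure_ivl: "finite_measure (ivl a b)"
  by standard (simp add: emeasure_ivl emeasure_lborel_Icc_eq)

interpretation ivl: finite_measure "ivl a b" for a b by (rule finite_measure_ivl)
interpretation ivl2: pair_sigma_finite "ivl a b" "ivl c d" for a b c d ..

lemma measure_ivl: "a \<le> b \<Longrightarrow> measure (ivl a b) UNIV = b - a"
  by (simp add: measure_def emeasure_ivl)

lemma integrable_ivl_bounded:
  fixes f :: "real \<Rightarrow> real"
  assumes "f \<in> borel_measurable borel" "\<And>x. a \<le> x \<Longrightarrow> x \<le> b \<Longrightarrow> \<bar>f x\<bar> \<le> B"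
  shows "integrable (ivl a b) f"
  using assms by (intro ivl.integrable_const_bound[of _ B]) (auto simp: AE_ivl)

lemma integrable_ivl_subset:
  fixes f :: "real \<Rightarrow> real"
  assumes "integrable (ivl a b) f" "a \<le> c" "d \<le> b"
  shows "integrable (ivl c d) f"
proof -
  have [measurable]: "f \<in> borel_measurable borel"
    using borel_measurable_integrable[OF assms(1)] by simp
  have "integrable lborel (\<lambda>x. indicator {c..d} x * (indicator {a..b} x * f x))"
    using assms(1) integrable_mult_indicator[of "{c..d}" lborel "\<lambda>x. indicator {a..b} x * f x"]
    by (simp add: integrable_ivl)
  also have "(\<lambda>x. indicator {c..d} x * (indicator {a..b} x * f x)) = (\<lambda>x. indicator {c..d} x * f x)"
    using assms(2,3) by (auto simp: indicator_def)
  finally show ?thesis by (simp add: integrable_ivl)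
qed

lemma borel_measurable_integrable_ivl:
  fixes f :: "real \<Rightarrow> real"
  shows "integrable (ivl a b) f \<Longrightarrow> f \<in> borel_measurable borel"
  using borel_measurable_integrable[of "ivl a b" f] by simp

lemma integral_ivl_eq_0:
  fixes f :: "real \<Rightarrow> real"
  assumes "b \<le> a" "f \<in> borel_measurable borel" shows "integral\<^sup>L (ivl a b) f = 0"
proof -
  have "AE x in lborel. x \<noteq> a"  by (rule AE_lborel_singleton)
  then have "(\<integral>x. f x \<partial>ivl a b) = (\<integral>x. 0 \<partial>ivl a b)"
    using assms by (intro integral_cong_AE) (auto simp: AE_ivl)
  then show ?thesis by simp
qed

lemma integral_ivl_combine:
  fixes f :: "real \<Rightarrow> real"
  assumes "integrable (ivl a c) f" "a \<le> b" "b \<le> c"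
  shows "integral\<^sup>L (ivl a c) f = integral\<^sup>L (ivl a b) f + integral\<^sup>L (ivl b c) f"
proof -
  have [measurable]: "f \<in> borel_measurable borel" by (rule borel_measurable_integrable_ivl[OF assms(1)])
  have i: "integrable lborel (\<lambda>x. indicator {a..b} x * f x)" "integrable lborel (\<lambda>x. indicator {b..c} x * f x)"
    using integrable_ivl_subset[OF assms(1), of a b] integrable_ivl_subset[OF assms(1), of b c] assms
    by (simp_all add: integrable_ivl)
  have "AE x in lborel. x \<noteq> b"  by (rule AE_lborel_singleton)
  then have "AE x in lborel. indicator {a..c} x * f x = indicator {a..b} x * f x + indicator {b..c} x * f x"
    by eventually_elim (use assms(2,3) in \<open>auto simp: indicator_def\<close>)
  then have "(\<integral>x. indicator {a..c} x * f x \<partial>lborel) = (\<integral>x. indicator {a..b} x * f x + indicator {b..c} x * f x \<partial>lborel)"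
    by (intro integral_cong_AE) auto
  then show ?thesis using i by (simp add: integral_ivl)
qed

lemma integral_ivl_nonneg_mono:
  fixes f :: "real \<Rightarrow> real"
  assumes "integrable (ivl a b) f" "a \<le> c" "d \<le> b" "\<And>x. 0 \<le> f x"
  shows "integral\<^sup>L (ivl c d) f \<le> integral\<^sup>L (ivl a b) f"
proof -
  have [measurable]: "f \<in> borel_measurable borel" by (rule borel_measurable_integrable_ivl[OF assms(1)])
  show ?thesis using assms integrable_ivl_subset[OF assms(1-3)]
    by (auto simp: integral_ivl integrable_ivl indicator_def intro!: integral_mono)
qed

lemma integral_ivl_sum:
  fixes f :: "real \<Rightarrow> real"
  assumes "integrable (ivl 0 (real n * d)) f" "0 \<le> d"
  shows "integral\<^sup>L (ivl 0 (real n * d)) f = (\<Sum>i<n. integral\<^sup>L (ivl (real i * d) (real (Suc i) * d)) f)"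
  using assms
proof (induction n)
  case 0
  then show ?case by (auto intro!: integral_ivl_eq_0 dest: borel_measurable_integrable_ivl)
next
  case (Suc n)
  have le: "real n * d \<le> real (Suc n) * d" using Suc.prems by (intro mult_right_mono) auto
  have "integrable (ivl 0 (real n * d)) f"
    using le by (intro integrable_ivl_subset[OF Suc.prems(1)]) auto
  with Suc have "integral\<^sup>L (ivl 0 (real n * d)) f = (\<Sum>i<n. integral\<^sup>L (ivl (real i * d) (real (Suc i) * d)) f)"
    by simp
  with integral_ivl_combine[OF Suc.prems(1), of "real n * d"] le Suc.prems show ?case by simp
qed

section \<open>Primitives of integrable functions: continuity, chain rule, product rule\<close>

lemma continuous_on_integral_ivl:
  fixes h :: "real \<Rightarrow> real"
  assumes "integrable (ivl a T) h"
  shows "continuous_on {a..T} (\<lambda>s. integral\<^sup>L (ivl a s) h)"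
proof -
  have [measurable]: "h \<in> borel_measurable borel" by (rule borel_measurable_integrable_ivl[OF assms])
  have "isCont (\<lambda>s. \<integral>x. indicator {a..s} x * (indicator {a..T} x * h x) \<partial>lborel) s" for s
    unfolding continuous_at_sequentially
  proof (intro allI impI)
    fix X assume X: "X \<longlonglongrightarrow> s"
    have "(\<lambda>n. \<integral>x. indicator {a..X n} x * (indicator {a..T} x * h x) \<partial>lborel) \<longlonglongrightarrow>
      (\<integral>x. indicator {a..s} x * (indicator {a..T} x * h x) \<partial>lborel)"
    proof (rule integral_dominated_convergence[where w="\<lambda>x. norm (indicator {a..T} x * h x)"])
      show "integrable lborel (\<lambda>x. norm (indicator {a..T} x * h x))"
        using assms by (intro integrable_norm) (simp add: integrable_ivl)
      have "AE x in lborel. x \<noteq> s" by (rule AE_lborel_singleton)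
      then show "AE x in lborel. (\<lambda>n. indicator {a..X n} x * (indicator {a..T} x * h x)) \<longlonglongrightarrow>
         indicator {a..s} x * (indicator {a..T} x * h x)"
      proof eventually_elim
        case (elim x)
        have "\<forall>\<^sub>F n in sequentially. (indicator {a..X n} x :: real) = indicator {a..s} x"
        proof (cases "x < s")
          case True
          with X have "\<forall>\<^sub>F n in sequentially. x < X n" by (simp add: order_tendsto_iff)
          then show ?thesis by eventually_elim (use True in \<open>auto simp: indicator_def\<close>)
        next
          case False
          with X elim have "\<forall>\<^sub>F n in sequentially. X n < x" by (simp add: order_tendsto_iff)
          then show ?thesis by eventually_elim (use False elim in \<open>auto simp: indicator_def\<close>)
        qed
        then have "\<forall>\<^sub>F n in sequentially. indicator {a..X n} x * (indicator {a..T} x * h x) =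
           indicator {a..s} x * (indicator {a..T} x * h x)"
          by eventually_elim simp
        then show ?case by (simp add: tendsto_eventually)
      qed
      show "AE x in lborel. norm (indicator {a..X n} x * (indicator {a..T} x * h x)) \<le> norm (indicator {a..T} x * h x)" for n
        by (auto simp: indicator_def)
    qed auto
    then show "((\<lambda>s. \<integral>x. indicator {a..s} x * (indicator {a..T} x * h x) \<partial>lborel) \<circ> X) \<longlonglongrightarrow>
      (\<integral>x. indicator {a..s} x * (indicator {a..T} x * h x) \<partial>lborel)" by (simp add: o_def)
  qed
  then have "continuous_on {a..T} (\<lambda>s. \<integral>x. indicator {a..s} x * (indicator {a..T} x * h x) \<partial>lborel)"
    by (simp add: continuous_at_imp_continuous_on)
  then show ?thesis
    by (rule continuous_on_eq) (auto simp: integral_ivl indicator_def intro!: Bochner_Integration.integral_cong)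
qed


text \<open>\<open>Z\<close> is only absolutely continuous, and its differentiability almost
  everywhere is avoided. On a fine grid the mean value theorem for \<open>\<Phi>\<close> and the
  intermediate value theorem for \<open>Z\<close> write each increment of
  \<open>\<Phi> (Z s)\<close> as \<open>\<phi> (Z \<xi>)\<close> times an increment of
  \<open>Z\<close>, that is, as the integral of a step function times \<open>h\<close>. The sum
  telescopes to the same value on every grid, and dominated convergence refines the grid.\<close>

lemma chain_rule_primitive:
  fixes h \<Phi> \<phi> :: "real \<Rightarrow> real"
  assumes h: "integrable (ivl 0 t) h" and "0 \<le> t"
    and \<Phi>: "\<And>u. (\<Phi> has_real_derivative \<phi> u) (at u)" and \<phi>: "continuous_on UNIV \<phi>"
    and Z: "\<And>s. 0 \<le> s \<Longrightarrow> s \<le> t \<Longrightarrow> Z s = z0 + integral\<^sup>L (ivl 0 s) h"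
    and [measurable]: "Z \<in> borel_measurable borel"
  shows "integrable (ivl 0 t) (\<lambda>s. \<phi> (Z s) * h s)"
    and "\<Phi> (Z t) - \<Phi> z0 = (\<integral>s. \<phi> (Z s) * h s \<partial>ivl 0 t)"
proof -
  have [measurable]: "h \<in> borel_measurable borel" by (rule borel_measurable_integrable_ivl[OF h])
  have [measurable]: "\<phi> \<in> borel_measurable borel" by (rule borel_measurable_continuous_onI[OF \<phi>])
  have contZ: "continuous_on {0..t} Z"
    by (rule continuous_on_eq[where f="\<lambda>s. z0 + integral\<^sup>L (ivl 0 s) h"])
      (auto intro!: continuous_intros continuous_on_integral_ivl h simp: Z)
  then have "compact (Z ` {0..t})" by (intro compact_continuous_image) auto
  then obtain A where A: "\<And>s. 0 \<le> s \<Longrightarrow> s \<le> t \<Longrightarrow> \<bar>Z s\<bar> \<le> A"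
    using compact_imp_bounded bounded_iff by (metis (no_types, lifting) atLeastAtMost_iff imageI real_norm_def)
  have "compact (\<phi> ` {-A..A})"
    by (intro compact_continuous_image continuous_on_subset[OF \<phi>]) auto
  then obtain B where B: "\<And>u. \<bar>u\<bar> \<le> A \<Longrightarrow> \<bar>\<phi> u\<bar> \<le> B"
    using compact_imp_bounded bounded_iff by (metis (no_types, lifting) abs_le_iff atLeastAtMost_iff imageI minus_le_iff real_norm_def)
  have inth: "integrable (ivl 0 t) (\<lambda>s. B * \<bar>h s\<bar>)" using h by auto
  show int: "integrable (ivl 0 t) (\<lambda>s. \<phi> (Z s) * h s)"
  proof (rule Bochner_Integration.integrable_bound[OF inth])
    show "AE s in ivl 0 t. norm (\<phi> (Z s) * h s) \<le> norm (B * \<bar>h s\<bar>)"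
      unfolding AE_ivl
    proof (intro AE_I2 impI)
      fix s :: real assume s: "0 \<le> s \<and> s \<le> t"
      have "\<bar>\<phi> (Z s)\<bar> \<le> B" using A B s by auto
      then have "\<bar>\<phi> (Z s)\<bar> * \<bar>h s\<bar> \<le> B * \<bar>h s\<bar>" by (rule mult_right_mono) auto
      then show "norm (\<phi> (Z s) * h s) \<le> norm (B * \<bar>h s\<bar>)"
        by (auto simp: abs_mult intro: order_trans[OF _ mult_right_mono[OF abs_ge_self]])
    qed
  qed simp
  show "\<Phi> (Z t) - \<Phi> z0 = (\<integral>s. \<phi> (Z s) * h s \<partial>ivl 0 t)"
  proof (cases "t = 0")
    case True
    then show ?thesis using Z[of 0] by (simp add: integral_ivl_eq_0)
  next
    case False
    with \<open>0 \<le> t\<close> have "t > 0" by simp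
    \<comment> \<open>The grid has \<open>Suc n\<close> cells, which keeps the mesh meaningful for n
      = 0.\<close>
    define d where "d n = t / real (Suc n)" for n
    have d_pos: "d n > 0" for n using \<open>t > 0\<close> by (simp add: d_def)
    have dn: "real (Suc n) * d n = t" for n by (simp add: d_def)
    have grid: "0 \<le> real i * d n" "real (Suc i) * d n \<le> t" "real i * d n \<le> t" if "i < Suc n" for i n
    proof -
      show "0 \<le> real i * d n" using d_pos[of n] by simp
      show "real (Suc i) * d n \<le> t" using d_pos[of n] that dn[of n]
        by (metis Suc_leI less_imp_le mult_right_mono of_nat_le_iff)
      then show "real i * d n \<le> t" using d_pos[of n] by (simp add: algebra_simps)
    qed
    have "\<exists>\<xi>. real i * d n \<le> \<xi> \<and> \<xi> \<le> real (Suc i) * d n \<and>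
       \<Phi> (Z (real (Suc i) * d n)) - \<Phi> (Z (real i * d n)) = \<phi> (Z \<xi>) * (Z (real (Suc i) * d n) - Z (real i * d n))"
      if i: "i < Suc n" for i n
    proof -
      define l r where "l = real i * d n" and "r = real (Suc i) * d n"
      have lr: "l \<le> r" "0 \<le> l" "r \<le> t" using grid[OF i] d_pos[of n] unfolding l_def r_def by (auto simp: algebra_simps)
      have c: "continuous_on {l..r} Z" using lr by (intro continuous_on_subset[OF contZ]) auto
      show ?thesis unfolding l_def[symmetric] r_def[symmetric]
      proof (cases "Z l" "Z r" rule: linorder_cases)
        case less
        \<comment> \<open>The mean value theorem gives an intermediate value of \<open>Z\<close>,
          not a point; the intermediate value theorem turns it into \<open>Z x\<close> with
          \<open>x\<close> in the cell.\<close>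
        from MVT2[OF less, of \<Phi> \<phi>] \<Phi> obtain z where z: "Z l < z" "z < Z r" "\<Phi> (Z r) - \<Phi> (Z l) = (Z r - Z l) * \<phi> z" by auto
        with IVT'[of Z l z r] c lr obtain x where "l \<le> x" "x \<le> r" "Z x = z" by auto
        with z show "\<exists>\<xi>. l \<le> \<xi> \<and> \<xi> \<le> r \<and> \<Phi> (Z r) - \<Phi> (Z l) = \<phi> (Z \<xi>) * (Z r - Z l)" by (auto simp: mult.commute)
      next
        case equal
        then show "\<exists>\<xi>. l \<le> \<xi> \<and> \<xi> \<le> r \<and> \<Phi> (Z r) - \<Phi> (Z l) = \<phi> (Z \<xi>) * (Z r - Z l)" using lr by auto
      next
        case greater
        from MVT2[OF greater, of \<Phi> \<phi>] \<Phi> obtain z where z: "Z r < z" "z < Z l" "\<Phi> (Z l) - \<Phi> (Z r) = (Z l - Z r) * \<phi> z" by auto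
        with IVT2'[of Z r z l] c lr obtain x where "l \<le> x" "x \<le> r" "Z x = z" by auto
        with z show "\<exists>\<xi>. l \<le> \<xi> \<and> \<xi> \<le> r \<and> \<Phi> (Z r) - \<Phi> (Z l) = \<phi> (Z \<xi>) * (Z r - Z l)"
          by (intro exI[of _ x]) (auto simp: algebra_simps)
      qed
    qed
    note ex\<xi> = this
    define \<xi> where "\<xi> n i = (SOME \<xi>. real i * d n \<le> \<xi> \<and> \<xi> \<le> real (Suc i) * d n \<and>
       \<Phi> (Z (real (Suc i) * d n)) - \<Phi> (Z (real i * d n)) = \<phi> (Z \<xi>) * (Z (real (Suc i) * d n) - Z (real i * d n)))" for n i
    have \<xi>: "real i * d n \<le> \<xi> n i \<and> \<xi> n i \<le> real (Suc i) * d n \<and>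
       \<Phi> (Z (real (Suc i) * d n)) - \<Phi> (Z (real i * d n)) = \<phi> (Z (\<xi> n i)) * (Z (real (Suc i) * d n) - Z (real i * d n))"
      if "i < Suc n" for n i
      unfolding \<xi>_def by (rule someI_ex[OF ex\<xi>[OF that]])
    define \<theta> where "\<theta> n s = \<phi> (Z (\<xi> n (nat \<lfloor>s / d n\<rfloor>)))" for n s
    have [measurable]: "\<theta> n \<in> borel_measurable borel" for n
      unfolding \<theta>_def by measurable
    have idx: "nat \<lfloor>s / d n\<rfloor> < Suc n" "real (nat \<lfloor>s / d n\<rfloor>) * d n \<le> s" "s \<le> real (Suc (nat \<lfloor>s / d n\<rfloor>)) * d n"
      if "0 \<le> s" "s < t" for s n
    proof -
      have 1: "s / d n < real (Suc n)" using that dn[of n] d_pos[of n] by (simp add: divide_less_eq)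
      have 2: "0 \<le> s / d n" using that d_pos[of n] by simp
      show "nat \<lfloor>s / d n\<rfloor> < Suc n" using 1 2 by linarith
      have "real (nat \<lfloor>s / d n\<rfloor>) \<le> s / d n" using 2 by linarith
      then show "real (nat \<lfloor>s / d n\<rfloor>) * d n \<le> s" using d_pos[of n] by (simp add: le_divide_eq)
      have "s / d n \<le> real (Suc (nat \<lfloor>s / d n\<rfloor>))" using 2 by linarith
      then show "s \<le> real (Suc (nat \<lfloor>s / d n\<rfloor>)) * d n" using d_pos[of n] by (simp add: divide_le_eq)
    qed
    have \<xi>t: "0 \<le> \<xi> n i \<and> \<xi> n i \<le> t" if "i < Suc n" for n i
      using grid[OF that] \<xi>[OF that] by linarith
    have \<theta>B: "\<bar>\<theta> n s\<bar> \<le> B" if "0 \<le> s" "s < t" for s n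
      unfolding \<theta>_def using A B \<xi>t idx(1) that by auto
    \<comment> \<open>The end point \<open>t\<close> is left out because its cell index would be
      \<open>Suc n\<close>.\<close>
    have aet: "AE s in ivl 0 t. 0 \<le> s \<and> s < t"
      using AE_lborel_singleton[of t] by (auto simp: AE_ivl)
    have bnd: "AE s in ivl 0 t. norm (\<theta> n s * h s) \<le> B * \<bar>h s\<bar>" for n
      using aet by eventually_elim (use \<theta>B in \<open>auto simp: abs_mult intro!: mult_right_mono\<close>)
    have int\<theta>: "integrable (ivl 0 t) (\<lambda>s. \<theta> n s * h s)" for n
    proof (rule Bochner_Integration.integrable_bound[OF inth])
      show "AE s in ivl 0 t. norm (\<theta> n s * h s) \<le> norm (B * \<bar>h s\<bar>)"
        using bnd[of n] by eventually_elim auto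
    qed simp
    have eq: "(\<integral>s. \<theta> n s * h s \<partial>ivl 0 t) = \<Phi> (Z t) - \<Phi> z0" for n
    proof -
      have "(\<integral>s. \<theta> n s * h s \<partial>ivl 0 t) = (\<Sum>i<Suc n. \<integral>s. \<theta> n s * h s \<partial>ivl (real i * d n) (real (Suc i) * d n))"
        using integral_ivl_sum[of "Suc n" "d n"] int\<theta>[of n] d_pos[of n] dn[of n] by simp
      also have "\<dots> = (\<Sum>i<Suc n. \<Phi> (Z (real (Suc i) * d n)) - \<Phi> (Z (real i * d n)))"
      proof (rule sum.cong[OF refl])
        fix i assume "i \<in> {..<Suc n}"
        then have i: "i < Suc n" by simp
        define l r where "l = real i * d n" and "r = real (Suc i) * d n"
        have lr: "l \<le> r" "0 \<le> l" "r \<le> t" using grid[OF i] d_pos[of n] unfolding l_def r_def by (auto simp: algebra_simps)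
        have "AE s in ivl l r. l \<le> s \<and> s < r"
          using AE_lborel_singleton[of r] by (auto simp: AE_ivl)
        then have ae: "AE s in ivl l r. \<theta> n s * h s = \<phi> (Z (\<xi> n i)) * h s"
        proof eventually_elim
          case (elim s)
          then have "real i \<le> s / d n" "s / d n < real (Suc i)"
            using d_pos[of n] unfolding l_def r_def by (auto simp: le_divide_eq divide_less_eq)
          then have "nat \<lfloor>s / d n\<rfloor> = i" by (auto simp: floor_eq_iff nat_eq_iff intro!: eq_nat_nat_iff)
          then show ?case by (simp add: \<theta>_def)
        qed
        have "(\<integral>s. \<theta> n s * h s \<partial>ivl l r) = (\<integral>s. \<phi> (Z (\<xi> n i)) * h s \<partial>ivl l r)"
          by (rule integral_cong_AE) (use ae in auto)
        also have "\<dots> = \<phi> (Z (\<xi> n i)) * (Z r - Z l)"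
          using integral_ivl_combine[of 0 r h l] lr Z[of r] Z[of l] integrable_ivl_subset[OF h, of 0 r] by simp
        also have "\<dots> = \<Phi> (Z r) - \<Phi> (Z l)" using \<xi>[OF i] unfolding l_def r_def by simp
        finally show "(\<integral>s. \<theta> n s * h s \<partial>ivl (real i * d n) (real (Suc i) * d n)) =
           \<Phi> (Z (real (Suc i) * d n)) - \<Phi> (Z (real i * d n))" unfolding l_def r_def .
      qed
      also have "\<dots> = \<Phi> (Z t) - \<Phi> (Z 0)"
        using sum_lessThan_telescope[of "\<lambda>i. \<Phi> (Z (real i * d n))" "Suc n"] dn[of n] by simp
      also have "Z 0 = z0" using Z[of 0] \<open>0 \<le> t\<close> by (simp add: integral_ivl_eq_0)
      finally show ?thesis .
    qed
    have d0: "d \<longlonglongrightarrow> 0" unfolding d_def using LIMSEQ_Suc[OF lim_const_over_n[of t]] by simp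
    have "(\<lambda>n. \<integral>s. \<theta> n s * h s \<partial>ivl 0 t) \<longlonglongrightarrow> (\<integral>s. \<phi> (Z s) * h s \<partial>ivl 0 t)"
    proof (rule integral_dominated_convergence[where w="\<lambda>s. B * \<bar>h s\<bar>"])
      show "AE s in ivl 0 t. (\<lambda>n. \<theta> n s * h s) \<longlonglongrightarrow> \<phi> (Z s) * h s"
        using aet
      proof eventually_elim
        case (elim s)
        let ?x = "\<lambda>n. \<xi> n (nat \<lfloor>s / d n\<rfloor>)"
        have "\<bar>?x n - s\<bar> \<le> d n" for n
          using idx[of s n] \<xi>[of "nat \<lfloor>s / d n\<rfloor>" n] elim by (auto simp: algebra_simps abs_le_iff)
        then have "(\<lambda>n. ?x n - s) \<longlonglongrightarrow> 0"
          by (intro Lim_null_comparison[OF _ d0]) auto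
        then have "?x \<longlonglongrightarrow> s" by (simp add: LIM_zero_iff)
        then have "(\<lambda>n. Z (?x n)) \<longlonglongrightarrow> Z s"
          using \<xi>t idx(1) elim by (intro continuous_on_tendsto_compose[OF contZ]) auto
        then have "(\<lambda>n. \<phi> (Z (?x n))) \<longlonglongrightarrow> \<phi> (Z s)"
          by (intro continuous_on_tendsto_compose[OF \<phi>]) auto
        then show ?case unfolding \<theta>_def by (intro tendsto_intros)
      qed
    qed (use inth bnd in auto)
    with eq show ?thesis by (simp add: LIMSEQ_const_iff)
  qed
qed

lemma borel_measurable_integral_ivl:
  fixes h :: "real \<Rightarrow> real"
  assumes [measurable]: "h \<in> borel_measurable borel"
  shows "(\<lambda>s. integral\<^sup>L (ivl a s) h) \<in> borel_measurable borel"
proof -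
  have "(\<lambda>s. integral\<^sup>L (ivl a s) h) = (\<lambda>s. \<integral>x. (if a \<le> x \<and> x \<le> s then h x else 0) \<partial>lborel)"
    by (auto simp: integral_ivl indicator_def fun_eq_iff intro!: Bochner_Integration.integral_cong)
  also have "\<dots> \<in> borel_measurable borel" by measurable
  finally show ?thesis .
qed

text \<open>Polarisation: \<open>chain_rule_primitive\<close> for the square is applied to
  \<open>A + B\<close> and to \<open>A - B\<close>, and the difference of the two identities is
  divided by 4.\<close>

lemma product_rule_primitive:
  fixes h k :: "real \<Rightarrow> real"
  assumes h: "integrable (ivl 0 t) h" and k: "integrable (ivl 0 t) k" and "0 \<le> t"
    and A: "\<And>s. 0 \<le> s \<Longrightarrow> s \<le> t \<Longrightarrow> A s = a0 + integral\<^sup>L (ivl 0 s) h"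
    and B: "\<And>s. 0 \<le> s \<Longrightarrow> s \<le> t \<Longrightarrow> B s = b0 + integral\<^sup>L (ivl 0 s) k"
    and [measurable]: "A \<in> borel_measurable borel" "B \<in> borel_measurable borel"
  shows "integrable (ivl 0 t) (\<lambda>s. A s * k s)" "integrable (ivl 0 t) (\<lambda>s. B s * h s)"
    and "A t * B t - a0 * b0 = (\<integral>s. A s * k s \<partial>ivl 0 t) + (\<integral>s. B s * h s \<partial>ivl 0 t)"
proof -
  have d: "((\<lambda>u. u^2) has_real_derivative 2 * u) (at u)" for u :: real
    by (auto intro!: derivative_eq_intros)
  have c: "continuous_on UNIV (\<lambda>u::real. 2 * u)" by (intro continuous_intros)
  note cr = chain_rule_primitive[where \<Phi>="\<lambda>u. u^2" and \<phi>="\<lambda>u. 2 * u", OF _ \<open>0 \<le> t\<close> d c]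
  have AB: "A s + B s = (a0 + b0) + integral\<^sup>L (ivl 0 s) (\<lambda>x. h x + k x)"
       "A s - B s = (a0 - b0) + integral\<^sup>L (ivl 0 s) (\<lambda>x. h x - k x)" if "0 \<le> s" "s \<le> t" for s
  proof -
    have "integrable (ivl 0 s) h" "integrable (ivl 0 s) k"
      using that by (auto intro: integrable_ivl_subset[OF h] integrable_ivl_subset[OF k])
    then show "A s + B s = (a0 + b0) + integral\<^sup>L (ivl 0 s) (\<lambda>x. h x + k x)"
       "A s - B s = (a0 - b0) + integral\<^sup>L (ivl 0 s) (\<lambda>x. h x - k x)"
      using A[OF that] B[OF that] by auto
  qed
  have 1: "integrable (ivl 0 t) (\<lambda>s. 2 * (A s + B s) * (h s + k s))"
      "(A t + B t)^2 - (a0 + b0)^2 = (\<integral>s. 2 * (A s + B s) * (h s + k s) \<partial>ivl 0 t)"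
    using cr[of "\<lambda>x. h x + k x" "\<lambda>s. A s + B s" "a0 + b0"] AB h k by auto
  have 2: "integrable (ivl 0 t) (\<lambda>s. 2 * (A s - B s) * (h s - k s))"
      "(A t - B t)^2 - (a0 - b0)^2 = (\<integral>s. 2 * (A s - B s) * (h s - k s) \<partial>ivl 0 t)"
    using cr[of "\<lambda>x. h x - k x" "\<lambda>s. A s - B s" "a0 - b0"] AB h k by auto
  have 3: "integrable (ivl 0 t) (\<lambda>s. \<phi> s * m s)"
    if m: "integrable (ivl 0 t) m" and [measurable]: "\<phi> \<in> borel_measurable borel" and c: "continuous_on {0..t} \<phi>" for \<phi> m :: "real \<Rightarrow> real"
  proof -
    have [measurable]: "m \<in> borel_measurable borel" by (rule borel_measurable_integrable_ivl[OF m])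
    have "compact (\<phi> ` {0..t})" using c by (intro compact_continuous_image) auto
    then obtain C where C: "\<And>s. 0 \<le> s \<Longrightarrow> s \<le> t \<Longrightarrow> \<bar>\<phi> s\<bar> \<le> C"
      using compact_imp_bounded bounded_iff by (metis (no_types, lifting) atLeastAtMost_iff imageI real_norm_def)
    have "integrable (ivl 0 t) (\<lambda>s. C * \<bar>m s\<bar>)" using m by auto
    then show ?thesis
    proof (rule Bochner_Integration.integrable_bound)
      show "AE s in ivl 0 t. norm (\<phi> s * m s) \<le> norm (C * \<bar>m s\<bar>)"
        unfolding AE_ivl
      proof (intro AE_I2 impI)
        fix s :: real assume s: "0 \<le> s \<and> s \<le> t"
        then have "\<bar>\<phi> s\<bar> * \<bar>m s\<bar> \<le> C * \<bar>m s\<bar>" using C by (intro mult_right_mono) auto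
        then show "norm (\<phi> s * m s) \<le> norm (C * \<bar>m s\<bar>)"
          by (auto simp: abs_mult intro: order_trans[OF _ mult_right_mono[OF abs_ge_self]])
      qed
    qed simp
  qed
  have "continuous_on {0..t} A" "continuous_on {0..t} B"
    by (rule continuous_on_eq[where f="\<lambda>s. a0 + integral\<^sup>L (ivl 0 s) h"],
        auto intro!: continuous_intros continuous_on_integral_ivl h simp: A)
       (rule continuous_on_eq[where f="\<lambda>s. b0 + integral\<^sup>L (ivl 0 s) k"],
        auto intro!: continuous_intros continuous_on_integral_ivl k simp: B)
  with 3 h k show 4: "integrable (ivl 0 t) (\<lambda>s. A s * k s)" "integrable (ivl 0 t) (\<lambda>s. B s * h s)" by auto
  have "4 * (A t * B t - a0 * b0) = ((A t + B t)^2 - (a0 + b0)^2) - ((A t - B t)^2 - (a0 - b0)^2)"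
    by (simp add: power2_eq_square algebra_simps)
  also have "\<dots> = (\<integral>s. 2 * (A s + B s) * (h s + k s) - 2 * (A s - B s) * (h s - k s) \<partial>ivl 0 t)"
    using 1 2 by simp
  also have "\<dots> = (\<integral>s. 4 * (A s * k s) + 4 * (B s * h s) \<partial>ivl 0 t)"
    by (intro Bochner_Integration.integral_cong) (auto simp: algebra_simps)
  also have "\<dots> = 4 * ((\<integral>s. A s * k s \<partial>ivl 0 t) + (\<integral>s. B s * h s \<partial>ivl 0 t))"
    using 4 by simp
  finally show "A t * B t - a0 * b0 = (\<integral>s. A s * k s \<partial>ivl 0 t) + (\<integral>s. B s * h s \<partial>ivl 0 t)" by simp
qed

lemma integral_ivl_FTC:
  fixes F f :: "real \<Rightarrow> real"
  assumes "a \<le> b" "\<And>x. a \<le> x \<Longrightarrow> x \<le> b \<Longrightarrow> (F has_real_derivative f x) (at x within {a..b})"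
    and "continuous_on {a..b} f" and [measurable]: "f \<in> borel_measurable borel"
  shows "integral\<^sup>L (ivl a b) f = F b - F a"
  using integral_FTC_atLeastAtMost[of a b F f] assms
  by (simp add: integral_ivl has_real_derivative_iff_has_vector_derivative)

lemma integral_ivl_cong:
  fixes f g :: "real \<Rightarrow> real"
  assumes "\<And>x. a \<le> x \<Longrightarrow> x \<le> b \<Longrightarrow> f x = g x"
    and [measurable]: "f \<in> borel_measurable borel" "g \<in> borel_measurable borel"
  shows "integral\<^sup>L (ivl a b) f = integral\<^sup>L (ivl a b) g"
  using assms(1) by (auto simp: integral_ivl indicator_def intro!: Bochner_Integration.integral_cong)

lemma integral_ivl_indicator:
  fixes g :: "real \<Rightarrow> real"
  assumes [measurable]: "g \<in> borel_measurable borel"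
  shows "(\<integral>x. indicator {c..d} x * g x \<partial>ivl a b) = integral\<^sup>L (ivl (max a c) (min b d)) g"
  by (auto simp: integral_ivl indicator_def intro!: Bochner_Integration.integral_cong)

text \<open>The primitive is constant inside the interval and, by continuity, up to the ends, so
  closed intervals touching the ends are covered as well. Closed intervals form an
  intersection-stable generator of the Borel sets, and the sets over which \<open>g\<close>
  integrates to zero form a Dynkin system.\<close>

lemma AE_zero_if_integral_Icc_zero:
  fixes g :: "real \<Rightarrow> real"
  assumes g: "integrable (ivl a b) g" and "a < b"
    and zero: "\<And>c d. a < c \<Longrightarrow> c \<le> d \<Longrightarrow> d < b \<Longrightarrow> integral\<^sup>L (ivl c d) g = 0"
  shows "AE x in ivl a b. g x = 0"
proof -
  have [measurable]: "g \<in> borel_measurable borel" by (rule borel_measurable_integrable_ivl[OF g])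
  define P where "P s = integral\<^sup>L (ivl a s) g" for s
  have contP: "continuous_on {a..b} P" unfolding P_def by (rule continuous_on_integral_ivl[OF g])
  have diff: "integral\<^sup>L (ivl c d) g = P d - P c" if "a \<le> c" "c \<le> d" "d \<le> b" for c d
    using integral_ivl_combine[of a d g c] that integrable_ivl_subset[OF g, of a d] by (simp add: P_def)
  define m where "m = (a + b) / 2"
  have m: "a < m" "m < b" using \<open>a < b\<close> by (auto simp: m_def)
  have "P x = P m" if "x \<in> {a<..<b}" for x
    using zero[of x m] zero[of m x] diff[of x m] diff[of m x] m that by (cases "x \<le> m") auto
  moreover have "continuous_on (closure {a<..<b}) P" using contP \<open>a < b\<close> by simp
  ultimately have "P x = P m" if "x \<in> closure {a<..<b}" for x
    using continuous_constant_on_closure[of "{a<..<b}" P "P m" x] that by auto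
  then have Pc: "P x = P m" if "a \<le> x" "x \<le> b" for x using that \<open>a < b\<close> by simp
  have zero': "(\<integral>x. indicator {c..d} x * g x \<partial>ivl a b) = 0" for c d
  proof (cases "max a c \<le> min b d")
    case True
    then show ?thesis unfolding integral_ivl_indicator[OF \<open>g \<in> borel_measurable borel\<close>]
      using diff[of "max a c" "min b d"] Pc \<open>a < b\<close> by simp
  next
    case False
    then show ?thesis by (subst integral_ivl_indicator) (auto intro!: integral_ivl_eq_0)
  qed
  have indint: "integrable (ivl a b) (\<lambda>x. indicator A x * g x)" if "A \<in> sets borel" for A
    using integrable_mult_indicator[of A "ivl a b" g] that g by simp
  have all: "(\<integral>x. indicator A x * g x \<partial>ivl a b) = 0" if A: "A \<in> sets borel" for A
  proof -
    have subset_Pow_UNIV: "range (\<lambda>(a::real,b). {a..b}) \<subseteq> Pow UNIV" by simp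
    have st: "Int_stable (range (\<lambda>(a::real,b). {a..b}))" by (force simp: Int_stable_def)
    have "A \<in> sigma_sets UNIV (range (\<lambda>(a::real,b). {a..b}))"
      using A by (subst (asm) borel_eq_atLeastAtMost) simp
    from st subset_Pow_UNIV this show ?thesis
    proof (induction rule: sigma_sets_induct_disjoint)
      case (compl A)
      then have [measurable]: "A \<in> sets borel" by (subst borel_eq_atLeastAtMost) simp
      have "integral\<^sup>L (ivl a b) g = (\<integral>x. indicator {a..b} x * g x \<partial>ivl a b)"
        by (intro integral_ivl_cong) auto
      then have g0: "integral\<^sup>L (ivl a b) g = 0" using zero' by simp
      have "(\<integral>x. indicator (UNIV - A) x * g x \<partial>ivl a b) = (\<integral>x. g x - indicator A x * g x \<partial>ivl a b)"
        by (intro Bochner_Integration.integral_cong) (auto simp: indicator_def)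
      then show ?case using g0 compl indint[of A] g by simp
    next
      case (union A)
      then have mA: "A i \<in> sets borel" for i
        by (subst borel_eq_atLeastAtMost) (use union in auto)
      have "set_lebesgue_integral (ivl a b) (\<Union>i. A i) g = (\<Sum>i. set_lebesgue_integral (ivl a b) (A i) g)"
        using union mA indint by (intro lebesgue_integral_countable_add)
          (auto simp: set_integrable_def disjoint_family_on_def)
      then show ?case using union by (simp add: set_lebesgue_integral_def)
    qed (use zero' in auto)
  qed
  have "AE x in ivl a b. g x = (\<lambda>_. 0) x"
    by (rule density_unique_real) (use g all in \<open>auto simp: set_lebesgue_integral_def\<close>)
  then show ?thesis by simp
qed

section \<open>The circle\<close>

text \<open>The codomain is arbitrary because periodic predicates occur too, see
  \<open>AE_circ_shift\<close>.\<close>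

definition periodic2 :: "(real \<Rightarrow> 'a) \<Rightarrow> bool" where
  "periodic2 g \<longleftrightarrow> (\<forall>y. g (y + 2) = g y)"

lemma periodic2_int: "periodic2 g \<Longrightarrow> g (y + 2 * of_int k) = g y"
proof -
  assume g: "periodic2 g"
  have n: "g (y + 2 * of_nat n) = g y" for y n
  proof (induction n)
    case (Suc n)
    have "g (y + 2 * of_nat (Suc n)) = g ((y + 2 * of_nat n) + 2)" by (simp add: algebra_simps)
    then show ?case using Suc g unfolding periodic2_def by metis
  qed simp
  show "g (y + 2 * of_int k) = g y"
  proof (cases "k \<ge> 0")
    case True
    then obtain m where "k = int m" using zero_le_imp_eq_int by blast
    then show ?thesis using n[of y m] by simp
  next
    case False
    then obtain m where "- k = int m" using zero_le_imp_eq_int[of "-k"] by auto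
    then have "k = - int m" by simp
    then show ?thesis using n[of "y - 2 * m" m] by simp
  qed
qed

abbreviation circ :: "real measure" where "circ \<equiv> ivl (-1) 1"

lemma nn_integral_ivl_shift:
  assumes [measurable]: "g \<in> borel_measurable borel"
  shows "(\<integral>\<^sup>+y. g (y + s) \<partial>ivl a b) = (\<integral>\<^sup>+y. g y \<partial>ivl (a + s) (b + s))"
proof -
  have "(\<integral>\<^sup>+y. g y * indicator {a + s..b + s} y \<partial>lborel) = (\<integral>\<^sup>+y. g (y + s) * indicator {a..b} y \<partial>lborel)"
    by (subst nn_integral_real_affine[where c=1 and t=s])
      (auto simp: add.commute indicator_def intro!: nn_integral_cong)
  then show ?thesis by (simp add: nn_integral_ivl)
qed

lemma nn_integral_ivl_combine:
  assumes [measurable]: "g \<in> borel_measurable borel" and "a \<le> b" "b \<le> c"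
  shows "(\<integral>\<^sup>+y. g y \<partial>ivl a c) = (\<integral>\<^sup>+y. g y \<partial>ivl a b) + (\<integral>\<^sup>+y. g y \<partial>ivl b c)"
proof -
  have "AE x in lborel. x \<noteq> b"  by (rule AE_lborel_singleton)
  then have "AE x in lborel. g x * indicator {a..c} x = g x * indicator {a..b} x + g x * indicator {b..c} x"
    by eventually_elim (use assms(2,3) in \<open>auto simp: indicator_def\<close>)
  then have "(\<integral>\<^sup>+x. g x * indicator {a..c} x \<partial>lborel) =
      (\<integral>\<^sup>+x. g x * indicator {a..b} x + g x * indicator {b..c} x \<partial>lborel)"
    by (intro nn_integral_cong_AE) auto
  then show ?thesis by (simp add: nn_integral_ivl nn_integral_add)
qed

lemma nn_integral_ivl_uminus:
  assumes [measurable]: "g \<in> borel_measurable borel"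
  shows "(\<integral>\<^sup>+y. g (- y) \<partial>ivl a b) = (\<integral>\<^sup>+y. g y \<partial>ivl (- b) (- a))"
proof -
  have "(\<integral>\<^sup>+y. g y * indicator {-b..-a} y \<partial>lborel) = (\<integral>\<^sup>+y. g (- y) * indicator {a..b} y \<partial>lborel)"
    by (subst nn_integral_real_affine[where c="-1" and t=0])
      (auto simp: indicator_def intro!: nn_integral_cong)
  then show ?thesis by (simp add: nn_integral_ivl)
qed

text \<open>After reduction of the shift modulo 2, the part of the shifted window that sticks out
  beyond 1 is moved back by one period.\<close>

lemma nn_integral_circ_shift:
  assumes [measurable]: "g \<in> borel_measurable borel" and g: "periodic2 g"
  shows "(\<integral>\<^sup>+y. g (y + s) \<partial>circ) = (\<integral>\<^sup>+y. g y \<partial>circ)"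
proof -
  define k where "k = \<lfloor>s / 2\<rfloor>"
  define r where "r = s - 2 * of_int k"
  have r: "0 \<le> r" "r \<le> 2" unfolding r_def k_def by linarith+
  have "(\<integral>\<^sup>+y. g (y + s) \<partial>circ) = (\<integral>\<^sup>+y. g (y + r) \<partial>circ)"
    using periodic2_int[OF g, of "_ + r" k] by (simp add: r_def)
  also have "\<dots> = (\<integral>\<^sup>+y. g y \<partial>ivl (-1 + r) (1 + r))" by (rule nn_integral_ivl_shift) simp
  also have "\<dots> = (\<integral>\<^sup>+y. g y \<partial>ivl (-1 + r) 1) + (\<integral>\<^sup>+y. g y \<partial>ivl 1 (1 + r))"
    using r by (intro nn_integral_ivl_combine) auto
  also have "(\<integral>\<^sup>+y. g y \<partial>ivl 1 (1 + r)) = (\<integral>\<^sup>+y. g y \<partial>ivl (-1 + 2) ((-1 + r) + 2))"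
    by (simp add: algebra_simps)
  also have "\<dots> = (\<integral>\<^sup>+y. g (y + 2) \<partial>ivl (-1) (-1 + r))" by (rule nn_integral_ivl_shift[symmetric]) simp
  also have "\<dots> = (\<integral>\<^sup>+y. g y \<partial>ivl (-1) (-1 + r))" using g by (simp add: periodic2_def)
  also have "(\<integral>\<^sup>+y. g y \<partial>ivl (-1 + r) 1) + \<dots> = (\<integral>\<^sup>+y. g y \<partial>circ)"
    using r by (subst add.commute, intro nn_integral_ivl_combine[symmetric]) auto
  finally show ?thesis .
qed

text \<open>The hypothesis says that \<open>f\<close> and \<open>g\<close> have the same
  distribution; instances of \<open>\<phi>\<close> give the norm and the positive and negative
  parts. A change of variables thus has to be proved for nonnegative integrands only.\<close>

lemma integral_eq_if_nn_integral_eq: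
  fixes f :: "'a \<Rightarrow> real" and g :: "'b \<Rightarrow> real"
  assumes [measurable]: "f \<in> borel_measurable M" "g \<in> borel_measurable N"
    and eq: "\<And>\<phi>. \<phi> \<in> borel_measurable borel \<Longrightarrow> (\<integral>\<^sup>+x. \<phi> (f x) \<partial>M) = (\<integral>\<^sup>+x. \<phi> (g x) \<partial>N)"
  shows "integrable M f \<longleftrightarrow> integrable N g" and "integral\<^sup>L M f = integral\<^sup>L N g"
proof -
  show *: "integrable M f \<longleftrightarrow> integrable N g"
    unfolding integrable_iff_bounded using eq[of "\<lambda>x. ennreal (norm x)"] by simp
  show "integral\<^sup>L M f = integral\<^sup>L N g"
  proof (cases "integrable M f")
    case True
    with * show ?thesis using eq[of ennreal] eq[of "\<lambda>x. ennreal (- x)"] by (simp add: real_lebesgue_integral_def)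
  next
    case False
    with * show ?thesis by (simp add: not_integrable_integral_eq)
  qed
qed

lemma circ_shift:
  fixes g :: "real \<Rightarrow> real"
  assumes [measurable]: "g \<in> borel_measurable borel" and g: "periodic2 g"
  shows "integrable circ (\<lambda>y. g (y + s)) \<longleftrightarrow> integrable circ g"
    and "(\<integral>y. g (y + s) \<partial>circ) = (\<integral>y. g y \<partial>circ)"
proof -
  have *: "(\<integral>\<^sup>+y. \<phi> (g (y + s)) \<partial>circ) = (\<integral>\<^sup>+y. \<phi> (g y) \<partial>circ)" if [measurable]: "\<phi> \<in> borel_measurable borel" for \<phi>
    using g by (intro nn_integral_circ_shift) (auto simp: periodic2_def)
  show "integrable circ (\<lambda>y. g (y + s)) \<longleftrightarrow> integrable circ g"
    and "(\<integral>y. g (y + s) \<partial>circ) = (\<integral>y. g y \<partial>circ)"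
    by (rule integral_eq_if_nn_integral_eq; simp add: *)+
qed

lemma ivl_uminus:
  fixes g :: "real \<Rightarrow> real"
  assumes [measurable]: "g \<in> borel_measurable borel"
  shows "integrable (ivl a b) (\<lambda>y. g (- y)) \<longleftrightarrow> integrable (ivl (-b) (-a)) g"
    and "(\<integral>y. g (- y) \<partial>ivl a b) = (\<integral>y. g y \<partial>ivl (-b) (-a))"
proof -
  have *: "(\<integral>\<^sup>+y. \<phi> (g (- y)) \<partial>ivl a b) = (\<integral>\<^sup>+y. \<phi> (g y) \<partial>ivl (-b) (-a))" if [measurable]: "\<phi> \<in> borel_measurable borel" for \<phi>
    by (intro nn_integral_ivl_uminus) auto
  show "integrable (ivl a b) (\<lambda>y. g (- y)) \<longleftrightarrow> integrable (ivl (-b) (-a)) g"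
    and "(\<integral>y. g (- y) \<partial>ivl a b) = (\<integral>y. g y \<partial>ivl (-b) (-a))"
    by (rule integral_eq_if_nn_integral_eq; simp add: *)+
qed

lemma AE_ivl_uminus: "(AE y in ivl a b. P (- y)) \<longleftrightarrow> (AE y in ivl (-b) (-a). P y)"
  unfolding AE_ivl
proof
  have sym: "AE y in lborel. Q (- y)" if "AE y in lborel. Q y" for Q :: "real \<Rightarrow> bool"
  proof -
    have "lborel = distr lborel lborel (\<lambda>x. - x :: real)"
      using lborel_distr_uminus by (metis distr_cong sets_lborel)
    with that have "AE y in distr lborel lborel uminus. Q y" by metis
    then show ?thesis by (rule AE_distrD[rotated]) simp
  qed
  { assume "AE x in lborel. a \<le> x \<and> x \<le> b \<longrightarrow> P (- x)"
    from sym[OF this] show "AE x in lborel. - b \<le> x \<and> x \<le> - a \<longrightarrow> P x"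
      by eventually_elim auto }
  { assume "AE x in lborel. - b \<le> x \<and> x \<le> - a \<longrightarrow> P x"
    from sym[OF this] show "AE x in lborel. a \<le> x \<and> x \<le> b \<longrightarrow> P (- x)"
      by eventually_elim auto }
qed

text \<open>By countably many translates the statement passes from one period to almost every point
  of the line, where Lebesgue measure is translation invariant.\<close>

lemma AE_circ_shift:
  assumes P: "periodic2 P" and "AE y in circ. P y" shows "AE y in circ. P (y + s)"
proof -
  have Pi: "AE y in lborel. -1 + 2 * of_int k \<le> y \<and> y \<le> 1 + 2 * of_int k \<longrightarrow> P y" for k :: int
  proof -
    have "AE y in lborel. -1 \<le> y - 2 * of_int k \<and> y - 2 * of_int k \<le> 1 \<longrightarrow> P (y - 2 * of_int k)"
    proof -
      have "lborel = distr lborel borel ((+) (- (2 * of_int k) :: real))" by (simp add: lborel_distr_plus)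
      moreover have "AE y in lborel. -1 \<le> y \<and> y \<le> 1 \<longrightarrow> P y" using assms(2) by (simp add: AE_ivl)
      ultimately have "AE y in distr lborel borel ((+) (- (2 * of_int k) :: real)). -1 \<le> y \<and> y \<le> 1 \<longrightarrow> P y" by metis
      from AE_distrD[OF _ this] show ?thesis by simp
    qed
    then show ?thesis
    proof eventually_elim
      case (elim y)
      then show ?case using periodic2_int[OF P, of "y - 2 * of_int k" k] by auto
    qed
  qed
  have "AE y in lborel. P y"
  proof -
    have "AE y in lborel. \<forall>k::int. -1 + 2 * of_int k \<le> y \<and> y \<le> 1 + 2 * of_int k \<longrightarrow> P y"
      by (subst AE_all_countable) (use Pi in blast)
    then show ?thesis
    proof eventually_elim
      case (elim y)
      define k where "k = \<lfloor>(y + 1) / 2\<rfloor>"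
      have "-1 + 2 * of_int k \<le> y" "y \<le> 1 + 2 * of_int k"
        using of_int_floor_le[of "(y + 1) / 2"] real_of_int_floor_add_one_gt[of "(y + 1) / 2"]
        unfolding k_def[symmetric] by (auto simp: field_simps)
      with elim show ?case by blast
    qed
  qed
  moreover have "lborel = distr lborel borel ((+) s)" by (simp add: lborel_distr_plus)
  ultimately have "AE y in distr lborel borel ((+) s). P y" by metis
  from AE_distrD[OF _ this] have "AE y in lborel. P (s + y)" by simp
  then show ?thesis unfolding AE_ivl by eventually_elim (auto simp: add.commute)
qed

lemma integral_circ_fold:
  fixes g :: "real \<Rightarrow> real"
  assumes g: "integrable circ g"
  shows "integral\<^sup>L circ g = (\<integral>y. g y + g (- y) \<partial>ivl 0 1)"
    "integrable (ivl 0 1) g" "integrable (ivl 0 1) (\<lambda>y. g (- y))"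
proof -
  have [measurable]: "g \<in> borel_measurable borel" by (rule borel_measurable_integrable_ivl[OF g])
  show 1: "integrable (ivl 0 1) g" by (rule integrable_ivl_subset[OF g]) auto
  have "integrable (ivl (-1) 0) g" by (rule integrable_ivl_subset[OF g]) auto
  then show 2: "integrable (ivl 0 1) (\<lambda>y. g (- y))" using ivl_uminus(1)[of g 0 1] by simp
  show "integral\<^sup>L circ g = (\<integral>y. g y + g (- y) \<partial>ivl 0 1)"
    using 1 2 integral_ivl_combine[OF g, of 0] ivl_uminus(2)[of g 0 1] by simp
qed

lemma integrable_circ_fold:
  fixes g :: "real \<Rightarrow> real"
  assumes "integrable (ivl 0 1) g" "integrable (ivl 0 1) (\<lambda>y. g (- y))"
  shows "integrable circ g"
proof -
  have [measurable]: "g \<in> borel_measurable borel" by (rule borel_measurable_integrable_ivl[OF assms(1)])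
  have 1: "integrable (ivl (-1) 0) g" using ivl_uminus(1)[of g 0 1] assms by simp
  have "(\<integral>\<^sup>+y. ennreal (norm (g y)) \<partial>circ) = (\<integral>\<^sup>+y. ennreal (norm (g y)) \<partial>ivl (-1) 0) + (\<integral>\<^sup>+y. ennreal (norm (g y)) \<partial>ivl 0 1)"
    by (rule nn_integral_ivl_combine) auto
  then show ?thesis using 1 assms(1) unfolding integrable_iff_bounded by simp
qed

section \<open>Jensen's inequality for powers\<close>

text \<open>Convexity in tangent form; the Jensen inequalities below follow by taking the mean for
  \<open>m\<close>. The point 0 lies outside the open half-line of the convexity argument and
  reduces to \<open>1 \<le> p\<close>.\<close>

lemma powr_above_tangent:
  fixes x m p :: real
  assumes "0 \<le> x" "0 < m" "1 \<le> p"
  shows "m powr p + p * m powr (p - 1) * (x - m) \<le> x powr p"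
proof (cases "x = 0")
  case True
  have "p * m powr (p - 1) * m = p * m powr p"
    using \<open>0 < m\<close> by (simp add: powr_diff)
  moreover have "m powr p \<le> p * m powr p" using assms(3) by (simp add: mult_le_cancel_right1)
  ultimately show ?thesis using True assms by (simp add: algebra_simps)
next
  case False
  then have "x > 0" using assms by simp
  have "(x powr p - m powr p) \<ge> (p * m powr (p - 1)) * (x - m)"
    by (rule convex_on_imp_above_tangent[where A="{0<..}" and f="\<lambda>x. x powr p"])
      (use assms \<open>x > 0\<close> in \<open>auto intro!: powr_convex derivative_eq_intros simp: interior_open has_field_derivative_at_within\<close>)
  then show ?thesis by simp
qed

lemma (in finite_measure) integrable_powr_imp_integrable:
  fixes f :: "'a \<Rightarrow> real"
  assumes [measurable]: "f \<in> borel_measurable M" and f: "integrable M (\<lambda>x. \<bar>f x\<bar> powr p)" and "1 \<le> p"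
  shows "integrable M f"
proof (rule Bochner_Integration.integrable_bound)
  show "integrable M (\<lambda>x. 1 + \<bar>f x\<bar> powr p)" using f by simp
  show "AE x in M. norm (f x) \<le> norm (1 + \<bar>f x\<bar> powr p)"
  proof (rule AE_I2)
    fix x
    have "\<bar>f x\<bar> \<le> 1 + \<bar>f x\<bar> powr p"
    proof (cases "\<bar>f x\<bar> \<le> 1")
      case True
      then show ?thesis using powr_ge_zero[of "\<bar>f x\<bar>" p] by linarith
    next
      case False
      then have "\<bar>f x\<bar> powr 1 \<le> \<bar>f x\<bar> powr p" using \<open>1 \<le> p\<close> by (intro powr_mono) auto
      then show ?thesis using False by simp
    qed
    then show "norm (f x) \<le> norm (1 + \<bar>f x\<bar> powr p)" by (simp add: powr_ge_zero)
  qed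
qed simp

lemma (in finite_measure) jensen_powr:
  fixes f :: "'a \<Rightarrow> real"
  assumes [measurable]: "f \<in> borel_measurable M" and f: "integrable M (\<lambda>x. \<bar>f x\<bar> powr p)" and "1 \<le> p"
  shows "(\<integral>x. \<bar>f x\<bar> \<partial>M) powr p \<le> measure M (space M) powr (p - 1) * (\<integral>x. \<bar>f x\<bar> powr p \<partial>M)"
proof -
  let ?c = "measure M (space M)" and ?I = "\<integral>x. \<bar>f x\<bar> \<partial>M"
  have i: "integrable M (\<lambda>x. \<bar>f x\<bar>)" using integrable_powr_imp_integrable[OF assms] by simp
  have nn: "0 \<le> ?I" "0 \<le> (\<integral>x. \<bar>f x\<bar> powr p \<partial>M)" by auto
  show ?thesis
  proof (cases "?I = 0")
    case True
    then show ?thesis using nn by simp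
  next
    case False
    with nn have I: "?I > 0" by linarith
    have c: "?c > 0"
    proof (rule ccontr)
      assume "\<not> ?c > 0"
      then have "emeasure M (space M) = 0" by (simp add: emeasure_eq_measure zero_less_measure_iff)
      then have "AE x in M. False" by (intro AE_I[of _ _ "space M"]) auto
      then have "?I = (\<integral>x. 0 \<partial>M)" by (intro integral_cong_AE) auto
      with I show False by simp
    qed
    \<comment> \<open>At the mean value the linear term of the tangent integrates to zero. The power
      of the total mass in the claim comes from this normalisation.\<close>
    define m where "m = ?I / ?c"
    have m: "m > 0" using I c by (simp add: m_def)
    have "?c * m powr p = (\<integral>x. m powr p + p * m powr (p - 1) * (\<bar>f x\<bar> - m) \<partial>M)"
      using i c by (simp add: m_def field_simps)
    also have "\<dots> \<le> (\<integral>x. \<bar>f x\<bar> powr p \<partial>M)"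
      using i f m \<open>1 \<le> p\<close> by (intro integral_mono) (auto intro!: powr_above_tangent)
    finally have "?c powr (p - 1) * (?c * m powr p) \<le> ?c powr (p - 1) * (\<integral>x. \<bar>f x\<bar> powr p \<partial>M)"
      by (intro mult_left_mono) auto
    moreover have "?c powr (p - 1) * (?c * m powr p) = ?I powr p"
      using c I by (simp add: m_def powr_divide powr_diff)
    ultimately show ?thesis by simp
  qed
qed

lemma powr_sum_le:
  fixes x y p :: real
  assumes "0 \<le> x" "0 \<le> y" "1 \<le> p"
  shows "(x + y) powr p \<le> 2 powr (p - 1) * (x powr p + y powr p)"
proof (cases "x + y = 0")
  case True
  then show ?thesis using assms by simp
next
  case False
  define m where "m = (x + y) / 2"
  have m: "m > 0" using False assms by (simp add: m_def)
  have "2 * m powr p = (m powr p + p * m powr (p - 1) * (x - m)) + (m powr p + p * m powr (p - 1) * (y - m))"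
    by (simp add: m_def field_simps)
  also have "\<dots> \<le> x powr p + y powr p" using assms m by (intro add_mono powr_above_tangent)
  finally have "2 powr (p - 1) * (2 * m powr p) \<le> 2 powr (p - 1) * (x powr p + y powr p)"
    by (intro mult_left_mono) auto
  moreover have "2 powr (p - 1) * (2 * m powr p) = (x + y) powr p"
    using assms False by (simp add: m_def powr_divide powr_diff)
  ultimately show ?thesis by simp
qed

section \<open>Test functions\<close>

text \<open>Smoothness without formulas for higher derivatives: it suffices to exhibit a set of
  functions that contains a derivative of each of its members.\<close>

lemma iterated_deriv_closed:
  assumes S: "\<And>f. f \<in> S \<Longrightarrow> \<exists>g\<in>S. \<forall>x. (f has_real_derivative g x) (at x)" and "f \<in> S"
  shows "(deriv ^^ k) f \<in> S" "(deriv ^^ k) f differentiable_on UNIV"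
proof -
  have step: "deriv g \<in> S" if "g \<in> S" for g
  proof -
    obtain h where "h \<in> S" "\<forall>x. (g has_real_derivative h x) (at x)" using S[OF \<open>g \<in> S\<close>] by auto
    moreover from this have "deriv g = h" by (auto intro!: DERIV_imp_deriv)
    ultimately show ?thesis by simp
  qed
  show 1: "(deriv ^^ k) f \<in> S" by (induction k) (auto intro: step \<open>f \<in> S\<close>)
  from S[OF this] show "(deriv ^^ k) f differentiable_on UNIV"
    by (auto simp: differentiable_on_def real_differentiable_def)
qed

lemma test_functionI:
  assumes "\<And>f. f \<in> S \<Longrightarrow> \<exists>g\<in>S. \<forall>x. (f has_real_derivative g x) (at x)" "f \<in> S"
    and "0 < c" "d < 1" "\<And>x. x \<notin> {c..d} \<Longrightarrow> f x = 0"
  shows "f \<in> test_functions"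
proof -
  have "{x. f x \<noteq> 0} \<subseteq> {c..d}" using assms(5) by blast
  then have "closure {x. f x \<noteq> 0} \<subseteq> {c..d}" by (rule closure_minimal) auto
  with assms(3,4) have "closure {x. f x \<noteq> 0} \<subseteq> {0<..<1}" by force
  then show ?thesis using iterated_deriv_closed(2)[OF assms(1,2)] by (simp add: test_functions_def)
qed

lemma test_function_support:
  assumes "\<phi> \<in> test_functions"
  obtains c d where "0 < c" "c < d" "d < 1" "\<And>x. x \<notin> {c..d} \<Longrightarrow> \<phi> x = 0"
proof -
  let ?K = "closure {x. \<phi> x \<noteq> 0}"
  have K: "?K \<subseteq> {0<..<1}" using assms by (simp add: test_functions_def)
  have "bounded ?K" by (rule bounded_subset[OF _ K]) simp
  then have cK: "compact ?K" by (simp add: compact_eq_bounded_closed)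
  show thesis
  proof (cases "?K = {}")
    case True
    then have "\<phi> x = 0" for x using closure_subset[of "{x. \<phi> x \<noteq> 0}"] by auto
    then show ?thesis by (intro that[of "1/4" "1/2"]) auto
  next
    case False
    obtain s where s: "s \<in> ?K" "\<And>x. x \<in> ?K \<Longrightarrow> s \<le> x" using compact_attains_inf[OF cK False] by auto
    obtain t where t: "t \<in> ?K" "\<And>x. x \<in> ?K \<Longrightarrow> x \<le> t" using compact_attains_sup[OF cK False] by auto
    have "0 < s" "s < 1" "0 < t" "t < 1" using s t K by auto
    moreover have "\<phi> x = 0" if "x \<notin> {s / 2..(1 + t) / 2}" for x
    proof (rule ccontr)
      assume "\<phi> x \<noteq> 0"
      then have "x \<in> ?K" using closure_subset[of "{x. \<phi> x \<noteq> 0}"] by auto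
      with s(2)[of x] t(2)[of x] \<open>0 < s\<close> \<open>t < 1\<close> that show False by auto
    qed
    moreover have "s \<le> t" using s t by auto
    ultimately show ?thesis by (intro that[of "s / 2" "(1 + t) / 2"]) auto
  qed
qed

lemma test_function_deriv_iterate:
  assumes "\<phi> \<in> test_functions"
  shows "((deriv ^^ k) \<phi> has_real_derivative (deriv ^^ Suc k) \<phi> x) (at x)"
proof -
  have "(deriv ^^ k) \<phi> differentiable (at x)"
    using assms by (auto simp: test_functions_def differentiable_on_def)
  then show ?thesis by (simp add: DERIV_deriv_iff_real_differentiable)
qed

lemma test_function_deriv:
  "\<phi> \<in> test_functions \<Longrightarrow> (\<phi> has_real_derivative deriv \<phi> x) (at x)"
  using test_function_deriv_iterate[of \<phi> 0] by simp

lemma deriv_test_function: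
  assumes "\<phi> \<in> test_functions" shows "deriv \<phi> \<in> test_functions"
proof -
  obtain c d where cd: "0 < c" "c < d" "d < 1" "\<And>x. x \<notin> {c..d} \<Longrightarrow> \<phi> x = 0"
    using test_function_support[OF assms] by blast
  have "deriv \<phi> x = 0" if "x \<notin> {c..d}" for x
  proof -
    have "\<forall>\<^sub>F y in nhds x. y \<in> - {c..d}" using that by (intro eventually_nhds_in_open) auto
    then have "\<forall>\<^sub>F y in nhds x. \<phi> y = 0" by eventually_elim (use cd in auto)
    then have "deriv \<phi> x = deriv (\<lambda>_. 0) x" by (intro deriv_cong_ev) auto
    then show ?thesis by simp
  qed
  note out = this
  let ?S = "range (\<lambda>k. (deriv ^^ k) \<phi>)"
  show ?thesis
  proof (rule test_functionI[where S="?S" and c=c and d=d])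
    fix f assume "f \<in> ?S"
    then obtain k where f: "f = (deriv ^^ k) \<phi>" by auto
    have "\<forall>x. (f has_real_derivative (deriv ^^ Suc k) \<phi> x) (at x)"
      unfolding f using test_function_deriv_iterate[OF assms] by blast
    then show "\<exists>g\<in>?S. \<forall>x. (f has_real_derivative g x) (at x)" by (intro bexI[of _ "(deriv ^^ Suc k) \<phi>"] rangeI)
  qed (use cd out in \<open>auto intro: range_eqI[of _ _ 1]\<close>)
qed

lemma test_function_continuous: "\<phi> \<in> test_functions \<Longrightarrow> continuous_on A \<phi>"
  by (meson DERIV_isCont continuous_at_imp_continuous_on test_function_deriv)

lemma test_function_borel: "\<phi> \<in> test_functions \<Longrightarrow> \<phi> \<in> borel_measurable borel"
  by (simp add: borel_measurable_continuous_onI test_function_continuous)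

lemma test_function_boundary: "\<phi> \<in> test_functions \<Longrightarrow> x \<le> 0 \<or> 1 \<le> x \<Longrightarrow> \<phi> x = 0"
  by (erule test_function_support) auto

lemma test_function_bounded:
  assumes "\<phi> \<in> test_functions" obtains B where "\<And>x. \<bar>\<phi> x\<bar> \<le> B"
proof -
  have "compact (\<phi> ` {0..1})" by (intro compact_continuous_image test_function_continuous assms) auto
  then obtain B where B: "\<And>x. 0 \<le> x \<Longrightarrow> x \<le> 1 \<Longrightarrow> \<bar>\<phi> x\<bar> \<le> B"
    using compact_imp_bounded bounded_iff by (metis (no_types, lifting) atLeastAtMost_iff imageI real_norm_def)
  have "\<bar>\<phi> x\<bar> \<le> max B 0" for x
    using B[of x] test_function_boundary[OF assms, of x] by (cases "0 \<le> x \<and> x \<le> 1") auto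
  then show thesis by (rule that)
qed

lemma test_function_lincomb:
  assumes "\<phi> \<in> test_functions" "\<psi> \<in> test_functions"
  shows "(\<lambda>x. \<phi> x + l * \<psi> x) \<in> test_functions"
proof -
  obtain c d where cd: "0 < c" "c < d" "d < 1" "\<And>x. x \<notin> {c..d} \<Longrightarrow> \<phi> x = 0"
    using test_function_support[OF assms(1)] by blast
  obtain c' d' where cd': "0 < c'" "c' < d'" "d' < 1" "\<And>x. x \<notin> {c'..d'} \<Longrightarrow> \<psi> x = 0"
    using test_function_support[OF assms(2)] by blast
  let ?S = "range (\<lambda>k x. (deriv ^^ k) \<phi> x + l * (deriv ^^ k) \<psi> x)"
  show ?thesis
  proof (rule test_functionI[where S="?S" and c="min c c'" and d="max d d'"])
    fix f assume "f \<in> ?S"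
    then obtain k where f: "f = (\<lambda>x. (deriv ^^ k) \<phi> x + l * (deriv ^^ k) \<psi> x)" by auto
    have "\<forall>x. (f has_real_derivative (\<lambda>x. (deriv ^^ Suc k) \<phi> x + l * (deriv ^^ Suc k) \<psi> x) x) (at x)"
      unfolding f by (intro allI DERIV_add DERIV_cmult test_function_deriv_iterate assms)
    then show "\<exists>g\<in>?S. \<forall>x. (f has_real_derivative g x) (at x)" by (intro bexI[of _ "\<lambda>x. (deriv ^^ Suc k) \<phi> x + l * (deriv ^^ Suc k) \<psi> x"] rangeI)
  next
    show "\<phi> x + l * \<psi> x = 0" if "x \<notin> {min c c'..max d d'}" for x
    proof -
      have "\<phi> x = 0" by (rule cd(4)) (use that in auto)
      moreover have "\<psi> x = 0" by (rule cd'(4)) (use that in auto)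
      ultimately show ?thesis by simp
    qed
  qed (use cd cd' in \<open>auto intro: range_eqI[of _ _ 0]\<close>)
qed

text \<open>The primitive vanishes to the left of the support by its normalisation at 0, and to the
  right of it because the integral is zero.\<close>

lemma test_function_primitive:
  assumes \<psi>: "\<psi> \<in> test_functions" and zero: "integral\<^sup>L (ivl 0 1) \<psi> = 0"
  obtains \<phi> where "\<phi> \<in> test_functions" "deriv \<phi> = \<psi>"
proof -
  have [measurable]: "\<psi> \<in> borel_measurable borel" by (rule test_function_borel[OF \<psi>])
  obtain c d where cd: "0 < c" "c < d" "d < 1" "\<And>x. x \<notin> {c..d} \<Longrightarrow> \<psi> x = 0"
    using test_function_support[OF \<psi>] by blast
  have int\<psi>: "integrable (ivl a b) \<psi>" for a b
    using test_function_bounded[OF \<psi>] by (metis integrable_ivl_bounded test_function_borel \<psi>)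
  obtain \<Phi> where \<Phi>: "\<And>x::real. (\<Phi> has_vector_derivative \<psi> x) (at x)"
  proof -
    \<comment> \<open>The base point lies to the left of both \<open>x\<close> and 0, so negative
      \<open>x\<close> needs no oriented integral. The subtraction makes the value independent of
      the base point, as the next fact shows.\<close>
    define \<Phi> where "\<Phi> x = integral {-\<bar>x\<bar>-1..x} \<psi> - integral {-\<bar>x\<bar>-1..0} \<psi>" for x
    have e: "\<Phi> x = integral {-A..x} \<psi> - integral {-A..0} \<psi>" if "\<bar>x\<bar> + 1 \<le> A" for x A
    proof -
      have "\<psi> integrable_on {a..b}" for a b by (intro integrable_continuous_real test_function_continuous[OF \<psi>])
      then have "integral {-A..-\<bar>x\<bar>-1} \<psi> + integral {-\<bar>x\<bar>-1..x} \<psi> = integral {-A..x} \<psi>"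
        "integral {-A..-\<bar>x\<bar>-1} \<psi> + integral {-\<bar>x\<bar>-1..0} \<psi> = integral {-A..0} \<psi>"
        using that by (intro Henstock_Kurzweil_Integration.integral_combine; auto)+
      then show ?thesis unfolding \<Phi>_def by simp
    qed
    have "(\<Phi> has_vector_derivative \<psi> x) (at x)" for x
    proof -
      define A where "A = \<bar>x\<bar> + 2"
      have "((\<lambda>u. integral {-A..u} \<psi>) has_vector_derivative \<psi> x) (at x within {-A..x+1})"
        by (rule integral_has_vector_derivative) (auto simp: A_def test_function_continuous[OF \<psi>])
      moreover have "at x within {-A..x+1} = at x" by (rule at_within_interior) (auto simp: A_def)
      ultimately have "((\<lambda>u. integral {-A..u} \<psi> - integral {-A..0} \<psi>) has_vector_derivative \<psi> x) (at x)"
        by (auto intro!: derivative_eq_intros)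
      then show ?thesis
      proof (rule has_vector_derivative_transform_within_open[where S="ball x 1"])
        show "integral {-A..y} \<psi> - integral {-A..0} \<psi> = \<Phi> y" if "y \<in> ball x 1" for y
          using that by (intro e[symmetric]) (auto simp: A_def dist_real_def)
      qed auto
    qed
    then show thesis by (rule that)
  qed
  define \<phi> where "\<phi> x = \<Phi> x - \<Phi> 0" for x
  have d: "(\<phi> has_real_derivative \<psi> x) (at x)" for x
    unfolding \<phi>_def using \<Phi>[of x] by (auto intro!: derivative_eq_intros simp: has_real_derivative_iff_has_vector_derivative)
  have ftc: "integral\<^sup>L (ivl a b) \<psi> = \<phi> b - \<phi> a" if "a \<le> b" for a b
    by (rule integral_ivl_FTC) (use that d test_function_continuous[OF \<psi>] in \<open>auto intro: has_field_derivative_at_within\<close>)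
  have zi: "integral\<^sup>L (ivl a b) \<psi> = 0" if "b < c \<or> d < a" for a b
    using integral_ivl_cong[of a b \<psi> "\<lambda>_. 0"] that cd by auto
  have \<phi>0: "\<phi> 0 = 0" by (simp add: \<phi>_def)
  have \<phi>1: "\<phi> 1 = 0" using ftc[of 0 1] zero \<phi>0 by simp
  have out: "\<phi> x = 0" if "x \<notin> {c..d}" for x
  proof (cases "x < c")
    case True
    then show ?thesis using ftc[of x 0] ftc[of 0 x] zi[of x 0] zi[of 0 x] \<phi>0 cd by (cases "x \<le> 0") auto
  next
    case False
    then show ?thesis using that ftc[of x 1] ftc[of 1 x] zi[of 1 x] zi[of x 1] \<phi>1 cd by (cases "x \<le> 1") auto
  qed
  have "\<phi> \<in> test_functions"
  proof (rule test_functionI[where S="insert \<phi> (range (\<lambda>k. (deriv ^^ k) \<psi>))" and c=c and d=d])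
    fix f assume "f \<in> insert \<phi> (range (\<lambda>k. (deriv ^^ k) \<psi>))"
    then show "\<exists>g\<in>insert \<phi> (range (\<lambda>k. (deriv ^^ k) \<psi>)). \<forall>x. (f has_real_derivative g x) (at x)"
    proof
      assume "f = \<phi>"
      moreover have "\<psi> \<in> range (\<lambda>k. (deriv ^^ k) \<psi>)" by (auto intro: range_eqI[of _ _ 0])
      ultimately show ?thesis using d by blast
    next
      assume "f \<in> range (\<lambda>k. (deriv ^^ k) \<psi>)"
      then show ?thesis using test_function_deriv_iterate[OF \<psi>] by blast
    qed
  qed (use cd out in auto)
  moreover have "deriv \<phi> = \<psi>" using d by (auto intro!: DERIV_imp_deriv)
  ultimately show thesis by (rule that)
qed

section \<open>Smooth cutoffs\<close>

definition flat :: "real poly \<Rightarrow> real \<Rightarrow> real" where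
  "flat p x = (if 0 < x then poly p (1 / x) * exp (- 1 / x) else 0)"

lemma poly_mult_exp_tendsto_0: "((\<lambda>y::real. poly p y * exp (- y)) \<longlongrightarrow> 0) at_top"
proof -
  have "((\<lambda>y. \<Sum>i\<le>degree p. coeff p i * (y ^ i / exp y)) \<longlongrightarrow> (\<Sum>i\<le>degree p. coeff p i * 0)) at_top"
    by (intro tendsto_intros tendsto_power_div_exp_0)
  moreover have "(\<Sum>i\<le>degree p. coeff p i * (y ^ i / exp y)) = poly p y * exp (- y)" for y
    by (simp add: poly_altdef exp_minus sum_distrib_right divide_inverse mult.assoc)
  ultimately show ?thesis by simp
qed

text \<open>Differentiation of exp(-1/x) produces polynomials in 1/x; with such a factor carried
  along, the family is closed under differentiation. At 0 the right difference quotient is again of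
  this form, with \<open>p * monom 1 1\<close>, and tends to 0.\<close>

lemma flat_has_derivative:
  "(flat p has_real_derivative flat ((p - pderiv p) * monom 1 2) x) (at x)"
proof -
  let ?q = "(p - pderiv p) * monom 1 2"
  consider "x > 0" | "x < 0" | "x = 0" by linarith
  then show ?thesis
  proof cases
    case 1
    have "((\<lambda>x. poly p (1 / x) * exp (- 1 / x)) has_real_derivative flat ?q x) (at x)"
      using 1 by (auto intro!: derivative_eq_intros poly_DERIV[THEN DERIV_chain2]
          simp: flat_def poly_monom field_simps power2_eq_square)
    then show ?thesis
      by (rule has_field_derivative_transform_within_open[where S="{0<..}"]) (use 1 in \<open>auto simp: flat_def\<close>)
  next
    case 2
    have "((\<lambda>x. 0) has_real_derivative 0) (at x)" by simp
    then have "(flat p has_real_derivative 0) (at x)"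
      by (rule has_field_derivative_transform_within_open[where S="{..<0}"]) (use 2 in \<open>auto simp: flat_def\<close>)
    then show ?thesis using 2 by (simp add: flat_def)
  next
    case 3
    have "((\<lambda>h. poly (p * monom 1 1) (inverse h) * exp (- inverse h)) \<longlongrightarrow> 0) (at_right 0)"
      using filterlim_compose[OF poly_mult_exp_tendsto_0[of "p * monom 1 1"] filterlim_inverse_at_top_right] .
    then have r: "((\<lambda>h. (flat p h - flat p 0) / h) \<longlongrightarrow> 0) (at_right 0)"
      by (rule Lim_transform_eventually)
        (auto simp: eventually_at_right_field flat_def poly_monom field_simps intro!: exI[of _ 1])
    have l: "((\<lambda>h. (flat p h - flat p 0) / h) \<longlongrightarrow> 0) (at_left 0)"
      by (rule Lim_transform_eventually[where f="\<lambda>_. 0"])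
        (auto simp: eventually_at_left_field flat_def intro!: exI[of _ "-1"])
    have "((\<lambda>h. (flat p h - flat p 0) / h) \<longlongrightarrow> 0) (at 0)"
      using l r by (rule filterlim_split_at)
    then show ?thesis using 3 by (simp add: DERIV_def flat_def)
  qed
qed

text \<open>A class closed under differentiation that contains the truncated sines. Cosines need no
  rule of their own, being sines with the phase shifted by pi/2.\<close>

inductive_set smooth_algebra :: "(real \<Rightarrow> real) set" where
  flat: "(\<lambda>x. flat p (c * x + d)) \<in> smooth_algebra"
| sin: "(\<lambda>x. sin (c * x + d)) \<in> smooth_algebra"
| const: "(\<lambda>x. c) \<in> smooth_algebra"
| add: "f \<in> smooth_algebra \<Longrightarrow> g \<in> smooth_algebra \<Longrightarrow> (\<lambda>x. f x + g x) \<in> smooth_algebra"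
| mult: "f \<in> smooth_algebra \<Longrightarrow> g \<in> smooth_algebra \<Longrightarrow> (\<lambda>x. f x * g x) \<in> smooth_algebra"

lemma smooth_algebra_deriv:
  "f \<in> smooth_algebra \<Longrightarrow> \<exists>g\<in>smooth_algebra. \<forall>x. (f has_real_derivative g x) (at x)"
proof (induction rule: smooth_algebra.induct)
  case (flat p c d)
  have m: "(\<lambda>x. flat ((p - pderiv p) * monom 1 2) (c * x + d) * c) \<in> smooth_algebra"
    by (intro smooth_algebra.mult smooth_algebra.flat smooth_algebra.const)
  have "\<forall>x. ((\<lambda>x. flat p (c * x + d)) has_real_derivative flat ((p - pderiv p) * monom 1 2) (c * x + d) * c) (at x)"
    by (auto intro!: derivative_eq_intros flat_has_derivative[THEN DERIV_chain2])
  then show ?case by (rule bexI[OF _ m])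
next
  case (sin c d)
  have m: "(\<lambda>x. sin (c * x + (d + pi / 2)) * c) \<in> smooth_algebra"
    by (intro smooth_algebra.mult smooth_algebra.sin smooth_algebra.const)
  have "\<forall>x. ((\<lambda>x. sin (c * x + d)) has_real_derivative sin (c * x + (d + pi / 2)) * c) (at x)"
    by (auto intro!: derivative_eq_intros simp: sin_add cos_add algebra_simps)
  then show ?case by (rule bexI[OF _ m])
next
  case (const c)
  show ?case by (rule bexI[OF _ smooth_algebra.const[of 0]]) auto
next
  case (add f g)
  then obtain f' g' where "f' \<in> smooth_algebra" "g' \<in> smooth_algebra"
    "\<forall>x. (f has_real_derivative f' x) (at x)" "\<forall>x. (g has_real_derivative g' x) (at x)" by auto
  then show ?case by (intro bexI[of _ "\<lambda>x. f' x + g' x"]) (auto intro: DERIV_add smooth_algebra.intros)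
next
  case (mult f g)
  then obtain f' g' where "f' \<in> smooth_algebra" "g' \<in> smooth_algebra"
    "\<forall>x. (f has_real_derivative f' x) (at x)" "\<forall>x. (g has_real_derivative g' x) (at x)" by auto
  then show ?case using mult(1,2)
    by (intro bexI[of _ "\<lambda>x. f' x * g x + g' x * f x"]) (auto intro: DERIV_mult smooth_algebra.intros)
qed

text \<open>A smooth step: zero on the negative half-line, with limit 1 at infinity. Steep affine
  arguments turn it into an approximation of indicators.\<close>

definition plateau :: "real \<Rightarrow> real" where "plateau = flat 1"
definition plateau' :: "real \<Rightarrow> real" where "plateau' = flat (monom 1 2)"

lemma plateau_deriv: "(plateau has_real_derivative plateau' x) (at x)"
  using flat_has_derivative[of 1 x] by (simp add: plateau_def plateau'_def)

lemma plateau_bounds: "0 \<le> plateau x" "plateau x \<le> 1"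
  by (auto simp: plateau_def flat_def)

lemma plateau_tendsto: "filterlim f at_top F \<Longrightarrow> ((\<lambda>n. plateau (f n)) \<longlongrightarrow> 1) F"
proof -
  assume f: "filterlim f at_top F"
  have "((\<lambda>n. exp (- inverse (f n))) \<longlongrightarrow> exp (- 0)) F"
    by (intro tendsto_intros tendsto_inverse_0_at_top f)
  then have "((\<lambda>n. exp (- inverse (f n))) \<longlongrightarrow> 1) F" by simp
  then show ?thesis
    by (rule Lim_transform_eventually)
      (use f[THEN filterlim_at_top_dense[THEN iffD1], rule_format, of 0] in
        \<open>auto elim!: eventually_mono simp: plateau_def flat_def inverse_eq_divide\<close>)
qed

lemma plateau_in_algebra: "(\<lambda>x. plateau (c * x + d)) \<in> smooth_algebra"
  unfolding plateau_def by (rule smooth_algebra.flat)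

lemma plateau'_nonneg: "0 \<le> plateau' x" by (auto simp: plateau'_def flat_def poly_monom)

text \<open>For positive \<open>x\<close> and y = 1/x the product is (y + y^2) exp(-y). The
  quadratic Taylor bound of exp gives 2, and y tends to 0 as \<open>x\<close> grows. With the
  argument N x - 1 of a cutoff the weight \<open>x + 1\<close> becomes N x, which is what the factor
  x of the sine and the slope N of the cutoff contribute.\<close>

lemma plateau'_bounds:
  assumes "-1 \<le> x"
  shows "(x + 1) * plateau' x \<le> 2" "0 < x \<Longrightarrow> (x + 1) * plateau' x \<le> inverse x + (inverse x)^2"
proof -
  have *: "(x + 1) * plateau' x = (inverse x + (inverse x)^2) * exp (- inverse x)" if "0 < x"
    using that by (simp add: plateau'_def flat_def poly_monom field_simps power2_eq_square)
  show "(x + 1) * plateau' x \<le> inverse x + (inverse x)^2" if "0 < x"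
    unfolding *[OF that] using that by (intro mult_left_le) auto
  show "(x + 1) * plateau' x \<le> 2"
  proof (cases "0 < x")
    case True
    have "1 + inverse x + (inverse x)^2 / 2 \<le> exp (inverse x)"
      using True by (intro exp_lower_Taylor_quadratic) auto
    moreover have "0 < inverse x" using True by simp
    ultimately have "inverse x + (inverse x)^2 \<le> 2 * exp (inverse x)"
      by linarith
    then have "(inverse x + (inverse x)^2) * exp (- inverse x) \<le> 2 * exp (inverse x) * exp (- inverse x)"
      by (intro mult_right_mono) auto
    also have "\<dots> = 2" by (simp add: exp_minus)
    finally show ?thesis unfolding *[OF True] .
  qed (simp add: plateau'_def flat_def)
qed

text \<open>A smooth step up at \<open>c\<close> times one down at \<open>d\<close>, ever steeper
  with \<open>n\<close>; the product vanishes outside the interval for every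
  \<open>n\<close>.\<close>

lemma approx_indicator_test:
  assumes "0 < c" "d < 1"
  obtains \<phi> where "\<And>n::nat. \<phi> n \<in> test_functions" "\<And>n x. 0 \<le> \<phi> n x" "\<And>n x. \<phi> n x \<le> 1"
    "\<And>x. (\<lambda>n. \<phi> n x) \<longlonglongrightarrow> indicator {c<..<d} x"
proof
  define \<phi> where "\<phi> n x = plateau (real (Suc n) * x + (- real (Suc n) * c)) * plateau ((- real (Suc n)) * x + real (Suc n) * d)" for n x
  have z: "\<phi> n x = 0" if "x \<notin> {c<..<d}" for n x
  proof -
    have "x \<le> c \<or> d \<le> x" using that by auto
    then have "real (Suc n) * x \<le> real (Suc n) * c \<or> real (Suc n) * d \<le> real (Suc n) * x"
      by (auto intro!: mult_left_mono)
    then have "real (Suc n) * x + (- real (Suc n) * c) \<le> 0 \<or> (- real (Suc n)) * x + real (Suc n) * d \<le> 0"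
      by (simp del: of_nat_Suc)
    then show ?thesis unfolding \<phi>_def plateau_def flat_def by (auto simp del: of_nat_Suc)
  qed
  show "\<phi> n \<in> test_functions" for n
  proof (rule test_functionI[OF smooth_algebra_deriv])
    show "\<phi> n \<in> smooth_algebra" unfolding \<phi>_def by (intro smooth_algebra.mult plateau_in_algebra)
  qed (use z assms in auto)
  show "0 \<le> \<phi> n x" "\<phi> n x \<le> 1" for n x unfolding \<phi>_def by (auto intro!: mult_le_one plateau_bounds mult_nonneg_nonneg)
  show "(\<lambda>n. \<phi> n x) \<longlonglongrightarrow> indicator {c<..<d} x" for x
  proof (cases "x \<in> {c<..<d}")
    case True
    have *: "filterlim (\<lambda>n. real (Suc n) * e) at_top sequentially" if "e > 0" for e
      using that by real_asymp
    have "(\<lambda>n. \<phi> n x) \<longlonglongrightarrow> 1 * 1"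
      unfolding \<phi>_def
    proof (intro tendsto_mult plateau_tendsto)
      show "filterlim (\<lambda>n. real (Suc n) * x + (- real (Suc n) * c)) at_top sequentially"
        using *[of "x - c"] True by (simp add: algebra_simps)
      show "filterlim (\<lambda>n. - real (Suc n) * x + real (Suc n) * d) at_top sequentially"
        using *[of "d - x"] True by (simp add: algebra_simps)
    qed
    then show ?thesis using True by simp
  next
    case False
    then show ?thesis using z[of x] by simp
  qed
qed


section \<open>The fundamental lemma of the calculus of variations and primitives of weak
  derivatives\<close>

lemma integrable_ivl_mult_bounded:
  fixes f \<phi> :: "real \<Rightarrow> real"
  assumes f: "integrable (ivl a b) f" and [measurable]: "\<phi> \<in> borel_measurable borel"
    and B: "\<And>x. a \<le> x \<Longrightarrow> x \<le> b \<Longrightarrow> \<bar>\<phi> x\<bar> \<le> B"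
  shows "integrable (ivl a b) (\<lambda>x. f x * \<phi> x)"
proof (rule Bochner_Integration.integrable_bound)
  have [measurable]: "f \<in> borel_measurable borel" by (rule borel_measurable_integrable_ivl[OF f])
  show "(\<lambda>x. f x * \<phi> x) \<in> borel_measurable (ivl a b)" by simp
  show "integrable (ivl a b) (\<lambda>x. B * \<bar>f x\<bar>)" using f by simp
  show "AE x in ivl a b. norm (f x * \<phi> x) \<le> norm (B * \<bar>f x\<bar>)"
    unfolding AE_ivl
  proof (intro AE_I2 impI)
    fix x assume "a \<le> x \<and> x \<le> b"
    then have "\<bar>\<phi> x\<bar> \<le> \<bar>B\<bar>" using B[of x] by linarith
    then have "\<bar>f x\<bar> * \<bar>\<phi> x\<bar> \<le> \<bar>f x\<bar> * \<bar>B\<bar>" by (rule mult_left_mono) simp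
    then show "norm (f x * \<phi> x) \<le> norm (B * \<bar>f x\<bar>)" by (simp add: abs_mult mult.commute)
  qed
qed

lemma integrable_mult_test:
  assumes "integrable (ivl a b) f" "\<phi> \<in> test_functions"
  shows "integrable (ivl a b) (\<lambda>x. f x * \<phi> x)"
  using test_function_bounded[OF assms(2)] integrable_ivl_mult_bounded[OF assms(1) test_function_borel[OF assms(2)]]
  by metis

lemma integral_ivl_mult_tendsto:
  fixes f \<phi>0 :: "real \<Rightarrow> real" and \<phi> :: "nat \<Rightarrow> real \<Rightarrow> real"
  assumes f: "integrable (ivl a b) f" and \<phi>[measurable]: "\<And>n. \<phi> n \<in> borel_measurable borel" "\<phi>0 \<in> borel_measurable borel"
    and B: "\<And>n x. a \<le> x \<Longrightarrow> x \<le> b \<Longrightarrow> \<bar>\<phi> n x\<bar> \<le> B"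
    and lim: "\<And>x. a < x \<Longrightarrow> x < b \<Longrightarrow> (\<lambda>n. \<phi> n x) \<longlonglongrightarrow> \<phi>0 x"
  shows "(\<lambda>n. \<integral>x. f x * \<phi> n x \<partial>ivl a b) \<longlonglongrightarrow> (\<integral>x. f x * \<phi>0 x \<partial>ivl a b)"
proof (rule integral_dominated_convergence[where w="\<lambda>x. B * \<bar>f x\<bar>"])
  have [measurable]: "f \<in> borel_measurable borel" by (rule borel_measurable_integrable_ivl[OF f])
  show "(\<lambda>x. f x * \<phi>0 x) \<in> borel_measurable (ivl a b)" "\<And>n. (\<lambda>x. f x * \<phi> n x) \<in> borel_measurable (ivl a b)" by simp_all
  show "integrable (ivl a b) (\<lambda>x. B * \<bar>f x\<bar>)" using f by simp
  have "AE x in lborel. x \<noteq> a" "AE x in lborel. x \<noteq> b" by (rule AE_lborel_singleton)+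
  then show "AE x in ivl a b. (\<lambda>n. f x * \<phi> n x) \<longlonglongrightarrow> f x * \<phi>0 x"
    unfolding AE_ivl by eventually_elim (auto intro!: tendsto_intros lim)
  show "AE x in ivl a b. norm (f x * \<phi> n x) \<le> B * \<bar>f x\<bar>" for n
    unfolding AE_ivl
  proof (intro AE_I2 impI)
    fix x assume "a \<le> x \<and> x \<le> b"
    then have "\<bar>f x\<bar> * \<bar>\<phi> n x\<bar> \<le> \<bar>f x\<bar> * B" using B by (intro mult_left_mono) auto
    then show "norm (f x * \<phi> n x) \<le> B * \<bar>f x\<bar>" by (simp add: abs_mult mult.commute)
  qed
qed

text \<open>Integrals over closed subintervals are limits of integrals against smoothed
  indicators.\<close>

lemma du_bois_reymond:
  fixes f :: "real \<Rightarrow> real"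
  assumes f: "integrable (ivl 0 1) f" and zero: "\<And>\<phi>. \<phi> \<in> test_functions \<Longrightarrow> (\<integral>x. f x * \<phi> x \<partial>ivl 0 1) = 0"
  shows "AE x in ivl 0 1. f x = 0"
proof (rule AE_zero_if_integral_Icc_zero[OF f])
  have [measurable]: "f \<in> borel_measurable borel" by (rule borel_measurable_integrable_ivl[OF f])
  fix c d :: real assume cd: "0 < c" "c \<le> d" "d < 1"
  obtain \<phi> where \<phi>: "\<And>n::nat. \<phi> n \<in> test_functions" "\<And>n x. 0 \<le> \<phi> n x" "\<And>n x. \<phi> n x \<le> 1"
    "\<And>x. (\<lambda>n. \<phi> n x) \<longlonglongrightarrow> indicator {c<..<d} x" using approx_indicator_test[OF cd(1,3)] by blast
  have "(\<lambda>n. \<integral>x. f x * \<phi> n x \<partial>ivl 0 1) \<longlonglongrightarrow> (\<integral>x. f x * indicator {c<..<d} x \<partial>ivl 0 1)"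
    using \<phi> by (intro integral_ivl_mult_tendsto[OF f, where B=1]) (auto intro: test_function_borel)
  then have "(\<integral>x. f x * indicator {c<..<d} x \<partial>ivl 0 1) = 0"
    using zero[OF \<phi>(1)] by (simp add: LIMSEQ_const_iff)
  moreover have "(\<integral>x. f x * indicator {c<..<d} x \<partial>ivl 0 1) = integral\<^sup>L (ivl c d) f"
  proof -
    have "AE x in lborel. x \<noteq> c" "AE x in lborel. x \<noteq> d" by (rule AE_lborel_singleton)+
    then have "AE x in lborel. indicator {0..1} x * (f x * indicator {c<..<d} x) = indicator {c..d} x * f x"
      by eventually_elim (use cd in \<open>auto simp: indicator_def\<close>)
    then show ?thesis by (simp add: integral_ivl) (intro integral_cong_AE, auto)
  qed
  ultimately show "integral\<^sup>L (ivl c d) f = 0" by simp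
qed simp

lemma test_function_parts:
  fixes g :: "real \<Rightarrow> real"
  assumes g: "integrable (ivl 0 1) g" and \<phi>: "\<phi> \<in> test_functions"
  shows "(\<integral>x. integral\<^sup>L (ivl 0 x) g * deriv \<phi> x \<partial>ivl 0 1) = - (\<integral>x. g x * \<phi> x \<partial>ivl 0 1)"
proof -
  have [measurable]: "g \<in> borel_measurable borel" by (rule borel_measurable_integrable_ivl[OF g])
  have [measurable]: "\<phi> \<in> borel_measurable borel" "deriv \<phi> \<in> borel_measurable borel"
    by (intro test_function_borel \<phi> deriv_test_function)+
  have [measurable]: "(\<lambda>x. integral\<^sup>L (ivl 0 x) g) \<in> borel_measurable borel"
    by (rule borel_measurable_integral_ivl) simp
  have k: "integrable (ivl 0 1) (deriv \<phi>)"
    using test_function_bounded[OF deriv_test_function[OF \<phi>]] by (metis integrable_ivl_bounded deriv_test_function test_function_borel \<phi>)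
  have \<phi>0: "\<phi> s = 0 + integral\<^sup>L (ivl 0 s) (deriv \<phi>)" if "0 \<le> s" for s
    using integral_ivl_FTC[of 0 s \<phi> "deriv \<phi>"] that test_function_deriv[OF \<phi>]
      test_function_continuous[OF deriv_test_function[OF \<phi>]] test_function_boundary[OF \<phi>, of 0]
    by (simp add: has_field_derivative_at_within)
  have "integral\<^sup>L (ivl 0 1) g * \<phi> 1 - 0 * 0 = (\<integral>x. integral\<^sup>L (ivl 0 x) g * deriv \<phi> x \<partial>ivl 0 1) + (\<integral>x. \<phi> x * g x \<partial>ivl 0 1)"
    by (rule product_rule_primitive[OF g k]) (use \<phi>0 in auto)
  then show ?thesis using test_function_boundary[OF \<phi>, of 1] by (simp add: mult.commute)
qed

text \<open>The difference of \<open>f\<close> and the primitive of \<open>g\<close> has weak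
  derivative zero. Such a function is constant: any test function minus a multiple of a fixed one of
  integral 1 has integral zero and hence is the derivative of a test function.\<close>

lemma weak_deriv_primitive:
  fixes f g :: "real \<Rightarrow> real"
  assumes f: "integrable (ivl 0 1) f" and g: "integrable (ivl 0 1) g"
    and weak: "\<And>\<phi>. \<phi> \<in> test_functions \<Longrightarrow> (\<integral>x. f x * deriv \<phi> x \<partial>ivl 0 1) = - (\<integral>x. g x * \<phi> x \<partial>ivl 0 1)"
  obtains \<kappa> where "AE x in ivl 0 1. f x = \<kappa> + integral\<^sup>L (ivl 0 x) g"
proof -
  have [measurable]: "g \<in> borel_measurable borel" by (rule borel_measurable_integrable_ivl[OF g])
  have Gm[measurable]: "(\<lambda>x. integral\<^sup>L (ivl 0 x) g) \<in> borel_measurable borel"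
    by (rule borel_measurable_integral_ivl) simp
  have "compact ((\<lambda>x. integral\<^sup>L (ivl 0 x) g) ` {0..1})"
    by (intro compact_continuous_image continuous_on_integral_ivl g) auto
  then obtain B where "\<And>x. 0 \<le> x \<Longrightarrow> x \<le> 1 \<Longrightarrow> \<bar>integral\<^sup>L (ivl 0 x) g\<bar> \<le> B"
    using compact_imp_bounded bounded_iff by (metis (no_types, lifting) atLeastAtMost_iff imageI real_norm_def)
  then have iG: "integrable (ivl 0 1) (\<lambda>x. integral\<^sup>L (ivl 0 x) g)"
    by (intro integrable_ivl_bounded) auto
  define h where "h x = f x - integral\<^sup>L (ivl 0 x) g" for x
  have ih: "integrable (ivl 0 1) h" unfolding h_def using f iG by simp
  have hz: "(\<integral>x. h x * deriv \<phi> x \<partial>ivl 0 1) = 0" if \<phi>: "\<phi> \<in> test_functions" for \<phi>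
    using weak[OF \<phi>] test_function_parts[OF g \<phi>] integrable_mult_test[OF f deriv_test_function[OF \<phi>]]
      integrable_mult_test[OF iG deriv_test_function[OF \<phi>]]
    by (simp add: h_def left_diff_distrib)
  obtain \<psi>0 where \<psi>0: "\<psi>0 \<in> test_functions" "integral\<^sup>L (ivl 0 1) \<psi>0 = 1"
  proof -
    obtain \<phi> where \<phi>: "\<And>n::nat. \<phi> n \<in> test_functions" "\<And>n x. 0 \<le> \<phi> n x" "\<And>n x. \<phi> n x \<le> 1"
      "\<And>x. (\<lambda>n. \<phi> n x) \<longlonglongrightarrow> indicator {1/4<..<3/4} x" using approx_indicator_test[of "1/4" "3/4"] by auto
    have "(\<lambda>n. \<integral>x. 1 * \<phi> n x \<partial>ivl 0 1) \<longlonglongrightarrow> (\<integral>x. 1 * indicator {1/4<..<3/4} x \<partial>ivl 0 1)"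
      using \<phi> by (intro integral_ivl_mult_tendsto[where B=1] integrable_ivl_bounded[where B=1]) (auto intro: test_function_borel)
    moreover have "(\<integral>x. 1 * indicator {1/4<..<3/4} x \<partial>ivl 0 1) = (1 / 2 :: real)"
    proof -
      have "{1/4<..<3/4} \<inter> {0..1} = {1/4<..<3/4::real}" by auto
      then have "measure (ivl 0 1) {1/4<..<3/4} = measure lborel {1/4<..<3/4::real}"
        by (simp add: measure_def emeasure_ivl del: emeasure_lborel_Ioo)
      then show ?thesis by simp
    qed
    ultimately have "(\<lambda>n. \<integral>x. \<phi> n x \<partial>ivl 0 1) \<longlonglongrightarrow> 1 / 2" by (simp only: mult_1)
    then have "\<forall>\<^sub>F n in sequentially. (\<integral>x. \<phi> n x \<partial>ivl 0 1) > 1/4"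
      by (rule order_tendstoD) simp
    then obtain n where n: "(\<integral>x. \<phi> n x \<partial>ivl 0 1) > 1/4" by (auto simp: eventually_sequentially)
    let ?I = "\<integral>x. \<phi> n x \<partial>ivl 0 1"
    have i: "integrable (ivl 0 1) (\<phi> n)"
      using \<phi> by (intro integrable_ivl_bounded[where B=1]) (auto intro: test_function_borel)
    \<comment> \<open>A multiple of \<open>\<phi> n\<close> with integral 1, written as a
      combination of \<open>\<phi> n\<close> with itself so that
      \<open>test_function_lincomb\<close> applies. The limit 1/2 is used to make the divisor
      positive.\<close>
    show thesis
    proof (rule that[of "\<lambda>x. \<phi> n x + (1 / ?I - 1) * \<phi> n x"])
      show "integral\<^sup>L (ivl 0 1) (\<lambda>x. \<phi> n x + (1 / ?I - 1) * \<phi> n x) = 1"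
        using i n by (simp add: field_simps)
    qed (intro test_function_lincomb \<phi>)
  qed
  define \<kappa> where "\<kappa> = (\<integral>x. h x * \<psi>0 x \<partial>ivl 0 1)"
  have "AE x in ivl 0 1. h x - \<kappa> = 0"
  proof (rule du_bois_reymond)
    show "integrable (ivl 0 1) (\<lambda>x. h x - \<kappa>)" using ih by simp
    fix \<psi> assume \<psi>: "\<psi> \<in> test_functions"
    let ?I = "integral\<^sup>L (ivl 0 1) \<psi>"
    have i: "integrable (ivl 0 1) \<phi>" if "\<phi> \<in> test_functions" for \<phi>
      using test_function_bounded[OF that] by (metis integrable_ivl_bounded test_function_borel that)
    have "(\<lambda>x. \<psi> x + (- ?I) * \<psi>0 x) \<in> test_functions" by (intro test_function_lincomb \<psi> \<psi>0)
    moreover have "integral\<^sup>L (ivl 0 1) (\<lambda>x. \<psi> x + (- ?I) * \<psi>0 x) = 0"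
      using i[OF \<psi>] i[OF \<psi>0(1)] \<psi>0(2) by simp
    ultimately obtain \<phi> where \<phi>: "\<phi> \<in> test_functions" "deriv \<phi> = (\<lambda>x. \<psi> x + (- ?I) * \<psi>0 x)"
      by (rule test_function_primitive)
    have "0 = (\<integral>x. h x * \<psi> x - ?I * (h x * \<psi>0 x) \<partial>ivl 0 1)"
      using hz[OF \<phi>(1)] unfolding \<phi>(2) by (simp add: algebra_simps)
    also have "\<dots> = (\<integral>x. h x * \<psi> x \<partial>ivl 0 1) - ?I * \<kappa>"
      using integrable_mult_test[OF ih \<psi>] integrable_mult_test[OF ih \<psi>0(1)] by (simp add: \<kappa>_def)
    finally show "(\<integral>x. (h x - \<kappa>) * \<psi> x \<partial>ivl 0 1) = 0"
      using integrable_mult_test[OF ih \<psi>] i[OF \<psi>] by (simp add: left_diff_distrib mult.commute[of _ \<kappa>])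
  qed
  then have "AE x in ivl 0 1. f x = \<kappa> + integral\<^sup>L (ivl 0 x) g" by eventually_elim (simp add: h_def)
  then show thesis by (rule that)
qed

section \<open>Truncations of the sine functions\<close>

lemma sin_npi_bounds:
  assumes "0 \<le> x" "x \<le> 1"
  shows "\<bar>sin (real k * pi * x)\<bar> \<le> real k * pi * x" "\<bar>sin (real k * pi * x)\<bar> \<le> real k * pi * (1 - x)"
proof -
  show "\<bar>sin (real k * pi * x)\<bar> \<le> real k * pi * x" using abs_sin_x_le_abs_x[of "real k * pi * x"] assms by simp
  have "sin (real k * pi * x) = - (cos (real k * pi) * sin (real k * pi * (1 - x)))"
    using sin_diff[of "real k * pi" "real k * pi * (1 - x)"] by (simp add: algebra_simps)
  then have "\<bar>sin (real k * pi * x)\<bar> = \<bar>sin (real k * pi * (1 - x))\<bar>" by (simp add: abs_mult)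
  then show "\<bar>sin (real k * pi * x)\<bar> \<le> real k * pi * (1 - x)"
    using abs_sin_x_le_abs_x[of "real k * pi * (1 - x)"] assms by simp
qed

text \<open>
  The truncations of the sine converge together with their first derivatives, boundedly: the
  derivative of the cutoff is of order \<open>1/x\<close> near the end point \<open>0\<close>, where the sine is of order \<open>x\<close>.
\<close>

lemma approx_sin_test:
  obtains \<phi> C where "\<And>n::nat. \<phi> n \<in> test_functions" "\<And>n x. \<bar>\<phi> n x\<bar> \<le> 1"
    "\<And>n x. 0 \<le> x \<Longrightarrow> x \<le> 1 \<Longrightarrow> \<bar>deriv (\<phi> n) x\<bar> \<le> C"
    "\<And>x. 0 < x \<Longrightarrow> x < 1 \<Longrightarrow> (\<lambda>n. \<phi> n x) \<longlonglongrightarrow> sin (real k * pi * x)"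
    "\<And>x. 0 < x \<Longrightarrow> x < 1 \<Longrightarrow> (\<lambda>n. deriv (\<phi> n) x) \<longlonglongrightarrow> real k * pi * cos (real k * pi * x)"
proof
  let ?\<omega> = "real k * pi"
  let ?N = "\<lambda>n. real (Suc n)"
  \<comment> \<open>With N = n + 1 the cutoffs vanish for x \<le> 1/N and for x \<ge> 1 - 1/N; for n
    = 0 the whole function is zero.\<close>
  define l r where "l n x = plateau (?N n * x + (- 1))" and "r n x = plateau ((- ?N n) * x + (?N n - 1))" for n x
  define l' r' where "l' n x = ?N n * plateau' (?N n * x + (- 1))"
     and "r' n x = ?N n * plateau' ((- ?N n) * x + (?N n - 1))" for n x
  define \<phi> where "\<phi> n x = sin (?\<omega> * x + 0) * (l n x * r n x)" for n x
  define \<phi>' where "\<phi>' n x = ?\<omega> * cos (?\<omega> * x) * (l n x * r n x) + sin (?\<omega> * x) * (l' n x * r n x - l n x * r' n x)" for n x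
  have \<phi>z: "\<phi> n x = 0" if "x \<notin> {1 / ?N n..1 - 1 / ?N n}" for n x
  proof -
    have "?N n * x + (- 1) \<le> 0 \<or> (- ?N n) * x + (?N n - 1) \<le> 0" using that by (auto simp: field_simps)
    then show ?thesis unfolding \<phi>_def l_def r_def plateau_def flat_def by auto
  qed
  show "\<phi> n \<in> test_functions" for n
  proof (rule test_functionI[OF smooth_algebra_deriv])
    show "\<phi> n \<in> smooth_algebra" unfolding \<phi>_def l_def r_def
      by (intro smooth_algebra.mult plateau_in_algebra smooth_algebra.sin)
  qed (use \<phi>z in auto)
  have d: "(\<phi> n has_real_derivative \<phi>' n x) (at x)" for n x
    unfolding \<phi>_def \<phi>'_def l_def r_def l'_def r'_def
    by (auto intro!: derivative_eq_intros plateau_deriv[THEN DERIV_chain2] simp: algebra_simps)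
  then have deriv\<phi>: "deriv (\<phi> n) x = \<phi>' n x" for n x by (rule DERIV_imp_deriv)
  have lr: "0 \<le> l n x" "l n x \<le> 1" "0 \<le> r n x" "r n x \<le> 1" for n x
    by (auto simp: l_def r_def plateau_bounds)
  then have lr1: "0 \<le> l n x * r n x" "l n x * r n x \<le> 1" for n x by (auto intro!: mult_le_one)
  show "\<bar>\<phi> n x\<bar> \<le> 1" for n x
    using lr1[of n x] mult_le_one[of "\<bar>sin (?\<omega> * x + 0)\<bar>" "l n x * r n x"] unfolding \<phi>_def by (simp add: abs_mult lr)
  have l'0: "0 \<le> l' n x" "0 \<le> r' n x" for n x by (auto simp: l'_def r'_def plateau'_nonneg)
  \<comment> \<open>Near 0 the sine is at most its frequency times x, and the slope of
    \<open>l\<close> carries a factor N; together they form the weight of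
    \<open>plateau'_bounds\<close>. The other end is its mirror image.\<close>
  have sl: "\<bar>sin (?\<omega> * x)\<bar> * l' n x \<le> ?\<omega> * ((?N n * x + (-1) + 1) * plateau' (?N n * x + (-1)))"
    if "0 \<le> x" "x \<le> 1" for n x
  proof -
    have "\<bar>sin (?\<omega> * x)\<bar> * l' n x \<le> (?\<omega> * x) * l' n x"
      using sin_npi_bounds(1)[OF that] l'0 by (intro mult_right_mono) auto
    then show ?thesis by (simp add: l'_def algebra_simps)
  qed
  have sr: "\<bar>sin (?\<omega> * x)\<bar> * r' n x \<le> ?\<omega> * (((- ?N n) * x + (?N n - 1) + 1) * plateau' ((- ?N n) * x + (?N n - 1)))"
    if "0 \<le> x" "x \<le> 1" for n x
  proof -
    have "\<bar>sin (?\<omega> * x)\<bar> * r' n x \<le> (?\<omega> * (1 - x)) * r' n x"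
      using sin_npi_bounds(2)[OF that] l'0 by (intro mult_right_mono) auto
    then show ?thesis by (simp add: r'_def algebra_simps)
  qed
  have args: "-1 \<le> ?N n * x + (-1)" "-1 \<le> (- ?N n) * x + (?N n - 1)" if "0 \<le> x" "x \<le> 1" for n x
    using that mult_left_mono[of x 1 "?N n"] by (simp_all add: algebra_simps)
  have tail: "\<bar>sin (?\<omega> * x) * (l' n x * r n x - l n x * r' n x)\<bar> \<le> \<bar>sin (?\<omega> * x)\<bar> * l' n x + \<bar>sin (?\<omega> * x)\<bar> * r' n x" for n x
  proof -
    have "l' n x * r n x \<le> l' n x * 1" "l n x * r' n x \<le> 1 * r' n x" "0 \<le> l' n x * r n x" "0 \<le> l n x * r' n x"
      using lr l'0 by (intro mult_left_mono mult_right_mono mult_nonneg_nonneg; simp)+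
    then have "\<bar>l' n x * r n x - l n x * r' n x\<bar> \<le> l' n x + r' n x" by linarith
    then have "\<bar>sin (?\<omega> * x)\<bar> * \<bar>l' n x * r n x - l n x * r' n x\<bar> \<le> \<bar>sin (?\<omega> * x)\<bar> * (l' n x + r' n x)"
      by (rule mult_left_mono) simp
    then show ?thesis by (simp add: abs_mult distrib_left)
  qed
  show "\<bar>deriv (\<phi> n) x\<bar> \<le> ?\<omega> + (?\<omega> * 2 + ?\<omega> * 2)" if "0 \<le> x" "x \<le> 1" for n x
  proof -
    have "\<bar>?\<omega> * cos (?\<omega> * x) * (l n x * r n x)\<bar> = ?\<omega> * (\<bar>cos (?\<omega> * x)\<bar> * (l n x * r n x))"
      using lr1[of n x] by (simp add: abs_mult lr)
    also have "\<dots> \<le> ?\<omega> * 1" by (intro mult_left_mono[OF mult_le_one[OF abs_cos_le_one lr1]]) simp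
    finally have 1: "\<bar>?\<omega> * cos (?\<omega> * x) * (l n x * r n x)\<bar> \<le> ?\<omega>" by simp
    have 2: "\<bar>sin (?\<omega> * x)\<bar> * l' n x \<le> ?\<omega> * 2"
      by (rule order_trans[OF sl[OF that] mult_left_mono[OF plateau'_bounds(1)]]) (use args[OF that] in auto)
    have 3: "\<bar>sin (?\<omega> * x)\<bar> * r' n x \<le> ?\<omega> * 2"
      by (rule order_trans[OF sr[OF that] mult_left_mono[OF plateau'_bounds(1)]]) (use args[OF that] in auto)
    show ?thesis unfolding deriv\<phi> \<phi>'_def using 1 2 3 tail[of x n]
      abs_triangle_ineq[of "?\<omega> * cos (?\<omega> * x) * (l n x * r n x)" "sin (?\<omega> * x) * (l' n x * r n x - l n x * r' n x)"]
      by linarith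
  qed
  fix x :: real assume x: "0 < x" "x < 1"
  have A1: "filterlim (\<lambda>n. ?N n * x + (- 1)) at_top sequentially" using x by real_asymp
  have A2: "filterlim (\<lambda>n. (- ?N n) * x + (?N n - 1)) at_top sequentially" using x by real_asymp
  have L: "(\<lambda>n. l n x * r n x) \<longlonglongrightarrow> 1 * 1"
    unfolding l_def r_def by (intro tendsto_mult plateau_tendsto A1 A2)
  show "(\<lambda>n. \<phi> n x) \<longlonglongrightarrow> sin (?\<omega> * x)"
    unfolding \<phi>_def using tendsto_mult[OF tendsto_const[of "sin (?\<omega> * x)"] L] by simp
  \<comment> \<open>For interior \<open>x\<close> the arguments of the cutoffs tend to infinity, and
    the second bound of \<open>plateau'_bounds\<close> makes the terms with a derivative of a cutoff
    vanish in the limit.\<close>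
  have z: "(\<lambda>n. ?\<omega> * ((f n + 1) * plateau' (f n))) \<longlonglongrightarrow> 0" if f: "filterlim f at_top sequentially" for f
  proof (rule Lim_null_comparison)
    have "\<forall>\<^sub>F n in sequentially. 0 < f n" using f by (simp add: filterlim_at_top_dense)
    then show "\<forall>\<^sub>F n in sequentially. norm (?\<omega> * ((f n + 1) * plateau' (f n))) \<le> ?\<omega> * (inverse (f n) + (inverse (f n))\<^sup>2)"
    proof eventually_elim
      case (elim n)
      have "0 \<le> (f n + 1) * plateau' (f n)" using elim plateau'_nonneg by (intro mult_nonneg_nonneg) auto
      then show ?case using plateau'_bounds(2)[of "f n"] elim by (auto simp: abs_mult intro!: mult_left_mono)
    qed
    show "(\<lambda>n. ?\<omega> * (inverse (f n) + (inverse (f n))\<^sup>2)) \<longlonglongrightarrow> 0"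
    proof -
      note i = tendsto_inverse_0_at_top[OF f]
      show ?thesis using tendsto_mult[OF tendsto_const[of "?\<omega>"] tendsto_add[OF i tendsto_power[OF i, of 2]]] by simp
    qed
  qed
  have "(\<lambda>n. sin (?\<omega> * x) * (l' n x * r n x - l n x * r' n x)) \<longlonglongrightarrow> 0"
  proof (rule Lim_null_comparison)
    show "\<forall>\<^sub>F n in sequentially. norm (sin (?\<omega> * x) * (l' n x * r n x - l n x * r' n x)) \<le>
      ?\<omega> * ((?N n * x + (-1) + 1) * plateau' (?N n * x + (-1))) + ?\<omega> * (((- ?N n) * x + (?N n - 1) + 1) * plateau' ((- ?N n) * x + (?N n - 1)))"
    proof (rule always_eventually, rule allI)
      fix n
      show "norm (sin (?\<omega> * x) * (l' n x * r n x - l n x * r' n x)) \<le>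
      ?\<omega> * ((?N n * x + (-1) + 1) * plateau' (?N n * x + (-1))) + ?\<omega> * (((- ?N n) * x + (?N n - 1) + 1) * plateau' ((- ?N n) * x + (?N n - 1)))"
        using tail[of x n] sl[of x n] sr[of x n] x by (simp only: real_norm_def) linarith
    qed
  qed (use tendsto_add[OF z[OF A1] z[OF A2]] in simp)
  moreover have "(\<lambda>n. ?\<omega> * cos (?\<omega> * x) * (l n x * r n x)) \<longlonglongrightarrow> ?\<omega> * cos (?\<omega> * x)"
    using tendsto_mult[OF tendsto_const[of "?\<omega> * cos (?\<omega> * x)"] L] by simp
  ultimately show "(\<lambda>n. deriv (\<phi> n) x) \<longlonglongrightarrow> ?\<omega> * cos (?\<omega> * x)"
    unfolding deriv\<phi> \<phi>'_def using tendsto_add by fastforce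
qed

section \<open>Transport on the circle\<close>

text \<open>By Fubini the shift, which may vary with time, is removed on each time slice by
  translation invariance. The shift by the time itself passes to characteristic coordinates.\<close>

lemma pair_shift:
  fixes G :: "real \<times> real \<Rightarrow> real"
  assumes [measurable]: "G \<in> borel_measurable (borel \<Otimes>\<^sub>M borel)" "s \<in> borel_measurable borel"
    and per: "\<And>r. periodic2 (\<lambda>y. G (r, y))"
  shows "integrable (ivl a b \<Otimes>\<^sub>M circ) (\<lambda>(r, y). G (r, y + s r)) \<longleftrightarrow> integrable (ivl a b \<Otimes>\<^sub>M circ) G"
    and "(\<integral>(r, y). G (r, y + s r) \<partial>(ivl a b \<Otimes>\<^sub>M circ)) = integral\<^sup>L (ivl a b \<Otimes>\<^sub>M circ) G"
proof -
  have *: "(\<integral>\<^sup>+z. \<phi> (case z of (r, y) \<Rightarrow> G (r, y + s r)) \<partial>(ivl a b \<Otimes>\<^sub>M circ)) = (\<integral>\<^sup>+z. \<phi> (G z) \<partial>(ivl a b \<Otimes>\<^sub>M circ))"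
    if [measurable]: "\<phi> \<in> borel_measurable borel" for \<phi> :: "real \<Rightarrow> ennreal"
  proof -
    have "(\<integral>\<^sup>+y. \<phi> (G (r, y + s r)) \<partial>circ) = (\<integral>\<^sup>+y. \<phi> (G (r, y)) \<partial>circ)" for r
      using nn_integral_circ_shift[of "\<lambda>y. \<phi> (G (r, y))" "s r"] per[of r] by (simp add: periodic2_def)
    then show ?thesis
      by (simp add: ivl.nn_integral_fst[symmetric] split_beta)
  qed
  show "integrable (ivl a b \<Otimes>\<^sub>M circ) (\<lambda>(r, y). G (r, y + s r)) \<longleftrightarrow> integrable (ivl a b \<Otimes>\<^sub>M circ) G"
    and "(\<integral>(r, y). G (r, y + s r) \<partial>(ivl a b \<Otimes>\<^sub>M circ)) = integral\<^sup>L (ivl a b \<Otimes>\<^sub>M circ) G"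
    by (rule integral_eq_if_nn_integral_eq; simp add: *)+
qed

lemma pair_reflect:
  fixes G :: "real \<times> real \<Rightarrow> real"
  assumes [measurable]: "G \<in> borel_measurable (borel \<Otimes>\<^sub>M borel)"
  shows "integrable (ivl a b \<Otimes>\<^sub>M circ) (\<lambda>(r, y). G (r, - y)) \<longleftrightarrow> integrable (ivl a b \<Otimes>\<^sub>M circ) G"
    and "(\<integral>(r, y). G (r, - y) \<partial>(ivl a b \<Otimes>\<^sub>M circ)) = integral\<^sup>L (ivl a b \<Otimes>\<^sub>M circ) G"
proof -
  have *: "(\<integral>\<^sup>+z. \<phi> (case z of (r, y) \<Rightarrow> G (r, - y)) \<partial>(ivl a b \<Otimes>\<^sub>M circ)) = (\<integral>\<^sup>+z. \<phi> (G z) \<partial>(ivl a b \<Otimes>\<^sub>M circ))"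
    if [measurable]: "\<phi> \<in> borel_measurable borel" for \<phi> :: "real \<Rightarrow> ennreal"
  proof -
    have "(\<integral>\<^sup>+y. \<phi> (G (r, - y)) \<partial>circ) = (\<integral>\<^sup>+y. \<phi> (G (r, y)) \<partial>circ)" for r
      using nn_integral_ivl_uminus[of "\<lambda>y. \<phi> (G (r, y))" "-1" 1] by simp
    then show ?thesis
      by (simp add: ivl.nn_integral_fst[symmetric] split_beta)
  qed
  show "integrable (ivl a b \<Otimes>\<^sub>M circ) (\<lambda>(r, y). G (r, - y)) \<longleftrightarrow> integrable (ivl a b \<Otimes>\<^sub>M circ) G"
    and "(\<integral>(r, y). G (r, - y) \<partial>(ivl a b \<Otimes>\<^sub>M circ)) = integral\<^sup>L (ivl a b \<Otimes>\<^sub>M circ) G"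
    by (rule integral_eq_if_nn_integral_eq; simp add: *)+
qed

lemma integrable_mult_AE_bounded:
  fixes f \<phi> :: "'a \<Rightarrow> real"
  assumes f: "integrable M f" and [measurable]: "\<phi> \<in> borel_measurable M" and B: "AE x in M. \<bar>\<phi> x\<bar> \<le> B"
  shows "integrable M (\<lambda>x. \<phi> x * f x)"
proof (rule Bochner_Integration.integrable_bound)
  show "integrable M (\<lambda>x. B * \<bar>f x\<bar>)" using f by simp
  show "(\<lambda>x. \<phi> x * f x) \<in> borel_measurable M" using f by measurable
  show "AE x in M. norm (\<phi> x * f x) \<le> norm (B * \<bar>f x\<bar>)"
    using B
  proof eventually_elim
    case (elim x)
    then have "\<bar>\<phi> x\<bar> * \<bar>f x\<bar> \<le> \<bar>B\<bar> * \<bar>f x\<bar>" by (intro mult_right_mono) auto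
    then show ?case by (simp add: abs_mult)
  qed
qed

section \<open>Mild solutions and their integral functionals\<close>

lemma periodic2_comp: "periodic2 g \<Longrightarrow> periodic2 (\<lambda>y. h (g y))"
  unfolding periodic2_def by metis

lemma periodic2_comp2: "periodic2 f \<Longrightarrow> periodic2 g \<Longrightarrow> periodic2 (\<lambda>y. h (f y) (g y))"
  unfolding periodic2_def by metis

text \<open>Duhamel's formula for the transport equation along the characteristic through (t, x).
  Being a pointwise formula, it fixes one version of the solution.\<close>

definition mild :: "(real \<Rightarrow> real) \<Rightarrow> (real \<times> real \<Rightarrow> real) \<Rightarrow> real \<Rightarrow> real \<Rightarrow> real" where
  "mild U0 F t x = U0 (x - t) + (\<integral>r. F (r, x - t + r) \<partial>ivl 0 t)"

text \<open>The source is treated as given; its nonlinear dependence on \<open>V\<close> enters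
  later, in the form of inequalities. Oddness of \<open>F\<close> conserves the mean of
  \<open>U\<close> and allows \<open>symmetrize\<close>.\<close>

locale transport =
  fixes U0 :: "real \<Rightarrow> real" and F :: "real \<times> real \<Rightarrow> real"
  assumes U0_borel [measurable]: "U0 \<in> borel_measurable borel"
    and F_borel [measurable]: "F \<in> borel_measurable (borel \<Otimes>\<^sub>M borel)"
    and U0_periodic: "periodic2 U0"
    and F_periodic: "periodic2 (\<lambda>y. F (r, y))"
    and F_odd: "F (r, - y) = - F (r, y)"
    and U0_integrable: "integrable circ U0"
    and F_integrable: "integrable (ivl 0 T \<Otimes>\<^sub>M circ) F"
begin

abbreviation U :: "real \<Rightarrow> real \<Rightarrow> real" where "U \<equiv> mild U0 F"
definition V :: "real \<Rightarrow> real \<Rightarrow> real" where "V s y = (U s (- y) - U s y) / 2"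

lemma U_borel: "(\<lambda>p. U (fst p) (snd p)) \<in> borel_measurable (borel \<Otimes>\<^sub>M borel)"
proof -
  have "(\<lambda>p. U (fst p) (snd p)) = (\<lambda>p. U0 (snd p - fst p) +
     (\<integral>r. (if 0 \<le> r \<and> r \<le> fst p then F (r, snd p - fst p + r) else 0) \<partial>lborel))"
    by (auto simp: mild_def integral_ivl fun_eq_iff indicator_def intro!: Bochner_Integration.integral_cong)
  also have "\<dots> \<in> borel_measurable (borel \<Otimes>\<^sub>M borel)" by measurable
  finally show ?thesis .
qed

lemma U_measurable [measurable]:
  assumes [measurable]: "f \<in> borel_measurable M" "g \<in> borel_measurable M"
  shows "(\<lambda>x. U (f x) (g x)) \<in> borel_measurable M"
proof -
  have "(\<lambda>x. (\<lambda>p. U (fst p) (snd p)) (f x, g x)) \<in> borel_measurable M"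
    by (rule measurable_compose[OF _ U_borel]) measurable
  then show ?thesis by simp
qed

lemma V_measurable [measurable]:
  assumes [measurable]: "f \<in> borel_measurable M" "g \<in> borel_measurable M"
  shows "(\<lambda>x. V (f x) (g x)) \<in> borel_measurable M"
  unfolding V_def by measurable

lemma U_periodic: "periodic2 (U s)"
proof -
  have "U0 (y + 2 - s) = U0 (y - s)" for y
    using U0_periodic[unfolded periodic2_def, rule_format, of "y - s"] by (simp add: algebra_simps)
  moreover have "F (r, y + 2 - s + r) = F (r, y - s + r)" for y r
    using F_periodic[of r, unfolded periodic2_def, rule_format, of "y - s + r"] by (simp add: algebra_simps)
  ultimately show ?thesis by (simp add: periodic2_def mild_def)
qed

lemma U_0 [simp]: "U 0 x = U0 x"
  by (simp add: mild_def integral_ivl_eq_0)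

text \<open>Along a characteristic the solution is a primitive in time, the form required by
  \<open>chain_rule_primitive\<close>.\<close>

lemma U_char: "U s (y + s) = U0 y + (\<integral>r. F (r, y + r) \<partial>ivl 0 s)"
  by (simp add: mild_def)

lemma F_char_integrable: "integrable (ivl 0 T \<Otimes>\<^sub>M circ) (\<lambda>(r, y). F (r, y + r))"
  by (rule pair_shift(1)[THEN iffD2]) (measurable, rule F_periodic, rule F_integrable)

lemma AE_char_integrable: "AE y in circ. integrable (ivl 0 T) (\<lambda>r. F (r, y + r))"
  by (rule ivl2.AE_integrable_snd[OF F_char_integrable])

text \<open>The chain rule holds along almost every characteristic. After integration over the
  starting points, translation invariance returns to the original coordinates, with a fixed shift
  for \<open>U t\<close> and a time-dependent one for the source.\<close>

lemma energy:
  fixes \<Phi> \<phi> :: "real \<Rightarrow> real"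
  assumes "0 \<le> t" and \<Phi>: "\<And>u. (\<Phi> has_real_derivative \<phi> u) (at u)" and \<phi>: "continuous_on UNIV \<phi>"
    and \<Phi>0: "integrable circ (\<lambda>y. \<Phi> (U0 y))"
    and int: "integrable (ivl 0 t \<Otimes>\<^sub>M circ) (\<lambda>(s, y). \<phi> (U s y) * F (s, y))"
  shows "integrable circ (\<lambda>y. \<Phi> (U t y))"
    and "(\<integral>y. \<Phi> (U t y) \<partial>circ) = (\<integral>y. \<Phi> (U0 y) \<partial>circ) + (\<integral>(s, y). \<phi> (U s y) * F (s, y) \<partial>(ivl 0 t \<Otimes>\<^sub>M circ))"
proof -
  have [measurable]: "\<phi> \<in> borel_measurable borel" by (rule borel_measurable_continuous_onI[OF \<phi>])
  have [measurable]: "\<Phi> \<in> borel_measurable borel"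
    by (rule borel_measurable_continuous_onI) (meson DERIV_isCont \<Phi> continuous_at_imp_continuous_on)
  let ?g = "\<lambda>(s, y). \<phi> (U s y) * F (s, y)"
  have gper: "periodic2 (\<lambda>y. ?g (r, y))" for r
    using periodic2_comp2[OF U_periodic[of r] F_periodic[of r], of "\<lambda>u f. \<phi> u * f"] by simp
  have gm: "?g \<in> borel_measurable (borel \<Otimes>\<^sub>M borel)" unfolding split_beta by measurable
  have sp: "(\<lambda>(s, y). \<phi> (U s (y + s)) * F (s, y + s)) = (\<lambda>(r, y). ?g (r, y + r))" by simp
  have i: "integrable (ivl 0 t \<Otimes>\<^sub>M circ) (\<lambda>(s, y). \<phi> (U s (y + s)) * F (s, y + s))"
    unfolding sp by (rule pair_shift(1)[THEN iffD2, OF gm _ gper int]) (rule measurable_ident_sets, rule refl)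
  have I: "(\<integral>(s, y). \<phi> (U s (y + s)) * F (s, y + s) \<partial>(ivl 0 t \<Otimes>\<^sub>M circ)) = integral\<^sup>L (ivl 0 t \<Otimes>\<^sub>M circ) ?g"
    unfolding sp by (rule pair_shift(2)[OF gm _ gper]) (rule measurable_ident_sets, rule refl)
  have ae: "AE y in circ. \<Phi> (U t (y + t)) = \<Phi> (U0 y) + (\<integral>s. \<phi> (U s (y + s)) * F (s, y + s) \<partial>ivl 0 t)"
    using AE_char_integrable[of t]
  proof eventually_elim
    case (elim y)
    have "\<Phi> (U t (y + t)) - \<Phi> (U0 y) = (\<integral>s. \<phi> (U s (y + s)) * F (s, y + s) \<partial>ivl 0 t)"
    proof (rule chain_rule_primitive(2)[OF elim \<open>0 \<le> t\<close> \<Phi> \<phi>, where Z="\<lambda>s. U s (y + s)"])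
      show "(\<lambda>s. U s (y + s)) \<in> borel_measurable borel" by measurable
    qed (rule U_char)
    then show ?case by simp
  qed
  have rhs: "integrable circ (\<lambda>y. \<Phi> (U0 y) + (\<integral>s. \<phi> (U s (y + s)) * F (s, y + s) \<partial>ivl 0 t))"
    using \<Phi>0 ivl2.integrable_snd[OF i] by simp
  have "integrable circ (\<lambda>y. \<Phi> (U t (y + t))) \<longleftrightarrow> integrable circ (\<lambda>y. \<Phi> (U0 y) + (\<integral>s. \<phi> (U s (y + s)) * F (s, y + s) \<partial>ivl 0 t))"
    using ae rhs by (intro integrable_cong_AE) auto
  then have it: "integrable circ (\<lambda>y. \<Phi> (U t (y + t)))" using rhs by simp
  have p: "periodic2 (\<lambda>y. \<Phi> (U t y))" by (rule periodic2_comp[OF U_periodic])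
  then show "integrable circ (\<lambda>y. \<Phi> (U t y))" using circ_shift(1)[of "\<lambda>y. \<Phi> (U t y)" t] it by simp
  have "(\<integral>y. \<Phi> (U t y) \<partial>circ) = (\<integral>y. \<Phi> (U t (y + t)) \<partial>circ)"
    using circ_shift(2)[of "\<lambda>y. \<Phi> (U t y)" t] p by simp
  also have "\<dots> = (\<integral>y. \<Phi> (U0 y) + (\<integral>s. \<phi> (U s (y + s)) * F (s, y + s) \<partial>ivl 0 t) \<partial>circ)"
    using ae rhs by (intro integral_cong_AE) auto
  also have "\<dots> = (\<integral>y. \<Phi> (U0 y) \<partial>circ) + integral\<^sup>L (ivl 0 t \<Otimes>\<^sub>M circ) ?g"
    using \<Phi>0 ivl2.integrable_snd[OF i] ivl2.integral_snd[OF i] I by simp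
  finally show "(\<integral>y. \<Phi> (U t y) \<partial>circ) = (\<integral>y. \<Phi> (U0 y) \<partial>circ) + integral\<^sup>L (ivl 0 t \<Otimes>\<^sub>M circ) ?g" .
qed

text \<open>Since \<open>F\<close> is odd, reflecting and averaging replaces
  \<open>\<phi> (U s y)\<close> by half its difference with the mirror value. For monotone
  \<open>\<phi>\<close> that difference has the sign of \<open>V\<close>, which a damping source
  shares.\<close>

lemma symmetrize:
  fixes \<phi> :: "real \<Rightarrow> real"
  assumes [measurable]: "\<phi> \<in> borel_measurable borel"
    and int: "integrable (ivl 0 t \<Otimes>\<^sub>M circ) (\<lambda>(s, y). \<phi> (U s y) * F (s, y))"
  shows "integrable (ivl 0 t \<Otimes>\<^sub>M circ) (\<lambda>(s, y). (\<phi> (U s (- y)) - \<phi> (U s y)) * F (s, y))"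
    and "(\<integral>(s, y). \<phi> (U s y) * F (s, y) \<partial>(ivl 0 t \<Otimes>\<^sub>M circ)) =
      - (\<integral>(s, y). (\<phi> (U s (- y)) - \<phi> (U s y)) * F (s, y) \<partial>(ivl 0 t \<Otimes>\<^sub>M circ)) / 2"
proof -
  let ?M = "ivl 0 t \<Otimes>\<^sub>M circ"
  let ?g = "\<lambda>(s, y). \<phi> (U s y) * F (s, y)"
  have i: "integrable ?M (\<lambda>(s, y). \<phi> (U s (- y)) * F (s, y))"
    and e: "(\<integral>(s, y). \<phi> (U s (- y)) * F (s, y) \<partial>?M) = - integral\<^sup>L ?M ?g"
  proof -
    have gm: "?g \<in> borel_measurable (borel \<Otimes>\<^sub>M borel)" unfolding split_beta by measurable
    have eq: "(\<lambda>(r, y). ?g (r, - y)) = (\<lambda>z. - (case z of (s, y) \<Rightarrow> \<phi> (U s (- y)) * F (s, y)))"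
      by (auto simp: F_odd)
    have "integrable ?M (\<lambda>z. - (case z of (s, y) \<Rightarrow> \<phi> (U s (- y)) * F (s, y)))"
      using pair_reflect(1)[OF gm, of 0 t] int unfolding eq by blast
    from integrable_minus[OF this] show "integrable ?M (\<lambda>(s, y). \<phi> (U s (- y)) * F (s, y))"
      by (simp only: minus_minus cond_case_prod_eta)
    have "(\<integral>z. - (case z of (s, y) \<Rightarrow> \<phi> (U s (- y)) * F (s, y)) \<partial>?M) = integral\<^sup>L ?M ?g"
      using pair_reflect(2)[OF gm, of 0 t] unfolding eq .
    then show "(\<integral>(s, y). \<phi> (U s (- y)) * F (s, y) \<partial>?M) = - integral\<^sup>L ?M ?g"
      by (simp only: integral_minus minus_equation_iff)
  qed
  have s: "(\<lambda>(s, y). (\<phi> (U s (- y)) - \<phi> (U s y)) * F (s, y)) = (\<lambda>z. (case z of (s, y) \<Rightarrow> \<phi> (U s (- y)) * F (s, y)) - ?g z)"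
    by (auto simp: left_diff_distrib)
  show "integrable ?M (\<lambda>(s, y). (\<phi> (U s (- y)) - \<phi> (U s y)) * F (s, y))"
    unfolding s using i int by (rule Bochner_Integration.integrable_diff)
  show "integral\<^sup>L ?M ?g = - (\<integral>(s, y). (\<phi> (U s (- y)) - \<phi> (U s y)) * F (s, y) \<partial>?M) / 2"
    unfolding s using i int e by (subst Bochner_Integration.integral_diff) auto
qed

lemma integral_F_zero: "integral\<^sup>L (ivl 0 t \<Otimes>\<^sub>M circ) F = 0"
  using symmetrize(2)[of "\<lambda>_. 1" t] F_integrable by (simp add: case_prod_unfold)

lemma integral_U: "0 \<le> t \<Longrightarrow> integrable circ (U t)" "0 \<le> t \<Longrightarrow> integral\<^sup>L circ (U t) = integral\<^sup>L circ U0"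
  using energy[of t "\<lambda>u. u" "\<lambda>_. 1"] U0_integrable F_integrable integral_F_zero by (simp_all add: case_prod_unfold)

text \<open>The two sides differ in how the integral over [0,t+s] is split. This is legitimate on
  the characteristics along which \<open>F\<close> is integrable, hence almost everywhere.\<close>

lemma restart_AE:
  assumes "0 \<le> t" "0 \<le> s"
  shows "AE y in circ. mild (U t) (\<lambda>(r, y). F (t + r, y)) s y = U (t + s) y"
proof -
  have "periodic2 (\<lambda>y. integrable (ivl 0 (t + s)) (\<lambda>r. F (r, y + r)))"
    unfolding periodic2_def
  proof
    fix y
    have "F (r, y + 2 + r) = F (r, y + r)" for r
      using F_periodic[of r, unfolded periodic2_def, rule_format, of "y + r"] by (simp add: add_ac)
    then show "integrable (ivl 0 (t + s)) (\<lambda>r. F (r, y + 2 + r)) = integrable (ivl 0 (t + s)) (\<lambda>r. F (r, y + r))" by simp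
  qed
  \<comment> \<open>The shift leads from the position at time \<open>t + s\<close> to the foot of
    the characteristic.\<close>
  from AE_circ_shift[OF this AE_char_integrable, of "- s - t"]
  show ?thesis
  proof eventually_elim
    case (elim y)
    let ?f = "\<lambda>r. F (r, y - s - t + r)"
    have [measurable]: "?f \<in> borel_measurable borel" by measurable
    have e: "y + (- s - t) + r = y - s - t + r" for r by simp
    from elim have i: "integrable (ivl 0 (t + s)) ?f" unfolding e .
    have sh: "(\<integral>r. F (t + r, y - s + r) \<partial>ivl 0 s) = integral\<^sup>L (ivl t (t + s)) ?f"
    proof -
      have *: "(\<integral>\<^sup>+r. \<phi> (F (t + r, y - s + r)) \<partial>ivl 0 s) = (\<integral>\<^sup>+r. \<phi> (?f r) \<partial>ivl t (t + s))"
        if [measurable]: "\<phi> \<in> borel_measurable borel" for \<phi> :: "real \<Rightarrow> ennreal"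
        using nn_integral_ivl_shift[where g="\<lambda>r. \<phi> (?f r)" and s=t and a=0 and b=s] by (simp add: algebra_simps)
      show ?thesis by (rule integral_eq_if_nn_integral_eq; simp add: *)
    qed
    have "mild (U t) (\<lambda>(r, y). F (t + r, y)) s y = U0 (y - s - t) + integral\<^sup>L (ivl 0 t) ?f + integral\<^sup>L (ivl t (t + s)) ?f"
      unfolding mild_def by (simp add: sh)
    also have "\<dots> = U0 (y - s - t) + integral\<^sup>L (ivl 0 (t + s)) ?f"
      using integral_ivl_combine[OF i, of t] assms by simp
    also have "\<dots> = U (t + s) y"
      by (simp add: mild_def algebra_simps diff_diff_eq)
    finally show ?case .
  qed
qed

lemma restart:
  assumes "0 \<le> t"
  shows "transport (U t) (\<lambda>(r, y). F (t + r, y))"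
proof
  show "integrable circ (U t)" by (rule integral_U[OF assms])
  show "periodic2 (U t)" by (rule U_periodic)
  fix T :: real
  have *: "(\<integral>\<^sup>+z. ennreal (norm (case z of (r, y) \<Rightarrow> F (t + r, y))) \<partial>(ivl 0 T \<Otimes>\<^sub>M circ)) \<le> (\<integral>\<^sup>+z. ennreal (norm (F z)) \<partial>(ivl 0 (t + T) \<Otimes>\<^sub>M circ))"
  proof -
    have "(\<integral>\<^sup>+z. ennreal (norm (case z of (r, y) \<Rightarrow> F (t + r, y))) \<partial>(ivl 0 T \<Otimes>\<^sub>M circ)) =
      (\<integral>\<^sup>+r. (\<integral>\<^sup>+y. ennreal (norm (F (r + t, y))) \<partial>circ) \<partial>ivl 0 T)"
      by (simp add: ivl.nn_integral_fst[symmetric] add.commute)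
    also have "\<dots> = (\<integral>\<^sup>+r. (\<integral>\<^sup>+y. ennreal (norm (F (r, y))) \<partial>circ) \<partial>ivl t (T + t))"
      by (subst nn_integral_ivl_shift) (auto intro: ivl.borel_measurable_nn_integral)
    also have "\<dots> \<le> (\<integral>\<^sup>+r. (\<integral>\<^sup>+y. ennreal (norm (F (r, y))) \<partial>circ) \<partial>ivl 0 (t + T))"
    proof -
      have [measurable]: "(\<lambda>r. \<integral>\<^sup>+y. ennreal (norm (F (r, y))) \<partial>circ) \<in> borel_measurable borel"
        by (rule ivl.borel_measurable_nn_integral) measurable
      show ?thesis using assms by (simp add: nn_integral_ivl) (intro nn_integral_mono, auto simp: indicator_def)
    qed
    also have "\<dots> = (\<integral>\<^sup>+z. ennreal (norm (F z)) \<partial>(ivl 0 (t + T) \<Otimes>\<^sub>M circ))"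
      by (simp add: ivl.nn_integral_fst[symmetric])
    finally show ?thesis .
  qed
  show "integrable (ivl 0 T \<Otimes>\<^sub>M circ) (\<lambda>(r, y). F (t + r, y))"
    using F_integrable[of "t + T"] * unfolding integrable_iff_bounded by (auto intro: le_less_trans)
qed (use F_periodic F_odd in \<open>auto simp: periodic2_def\<close>)

end

lemma AE_ivl_shift:
  assumes "AE y in ivl (a + s) (b + s). P y" shows "AE y in ivl a b. P (y + s)"
proof -
  have "lborel = distr lborel borel ((+) s)" by (simp add: lborel_distr_plus)
  moreover have "AE y in lborel. a + s \<le> y \<and> y \<le> b + s \<longrightarrow> P y" using assms by (simp add: AE_ivl)
  ultimately have "AE y in distr lborel borel ((+) s). a + s \<le> y \<and> y \<le> b + s \<longrightarrow> P y" by metis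
  from AE_distrD[OF _ this] have "AE y in lborel. a + s \<le> s + y \<and> s + y \<le> b + s \<longrightarrow> P (s + y)" by simp
  then show ?thesis unfolding AE_ivl by eventually_elim (auto simp: add.commute)
qed

lemma AE_ivl_subset: "AE y in ivl a b. P y \<Longrightarrow> a \<le> c \<Longrightarrow> d \<le> b \<Longrightarrow> AE y in ivl c d. P y"
  unfolding AE_ivl by (erule AE_mp) (auto intro!: AE_I2)

section \<open>The maximum principle\<close>

definition soft_plus :: "real \<Rightarrow> real" where "soft_plus x = (if x \<le> 0 then 0 else x - ln (1 + x))"

text \<open>\<open>soft_plus\<close> is convex, vanishes exactly for nonpositive arguments, and has
  slope below 1. The bounded slope makes \<open>\<phi> (U s y) * F (s, y)\<close> integrable as soon
  as \<open>F\<close> is, while no bound on \<open>U\<close> is known yet.\<close>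

lemma soft_plus_deriv: "(soft_plus has_real_derivative max 0 x / (1 + max 0 x)) (at x)"
proof -
  consider "x > 0" | "x < 0" | "x = 0" by linarith
  then show ?thesis
  proof cases
    case 1
    have "((\<lambda>x. x - ln (1 + x)) has_real_derivative max 0 x / (1 + max 0 x)) (at x)"
      using 1 by (auto intro!: derivative_eq_intros simp: field_simps)
    then show ?thesis
      by (rule has_field_derivative_transform_within_open[where S="{0<..}"]) (use 1 in \<open>auto simp: soft_plus_def\<close>)
  next
    case 2
    have "((\<lambda>x. 0) has_real_derivative 0) (at x)" by simp
    then have "(soft_plus has_real_derivative 0) (at x)"
      by (rule has_field_derivative_transform_within_open[where S="{..<0}"]) (use 2 in \<open>auto simp: soft_plus_def\<close>)
    then show ?thesis using 2 by simp
  next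
    case 3
    have "((\<lambda>h. soft_plus h / h) \<longlongrightarrow> 0) (at 0)"
    proof (rule Lim_null_comparison)
      show "\<forall>\<^sub>F h in at 0. norm (soft_plus h / h) \<le> \<bar>h\<bar>"
        unfolding eventually_at
      proof (intro exI[of _ 1] conjI ballI impI)
        fix h :: real assume h: "h \<noteq> 0 \<and> dist h 0 < 1"
        show "norm (soft_plus h / h) \<le> \<bar>h\<bar>"
        proof (cases "h > 0")
          case True
          then have "h - h\<^sup>2 \<le> ln (1 + h)" using h by (intro ln_one_plus_pos_lower_bound) auto
          moreover have "ln (1 + h) \<le> h" using True by (intro ln_add_one_self_le_self) auto
          ultimately have "\<bar>soft_plus h\<bar> \<le> h * h" using True by (simp add: soft_plus_def power2_eq_square)
          then show ?thesis using True by (simp add: divide_le_eq)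
        qed (simp add: soft_plus_def)
      qed simp
      show "((\<lambda>h::real. \<bar>h\<bar>) \<longlongrightarrow> 0) (at 0)" by (rule tendsto_eq_intros refl)+ simp
    qed
    then show ?thesis using 3 by (simp add: DERIV_def) (simp add: soft_plus_def)
  qed
qed

lemma soft_plus_nonneg: "0 \<le> soft_plus x"
  using ln_add_one_self_le_self[of x] by (auto simp: soft_plus_def)

lemma soft_plus_eq_0: "soft_plus x = 0 \<longleftrightarrow> x \<le> 0"
  using ln_eq_minus_one[of "1 + x"] by (auto simp: soft_plus_def)

context transport
begin

text \<open>By \<open>energy\<close> and \<open>symmetrize\<close> the integral of
  \<open>\<Phi> (U t y)\<close> cannot grow: a source with the sign of \<open>V\<close> meets an
  increment of the monotone \<open>\<phi>\<close> with the same sign. It starts at zero and cannot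
  become negative.\<close>

lemma convex_functional_zero:
  fixes \<Phi> \<phi> :: "real \<Rightarrow> real"
  assumes "0 \<le> t" and \<Phi>: "\<And>u. (\<Phi> has_real_derivative \<phi> u) (at u)" and \<phi>: "continuous_on UNIV \<phi>"
    and mono: "\<And>u v. u \<le> v \<Longrightarrow> \<phi> u \<le> \<phi> v" and B: "\<And>u. \<bar>\<phi> u\<bar> \<le> B"
    and nonneg: "\<And>u. 0 \<le> \<Phi> u" and zero: "AE y in circ. \<Phi> (U0 y) = 0"
    and damp: "AE s in ivl 0 t. AE y in circ. 0 \<le> F (s, y) * V s y"
  shows "AE y in circ. \<Phi> (U t y) = 0"
proof -
  have [measurable]: "\<phi> \<in> borel_measurable borel" by (rule borel_measurable_continuous_onI[OF \<phi>])
  have [measurable]: "\<Phi> \<in> borel_measurable borel"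
    by (rule borel_measurable_continuous_onI) (meson DERIV_isCont \<Phi> continuous_at_imp_continuous_on)
  let ?M = "ivl 0 t \<Otimes>\<^sub>M circ"
  have "integrable ?M (\<lambda>z. \<phi> (U (fst z) (snd z)) * F z)"
    using B by (intro integrable_mult_AE_bounded[OF F_integrable]) auto
  then have int: "integrable ?M (\<lambda>(s, y). \<phi> (U s y) * F (s, y))" by (simp add: case_prod_unfold)
  have z: "integrable circ (\<lambda>y. \<Phi> (U0 y)) \<longleftrightarrow> integrable circ (\<lambda>y. 0::real)"
    using zero by (intro integrable_cong_AE) auto
  then have i0: "integrable circ (\<lambda>y. \<Phi> (U0 y))" by simp
  have z0: "(\<integral>y. \<Phi> (U0 y) \<partial>circ) = (\<integral>y. 0 \<partial>circ)" using zero by (intro integral_cong_AE) auto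
  have damp': "AE z in ?M. 0 \<le> F z * V (fst z) (snd z)"
  proof (rule ivl2.AE_pair_measure)
    show "{z \<in> space ?M. 0 \<le> F z * V (fst z) (snd z)} \<in> sets ?M" by measurable
  qed (use damp in simp)
  have "0 \<le> (\<integral>(s, y). (\<phi> (U s (- y)) - \<phi> (U s y)) * F (s, y) \<partial>?M)"
  proof (rule integral_nonneg_AE)
    show "AE z in ?M. 0 \<le> (case z of (s, y) \<Rightarrow> (\<phi> (U s (- y)) - \<phi> (U s y)) * F (s, y))"
      using damp'
    proof eventually_elim
      case (elim z)
      obtain s y where z: "z = (s, y)" by fastforce
      consider "U s (- y) = U s y" | "U s y < U s (- y)" | "U s (- y) < U s y" by linarith
      then show ?case
      proof cases
        case 1 then show ?thesis by (simp add: z)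
      next
        case 2
        then have "0 \<le> F (s, y)" using elim by (simp add: z V_def zero_le_mult_iff)
        then show ?thesis using mono[of "U s y" "U s (- y)"] 2 by (simp add: z)
      next
        case 3
        then have "F (s, y) \<le> 0" using elim by (simp add: z V_def zero_le_mult_iff)
        then show ?thesis using mono[of "U s (- y)" "U s y"] 3 by (simp add: z mult_nonpos_nonpos)
      qed
    qed
  qed
  then have "(\<integral>y. \<Phi> (U t y) \<partial>circ) \<le> 0"
    using energy(2)[OF \<open>0 \<le> t\<close> \<Phi> \<phi> i0 int] symmetrize(2)[OF _ int] z0 by simp
  moreover have "0 \<le> (\<integral>y. \<Phi> (U t y) \<partial>circ)" using nonneg by simp
  ultimately show ?thesis
    using integral_nonneg_eq_0_iff_AE[OF energy(1)[OF \<open>0 \<le> t\<close> \<Phi> \<phi> i0 int]] nonneg by simp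
qed

lemma max_principle:
  assumes "0 \<le> t" and M: "AE y in circ. \<bar>U0 y\<bar> \<le> M"
    and damp: "AE s in ivl 0 t. AE y in circ. 0 \<le> F (s, y) * V s y"
  shows "AE y in circ. \<bar>U t y\<bar> \<le> M"
proof -
  have mono: "max 0 u / (1 + max 0 u) \<le> max 0 v / (1 + max 0 v)" if "u \<le> v" for u v :: real
    using that by (auto simp: divide_le_eq le_divide_eq field_simps)
  have B: "\<bar>max 0 u / (1 + max 0 u)\<bar> \<le> 1" for u :: real by simp
  have "AE y in circ. soft_plus (U t y - M) = 0"
  proof (rule convex_functional_zero[where B=1, OF \<open>0 \<le> t\<close> _ _ _ _ _ _ damp])
    show "((\<lambda>u. soft_plus (u - M)) has_real_derivative max 0 (u - M) / (1 + max 0 (u - M))) (at u)" for u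
    proof -
      have "((\<lambda>u. soft_plus (u - M)) has_real_derivative max 0 (u - M) / (1 + max 0 (u - M)) * 1) (at u)"
        by (rule DERIV_chain2[OF soft_plus_deriv]) (auto intro!: derivative_eq_intros)
      then show ?thesis by simp
    qed
    show "continuous_on UNIV (\<lambda>u. max 0 (u - M) / (1 + max 0 (u - M)))"
      by (intro continuous_intros) (auto simp: max_def)
    show "AE y in circ. soft_plus (U0 y - M) = 0" using M by eventually_elim (auto simp: soft_plus_eq_0)
  qed (use mono B soft_plus_nonneg in auto)
  moreover have "AE y in circ. soft_plus (- U t y - M) = 0"
  proof (rule convex_functional_zero[where B=1, OF \<open>0 \<le> t\<close> _ _ _ _ _ _ damp])
    show "((\<lambda>u. soft_plus (- u - M)) has_real_derivative - (max 0 (- u - M) / (1 + max 0 (- u - M)))) (at u)" for u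
    proof -
      have "((\<lambda>u. soft_plus (- u - M)) has_real_derivative max 0 (- u - M) / (1 + max 0 (- u - M)) * - 1) (at u)"
        by (rule DERIV_chain2[OF soft_plus_deriv]) (auto intro!: derivative_eq_intros)
      then show ?thesis by simp
    qed
    show "continuous_on UNIV (\<lambda>u. - (max 0 (- u - M) / (1 + max 0 (- u - M))))"
      by (intro continuous_intros) (auto simp: max_def)
    show "AE y in circ. soft_plus (- U0 y - M) = 0" using M by eventually_elim (auto simp: soft_plus_eq_0)
    show "- (max 0 (- u - M) / (1 + max 0 (- u - M))) \<le> - (max 0 (- v - M) / (1 + max 0 (- v - M)))" if "u \<le> v" for u v
      using mono[of "- v - M" "- u - M"] that by simp
    show "\<bar>- (max 0 (- u - M) / (1 + max 0 (- u - M)))\<bar> \<le> 1" for u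
      using B[of "- u - M"] by simp
  qed (use soft_plus_nonneg in auto)
  ultimately show ?thesis by eventually_elim (auto simp: soft_plus_eq_0)
qed

end

section \<open>The power functional\<close>

text \<open>The derivative p |u|^(p-1) sgn u, split into positive and negative parts so that it is
  visibly continuous at 0.\<close>

definition pow_deriv :: "real \<Rightarrow> real \<Rightarrow> real" where
  "pow_deriv p u = p * (max 0 u powr (p - 1) - max 0 (- u) powr (p - 1))"

lemma pow_deriv:
  assumes "2 \<le> p"
  shows "((\<lambda>u. \<bar>u\<bar> powr p) has_real_derivative pow_deriv p u) (at u)"
proof -
  consider "u > 0" | "u < 0" | "u = 0" by linarith
  then show ?thesis
  proof cases
    case 1
    have "((\<lambda>u. u powr p) has_real_derivative pow_deriv p u) (at u)"
      using 1 by (auto intro!: derivative_eq_intros simp: pow_deriv_def powr_diff)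
    then show ?thesis
      by (rule has_field_derivative_transform_within_open[where S="{0<..}"]) (use 1 in auto)
  next
    case 2
    have "((\<lambda>u. (- u) powr p) has_real_derivative pow_deriv p u) (at u)"
      using 2 by (auto intro!: derivative_eq_intros simp: pow_deriv_def powr_diff)
    then show ?thesis
      by (rule has_field_derivative_transform_within_open[where S="{..<0}"]) (use 2 in auto)
  next
    case 3
    have "((\<lambda>h. \<bar>h\<bar> powr p / h) \<longlongrightarrow> 0) (at 0)"
    proof (rule Lim_null_comparison)
      show "\<forall>\<^sub>F h in at 0. norm (\<bar>h\<bar> powr p / h) \<le> \<bar>h\<bar>"
        unfolding eventually_at
      proof (intro exI[of _ 1] conjI ballI impI)
        fix h :: real assume h: "h \<noteq> 0 \<and> dist h 0 < 1"
        then have "\<bar>h\<bar> powr p \<le> \<bar>h\<bar> powr 2" using assms by (intro powr_mono') auto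
        then have "\<bar>h\<bar> powr p \<le> \<bar>h\<bar> * \<bar>h\<bar>" using h by (simp add: power2_eq_square)
        then show "norm (\<bar>h\<bar> powr p / h) \<le> \<bar>h\<bar>" using h by (simp add: abs_divide divide_le_eq)
      qed simp
      show "((\<lambda>h::real. \<bar>h\<bar>) \<longlongrightarrow> 0) (at 0)" by (rule tendsto_eq_intros refl)+ simp
    qed
    then show ?thesis using 3 assms by (simp add: DERIV_def pow_deriv_def)
  qed
qed

lemma pow_deriv_continuous: "2 \<le> p \<Longrightarrow> continuous_on UNIV (pow_deriv p)"
  unfolding pow_deriv_def by (intro continuous_intros continuous_on_powr') auto

lemma powr_superadditive:
  fixes x y q :: real
  assumes "0 \<le> x" "0 \<le> y" "1 \<le> q"
  shows "x powr q + y powr q \<le> (x + y) powr q"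
proof -
  have *: "u powr q = u * u powr (q - 1)" if "0 \<le> u" for u :: real
    using that powr_mult_base[of u "q - 1"] by simp
  have "x * x powr (q - 1) + y * y powr (q - 1) \<le> x * (x + y) powr (q - 1) + y * (x + y) powr (q - 1)"
    using assms by (intro add_mono mult_left_mono powr_mono2) auto
  then show ?thesis using assms by (simp add: * algebra_simps)
qed

text \<open>Quantitative monotonicity. For arguments of equal sign, superadditivity of the power
  gives it even without the factor 1/2; for opposite signs the larger modulus is at least half the
  gap.\<close>

lemma pow_deriv_diff:
  assumes "2 \<le> p" "a \<le> b"
  shows "p * ((b - a) / 2) powr (p - 1) \<le> pow_deriv p b - pow_deriv p a"
proof -
  let ?q = "p - 1"
  have q: "1 \<le> ?q" using assms by simp
  have half: "((b - a) / 2) powr ?q \<le> (b - a) powr ?q" using assms by (intro powr_mono2) auto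
  have "((b - a) / 2) powr ?q \<le> (max 0 b powr ?q - max 0 (- b) powr ?q) - (max 0 a powr ?q - max 0 (- a) powr ?q)"
  proof -
    consider "0 \<le> a" | "b \<le> 0" | "a < 0" "0 < b" by linarith
    then show ?thesis
    proof cases
      case 1
      then show ?thesis using powr_superadditive[of a "b - a" ?q] assms q half by simp
    next
      case 2
      then show ?thesis using powr_superadditive[of "- b" "b - a" ?q] assms q half by simp
    next
      case 3
      have "((b - a) / 2) powr ?q \<le> max b (- a) powr ?q" using 3 assms by (intro powr_mono2) auto
      also have "\<dots> \<le> b powr ?q + (- a) powr ?q" by (auto simp: max_def)
      finally show ?thesis using 3 by simp
    qed
  qed
  then have "p * ((b - a) / 2) powr ?q \<le> p * ((max 0 b powr ?q - max 0 (- b) powr ?q) - (max 0 a powr ?q - max 0 (- a) powr ?q))"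
    using assms by (intro mult_left_mono) auto
  then show ?thesis by (simp add: pow_deriv_def algebra_simps)
qed

text \<open>\<open>v\<close> being half the gap, \<open>pow_deriv_diff\<close> contributes p
  |v|^(p-1) and the lower bound on \<open>f * v\<close> a further c0 \<alpha> |v|. Negative
  \<open>v\<close> is the case of exchanged \<open>a\<close>, \<open>b\<close> and opposite
  \<open>f\<close>.\<close>

lemma pow_deriv_dissipation:
  assumes p: "2 \<le> p" and "0 \<le> \<alpha>" "0 \<le> c0" and F: "c0 * \<alpha> * v^2 \<le> f * v" "\<alpha> = 0 \<or> v = 0 \<Longrightarrow> f = 0" and v: "v = (b - a) / 2"
  shows "p * c0 * (\<alpha> * \<bar>v\<bar> powr p) \<le> (pow_deriv p b - pow_deriv p a) * f"
proof -
  have pos: "p * c0 * (\<alpha> * \<bar>v\<bar> powr p) \<le> (pow_deriv p b - pow_deriv p a) * f"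
    if F: "c0 * \<alpha> * v^2 \<le> f * v" and v: "v = (b - a) / 2" and "v > 0" for f v a b
  proof -
    have f: "c0 * \<alpha> * v \<le> f" using F \<open>v > 0\<close> by (simp add: power2_eq_square)
    have "p * c0 * (\<alpha> * \<bar>v\<bar> powr p) = (p * v powr (p - 1)) * (c0 * \<alpha> * v)"
      using \<open>v > 0\<close> by (simp add: powr_diff)
    also have "\<dots> \<le> (pow_deriv p b - pow_deriv p a) * f"
    proof (rule mult_mono)
      show "p * v powr (p - 1) \<le> pow_deriv p b - pow_deriv p a"
        using pow_deriv_diff[OF p, of a b] \<open>v > 0\<close> unfolding v by simp
      then show "0 \<le> pow_deriv p b - pow_deriv p a"
        using p by (meson mult_nonneg_nonneg order_trans powr_ge_zero zero_le_numeral)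
    qed (use f \<open>v > 0\<close> assms in auto)
    finally show ?thesis .
  qed
  consider "v > 0" | "v < 0" | "v = 0" by linarith
  then show ?thesis
  proof cases
    case 1 then show ?thesis using pos[OF F(1) v] by blast
  next
    case 2
    have "p * c0 * (\<alpha> * \<bar>- v\<bar> powr p) \<le> (pow_deriv p a - pow_deriv p b) * (- f)"
    proof (rule pos)
      show "c0 * \<alpha> * (- v)\<^sup>2 \<le> - f * - v" using F(1) by simp
      show "- v = (a - b) / 2" unfolding v by (simp add: field_simps)
    qed (use 2 in simp)
    then show ?thesis by (simp add: algebra_simps)
  next
    case 3
    then show ?thesis using F p v by auto
  qed
qed

section \<open>Observability and decay\<close>

text \<open>If the power is not integrable the right side is infinite, for which positive total mass
  is required. With extended values the observability estimate needs no integrability side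
  conditions.\<close>

lemma (in finite_measure) nn_jensen_powr:
  fixes f :: "'a \<Rightarrow> real"
  assumes [measurable]: "f \<in> borel_measurable M" and "1 \<le> p" and c: "0 < measure M (space M)"
  shows "ennreal ((\<integral>x. \<bar>f x\<bar> \<partial>M) powr p) \<le> ennreal (measure M (space M) powr (p - 1)) * (\<integral>\<^sup>+x. ennreal (\<bar>f x\<bar> powr p) \<partial>M)"
proof (cases "integrable M (\<lambda>x. \<bar>f x\<bar> powr p)")
  case True
  then have "(\<integral>\<^sup>+x. ennreal (\<bar>f x\<bar> powr p) \<partial>M) = ennreal (\<integral>x. \<bar>f x\<bar> powr p \<partial>M)"
    by (intro nn_integral_eq_integral) auto
  then show ?thesis using jensen_powr[OF _ True \<open>1 \<le> p\<close>]
    by (simp add: ennreal_mult[symmetric] ennreal_leI)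
next
  case False
  then have "(\<integral>\<^sup>+x. ennreal (\<bar>f x\<bar> powr p) \<partial>M) = \<infinity>"
    by (auto simp: integrable_iff_bounded less_top[symmetric])
  then show ?thesis using c by (simp add: ennreal_mult_top)
qed

lemma powr_add3_le:
  fixes x y z p :: real
  assumes "0 \<le> x" "0 \<le> y" "0 \<le> z" "0 \<le> p"
  shows "(x + y + z) powr p \<le> 3 powr p * (x powr p + y powr p + z powr p)"
proof -
  define m where "m = max x (max y z)"
  have "(x + y + z) powr p \<le> (3 * m) powr p" using assms by (intro powr_mono2) (auto simp: m_def)
  also have "\<dots> = 3 powr p * m powr p" using assms by (subst powr_mult) (auto simp: m_def)
  also have "m powr p \<le> x powr p + y powr p + z powr p"
    using powr_ge_zero[of x p] powr_ge_zero[of y p] powr_ge_zero[of z p] by (auto simp: m_def max_def)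
  finally show ?thesis by (simp add: mult_left_mono)
qed

lemma powr_add2_le:
  fixes x y p :: real
  assumes "0 \<le> x" "0 \<le> y" "1 \<le> p"
  shows "(x + y) powr p \<le> 2 powr p * (x powr p + y powr p)"
proof -
  have "(2::real) powr (p - 1) \<le> 2 powr p" by (intro powr_mono) auto
  then have "2 powr (p - 1) * (x powr p + y powr p) \<le> 2 powr p * (x powr p + y powr p)"
    by (intro mult_right_mono) auto
  then show ?thesis using powr_sum_le[OF assms] by linarith
qed

lemma nn_integral_ivl_reflect_shift:
  assumes [measurable]: "g \<in> borel_measurable borel" and g: "periodic2 g"
  shows "(\<integral>\<^sup>+s. g (y - s) \<partial>ivl 0 2) = (\<integral>\<^sup>+y. g y \<partial>circ)"
proof -
  have "(\<integral>\<^sup>+s. g (y - s) \<partial>ivl 0 2) = (\<integral>\<^sup>+s. g (y + - s) \<partial>ivl 0 2)" by simp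
  also have "\<dots> = (\<integral>\<^sup>+s. g (y + s) \<partial>ivl (-2) 0)"
    using nn_integral_ivl_uminus[of "\<lambda>s. g (y + s)" 0 2] by simp
  also have "\<dots> = (\<integral>\<^sup>+s. g (s + (y - 1)) \<partial>circ)"
    using nn_integral_ivl_shift[where g="\<lambda>s. g (y + s)" and s="-1" and a="-1" and b=1] by (simp add: algebra_simps)
  also have "\<dots> = (\<integral>\<^sup>+y. g y \<partial>circ)" by (rule nn_integral_circ_shift) (use g in auto)
  finally show ?thesis .
qed

section \<open>Distance to translates in L^p\<close>

definition modulus :: "real \<Rightarrow> (real \<Rightarrow> real) \<Rightarrow> real \<Rightarrow> ennreal" where
  "modulus p U h = (\<integral>\<^sup>+y. ennreal (\<bar>U (y - h) - U y\<bar> powr p) \<partial>circ)"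

text \<open>The exponent is the number of steps of length at most d - c that reach length 2, and
  \<open>2 * 2 powr p\<close> is the cost of each. The last factor is the cost of producing one
  short step by averaging over the left half of [c,d].\<close>

definition modulus_const :: "real \<Rightarrow> real \<Rightarrow> real \<Rightarrow> real" where
  "modulus_const p c d = (2 * 2 powr p) ^ nat \<lceil>2 / (d - c)\<rceil> * (2 powr p * 4 / (d - c))"

context
  fixes p :: real and U :: "real \<Rightarrow> real"
  assumes p: "1 \<le> p" and U_borel [measurable]: "U \<in> borel_measurable borel" and U_per: "periodic2 U"
begin

lemma periodic2_diff: "periodic2 (\<lambda>y. U (y - h) - U (y - k))"
  using U_per unfolding periodic2_def by (metis add_diff_eq diff_add_eq)

lemma modulus_alt: "modulus p U (h - k) = (\<integral>\<^sup>+y. ennreal (\<bar>U (y - h) - U (y - k)\<bar> powr p) \<partial>circ)"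
proof -
  have "(\<integral>\<^sup>+y. ennreal (\<bar>U ((y + - k) - (h - k)) - U (y + - k)\<bar> powr p) \<partial>circ) = modulus p U (h - k)"
    unfolding modulus_def
  proof (rule nn_integral_circ_shift[of "\<lambda>y. ennreal (\<bar>U (y - (h - k)) - U y\<bar> powr p)" "- k"])
    show "periodic2 (\<lambda>y. ennreal (\<bar>U (y - (h - k)) - U y\<bar> powr p))"
      using periodic2_comp[OF periodic2_diff[of "h - k" 0], of "\<lambda>u. ennreal (\<bar>u\<bar> powr p)"] by simp
  qed measurable
  then show ?thesis by simp
qed

lemma modulus_0: "modulus p U 0 = 0"
  by (simp add: modulus_def)

lemma modulus_uminus: "modulus p U (- h) = modulus p U h"
  using modulus_alt[of 0 h] by (simp add: modulus_def abs_minus_commute)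

lemma modulus_add: "modulus p U (h + k) \<le> ennreal (2 powr p) * (modulus p U h + modulus p U k)"
proof -
  have "modulus p U (h + k) \<le> (\<integral>\<^sup>+y. ennreal (2 powr p) * (ennreal (\<bar>U (y - (h + k)) - U (y - k)\<bar> powr p) + ennreal (\<bar>U (y - k) - U y\<bar> powr p)) \<partial>circ)"
    unfolding modulus_def
  proof (rule nn_integral_mono)
    fix y
    let ?a = "\<bar>U (y - (h + k)) - U (y - k)\<bar>" and ?b = "\<bar>U (y - k) - U y\<bar>"
    have "\<bar>U (y - (h + k)) - U y\<bar> powr p \<le> (?a + ?b) powr p" using p by (intro powr_mono2) auto
    also have "\<dots> \<le> 2 powr p * (?a powr p + ?b powr p)" by (rule powr_add2_le) (use p in auto)
    finally show "ennreal (\<bar>U (y - (h + k)) - U y\<bar> powr p) \<le> ennreal (2 powr p) * (ennreal (?a powr p) + ennreal (?b powr p))"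
      by (simp add: ennreal_mult[symmetric] ennreal_leI flip: ennreal_plus)
  qed
  also have "\<dots> = ennreal (2 powr p) * (modulus p U h + modulus p U k)"
    using modulus_alt[of "h + k" k] by (simp add: nn_integral_cmult nn_integral_add) (simp add: modulus_def)
  finally show ?thesis .
qed

lemma modulus_mult: "modulus p U (real n * h) \<le> ennreal ((2 * 2 powr p) ^ n) * modulus p U h"
proof (induction n)
  case 0
  then show ?case by (simp add: modulus_0)
next
  case (Suc n)
  \<comment> \<open>The constant of step \<open>n\<close> also majorises the single new translation,
    whence the factor 2 beside the \<open>2 powr p\<close> of \<open>modulus_add\<close>.\<close>
  have 1: "1 \<le> (2 * 2 powr p) ^ n" 
  proof (rule one_le_power)
    have "1 \<le> (2::real) powr p" using p by (intro ge_one_powr_ge_zero) auto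
    then show "1 \<le> 2 * (2::real) powr p" by linarith
  qed
  have "real (Suc n) * h = real n * h + h" by (simp add: algebra_simps)
  then have "modulus p U (real (Suc n) * h) = modulus p U (real n * h + h)" by (rule arg_cong)
  also have "\<dots> \<le> ennreal (2 powr p) * (modulus p U (real n * h) + modulus p U h)" by (rule modulus_add)
  also have "\<dots> \<le> ennreal (2 powr p) * (ennreal ((2 * 2 powr p) ^ n) * modulus p U h + ennreal ((2 * 2 powr p) ^ n) * modulus p U h)"
  proof (intro mult_left_mono add_mono Suc)
    have "ennreal 1 * modulus p U h \<le> ennreal ((2 * 2 powr p) ^ n) * modulus p U h"
      using 1 by (intro mult_right_mono ennreal_leI) auto
    then show "modulus p U h \<le> ennreal ((2 * 2 powr p) ^ n) * modulus p U h" by simp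
  qed auto
  also have "\<dots> = ennreal (2 powr p) * (2 * (ennreal ((2 * 2 powr p) ^ n) * modulus p U h))"
    by (rule arg_cong[where f="\<lambda>x. ennreal (2 powr p) * x"], rule mult_2[symmetric])
  also have "\<dots> = ennreal ((2 * 2 powr p) ^ Suc n) * modulus p U h"
  proof -
    have "ennreal ((2 * 2 powr p) ^ Suc n) = ennreal (2 powr p) * (2 * ennreal ((2 * 2 powr p) ^ n))"
      by (simp add: ennreal_mult[symmetric] mult_ac flip: ennreal_numeral)
    then show ?thesis by (simp only: mult.assoc)
  qed
  finally show ?case .
qed

lemma modulus_borel [measurable]: "modulus p U \<in> borel_measurable borel"
  unfolding modulus_def by (rule ivl.borel_measurable_nn_integral) measurable

text \<open>A short translation 2\<eta> is the difference of the translations by 2(y + \<eta>) and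
  2y, both in the observed range for y in the left half of [c,d]; averaging over that half bounds
  it. A general h is a multiple of a short translation.\<close>

lemma modulus_le_average:
  assumes "c < d" and h: "0 \<le> h" "h \<le> 2"
  shows "modulus p U h \<le> ennreal (modulus_const p c d) * (\<integral>\<^sup>+y. modulus p U (2 * y) \<partial>ivl c d)"
proof -
  define m where "m = (c + d) / 2"
  have m: "c < m" "m < d" using assms by (auto simp: m_def)
  let ?I = "\<integral>\<^sup>+y. modulus p U (2 * y) \<partial>ivl c d"
  have sub: "(\<integral>\<^sup>+y. modulus p U (2 * y) \<partial>ivl a b) \<le> ?I" if "c \<le> a" "b \<le> d" for a b
    using that by (simp add: nn_integral_ivl) (intro nn_integral_mono, auto simp: indicator_def)
  have small: "modulus p U (2 * \<eta>) \<le> ennreal (2 powr p * 2 / (m - c)) * ?I" if \<eta>: "0 \<le> \<eta>" "\<eta> \<le> m - c" for \<eta>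
  proof -
    have "ennreal (m - c) * modulus p U (2 * \<eta>) = (\<integral>\<^sup>+y. modulus p U (2 * \<eta>) \<partial>ivl c m)"
      using m by (simp add: emeasure_ivl mult.commute)
    also have "\<dots> \<le> (\<integral>\<^sup>+y. ennreal (2 powr p) * (modulus p U (2 * (y + \<eta>)) + modulus p U (2 * y)) \<partial>ivl c m)"
    proof (rule nn_integral_mono)
      fix y
      have "modulus p U (2 * \<eta>) = modulus p U (2 * (y + \<eta>) + - (2 * y))" by simp
      also have "\<dots> \<le> ennreal (2 powr p) * (modulus p U (2 * (y + \<eta>)) + modulus p U (- (2 * y)))" by (rule modulus_add)
      finally show "modulus p U (2 * \<eta>) \<le> ennreal (2 powr p) * (modulus p U (2 * (y + \<eta>)) + modulus p U (2 * y))"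
        by (simp only: modulus_uminus)
    qed
    also have "\<dots> = ennreal (2 powr p) * ((\<integral>\<^sup>+y. modulus p U (2 * (y + \<eta>)) \<partial>ivl c m) + (\<integral>\<^sup>+y. modulus p U (2 * y) \<partial>ivl c m))"
      by (simp add: nn_integral_cmult nn_integral_add)
    also have "(\<integral>\<^sup>+y. modulus p U (2 * (y + \<eta>)) \<partial>ivl c m) = (\<integral>\<^sup>+y. modulus p U (2 * y) \<partial>ivl (c + \<eta>) (m + \<eta>))"
      by (rule nn_integral_ivl_shift) measurable
    also have "ennreal (2 powr p) * ((\<integral>\<^sup>+y. modulus p U (2 * y) \<partial>ivl (c + \<eta>) (m + \<eta>)) + (\<integral>\<^sup>+y. modulus p U (2 * y) \<partial>ivl c m)) \<le>
      ennreal (2 powr p) * (?I + ?I)"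
      using \<eta> m by (intro mult_left_mono add_mono sub) (auto simp: m_def field_simps)
    finally have "ennreal (1 / (m - c)) * (ennreal (m - c) * modulus p U (2 * \<eta>)) \<le> ennreal (1 / (m - c)) * (ennreal (2 powr p) * (?I + ?I))"
      by (intro mult_left_mono) auto
    moreover have "ennreal (1 / (m - c)) * (ennreal (m - c) * modulus p U (2 * \<eta>)) = modulus p U (2 * \<eta>)"
      using m by (simp add: mult.assoc[symmetric] ennreal_mult[symmetric])
    moreover have "ennreal (1 / (m - c)) * (ennreal (2 powr p) * (?I + ?I)) = ennreal (2 powr p * 2 / (m - c)) * ?I"
    proof -
      have "ennreal (2 powr p * 2 / (m - c)) = ennreal (1 / (m - c)) * (ennreal (2 powr p) * 2)"
        using m by (simp add: ennreal_mult[symmetric] flip: ennreal_numeral)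
      then show ?thesis by (simp add: mult_2[symmetric] mult.assoc)
    qed
    ultimately show ?thesis by simp
  qed
  have mc: "m - c = (d - c) / 2" by (simp add: m_def field_simps)
  define n where "n = nat \<lceil>2 / (d - c)\<rceil>"
  have n: "1 / (m - c) \<le> real n" unfolding n_def mc using assms by (simp add: of_nat_ceiling)
  have "0 < 1 / (m - c)" using m by simp
  with n have n0: "0 < real n" by linarith
  \<comment> \<open>\<open>n\<close> translations by 2\<eta> make up h; h \<le> 2 and the choice of
    \<open>n\<close> keep \<eta> within half the length of [c,d].\<close>
  define \<eta> where "\<eta> = h / 2 / real n"
  have "\<eta> \<le> 1 / real n" using h n0 by (simp add: \<eta>_def field_simps)
  also have "\<dots> \<le> m - c" using n n0 m by (simp add: field_simps)
  finally have \<eta>: "0 \<le> \<eta>" "\<eta> \<le> m - c" using h n0 by (auto simp: \<eta>_def)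
  have "modulus p U h = modulus p U (real n * (2 * \<eta>))" using n0 by (simp add: \<eta>_def)
  also have "\<dots> \<le> ennreal ((2 * 2 powr p) ^ n) * modulus p U (2 * \<eta>)" by (rule modulus_mult)
  also have "\<dots> \<le> ennreal ((2 * 2 powr p) ^ n) * (ennreal (2 powr p * 2 / (m - c)) * ?I)"
    by (intro mult_left_mono small \<eta>) auto
  also have "\<dots> = ennreal ((2 * 2 powr p) ^ n * (2 powr p * 2 / (m - c))) * ?I"
    using m by (subst ennreal_mult) (auto simp: mult.assoc)
  also have "(2 * 2 powr p) ^ n * (2 powr p * 2 / (m - c)) = modulus_const p c d"
    unfolding modulus_const_def n_def mc by simp
  finally show ?thesis .
qed

text \<open>With mean zero, U(y) is minus half the integral of U(y - h) - U(y) over one period of h.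
  Jensen costs 2^(p-1) against the 2^p on the left, which leaves the factor 1/2.\<close>

lemma mean_zero_le_modulus:
  assumes int: "integrable circ U" and mean: "integral\<^sup>L circ U = 0"
  shows "(\<integral>\<^sup>+y. ennreal (\<bar>U y\<bar> powr p) \<partial>circ) \<le> ennreal (1 / 2) * (\<integral>\<^sup>+h. modulus p U h \<partial>ivl 0 2)"
proof -
  have pt: "ennreal (\<bar>U y\<bar> powr p) \<le> ennreal (1 / 2) * (\<integral>\<^sup>+h. ennreal (\<bar>U (y - h) - U y\<bar> powr p) \<partial>ivl 0 2)" for y
  proof -
    have shift: "integrable (ivl 0 2) (\<lambda>h. U (y - h)) \<longleftrightarrow> integrable circ U" "(\<integral>h. U (y - h) \<partial>ivl 0 2) = integral\<^sup>L circ U"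
    proof -
      have *: "(\<integral>\<^sup>+h. \<phi> (U (y - h)) \<partial>ivl 0 2) = (\<integral>\<^sup>+h. \<phi> (U h) \<partial>circ)"
        if [measurable]: "\<phi> \<in> borel_measurable borel" for \<phi> :: "real \<Rightarrow> ennreal"
        by (rule nn_integral_ivl_reflect_shift[of "\<lambda>h. \<phi> (U h)"]) (auto intro: periodic2_comp[OF U_per])
      show "integrable (ivl 0 2) (\<lambda>h. U (y - h)) \<longleftrightarrow> integrable circ U" "(\<integral>h. U (y - h) \<partial>ivl 0 2) = integral\<^sup>L circ U"
        by (rule integral_eq_if_nn_integral_eq; simp add: *)+
    qed
    have "2 * \<bar>U y\<bar> = \<bar>\<integral>h. U (y - h) - U y \<partial>ivl 0 2\<bar>"
      using shift int mean by (simp add: measure_ivl abs_mult)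
    also have "\<dots> \<le> (\<integral>h. \<bar>U (y - h) - U y\<bar> \<partial>ivl 0 2)" by (rule integral_abs_bound)
    finally have "(2 * \<bar>U y\<bar>) powr p \<le> (\<integral>h. \<bar>U (y - h) - U y\<bar> \<partial>ivl 0 2) powr p"
      using p by (intro powr_mono2) auto
    then have "ennreal ((2 * \<bar>U y\<bar>) powr p) \<le> ennreal ((\<integral>h. \<bar>U (y - h) - U y\<bar> \<partial>ivl 0 2) powr p)" by (rule ennreal_leI)
    also have "\<dots> \<le> ennreal (2 powr (p - 1)) * (\<integral>\<^sup>+h. ennreal (\<bar>U (y - h) - U y\<bar> powr p) \<partial>ivl 0 2)"
      using ivl.nn_jensen_powr[where a=0 and b=2 and f="\<lambda>h. U (y - h) - U y" and p=p] p by (simp add: measure_ivl)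
    finally have "ennreal (1 / 2 powr p) * ennreal ((2 * \<bar>U y\<bar>) powr p) \<le>
       ennreal (1 / 2 powr p) * (ennreal (2 powr (p - 1)) * (\<integral>\<^sup>+h. ennreal (\<bar>U (y - h) - U y\<bar> powr p) \<partial>ivl 0 2))"
      by (intro mult_left_mono) auto
    moreover have "ennreal (1 / 2 powr p) * ennreal ((2 * \<bar>U y\<bar>) powr p) = ennreal (\<bar>U y\<bar> powr p)"
      by (subst ennreal_mult[symmetric]) (auto simp: powr_mult)
    moreover have "ennreal (1 / 2 powr p) * ennreal (2 powr (p - 1)) = ennreal (1 / 2)"
      by (subst ennreal_mult[symmetric]) (auto simp: powr_diff)
    ultimately show ?thesis by (simp add: mult.assoc[symmetric])
  qed
  have "(\<integral>\<^sup>+y. ennreal (\<bar>U y\<bar> powr p) \<partial>circ) \<le> (\<integral>\<^sup>+y. ennreal (1 / 2) * (\<integral>\<^sup>+h. ennreal (\<bar>U (y - h) - U y\<bar> powr p) \<partial>ivl 0 2) \<partial>circ)"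
    by (intro nn_integral_mono pt)
  also have "\<dots> = ennreal (1 / 2) * (\<integral>\<^sup>+y. (\<integral>\<^sup>+h. ennreal (\<bar>U (y - h) - U y\<bar> powr p) \<partial>ivl 0 2) \<partial>circ)"
    by (rule nn_integral_cmult) (rule ivl.borel_measurable_nn_integral, measurable)
  also have "(\<integral>\<^sup>+y. (\<integral>\<^sup>+h. ennreal (\<bar>U (y - h) - U y\<bar> powr p) \<partial>ivl 0 2) \<partial>circ) = (\<integral>\<^sup>+h. modulus p U h \<partial>ivl 0 2)"
    unfolding modulus_def by (rule ivl2.Fubini'[of "\<lambda>h y. ennreal (\<bar>U (y - h) - U y\<bar> powr p)"]) measurable
  finally show ?thesis .
qed

end

section \<open>The damped equation on the circle: dissipation, observability, decay\<close>

lemma AE_circ_uminus: "(AE y in circ. P (- y)) \<longleftrightarrow> (AE y in circ. P y)"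
  using AE_ivl_uminus[where P=P and a="-1" and b=1] by (simp only: minus_minus)

text \<open>The product of the constants of \<open>modulus_le_average\<close> and
  \<open>observability_average\<close> and of the inverse of the factor p c0 / 2 in
  \<open>dissipation\<close>.\<close>

definition obs_const :: "real \<Rightarrow> real \<Rightarrow> real \<Rightarrow> real \<Rightarrow> real \<Rightarrow> real \<Rightarrow> real \<Rightarrow> real" where
  "obs_const p c d a0 A c0 C0 = modulus_const p c d *
     (3 powr p * (2 powr p / a0 + 2 * (2 powr (p - 1) * (C0 powr p * A powr (p - 1))))) * (2 / (p * c0))"

text \<open>The maximum with 1/2 keeps the factor positive, since its logarithm becomes the
  rate.\<close>

definition decay_factor :: "real \<Rightarrow> real \<Rightarrow> real \<Rightarrow> real \<Rightarrow> real \<Rightarrow> real \<Rightarrow> real \<Rightarrow> real" where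
  "decay_factor p c d a0 A c0 C0 = max (1 / 2) (1 - 1 / obs_const p c d a0 A c0 C0)"

lemma obs_const_pos:
  assumes "c < d" "0 < a0" "0 < c0" "2 \<le> p"
  shows "0 < obs_const p c d a0 A c0 C0"
proof -
  have "0 < 2 powr p / a0 + 2 * (2 powr (p - 1) * (C0 powr p * A powr (p - 1)))"
    using assms by (intro add_pos_nonneg) auto
  moreover have "0 < modulus_const p c d" using assms by (auto simp: modulus_const_def)
  ultimately show ?thesis using assms by (simp add: obs_const_def)
qed

lemma decay_factor_bounds:
  assumes "c < d" "0 < a0" "0 < c0" "2 \<le> p"
  shows "0 < decay_factor p c d a0 A c0 C0" "decay_factor p c d a0 A c0 C0 < 1"
  using obs_const_pos[OF assms] by (auto simp: decay_factor_def max_def)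

text \<open>Two-sided comparison of \<open>F\<close> with \<alpha> V stands in for the nonlinearity:
  the lower bound feeds the dissipation, the upper one the comparison with the free wave. The bound
  \<open>M\<close> gives integrability of the powers of \<open>U\<close>.\<close>

locale damped_transport = transport +
  fixes \<alpha> :: "real \<Rightarrow> real" and a0 A c d c0 C0 M p :: real
  assumes \<alpha>_borel [measurable]: "\<alpha> \<in> borel_measurable borel"
    and \<alpha>_bounds: "0 \<le> \<alpha> y" "\<alpha> y \<le> A"
    and \<alpha>_lower: "c \<le> y \<Longrightarrow> y \<le> d \<Longrightarrow> a0 \<le> \<alpha> y"
    and cd: "0 \<le> c" "c < d" "d \<le> 1" and a0: "0 < a0" and c0: "0 < c0" and C0: "0 \<le> C0" and p: "2 \<le> p"
    and damping: "AE s in ivl 0 T. AE y in circ. c0 * \<alpha> y * (V s y)^2 \<le> F (s, y) * V s y \<and> \<bar>F (s, y)\<bar> \<le> C0 * \<alpha> y * \<bar>V s y\<bar>"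
    and bounded: "0 \<le> t \<Longrightarrow> AE y in circ. \<bar>U t y\<bar> \<le> M"
    and mean_zero: "integral\<^sup>L circ U0 = 0"
begin

lemma damping_pair:
  "AE z in ivl 0 T \<Otimes>\<^sub>M circ. c0 * \<alpha> (snd z) * (V (fst z) (snd z))^2 \<le> F z * V (fst z) (snd z) \<and> \<bar>F z\<bar> \<le> C0 * \<alpha> (snd z) * \<bar>V (fst z) (snd z)\<bar>"
proof (rule ivl2.AE_pair_measure)
  show "{z \<in> space (ivl 0 T \<Otimes>\<^sub>M circ). c0 * \<alpha> (snd z) * (V (fst z) (snd z))^2 \<le> F z * V (fst z) (snd z) \<and> \<bar>F z\<bar> \<le> C0 * \<alpha> (snd z) * \<bar>V (fst z) (snd z)\<bar>} \<in> sets (ivl 0 T \<Otimes>\<^sub>M circ)"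
    by measurable
qed (use damping[of T] in simp)

lemma bounded_pair: "AE z in ivl 0 T \<Otimes>\<^sub>M circ. \<bar>U (fst z) (snd z)\<bar> \<le> M"
proof (rule ivl2.AE_pair_measure)
  show "{z \<in> space (ivl 0 T \<Otimes>\<^sub>M circ). \<bar>U (fst z) (snd z)\<bar> \<le> M} \<in> sets (ivl 0 T \<Otimes>\<^sub>M circ)" by measurable
  show "AE s in ivl 0 T. AE y in circ. \<bar>U (fst (s, y)) (snd (s, y))\<bar> \<le> M"
    unfolding AE_ivl[of _ 0] using bounded by (intro AE_I2) auto
qed

definition E :: "real \<Rightarrow> real" where "E t = (\<integral>y. \<bar>U t y\<bar> powr p \<partial>circ)"
text \<open>Extended-valued, so that it can be used before \<open>dissipation\<close> shows that it
  is finite.\<close>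

definition D :: "real \<Rightarrow> ennreal" where "D T = (\<integral>\<^sup>+z. ennreal (\<alpha> (snd z) * \<bar>V (fst z) (snd z)\<bar> powr p) \<partial>(ivl 0 T \<Otimes>\<^sub>M circ))"

lemma pow_integrable: "0 \<le> t \<Longrightarrow> integrable circ (\<lambda>y. \<bar>U t y\<bar> powr p)"
proof -
  assume "0 \<le> t"
  have "AE y in circ. norm (\<bar>U t y\<bar> powr p) \<le> M powr p"
    using bounded[OF \<open>0 \<le> t\<close>] by eventually_elim (use p in \<open>auto intro!: powr_mono2\<close>)
  then show ?thesis by (intro ivl.integrable_const_bound) auto
qed

lemma E_nonneg: "0 \<le> E t" by (simp add: E_def)

text \<open>The power functional in \<open>energy\<close>; \<open>M\<close> bounds its derivative
  along the solution. The constant p c0 comes from \<open>pow_deriv_dissipation\<close>, and the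
  symmetrisation halves it.\<close>

lemma dissipation:
  assumes "0 \<le> t"
  shows "ennreal (p * c0 / 2) * D t \<le> ennreal (E 0 - E t)" and "E t \<le> E 0"
proof -
  let ?M = "ivl 0 t \<Otimes>\<^sub>M circ"
  have p': "0 < p" using p by simp
  have [measurable]: "pow_deriv p \<in> borel_measurable borel"
    by (rule borel_measurable_continuous_onI[OF pow_deriv_continuous[OF p]])
  have pb: "\<bar>pow_deriv p u\<bar> \<le> p * (M powr (p - 1) + M powr (p - 1))" if "\<bar>u\<bar> \<le> M" for u
  proof -
    have "max 0 u powr (p - 1) \<le> M powr (p - 1)" "max 0 (- u) powr (p - 1) \<le> M powr (p - 1)"
      using that p by (auto intro!: powr_mono2)
    then have "\<bar>max 0 u powr (p - 1) - max 0 (- u) powr (p - 1)\<bar> \<le> M powr (p - 1) + M powr (p - 1)"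
      using powr_ge_zero[of "max 0 u" "p - 1"] powr_ge_zero[of "max 0 (- u)" "p - 1"] by linarith
    then show ?thesis using p' by (simp add: pow_deriv_def abs_mult)
  qed
  have "integrable ?M (\<lambda>z. pow_deriv p (U (fst z) (snd z)) * F z)"
  proof (rule integrable_mult_AE_bounded[OF F_integrable])
    show "AE z in ?M. \<bar>pow_deriv p (U (fst z) (snd z))\<bar> \<le> p * (M powr (p - 1) + M powr (p - 1))"
      using bounded_pair by eventually_elim (rule pb)
  qed measurable
  then have int: "integrable ?M (\<lambda>(s, y). pow_deriv p (U s y) * F (s, y))" by (simp add: case_prod_unfold)
  let ?g = "\<lambda>(s, y). (pow_deriv p (U s (- y)) - pow_deriv p (U s y)) * F (s, y)"
  have sym: "integrable ?M ?g" "(\<integral>(s, y). pow_deriv p (U s y) * F (s, y) \<partial>?M) = - integral\<^sup>L ?M ?g / 2"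
    by (rule symmetrize[OF _ int]; simp)+
  have "integrable circ (\<lambda>y. \<bar>U0 y\<bar> powr p)" using pow_integrable[of 0] by simp
  from energy(2)[OF assms pow_deriv[OF p] pow_deriv_continuous[OF p] this int]
  have E: "E 0 - E t = integral\<^sup>L ?M ?g / 2" using sym(2) by (simp add: E_def)
  have ge: "AE z in ?M. p * c0 * (\<alpha> (snd z) * \<bar>V (fst z) (snd z)\<bar> powr p) \<le> ?g z"
    using damping_pair[of t]
  proof eventually_elim
    case (elim z)
    obtain s y where z: "z = (s, y)" by fastforce
    have "p * c0 * (\<alpha> y * \<bar>V s y\<bar> powr p) \<le> (pow_deriv p (U s (- y)) - pow_deriv p (U s y)) * F (s, y)"
      by (rule pow_deriv_dissipation) (use p \<alpha>_bounds c0 elim in \<open>auto simp: z V_def\<close>)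
    then show ?case by (simp add: z)
  qed
  have g0: "AE z in ?M. 0 \<le> ?g z"
    using ge
  proof eventually_elim
    case (elim z)
    have "0 \<le> p * c0 * (\<alpha> (snd z) * \<bar>V (fst z) (snd z)\<bar> powr p)" using p' c0 \<alpha>_bounds by simp
    with elim show ?case by linarith
  qed
  show "E t \<le> E 0" using E integral_nonneg_AE[OF g0] by simp
  have "ennreal (p * c0) * D t = (\<integral>\<^sup>+z. ennreal (p * c0) * ennreal (\<alpha> (snd z) * \<bar>V (fst z) (snd z)\<bar> powr p) \<partial>?M)"
    unfolding D_def by (rule nn_integral_cmult[symmetric]) measurable
  also have "\<dots> = (\<integral>\<^sup>+z. ennreal (p * c0 * (\<alpha> (snd z) * \<bar>V (fst z) (snd z)\<bar> powr p)) \<partial>?M)"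
    using p' c0 \<alpha>_bounds by (intro nn_integral_cong) (simp add: ennreal_mult)
  also have "\<dots> \<le> (\<integral>\<^sup>+z. ennreal (?g z) \<partial>?M)"
    using ge by (intro nn_integral_mono_AE) (auto intro: ennreal_leI)
  also have "\<dots> = ennreal (integral\<^sup>L ?M ?g)"
    by (rule nn_integral_eq_integral[OF sym(1) g0])
  finally have "ennreal (1 / 2) * (ennreal (p * c0) * D t) \<le> ennreal (1 / 2) * ennreal (integral\<^sup>L ?M ?g)"
    by (rule mult_left_mono) simp
  moreover have "ennreal (1 / 2) * (ennreal (p * c0) * D t) = ennreal (p * c0 / 2) * D t"
    using p' c0 by (subst mult.assoc[symmetric], subst ennreal_mult[symmetric]) auto
  moreover have "ennreal (1 / 2) * ennreal (integral\<^sup>L ?M ?g) = ennreal (E 0 - E t)"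
    unfolding E using integral_nonneg_AE[OF g0] by (subst ennreal_mult[symmetric]) auto
  ultimately show "ennreal (p * c0 / 2) * D t \<le> ennreal (E 0 - E t)" by simp
qed

text \<open>The total force met along a characteristic during one period; it dominates the deviation
  from the free wave.\<close>

definition N :: "real \<Rightarrow> real" where "N y = (\<integral>r. \<bar>F (r, y + r)\<bar> \<partial>ivl 0 2)"

lemma N_borel [measurable]: "N \<in> borel_measurable borel"
  unfolding N_def by (rule ivl.borel_measurable_lebesgue_integral) measurable

lemma N_nonneg: "0 \<le> N y" by (simp add: N_def)

lemma N_periodic: "periodic2 N"
proof -
  have "F (r, y + 2 + r) = F (r, y + r)" for y r
    using F_periodic[of r, unfolded periodic2_def, rule_format, of "y + r"] by (simp add: add_ac)
  then show ?thesis by (simp add: periodic2_def N_def)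
qed

text \<open>The exceptional set of starting points is the same for all times up to 2, because it
  depends only on the integrability of \<open>F\<close> along the characteristic.\<close>

lemma char_le_N: "AE y in circ. \<forall>s. 0 \<le> s \<longrightarrow> s \<le> 2 \<longrightarrow> \<bar>U s (y + s) - U0 y\<bar> \<le> N y"
  using AE_char_integrable[of 2]
proof eventually_elim
  case (elim y)
  show ?case
  proof (intro allI impI)
    fix s :: real assume s: "0 \<le> s" "s \<le> 2"
    have "\<bar>U s (y + s) - U0 y\<bar> = \<bar>\<integral>r. F (r, y + r) \<partial>ivl 0 s\<bar>" by (simp add: U_char)
    also have "\<dots> \<le> (\<integral>r. \<bar>F (r, y + r)\<bar> \<partial>ivl 0 s)" by (rule integral_abs_bound)
    also have "\<dots> \<le> N y" unfolding N_def using elim s by (intro integral_ivl_nonneg_mono) auto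
    finally show "\<bar>U s (y + s) - U0 y\<bar> \<le> N y" .
  qed
qed

lemma N_le_D: "(\<integral>\<^sup>+y. ennreal (N y powr p) \<partial>circ) \<le> ennreal (2 powr (p - 1) * (C0 powr p * A powr (p - 1))) * D 2"
proof -
  have "(\<integral>\<^sup>+y. ennreal (N y powr p) \<partial>circ) \<le> (\<integral>\<^sup>+y. ennreal (2 powr (p - 1)) * (\<integral>\<^sup>+r. ennreal (\<bar>F (r, y + r)\<bar> powr p) \<partial>ivl 0 2) \<partial>circ)"
  proof (rule nn_integral_mono)
    fix y
    show "ennreal (N y powr p) \<le> ennreal (2 powr (p - 1)) * (\<integral>\<^sup>+r. ennreal (\<bar>F (r, y + r)\<bar> powr p) \<partial>ivl 0 2)"
      unfolding N_def using ivl.nn_jensen_powr[where a=0 and b=2 and f="\<lambda>r. F (r, y + r)" and p=p] p by (simp add: measure_ivl)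
  qed
  also have "\<dots> = ennreal (2 powr (p - 1)) * (\<integral>\<^sup>+y. (\<integral>\<^sup>+r. ennreal (\<bar>F (r, y + r)\<bar> powr p) \<partial>ivl 0 2) \<partial>circ)"
    by (rule nn_integral_cmult) (rule ivl.borel_measurable_nn_integral, measurable)
  also have "(\<integral>\<^sup>+y. (\<integral>\<^sup>+r. ennreal (\<bar>F (r, y + r)\<bar> powr p) \<partial>ivl 0 2) \<partial>circ) = (\<integral>\<^sup>+r. (\<integral>\<^sup>+y. ennreal (\<bar>F (r, y + r)\<bar> powr p) \<partial>circ) \<partial>ivl 0 2)"
    by (rule ivl2.Fubini'[of "\<lambda>r y. ennreal (\<bar>F (r, y + r)\<bar> powr p)"]) measurable
  also have "\<dots> = (\<integral>\<^sup>+r. (\<integral>\<^sup>+y. ennreal (\<bar>F (r, y)\<bar> powr p) \<partial>circ) \<partial>ivl 0 2)"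
    by (intro nn_integral_cong nn_integral_circ_shift[where g="\<lambda>y. ennreal (\<bar>F (_, y)\<bar> powr p)"])
      (measurable, rule periodic2_comp[OF F_periodic])
  also have "\<dots> = (\<integral>\<^sup>+z. ennreal (\<bar>F z\<bar> powr p) \<partial>(ivl 0 2 \<Otimes>\<^sub>M circ))"
    by (rule ivl.nn_integral_fst) measurable
  also have "\<dots> \<le> (\<integral>\<^sup>+z. ennreal (C0 powr p * A powr (p - 1)) * ennreal (\<alpha> (snd z) * \<bar>V (fst z) (snd z)\<bar> powr p) \<partial>(ivl 0 2 \<Otimes>\<^sub>M circ))"
  proof (rule nn_integral_mono_AE)
    show "AE z in ivl 0 2 \<Otimes>\<^sub>M circ. ennreal (\<bar>F z\<bar> powr p) \<le> ennreal (C0 powr p * A powr (p - 1)) * ennreal (\<alpha> (snd z) * \<bar>V (fst z) (snd z)\<bar> powr p)"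
      using damping_pair[of 2]
    proof eventually_elim
      case (elim z)
      let ?v = "\<bar>V (fst z) (snd z)\<bar>" and ?a = "\<alpha> (snd z)"
      have "\<bar>F z\<bar> powr p \<le> (C0 * ?a * ?v) powr p" using elim p by (intro powr_mono2) auto
      also have "\<dots> = C0 powr p * ?a powr p * ?v powr p"
        using C0 \<alpha>_bounds by (simp add: powr_mult)
      \<comment> \<open>Only one power of \<alpha> is wanted, as in \<open>D\<close>; the others are
        absorbed by the bound \<open>A\<close>.\<close>
      also have "?a powr p = ?a powr (p - 1) * ?a"
        using powr_mult_base[of ?a "p - 1"] \<alpha>_bounds by (simp add: mult.commute)
      also have "C0 powr p * (?a powr (p - 1) * ?a) * ?v powr p \<le> C0 powr p * (A powr (p - 1) * ?a) * ?v powr p"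
        using \<alpha>_bounds p by (intro mult_right_mono mult_left_mono powr_mono2) auto
      finally have "ennreal (\<bar>F z\<bar> powr p) \<le> ennreal ((C0 powr p * A powr (p - 1)) * (?a * ?v powr p))"
        by (intro ennreal_leI) (simp add: mult_ac)
      then show ?case using \<alpha>_bounds by (subst (asm) ennreal_mult) auto
    qed
  qed
  also have "\<dots> = ennreal (C0 powr p * A powr (p - 1)) * D 2"
    unfolding D_def by (rule nn_integral_cmult) measurable
  finally show ?thesis by (simp add: ennreal_mult mult.assoc mult_left_mono)
qed

text \<open>On the damping region 2 |V| at time s is the difference of the values at the mirror
  points, and each value differs by at most \<open>N\<close> from the initial value at the foot of
  its characteristic. The feet \<open>- y - s\<close> and \<open>y - s\<close> are 2y apart, and
  integration over a period of s gives the full distance to the translate.\<close>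

lemma observability_average:
  "(\<integral>\<^sup>+y. modulus p U0 (2 * y) \<partial>ivl c d) \<le> ennreal (3 powr p * (2 powr p / a0 + 2 * (2 powr (p - 1) * (C0 powr p * A powr (p - 1))))) * D 2"
proof -
  let ?e = "\<lambda>x. ennreal (\<bar>x\<bar> powr p)"
  let ?N = "\<integral>\<^sup>+y. ennreal (N y powr p) \<partial>circ"
  have mod: "modulus p U0 (2 * y) = (\<integral>\<^sup>+s. ?e (U0 (- y - s) - U0 (y - s)) \<partial>ivl 0 2)" for y
  proof -
    have "(\<integral>\<^sup>+s. ?e (U0 ((y - s) - 2 * y) - U0 (y - s)) \<partial>ivl 0 2) = modulus p U0 (2 * y)"
      unfolding modulus_def
    proof (rule nn_integral_ivl_reflect_shift[of "\<lambda>x. ?e (U0 (x - 2 * y) - U0 x)"])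
      show "periodic2 (\<lambda>x. ?e (U0 (x - 2 * y) - U0 x))"
        using periodic2_comp[OF periodic2_diff[of p U0 "2 * y" 0], of ?e] p U0_borel U0_periodic by simp
    qed measurable
    moreover have "(y - s) - 2 * y = - y - s" for s by simp
    ultimately show ?thesis by simp
  qed
  define P where "P y \<longleftrightarrow> (\<forall>s. 0 \<le> s \<longrightarrow> s \<le> 2 \<longrightarrow> \<bar>U s (y + s) - U0 y\<bar> \<le> N y)" for y
  have Pper: "periodic2 P"
    unfolding periodic2_def
  proof
    fix y
    have "U s (y + 2 + s) = U s (y + s)" for s
      using U_periodic[of s, unfolded periodic2_def, rule_format, of "y + s"] by (simp add: add_ac)
    moreover have "U0 (y + 2) = U0 y" "N (y + 2) = N y"
      using U0_periodic N_periodic unfolding periodic2_def by auto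
    ultimately show "P (y + 2) = P y" unfolding P_def by simp
  qed
  have Pae: "AE y in circ. P y" unfolding P_def by (rule char_le_N)
  have pt: "AE y in ivl c d. ?e (U0 (- y - s) - U0 (y - s)) \<le>
      ennreal (3 powr p) * (ennreal (2 powr p / a0) * ennreal (\<alpha> y * \<bar>V s y\<bar> powr p) + ennreal (N (- y - s) powr p) + ennreal (N (y - s) powr p))"
    if s: "0 \<le> s" "s \<le> 2" for s
  proof -
    \<comment> \<open>The exceptional null set has to be avoided at both feet: directly for
      \<open>y - s\<close> and through the reflection for \<open>- y - s\<close>.\<close>
    have P1: "AE y in circ. P (y + - s)" by (rule AE_circ_shift[OF Pper Pae])
    then have "AE y in ivl (- 1) 1. P (- y + - s)"
      by (subst AE_circ_uminus[where P="\<lambda>y. P (y + - s)"])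
    with P1 have "AE y in circ. P (y - s) \<and> P (- y - s)" by simp
    then have "AE y in ivl c d. P (y - s) \<and> P (- y - s)" by (rule AE_ivl_subset) (use cd in auto)
    moreover have "AE y in ivl c d. a0 \<le> \<alpha> y" unfolding AE_ivl using \<alpha>_lower by auto
    ultimately show ?thesis
    proof eventually_elim
      case (elim y)
      have 1: "\<bar>U s y - U0 (y - s)\<bar> \<le> N (y - s)" "\<bar>U s (- y) - U0 (- y - s)\<bar> \<le> N (- y - s)"
        using elim s unfolding P_def by (auto dest!: spec[of _ s])
      then have "\<bar>U0 (- y - s) - U0 (y - s)\<bar> \<le> 2 * \<bar>V s y\<bar> + N (- y - s) + N (y - s)"
        unfolding V_def by (auto simp: abs_le_iff)
      then have "\<bar>U0 (- y - s) - U0 (y - s)\<bar> powr p \<le> (2 * \<bar>V s y\<bar> + N (- y - s) + N (y - s)) powr p"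
        using p by (intro powr_mono2) auto
      also have "\<dots> \<le> 3 powr p * ((2 * \<bar>V s y\<bar>) powr p + N (- y - s) powr p + N (y - s) powr p)"
        using p N_nonneg by (intro powr_add3_le) auto
      also have "(2 * \<bar>V s y\<bar>) powr p = (2 powr p / a0) * (a0 * \<bar>V s y\<bar> powr p)"
        using a0 by (simp add: powr_mult)
      also have "3 powr p * ((2 powr p / a0) * (a0 * \<bar>V s y\<bar> powr p) + N (- y - s) powr p + N (y - s) powr p) \<le>
         3 powr p * ((2 powr p / a0) * (\<alpha> y * \<bar>V s y\<bar> powr p) + N (- y - s) powr p + N (y - s) powr p)"
        using elim a0 by (intro mult_left_mono add_right_mono mult_right_mono) auto
      finally have "?e (U0 (- y - s) - U0 (y - s)) \<le> ennreal (3 powr p * ((2 powr p / a0) * (\<alpha> y * \<bar>V s y\<bar> powr p) + N (- y - s) powr p + N (y - s) powr p))"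
        by (rule ennreal_leI)
      moreover have *: "ennreal (k * (x * z + u + w)) = ennreal k * (ennreal x * ennreal z + ennreal u + ennreal w)"
        if "0 \<le> k" "0 \<le> x" "0 \<le> z" "0 \<le> u" "0 \<le> w" for k x z u w :: real
        using that by (simp add: ennreal_mult)
      have "ennreal (3 powr p * ((2 powr p / a0) * (\<alpha> y * \<bar>V s y\<bar> powr p) + N (- y - s) powr p + N (y - s) powr p)) =
        ennreal (3 powr p) * (ennreal (2 powr p / a0) * ennreal (\<alpha> y * \<bar>V s y\<bar> powr p) + ennreal (N (- y - s) powr p) + ennreal (N (y - s) powr p))"
        by (rule *) (use \<alpha>_bounds a0 in auto)
      ultimately show ?case by (simp only:)
    qed
  qed
  have "(\<integral>\<^sup>+y. modulus p U0 (2 * y) \<partial>ivl c d) = (\<integral>\<^sup>+y. (\<integral>\<^sup>+s. ?e (U0 (- y - s) - U0 (y - s)) \<partial>ivl 0 2) \<partial>ivl c d)"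
    by (simp only: mod)
  also have "\<dots> = (\<integral>\<^sup>+s. (\<integral>\<^sup>+y. ?e (U0 (- y - s) - U0 (y - s)) \<partial>ivl c d) \<partial>ivl 0 2)"
    by (rule ivl2.Fubini'[of "\<lambda>s y. ?e (U0 (- y - s) - U0 (y - s))"]) measurable
  also have "\<dots> \<le> (\<integral>\<^sup>+s. (\<integral>\<^sup>+y. ennreal (3 powr p) * (ennreal (2 powr p / a0) * ennreal (\<alpha> y * \<bar>V s y\<bar> powr p) + ennreal (N (- y - s) powr p) + ennreal (N (y - s) powr p)) \<partial>ivl c d) \<partial>ivl 0 2)"
    by (intro nn_integral_mono_AE) (unfold AE_ivl[of _ 0], intro AE_I2 impI nn_integral_mono_AE pt, auto)
  also have "\<dots> = (\<integral>\<^sup>+s. ennreal (3 powr p) * (ennreal (2 powr p / a0) * (\<integral>\<^sup>+y. ennreal (\<alpha> y * \<bar>V s y\<bar> powr p) \<partial>ivl c d) + (\<integral>\<^sup>+y. ennreal (N (- y - s) powr p) \<partial>ivl c d) + (\<integral>\<^sup>+y. ennreal (N (y - s) powr p) \<partial>ivl c d)) \<partial>ivl 0 2)"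
    by (simp add: nn_integral_cmult nn_integral_add)
  also have "\<dots> = ennreal (3 powr p) * (ennreal (2 powr p / a0) * (\<integral>\<^sup>+s. (\<integral>\<^sup>+y. ennreal (\<alpha> y * \<bar>V s y\<bar> powr p) \<partial>ivl c d) \<partial>ivl 0 2)
     + (\<integral>\<^sup>+s. (\<integral>\<^sup>+y. ennreal (N (- y - s) powr p) \<partial>ivl c d) \<partial>ivl 0 2) + (\<integral>\<^sup>+s. (\<integral>\<^sup>+y. ennreal (N (y - s) powr p) \<partial>ivl c d) \<partial>ivl 0 2))"
  proof -
    have [measurable]: "(\<lambda>s. \<integral>\<^sup>+y. ennreal (\<alpha> y * \<bar>V s y\<bar> powr p) \<partial>ivl c d) \<in> borel_measurable borel"
      "(\<lambda>s. \<integral>\<^sup>+y. ennreal (N (- y - s) powr p) \<partial>ivl c d) \<in> borel_measurable borel"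
      "(\<lambda>s. \<integral>\<^sup>+y. ennreal (N (y - s) powr p) \<partial>ivl c d) \<in> borel_measurable borel"
      by (rule ivl.borel_measurable_nn_integral, measurable)+
    show ?thesis by (simp add: nn_integral_cmult nn_integral_add)
  qed
  also have "\<dots> \<le> ennreal (3 powr p) * (ennreal (2 powr p / a0) * D 2 + ?N + ?N)"
  proof (intro mult_left_mono add_mono)
    have "(\<integral>\<^sup>+s. (\<integral>\<^sup>+y. ennreal (\<alpha> y * \<bar>V s y\<bar> powr p) \<partial>ivl c d) \<partial>ivl 0 2) \<le> (\<integral>\<^sup>+s. (\<integral>\<^sup>+y. ennreal (\<alpha> y * \<bar>V s y\<bar> powr p) \<partial>circ) \<partial>ivl 0 2)"
      using cd by (intro nn_integral_mono) (simp add: nn_integral_ivl, intro nn_integral_mono, auto simp: indicator_def)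
    also have "\<dots> = D 2" unfolding D_def
      using ivl.nn_integral_fst[of "\<lambda>z. ennreal (\<alpha> (snd z) * \<bar>V (fst z) (snd z)\<bar> powr p)" "ivl 0 2" "-1" 1] by simp
    finally show "(\<integral>\<^sup>+s. (\<integral>\<^sup>+y. ennreal (\<alpha> y * \<bar>V s y\<bar> powr p) \<partial>ivl c d) \<partial>ivl 0 2) \<le> D 2" .
    \<comment> \<open>Once s is integrated over a period, the error terms no longer depend on y; the
      remaining length d - c is at most 1.\<close>
    have le1: "(\<integral>\<^sup>+y. ?N \<partial>ivl c d) \<le> ?N"
    proof -
      have "(\<integral>\<^sup>+y. ?N \<partial>ivl c d) = ennreal (d - c) * ?N" using cd by (simp add: emeasure_ivl mult.commute)
      also have "\<dots> \<le> ennreal 1 * ?N" using cd by (intro mult_right_mono ennreal_leI) auto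
      finally show ?thesis by simp
    qed
    have red: "(\<integral>\<^sup>+s. ennreal (N (x - s) powr p) \<partial>ivl 0 2) = ?N" for x
      by (rule nn_integral_ivl_reflect_shift[of "\<lambda>y. ennreal (N y powr p)"]) (auto intro: periodic2_comp[OF N_periodic])
    have "(\<integral>\<^sup>+s. (\<integral>\<^sup>+y. ennreal (N (- y - s) powr p) \<partial>ivl c d) \<partial>ivl 0 2) = (\<integral>\<^sup>+y. (\<integral>\<^sup>+s. ennreal (N (- y - s) powr p) \<partial>ivl 0 2) \<partial>ivl c d)"
      by (rule ivl2.Fubini'[of "\<lambda>s y. ennreal (N (- y - s) powr p)", symmetric]) measurable
    then show "(\<integral>\<^sup>+s. (\<integral>\<^sup>+y. ennreal (N (- y - s) powr p) \<partial>ivl c d) \<partial>ivl 0 2) \<le> ?N"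
      unfolding red using le1 by simp
    have "(\<integral>\<^sup>+s. (\<integral>\<^sup>+y. ennreal (N (y - s) powr p) \<partial>ivl c d) \<partial>ivl 0 2) = (\<integral>\<^sup>+y. (\<integral>\<^sup>+s. ennreal (N (y - s) powr p) \<partial>ivl 0 2) \<partial>ivl c d)"
      by (rule ivl2.Fubini'[of "\<lambda>s y. ennreal (N (y - s) powr p)", symmetric]) measurable
    then show "(\<integral>\<^sup>+s. (\<integral>\<^sup>+y. ennreal (N (y - s) powr p) \<partial>ivl c d) \<partial>ivl 0 2) \<le> ?N"
      unfolding red using le1 by simp
  qed auto
  also have "\<dots> \<le> ennreal (3 powr p) * (ennreal (2 powr p / a0) * D 2 + ennreal (2 powr (p - 1) * (C0 powr p * A powr (p - 1))) * D 2
      + ennreal (2 powr (p - 1) * (C0 powr p * A powr (p - 1))) * D 2)"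
    by (intro mult_left_mono add_mono N_le_D) auto
  also have "\<dots> = ennreal (3 powr p * (2 powr p / a0 + 2 * (2 powr (p - 1) * (C0 powr p * A powr (p - 1))))) * D 2"
  proof -
    have *: "ennreal k * (ennreal x * w + ennreal q * w + ennreal q * w) = ennreal (k * (x + 2 * q)) * w"
      if "0 \<le> k" "0 \<le> x" "0 \<le> q" for k x q w
    proof -
      have "ennreal (k * (x + 2 * q)) = ennreal (k * (x + q + q))" by (simp add: add.assoc)
      also have "\<dots> = ennreal k * (ennreal x + ennreal q + ennreal q)"
        using that by (simp only: ennreal_mult ennreal_plus add_nonneg_nonneg)
      finally show ?thesis by (simp only: distrib_right mult.assoc)
    qed
    show ?thesis by (rule *) (use a0 in auto)
  qed
  finally show ?thesis .
qed


lemma observability: "E 0 \<le> obs_const p c d a0 A c0 C0 * (E 0 - E 2)"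
proof -
  let ?K = "3 powr p * (2 powr p / a0 + 2 * (2 powr (p - 1) * (C0 powr p * A powr (p - 1))))"
  let ?m = "modulus_const p c d"
  have p1: "1 \<le> p" and p0: "0 < p" using p by auto
  have K: "0 \<le> ?K" using a0 by simp
  have m: "0 \<le> ?m" using cd by (auto simp: modulus_const_def)
  have "ennreal (E 0) = (\<integral>\<^sup>+y. ennreal (\<bar>U0 y\<bar> powr p) \<partial>circ)"
    using pow_integrable[of 0] by (simp add: E_def nn_integral_eq_integral)
  also have "\<dots> \<le> ennreal (1 / 2) * (\<integral>\<^sup>+h. modulus p U0 h \<partial>ivl 0 2)"
    by (rule mean_zero_le_modulus[OF p1 U0_borel U0_periodic U0_integrable mean_zero])
  also have "\<dots> \<le> ennreal (1 / 2) * (\<integral>\<^sup>+h. ennreal ?m * (ennreal ?K * D 2) \<partial>ivl 0 2)"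
  proof (intro mult_left_mono nn_integral_mono_AE)
    show "AE h in ivl 0 2. modulus p U0 h \<le> ennreal ?m * (ennreal ?K * D 2)"
      unfolding AE_ivl
    proof (intro AE_I2 impI)
      fix h :: real assume "0 \<le> h \<and> h \<le> 2"
      then have "modulus p U0 h \<le> ennreal ?m * (\<integral>\<^sup>+y. modulus p U0 (2 * y) \<partial>ivl c d)"
        by (intro modulus_le_average[OF p1 U0_borel U0_periodic]) (use cd in auto)
      also have "\<dots> \<le> ennreal ?m * (ennreal ?K * D 2)"
        by (intro mult_left_mono observability_average) simp
      finally show "modulus p U0 h \<le> ennreal ?m * (ennreal ?K * D 2)" .
    qed
  qed simp
  \<comment> \<open>The bound is uniform in h, and the length 2 of the range of h cancels the 1/2 of
    \<open>mean_zero_le_modulus\<close>.\<close>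
  also have "\<dots> = ennreal (1 / 2) * ennreal 2 * (ennreal ?m * (ennreal ?K * D 2))"
    by (simp add: emeasure_ivl mult_ac)
  also have "ennreal (1 / 2) * ennreal 2 = 1" by (subst ennreal_mult[symmetric]) auto
  also have "1 * (ennreal ?m * (ennreal ?K * D 2)) = ennreal (obs_const p c d a0 A c0 C0) * (ennreal (p * c0 / 2) * D 2)"
  proof -
    have "ennreal (obs_const p c d a0 A c0 C0) * ennreal (p * c0 / 2) = ennreal ?m * ennreal ?K"
      using K m p0 c0 obs_const_pos[of c d a0 c0 p A C0] cd a0 p
      by (subst (1 2) ennreal_mult[symmetric]) (auto simp: obs_const_def)
    then show ?thesis by (simp only: mult.assoc[symmetric] mult_1)
  qed
  also have "\<dots> \<le> ennreal (obs_const p c d a0 A c0 C0) * ennreal (E 0 - E 2)"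
    by (intro mult_left_mono dissipation) auto
  also have "\<dots> = ennreal (obs_const p c d a0 A c0 C0 * (E 0 - E 2))"
    using obs_const_pos[of c d a0 c0 p A C0] cd a0 c0 p dissipation(2)[of 2] by (subst ennreal_mult) auto
  finally show ?thesis
    using obs_const_pos[of c d a0 c0 p A C0] cd a0 c0 p dissipation(2)[of 2] by (subst (asm) ennreal_le_iff) auto
qed

lemma contraction: "E 2 \<le> decay_factor p c d a0 A c0 C0 * E 0"
proof -
  let ?K = "obs_const p c d a0 A c0 C0"
  have K: "0 < ?K" using obs_const_pos[of c d a0 c0 p A C0] cd a0 c0 p by auto
  have "E 2 \<le> (1 - 1 / ?K) * E 0" using observability K by (simp add: field_simps)
  also have "\<dots> \<le> decay_factor p c d a0 A c0 C0 * E 0"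
    by (intro mult_right_mono E_nonneg) (simp add: decay_factor_def)
  finally show ?thesis .
qed

text \<open>All constants survive a restart, the sup bound because it is assumed at every time; this
  lets the contraction be iterated.\<close>

lemma restart_damped:
  assumes t: "0 \<le> t"
  shows "damped_transport (U t) (\<lambda>(r, y). F (t + r, y)) \<alpha> a0 A c d c0 C0 M p"
proof -
  interpret R: transport "U t" "\<lambda>(r, y). F (t + r, y)" by (rule restart[OF t])
  show ?thesis
  proof
    show "integral\<^sup>L circ (U t) = 0" using integral_U(2)[OF t] mean_zero by simp
    show "AE y in circ. \<bar>R.U s y\<bar> \<le> M" if "0 \<le> s" for s
    proof -
      have "AE y in circ. \<bar>U (t + s) y\<bar> \<le> M" using t that by (intro bounded) simp
      with restart_AE[OF t that] show ?thesis by eventually_elim simp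
    qed
    fix T :: real
    have "AE s in ivl (0 + t) (T + t). AE y in circ. c0 * \<alpha> y * (V s y)^2 \<le> F (s, y) * V s y \<and> \<bar>F (s, y)\<bar> \<le> C0 * \<alpha> y * \<bar>V s y\<bar>"
      by (rule AE_ivl_subset[OF damping[of "T + t"]]) (use t in auto)
    from AE_ivl_shift[OF this]
    have ae: "AE s in ivl 0 T. AE y in circ. c0 * \<alpha> y * (V (s + t) y)^2 \<le> F (s + t, y) * V (s + t) y \<and> \<bar>F (s + t, y)\<bar> \<le> C0 * \<alpha> y * \<bar>V (s + t) y\<bar>" .
    have "AE s in ivl 0 T. 0 \<le> s" by (auto simp: AE_ivl)
    with ae show "AE s in ivl 0 T. AE y in circ. c0 * \<alpha> y * (R.V s y)\<^sup>2 \<le> (case (s, y) of (r, y) \<Rightarrow> F (t + r, y)) * R.V s y \<and>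
           \<bar>case (s, y) of (r, y) \<Rightarrow> F (t + r, y)\<bar> \<le> C0 * \<alpha> y * \<bar>R.V s y\<bar>"
    proof eventually_elim
      case (elim s)
      have r: "AE y in circ. R.U s y = U (t + s) y" by (rule restart_AE[OF t elim(2)])
      then have "AE y in circ. R.U s (- y) = U (t + s) (- y)"
        by (subst AE_circ_uminus[where P="\<lambda>y. R.U s y = U (t + s) y"])
      with r have "AE y in circ. R.V s y = V (s + t) y"
        unfolding V_def R.V_def add.commute[of s t] by eventually_elim (simp only:)
      with elim(1) show ?case by eventually_elim (simp add: add.commute)
    qed
  qed (use \<alpha>_bounds \<alpha>_lower cd a0 c0 C0 p in auto)
qed

lemma restart_E:
  assumes t: "0 \<le> t" "0 \<le> s"
  shows "damped_transport.E (U t) (\<lambda>(r, y). F (t + r, y)) p s = E (t + s)"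
proof -
  interpret R: damped_transport "U t" "\<lambda>(r, y). F (t + r, y)" \<alpha> a0 A c d c0 C0 M p
    by (rule restart_damped[OF t(1)])
  show ?thesis unfolding E_def R.E_def
    by (intro integral_cong_AE) (use restart_AE[OF t] in auto)
qed

lemma E_antimono: "0 \<le> s \<Longrightarrow> s \<le> t \<Longrightarrow> E t \<le> E s"
proof -
  assume st: "0 \<le> s" "s \<le> t"
  interpret R: damped_transport "U s" "\<lambda>(r, y). F (s + r, y)" \<alpha> a0 A c d c0 C0 M p
    by (rule restart_damped[OF st(1)])
  show "E t \<le> E s"
    using R.dissipation(2)[of "t - s"] restart_E[of s "t - s"] restart_E[of s 0] st by simp
qed

lemma E_discrete_decay: "E (2 * real n) \<le> decay_factor p c d a0 A c0 C0 ^ n * E 0"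
proof (induction n)
  case (Suc n)
  interpret R: damped_transport "U (2 * real n)" "\<lambda>(r, y). F (2 * real n + r, y)" \<alpha> a0 A c d c0 C0 M p
    by (rule restart_damped) simp
  let ?g = "decay_factor p c d a0 A c0 C0"
  have g: "0 < ?g" using decay_factor_bounds[of c d a0 c0 p A C0] cd a0 c0 p by auto
  have "E (2 * real (Suc n)) = R.E 2" using restart_E[of "2 * real n" 2] by (simp add: algebra_simps)
  also have "\<dots> \<le> ?g * R.E 0" by (rule R.contraction)
  also have "R.E 0 = E (2 * real n)" using restart_E[of "2 * real n" 0] by simp
  also have "?g * E (2 * real n) \<le> ?g * (?g ^ n * E 0)" using Suc g by (intro mult_left_mono) auto
  finally show ?case by simp
qed simp

lemma exponential_decay:
  assumes "0 \<le> t"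
  shows "E t \<le> 1 / decay_factor p c d a0 A c0 C0 * exp (ln (decay_factor p c d a0 A c0 C0) / 2 * t) * E 0"
proof -
  let ?g = "decay_factor p c d a0 A c0 C0"
  have g: "0 < ?g" "?g < 1" using decay_factor_bounds[of c d a0 c0 p A C0] cd a0 c0 p by auto
  \<comment> \<open>The number of complete periods; the incomplete one loses at most one factor,
    which is divided out in the constant.\<close>
  define n where "n = nat \<lfloor>t / 2\<rfloor>"
  have n: "2 * real n \<le> t" "t / 2 - 1 \<le> real n" using assms unfolding n_def by linarith+
  have "E t \<le> E (2 * real n)" using n by (intro E_antimono) auto
  also have "\<dots> \<le> ?g ^ n * E 0" by (rule E_discrete_decay)
  also have "?g ^ n \<le> 1 / ?g * exp (ln ?g / 2 * t)"
  proof -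
    have "?g ^ n = ?g powr real n" using g by (simp add: powr_realpow)
    also have "\<dots> \<le> ?g powr (t / 2 - 1)" using g n by (intro powr_mono') auto
    also have "\<dots> = exp (ln ?g / 2 * t) / ?g" using g by (simp add: powr_def left_diff_distrib exp_diff mult.commute)
    finally show ?thesis by simp
  qed
  then have "?g ^ n * E 0 \<le> 1 / ?g * exp (ln ?g / 2 * t) * E 0" by (intro mult_right_mono E_nonneg)
  finally show ?thesis .
qed

end

section \<open>Completeness of the trigonometric system\<close>

text \<open>Arbitrary phases include the sines, and integer frequencies keep the sums and
  differences of the product formula inside the set.\<close>

inductive_set trig_poly :: "(real \<Rightarrow> real) set" where
  cos: "(\<lambda>y. cos (of_int k * pi * y + \<theta>)) \<in> trig_poly"
| add: "f \<in> trig_poly \<Longrightarrow> g \<in> trig_poly \<Longrightarrow> (\<lambda>y. f y + g y) \<in> trig_poly"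
| scale: "f \<in> trig_poly \<Longrightarrow> (\<lambda>y. c * f y) \<in> trig_poly"

lemma trig_poly_mult: "f \<in> trig_poly \<Longrightarrow> g \<in> trig_poly \<Longrightarrow> (\<lambda>y. f y * g y) \<in> trig_poly"
proof (induction f rule: trig_poly.induct)
  case (cos k \<theta>)
  from cos show ?case
  proof (induction g rule: trig_poly.induct)
    case (cos l \<eta>)
    have "(\<lambda>y. cos (of_int k * pi * y + \<theta>) * cos (of_int l * pi * y + \<eta>)) =
      (\<lambda>y. (1 / 2) * (cos (of_int (k - l) * pi * y + (\<theta> - \<eta>)) + cos (of_int (k + l) * pi * y + (\<theta> + \<eta>))))"
    proof
      fix y
      have "of_int (k - l) * pi * y + (\<theta> - \<eta>) = (of_int k * pi * y + \<theta>) - (of_int l * pi * y + \<eta>)"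
        "of_int (k + l) * pi * y + (\<theta> + \<eta>) = (of_int k * pi * y + \<theta>) + (of_int l * pi * y + \<eta>)"
        by (simp_all add: algebra_simps)
      then show "cos (of_int k * pi * y + \<theta>) * cos (of_int l * pi * y + \<eta>) =
        (1 / 2) * (cos (of_int (k - l) * pi * y + (\<theta> - \<eta>)) + cos (of_int (k + l) * pi * y + (\<theta> + \<eta>)))"
        by (simp only: cos_times_cos times_divide_eq_left mult_1_left)
    qed
    then show ?case by (simp only:) (intro trig_poly.scale trig_poly.add trig_poly.cos)
  next
    case (add g h)
    have "(\<lambda>y. cos (of_int k * pi * y + \<theta>) * (g y + h y)) = (\<lambda>y. cos (of_int k * pi * y + \<theta>) * g y + cos (of_int k * pi * y + \<theta>) * h y)"
      by (simp add: algebra_simps)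
    then show ?case using trig_poly.add[OF add.IH] by simp
  next
    case (scale g c)
    have "(\<lambda>y. cos (of_int k * pi * y + \<theta>) * (c * g y)) = (\<lambda>y. c * (cos (of_int k * pi * y + \<theta>) * g y))"
      by (simp add: algebra_simps)
    then show ?case using trig_poly.scale[OF scale.IH] by simp
  qed
next
  case (add f h)
  have "(\<lambda>y. (f y + h y) * g y) = (\<lambda>y. f y * g y + h y * g y)" by (simp add: algebra_simps)
  then show ?case using trig_poly.add[OF add.IH(1)[OF add.prems] add.IH(2)[OF add.prems]] by simp
next
  case (scale f c)
  have "(\<lambda>y. (c * f y) * g y) = (\<lambda>y. c * (f y * g y))" by (simp add: algebra_simps)
  then show ?case using trig_poly.scale[OF scale.IH[OF scale.prems]] by simp
qed

lemma trig_poly_const: "(\<lambda>y. c) \<in> trig_poly"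
  using trig_poly.scale[OF trig_poly.cos[of 0 0], of c] by simp

text \<open>Real-linear functionals on the complex plane become combinations of cos and sin on the
  unit circle, and products stay inside by \<open>trig_poly_mult\<close>.\<close>

lemma trig_poly_polynomial:
  assumes "real_polynomial_function P" shows "(\<lambda>y. P (cis (pi * y))) \<in> trig_poly"
  using assms
proof induction
  case (linear f)
  then interpret bounded_linear f .
  have "f z = Re z * f 1 + Im z * f \<i>" for z
  proof -
    have "z = of_real (Re z) + of_real (Im z) * \<i>" by (simp add: complex_eq_iff)
    from arg_cong[OF this, of f] show ?thesis
    using add[of "of_real (Re z)" "of_real (Im z) * \<i>"] scaleR[of "Re z" 1] scaleR[of "Im z" \<i>]
    by (simp add: scaleR_conv_of_real)
  qed
  note lin = this
  have f: "f (cis (pi * y)) = f 1 * cos (of_int 1 * pi * y + 0) + f \<i> * cos (of_int 1 * pi * y + (- pi / 2))" for y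
    by (subst lin) (simp add: cos_add cos_diff)
  show ?case unfolding f by (intro trig_poly.intros)
next
  case (const c)
  show ?case by (rule trig_poly_const)
next
  case (add f g)
  then show ?case by (intro trig_poly.add)
next
  case (mult f g)
  then show ?case by (intro trig_poly_mult)
qed

text \<open>Stone-Weierstrass on the unit circle extends the orthogonality to all continuous
  functions of \<open>cis (pi * y)\<close>. Indicators of closed intervals are bounded limits of
  such functions, and \<open>AE_zero_if_integral_Icc_zero\<close> concludes.\<close>

lemma trig_complete:
  fixes g :: "real \<Rightarrow> real"
  assumes g: "integrable circ g"
    and zero: "\<And>(k::nat) \<theta>. (\<integral>y. g y * cos (real k * pi * y + \<theta>) \<partial>circ) = 0"
  shows "AE y in circ. g y = 0"
proof -
  have [measurable]: "g \<in> borel_measurable borel" by (rule borel_measurable_integrable_ivl[OF g])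
  have cosm: "integrable circ (\<lambda>y. g y * cos (x * y + \<theta>))" for x \<theta>
    by (rule integrable_ivl_mult_bounded[OF g, where B=1]) auto
  have trig0: "integrable circ (\<lambda>y. g y * f y) \<and> (\<integral>y. g y * f y \<partial>circ) = 0" if "f \<in> trig_poly" for f
    using that
  proof induction
    case (cos k \<theta>)
    have "(\<integral>y. g y * cos (of_int k * pi * y + \<theta>) \<partial>circ) = 0"
    proof (cases "0 \<le> k")
      case True
      then show ?thesis using zero[of "nat k" \<theta>] by simp
    next
      case False
      \<comment> \<open>Negative frequencies reduce to natural ones because cos is even.\<close>
      have "cos (of_int k * pi * y + \<theta>) = cos (real (nat (- k)) * pi * y + (- \<theta>))" for y
        using cos_minus[of "of_int k * pi * y + \<theta>"] False by (simp add: algebra_simps)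
      then show ?thesis using zero[of "nat (- k)" "- \<theta>"] by simp
    qed
    with cosm[of "of_int k * pi" \<theta>] show ?case by blast
  next
    case (add f h) then show ?case by (simp add: distrib_left)
  next
    case (scale f c)
    have "(\<lambda>y. g y * (c * f y)) = (\<lambda>y. c * (g y * f y))" by (simp add: algebra_simps)
    with scale show ?case by simp
  qed
  have cont0: "(\<integral>y. g y * h (cis (pi * y)) \<partial>circ) = 0" if h: "continuous_on UNIV h" for h :: "complex \<Rightarrow> real"
  proof -
    have [measurable]: "(\<lambda>y. h (cis (pi * y))) \<in> borel_measurable borel"
      by (intro borel_measurable_continuous_onI continuous_on_compose2[OF h] continuous_intros) auto
    have "compact (h ` sphere 0 1)" by (intro compact_continuous_image continuous_on_subset[OF h]) auto
    then obtain B where "\<And>x. x \<in> h ` sphere 0 1 \<Longrightarrow> \<bar>x\<bar> \<le> B"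
      using compact_imp_bounded bounded_iff by (metis real_norm_def)
    then have hint: "integrable circ (\<lambda>y. g y * h (cis (pi * y)))"
      by (intro integrable_ivl_mult_bounded[OF g, where B=B]) auto
    have "\<bar>\<integral>y. g y * h (cis (pi * y)) \<partial>circ\<bar> \<le> e * (\<integral>y. \<bar>g y\<bar> \<partial>circ)" if "e > 0" for e
    proof -
      obtain P where P: "real_polynomial_function P" "\<And>x. x \<in> sphere 0 1 \<Longrightarrow> \<bar>h x - P x\<bar> < e"
        using Stone_Weierstrass_real_polynomial_function[of "sphere 0 1" h e] \<open>e > 0\<close> continuous_on_subset[OF h, of "sphere 0 1"] by auto
      note T = trig0[OF trig_poly_polynomial[OF P(1)]]
      have "(\<integral>y. g y * h (cis (pi * y)) \<partial>circ) = (\<integral>y. g y * h (cis (pi * y)) - g y * P (cis (pi * y)) \<partial>circ)"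
        using T hint by simp
      also have "\<bar>\<dots>\<bar> \<le> (\<integral>y. e * \<bar>g y\<bar> \<partial>circ)"
      proof (rule order_trans[OF integral_abs_bound])
        show "(\<integral>y. \<bar>g y * h (cis (pi * y)) - g y * P (cis (pi * y))\<bar> \<partial>circ) \<le> (\<integral>y. e * \<bar>g y\<bar> \<partial>circ)"
        proof (rule integral_mono)
          fix y
          have "\<bar>g y\<bar> * \<bar>h (cis (pi * y)) - P (cis (pi * y))\<bar> \<le> \<bar>g y\<bar> * e"
            using P(2)[of "cis (pi * y)"] by (intro mult_left_mono) auto
          then show "\<bar>g y * h (cis (pi * y)) - g y * P (cis (pi * y))\<bar> \<le> e * \<bar>g y\<bar>"
            by (simp add: right_diff_distrib[symmetric] abs_mult mult.commute)
        qed (use T hint g in auto)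
      qed
      finally show ?thesis by simp
    qed
    then have *: "\<bar>\<integral>y. g y * h (cis (pi * y)) \<partial>circ\<bar> \<le> e * (\<integral>y. \<bar>g y\<bar> \<partial>circ)" if "e > 0" for e using that by blast
    have "\<bar>\<integral>y. g y * h (cis (pi * y)) \<partial>circ\<bar> \<le> 0"
    proof (rule field_le_epsilon)
      fix e :: real assume e: "e > 0"
      let ?G = "\<integral>y. \<bar>g y\<bar> \<partial>circ"
      have G: "0 \<le> ?G" by simp
      \<comment> \<open>The added 1 avoids a division by zero when the integral of |g|
        vanishes.\<close>
      have "e / (x + 1) * x \<le> e" if "0 \<le> x" for x using that e by (simp add: field_simps)
      note this[OF G]
      then show "\<bar>\<integral>y. g y * h (cis (pi * y)) \<partial>circ\<bar> \<le> 0 + e"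
        using *[of "e / (?G + 1)"] e G by (auto intro: order_trans)
    qed
    then show ?thesis by simp
  qed
  show ?thesis
  proof (rule AE_zero_if_integral_Icc_zero[OF g])
    fix c d :: real assume cd: "-1 < c" "c \<le> d" "d < 1"
    \<comment> \<open>Truncated multiples of the distance from a closed arc give continuous
      functions on the circle that decrease to the indicator of the arc.\<close>
    define A where "A = (\<lambda>y. cis (pi * y)) ` {c..d}"
    have cA: "compact A" unfolding A_def by (intro compact_continuous_image continuous_intros) auto
    have A0: "A \<noteq> {}" using cd by (simp add: A_def)
    define h where "h n z = max 0 (1 - real n * infdist z A)" for n z
    have h: "continuous_on UNIV (h n)" for n unfolding h_def by (intro continuous_intros)
    have [measurable]: "(\<lambda>y. h n (cis (pi * y))) \<in> borel_measurable borel" for n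
      by (intro borel_measurable_continuous_onI continuous_on_compose2[OF h] continuous_intros) auto
    have "(\<lambda>n. \<integral>y. g y * h n (cis (pi * y)) \<partial>circ) \<longlonglongrightarrow> (\<integral>y. g y * indicator {c..d} y \<partial>circ)"
    proof (rule integral_ivl_mult_tendsto[OF g, where B=1])
      show "\<bar>h n (cis (pi * y))\<bar> \<le> 1" for n y by (auto simp: h_def infdist_nonneg)
      fix y :: real assume y: "-1 < y" "y < 1"
      show "(\<lambda>n. h n (cis (pi * y))) \<longlonglongrightarrow> indicator {c..d} y"
      proof (cases "y \<in> {c..d}")
        case True
        then have "cis (pi * y) \<in> A" by (auto simp: A_def)
        then show ?thesis using True by (simp add: h_def)
      next
        case False
        have "cis (pi * y) \<notin> A"
        proof
          assume "cis (pi * y) \<in> A"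
          then obtain x where x: "x \<in> {c..d}" "cis (pi * y) = cis (pi * x)" by (auto simp: A_def)
          \<comment> \<open>Both points lie strictly between -1 and 1, so equal values of
            \<open>cis\<close> leave only n = 0.\<close>
          have "\<bar>pi * (y - x)\<bar> < 2 * pi" using x(1) cd y by (simp add: abs_mult abs_less_iff)
          moreover have "cis (pi * (y - x)) = 1" using x(2) by (simp add: right_diff_distrib cis_divide[symmetric])
          then have "cos (pi * (y - x)) = 1" by (metis cis.sel(1) one_complex.sel(1))
          then obtain n :: int where n: "pi * (y - x) = of_int n * (2 * pi)" by (auto simp: cos_one_2pi_int)
          ultimately have "\<bar>of_int n :: real\<bar> * (2 * pi) < 1 * (2 * pi)" by (simp add: abs_mult)
          then have "\<bar>of_int n :: real\<bar> < 1" by (rule mult_right_less_imp_less) simp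
          then have "n = 0" by linarith
          with n have "y = x" by simp
          with x False show False by simp
        qed
        then have pos: "infdist (cis (pi * y)) A > 0"
          using infdist_pos_not_in_closed[of A] cA A0 by (simp add: compact_imp_closed)
        obtain N :: nat where N: "1 / infdist (cis (pi * y)) A < real N" using reals_Archimedean2 by blast
        have "h n (cis (pi * y)) = 0" if "n \<ge> N" for n
        proof -
          have "1 < real N * infdist (cis (pi * y)) A" using N pos by (simp add: divide_less_eq)
          also have "\<dots> \<le> real n * infdist (cis (pi * y)) A" using that pos by (intro mult_right_mono) auto
          finally show ?thesis by (simp add: h_def)
        qed
        then have "\<forall>\<^sub>F n in sequentially. h n (cis (pi * y)) = 0" by (auto simp: eventually_sequentially)
        then show ?thesis using False by (simp add: tendsto_eventually)
      qed
    qed auto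
    then have "(\<integral>y. g y * indicator {c..d} y \<partial>circ) = 0" using cont0[OF h] by (simp add: LIMSEQ_const_iff)
    then show "integral\<^sup>L (ivl c d) g = 0"
      using integral_ivl_indicator[where g=g and c=c and d=d and a="-1" and b=1] cd by (simp add: mult.commute)
  qed simp
qed

section \<open>Fourier coefficients\<close>

lemma cos_periodic2: "periodic2 (\<lambda>y. cos (real k * pi * y + \<theta>))"
  unfolding periodic2_def
proof
  fix y
  have "real k * pi * (y + 2) + \<theta> = (real k * pi * y + \<theta>) + 2 * of_int (int k) * pi" by (simp add: algebra_simps)
  then show "cos (real k * pi * (y + 2) + \<theta>) = cos (real k * pi * y + \<theta>)"
    by (simp only: cos_add cos_int_2pin sin_int_2pin) simp
qed

text \<open>Transport rotates a Fourier coefficient: the phase advances by k pi t for the initial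
  value, and by k pi (t - r) for what the source emits at time r.\<close>

lemma (in transport) fourier_mild:
  assumes "0 \<le> t"
  shows "(\<integral>y. U t y * cos (real k * pi * y + \<theta>) \<partial>circ) =
    (\<integral>y. U0 y * cos (real k * pi * y + (\<theta> + real k * pi * t)) \<partial>circ) +
    (\<integral>r. (\<integral>y. F (r, y) * cos (real k * pi * y + (\<theta> + real k * pi * (t - r))) \<partial>circ) \<partial>ivl 0 t)"
proof -
  let ?w = "real k * pi"
  have cb: "\<bar>cos x\<bar> \<le> 1" for x :: real by simp
  have i0: "integrable circ (\<lambda>y. U0 y * cos (?w * y + (\<theta> + ?w * t)))"
    by (rule integrable_ivl_mult_bounded[OF U0_integrable, where B=1]) auto
  have "integrable (ivl 0 t \<Otimes>\<^sub>M circ) (\<lambda>z. cos (?w * (snd z + t) + \<theta>) * (case z of (r, y) \<Rightarrow> F (r, y + r)))"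
    by (rule integrable_mult_AE_bounded[OF F_char_integrable, where B=1]) auto
  then have i1: "integrable (ivl 0 t \<Otimes>\<^sub>M circ) (\<lambda>(r, y). cos (?w * (y + t) + \<theta>) * F (r, y + r))"
    by (simp add: case_prod_unfold)
  have e: "?w * (y + t) + \<theta> = ?w * y + (\<theta> + ?w * t)" for y by (simp add: algebra_simps)
  have "(\<integral>y. U t y * cos (?w * y + \<theta>) \<partial>circ) = (\<integral>y. U t (y + t) * cos (?w * (y + t) + \<theta>) \<partial>circ)"
    by (rule circ_shift(2)[symmetric, of "\<lambda>y. U t y * cos (?w * y + \<theta>)"])
      (measurable, rule periodic2_comp2[OF U_periodic cos_periodic2])
  also have "\<dots> = (\<integral>y. U0 y * cos (?w * y + (\<theta> + ?w * t)) + (\<integral>r. cos (?w * (y + t) + \<theta>) * F (r, y + r) \<partial>ivl 0 t) \<partial>circ)"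
    unfolding e by (intro Bochner_Integration.integral_cong) (simp_all add: U_char distrib_right mult.commute)
  also have "\<dots> = (\<integral>y. U0 y * cos (?w * y + (\<theta> + ?w * t)) \<partial>circ) + (\<integral>y. (\<integral>r. cos (?w * (y + t) + \<theta>) * F (r, y + r) \<partial>ivl 0 t) \<partial>circ)"
    by (rule Bochner_Integration.integral_add[OF i0 ivl2.integrable_snd[OF i1]])
  also have "(\<integral>y. (\<integral>r. cos (?w * (y + t) + \<theta>) * F (r, y + r) \<partial>ivl 0 t) \<partial>circ) =
    (\<integral>r. (\<integral>y. cos (?w * (y + t) + \<theta>) * F (r, y + r) \<partial>circ) \<partial>ivl 0 t)"
    by (rule ivl2.Fubini_integral[OF i1])
  also have "\<dots> = (\<integral>r. (\<integral>y. F (r, y) * cos (?w * y + (\<theta> + ?w * (t - r))) \<partial>circ) \<partial>ivl 0 t)"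
  proof (rule Bochner_Integration.integral_cong[OF refl])
    fix r
    have "(\<integral>y. F (r, y + r) * cos (?w * (y + r) + (\<theta> + ?w * (t - r))) \<partial>circ) = (\<integral>y. F (r, y) * cos (?w * y + (\<theta> + ?w * (t - r))) \<partial>circ)"
      by (rule circ_shift(2)[of "\<lambda>y. F (r, y) * cos (?w * y + (\<theta> + ?w * (t - r)))"])
        (measurable, rule periodic2_comp2[OF F_periodic cos_periodic2])
    moreover have "?w * (y + r) + (\<theta> + ?w * (t - r)) = ?w * (y + t) + \<theta>" for y by (simp add: algebra_simps)
    ultimately have "(\<integral>y. F (r, y + r) * cos (?w * (y + t) + \<theta>) \<partial>circ) = (\<integral>y. F (r, y) * cos (?w * y + (\<theta> + ?w * (t - r))) \<partial>circ)"
      by (simp only:)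
    moreover have "(\<integral>y. cos (?w * (y + t) + \<theta>) * F (r, y + r) \<partial>circ) = (\<integral>y. F (r, y + r) * cos (?w * (y + t) + \<theta>) \<partial>circ)"
      by (intro Bochner_Integration.integral_cong refl mult.commute)
    ultimately show "(\<integral>y. cos (?w * (y + t) + \<theta>) * F (r, y + r) \<partial>circ) = (\<integral>y. F (r, y) * cos (?w * y + (\<theta> + ?w * (t - r))) \<partial>circ)"
      by (simp only:)
  qed
  finally show ?thesis .
qed

text \<open>Variation of constants for C' = \<omega> S, S' = - \<omega> C - f: after multiplication
  by the cosine and sine of \<theta> + \<omega> (t - r) the cross terms cancel. \<open>s\<close> and
  \<open>S\<close> are separate functions because they come from different versions of the velocity,
  which agree only for almost every time.\<close>

lemma oscillator:
  fixes C S f s :: "real \<Rightarrow> real"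
  assumes "0 \<le> t" and s: "integrable (ivl 0 t) s" and f: "integrable (ivl 0 t) f"
    and [measurable]: "C \<in> borel_measurable borel" "S \<in> borel_measurable borel"
    and C: "\<And>r. 0 \<le> r \<Longrightarrow> r \<le> t \<Longrightarrow> C r = C0 + (\<integral>x. \<omega> * s x \<partial>ivl 0 r)"
    and S: "\<And>r. 0 \<le> r \<Longrightarrow> r \<le> t \<Longrightarrow> S r = S0 + (\<integral>x. - \<omega> * C x - f x \<partial>ivl 0 r)"
    and ae: "AE r in ivl 0 t. s r = S r"
  shows "cos \<theta> * C t + sin \<theta> * S t = cos (\<theta> + \<omega> * t) * C0 + sin (\<theta> + \<omega> * t) * S0 - (\<integral>r. sin (\<theta> + \<omega> * (t - r)) * f r \<partial>ivl 0 t)"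
proof -
  have [measurable]: "s \<in> borel_measurable borel" "f \<in> borel_measurable borel"
    using s f by (auto dest: borel_measurable_integrable_ivl)
  have iws: "integrable (ivl 0 t) (\<lambda>x. \<omega> * s x)" using s by simp
  have "continuous_on {0..t} C"
    by (rule continuous_on_eq[where f="\<lambda>r. C0 + (\<integral>x. \<omega> * s x \<partial>ivl 0 r)"])
      (auto intro!: continuous_intros continuous_on_integral_ivl iws simp: C simp del: integral_mult_right_zero)
  then have "compact (C ` {0..t})" by (intro compact_continuous_image) auto
  then obtain B where "\<And>x. 0 \<le> x \<Longrightarrow> x \<le> t \<Longrightarrow> \<bar>C x\<bar> \<le> B"
    using compact_imp_bounded bounded_iff by (metis (no_types, lifting) atLeastAtMost_iff imageI real_norm_def)
  then have iC: "integrable (ivl 0 t) C" by (intro integrable_ivl_bounded) auto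
  have is': "integrable (ivl 0 t) (\<lambda>x. - \<omega> * C x - f x)" using iC f by simp
  let ?c = "\<lambda>r. cos (\<theta> + \<omega> * (t - r))" and ?s = "\<lambda>r. sin (\<theta> + \<omega> * (t - r))"
  have cs: "continuous_on UNIV (\<lambda>r. \<omega> * ?s r)" "continuous_on UNIV (\<lambda>r. - \<omega> * ?c r)" by (intro continuous_intros)+
  have ic: "integrable (ivl 0 t) (\<lambda>r. \<omega> * ?s r)"
    by (intro integrable_ivl_bounded[where B="\<bar>\<omega>\<bar>"]) (auto simp: abs_mult mult_left_le)
  have isn: "integrable (ivl 0 t) (\<lambda>r. - \<omega> * ?c r)"
    by (intro integrable_ivl_bounded[where B="\<bar>\<omega>\<bar>"]) (auto simp: abs_mult mult_left_le)
  have c: "?c r = cos (\<theta> + \<omega> * t) + (\<integral>x. \<omega> * ?s x \<partial>ivl 0 r)" if "0 \<le> r" for r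
  proof -
    have "(\<integral>x. \<omega> * ?s x \<partial>ivl 0 r) = ?c r - ?c 0"
      by (rule integral_ivl_FTC[OF that _ continuous_on_subset[OF cs(1)]]) (auto intro!: derivative_eq_intros)
    then show ?thesis by simp
  qed
  have s': "?s r = sin (\<theta> + \<omega> * t) + (\<integral>x. - \<omega> * ?c x \<partial>ivl 0 r)" if "0 \<le> r" for r
  proof -
    have "(\<integral>x. - \<omega> * ?c x \<partial>ivl 0 r) = ?s r - ?s 0"
      by (rule integral_ivl_FTC[OF that _ continuous_on_subset[OF cs(2)]]) (auto intro!: derivative_eq_intros)
    then show ?thesis by simp
  qed
  have p1: "integrable (ivl 0 t) (\<lambda>r. C r * (\<omega> * ?s r))" "integrable (ivl 0 t) (\<lambda>r. ?c r * (\<omega> * s r))"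
      "C t * ?c t - C0 * cos (\<theta> + \<omega> * t) = (\<integral>r. C r * (\<omega> * ?s r) \<partial>ivl 0 t) + (\<integral>r. ?c r * (\<omega> * s r) \<partial>ivl 0 t)"
    by (rule product_rule_primitive[OF iws ic \<open>0 \<le> t\<close> C, where B="?c"]; use c in simp)+
  have p2: "integrable (ivl 0 t) (\<lambda>r. S r * (- \<omega> * ?c r))" "integrable (ivl 0 t) (\<lambda>r. ?s r * (- \<omega> * C r - f r))"
      "S t * ?s t - S0 * sin (\<theta> + \<omega> * t) = (\<integral>r. S r * (- \<omega> * ?c r) \<partial>ivl 0 t) + (\<integral>r. ?s r * (- \<omega> * C r - f r) \<partial>ivl 0 t)"
    by (rule product_rule_primitive[OF is' isn \<open>0 \<le> t\<close> S, where B="?s"]; use s' in simp)+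
  have "(\<integral>r. - (?s r * f r) \<partial>ivl 0 t) =
    (\<integral>r. C r * (\<omega> * ?s r) + ?c r * (\<omega> * s r) + (S r * (- \<omega> * ?c r) + ?s r * (- \<omega> * C r - f r)) \<partial>ivl 0 t)"
  proof (rule integral_cong_AE)
    show "AE r in ivl 0 t. - (?s r * f r) = C r * (\<omega> * ?s r) + ?c r * (\<omega> * s r) + (S r * (- \<omega> * ?c r) + ?s r * (- \<omega> * C r - f r))"
      using ae by eventually_elim (simp add: algebra_simps)
  qed measurable
  also have "\<dots> = (C t * ?c t - C0 * cos (\<theta> + \<omega> * t)) + (S t * ?s t - S0 * sin (\<theta> + \<omega> * t))"
    using p1 p2 by simp
  finally show ?thesis by (simp add: mult.commute)
qed

section \<open>Unfolding the interval\<close>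

text \<open>The triangle wave, that is, the even 2-periodic extension of the identity on [0,1];
  \<open>sg\<close> is the square wave. In this form periodicity and parity are immediate.\<close>

definition tri :: "real \<Rightarrow> real" where "tri y = arccos (cos (pi * y)) / pi"
definition sg :: "real \<Rightarrow> real" where "sg y = sgn (sin (pi * y))"
text \<open>With z_x for \<open>w\<close> and z_t for \<open>u\<close> this is the function on the
  circle that satisfies the transport equation.\<close>

definition unfold_pair :: "(real \<Rightarrow> real) \<Rightarrow> (real \<Rightarrow> real) \<Rightarrow> real \<Rightarrow> real" where
  "unfold_pair w u y = w (tri y) - sg y * u (tri y)"
definition unfold_odd :: "(real \<times> real \<Rightarrow> real) \<Rightarrow> real \<times> real \<Rightarrow> real" where
  "unfold_odd g = (\<lambda>(s, y). sg y * g (s, tri y))"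

lemma tri_borel [measurable]: "tri \<in> borel_measurable borel"
proof -
  have "continuous_on UNIV (\<lambda>y. arccos (cos (pi * y)) / pi)"
    by (intro continuous_intros) auto
  then show ?thesis unfolding tri_def[abs_def] by (rule borel_measurable_continuous_onI)
qed

lemma sg_borel [measurable]: "sg \<in> borel_measurable borel"
  unfolding sg_def[abs_def] sgn_real_def by measurable

lemma unfold_pair_borel [measurable]:
  assumes [measurable]: "w \<in> borel_measurable borel" "u \<in> borel_measurable borel"
  shows "unfold_pair w u \<in> borel_measurable borel"
  unfolding unfold_pair_def[abs_def] by measurable

lemma unfold_odd_borel [measurable]:
  assumes [measurable]: "g \<in> borel_measurable (borel \<Otimes>\<^sub>M borel)"
  shows "unfold_odd g \<in> borel_measurable (borel \<Otimes>\<^sub>M borel)"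
  unfolding unfold_odd_def split_beta by measurable

lemma tri_id: "0 \<le> y \<Longrightarrow> y \<le> 1 \<Longrightarrow> tri y = y"
  by (simp add: tri_def arccos_cos)

lemma tri_uminus [simp]: "tri (- y) = tri y" by (simp add: tri_def)

lemma sg_uminus [simp]: "sg (- y) = - sg y" by (simp add: sg_def sgn_minus)

lemma sg_pos: "0 < y \<Longrightarrow> y < 1 \<Longrightarrow> sg y = 1"
  by (simp add: sg_def sin_gt_zero)

lemma sg_abs_le: "\<bar>sg y\<bar> \<le> 1" by (simp add: sg_def sgn_real_def)

lemma cis_shift: "cos (pi * (y + 2)) = cos (pi * y)" "sin (pi * (y + 2)) = sin (pi * y)"
proof -
  have "pi * (y + 2) = pi * y + 2 * pi" by (simp add: algebra_simps)
  then show "cos (pi * (y + 2)) = cos (pi * y)" "sin (pi * (y + 2)) = sin (pi * y)" by simp_all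
qed

lemma tri_periodic: "periodic2 tri" and sg_periodic: "periodic2 sg"
  unfolding periodic2_def tri_def sg_def cis_shift by simp_all

lemma AE_ivl01: "AE y in ivl 0 1. 0 < y \<and> y < 1"
proof -
  have "AE y in lborel. y \<noteq> 0" "AE y in lborel. y \<noteq> 1" by (rule AE_lborel_singleton)+
  then show ?thesis unfolding AE_ivl by eventually_elim auto
qed

lemma AE_circ_fold:
  assumes "AE y in ivl 0 1. P y" "AE y in ivl 0 1. P (- y)" shows "AE y in circ. P y"
proof -
  have "AE y in ivl (- 1) 0. P y" using assms(2) AE_ivl_uminus[where P=P and a=0 and b=1] by (simp only: minus_zero)
  with assms(1) show ?thesis unfolding AE_ivl by eventually_elim auto
qed

lemma unfold_pair_pos: "0 < y \<Longrightarrow> y < 1 \<Longrightarrow> unfold_pair w u y = w y - u y"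
  and unfold_pair_neg: "0 < y \<Longrightarrow> y < 1 \<Longrightarrow> unfold_pair w u (- y) = w y + u y"
  by (simp_all add: unfold_pair_def tri_id sg_pos)

lemma unfold_pair_integrable:
  assumes w: "integrable (ivl 0 1) w" and u: "integrable (ivl 0 1) u"
  shows "integrable circ (unfold_pair w u)"
proof (rule integrable_circ_fold)
  have [measurable]: "w \<in> borel_measurable borel" "u \<in> borel_measurable borel"
    using assms by (auto dest: borel_measurable_integrable_ivl)
  have "integrable (ivl 0 1) (\<lambda>y. unfold_pair w u y) \<longleftrightarrow> integrable (ivl 0 1) (\<lambda>y. w y - u y)"
    using AE_ivl01 by (intro integrable_cong_AE) (auto simp: unfold_pair_pos elim!: AE_mp)
  then show "integrable (ivl 0 1) (unfold_pair w u)" using w u by simp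
  have "integrable (ivl 0 1) (\<lambda>y. unfold_pair w u (- y)) \<longleftrightarrow> integrable (ivl 0 1) (\<lambda>y. w y + u y)"
    using AE_ivl01 by (intro integrable_cong_AE) (auto simp: unfold_pair_neg elim!: AE_mp)
  then show "integrable (ivl 0 1) (\<lambda>y. unfold_pair w u (- y))" using w u by simp
qed

text \<open>The even part of the unfolded function carries \<open>w\<close> and the odd part
  \<open>u\<close>. Hence only cosine coefficients of \<open>w\<close> and sine coefficients of
  \<open>u\<close> occur, and for frequencies k pi these sines satisfy the boundary
  conditions.\<close>

lemma unfold_pair_fourier:
  assumes w: "integrable (ivl 0 1) w" and u: "integrable (ivl 0 1) u"
  shows "(\<integral>y. unfold_pair w u y * cos (\<omega> * y + \<theta>) \<partial>circ) =
    2 * cos \<theta> * (\<integral>x. w x * cos (\<omega> * x) \<partial>ivl 0 1) + 2 * sin \<theta> * (\<integral>x. u x * sin (\<omega> * x) \<partial>ivl 0 1)"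
proof -
  have [measurable]: "w \<in> borel_measurable borel" "u \<in> borel_measurable borel"
    using assms by (auto dest: borel_measurable_integrable_ivl)
  have i: "integrable circ (\<lambda>y. unfold_pair w u y * cos (\<omega> * y + \<theta>))"
    by (rule integrable_ivl_mult_bounded[OF unfold_pair_integrable[OF assms], where B=1]) auto
  have wc: "integrable (ivl 0 1) (\<lambda>x. w x * cos (\<omega> * x))" by (rule integrable_ivl_mult_bounded[OF w, where B=1]) auto
  have us: "integrable (ivl 0 1) (\<lambda>x. u x * sin (\<omega> * x))" by (rule integrable_ivl_mult_bounded[OF u, where B=1]) auto
  have "(\<integral>y. unfold_pair w u y * cos (\<omega> * y + \<theta>) \<partial>circ) =
     (\<integral>y. unfold_pair w u y * cos (\<omega> * y + \<theta>) + unfold_pair w u (- y) * cos (\<omega> * - y + \<theta>) \<partial>ivl 0 1)"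
    by (rule integral_circ_fold(1)[OF i])
  also have "\<dots> = (\<integral>y. (2 * cos \<theta>) * (w y * cos (\<omega> * y)) + (2 * sin \<theta>) * (u y * sin (\<omega> * y)) \<partial>ivl 0 1)"
  proof (rule integral_cong_AE)
    show "AE y in ivl 0 1. unfold_pair w u y * cos (\<omega> * y + \<theta>) + unfold_pair w u (- y) * cos (\<omega> * - y + \<theta>) =
      (2 * cos \<theta>) * (w y * cos (\<omega> * y)) + (2 * sin \<theta>) * (u y * sin (\<omega> * y))"
      using AE_ivl01 by eventually_elim (simp add: unfold_pair_pos unfold_pair_neg cos_add cos_diff algebra_simps)
  qed measurable
  also have "\<dots> = 2 * cos \<theta> * (\<integral>x. w x * cos (\<omega> * x) \<partial>ivl 0 1) + 2 * sin \<theta> * (\<integral>x. u x * sin (\<omega> * x) \<partial>ivl 0 1)"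
    using wc us by simp
  finally show ?thesis .
qed

lemma unfold_odd_integrable:
  assumes g: "integrable (ivl 0 T \<Otimes>\<^sub>M ivl 0 1) g"
  shows "integrable (ivl 0 T \<Otimes>\<^sub>M circ) (unfold_odd g)"
proof -
  have gm: "g \<in> borel_measurable (borel \<Otimes>\<^sub>M borel)"
    using borel_measurable_integrable[OF g] by simp
  note [measurable] = gm
  have "(\<integral>\<^sup>+z. ennreal (norm (unfold_odd g z)) \<partial>(ivl 0 T \<Otimes>\<^sub>M circ)) =
     (\<integral>\<^sup>+s. (\<integral>\<^sup>+y. ennreal (norm (unfold_odd g (s, y))) \<partial>circ) \<partial>ivl 0 T)"
    by (rule ivl.nn_integral_fst[symmetric]) measurable
  also have "\<dots> \<le> (\<integral>\<^sup>+s. 2 * (\<integral>\<^sup>+y. ennreal (norm (g (s, y))) \<partial>ivl 0 1) \<partial>ivl 0 T)"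
  proof (rule nn_integral_mono)
    fix s
    have le: "(\<integral>\<^sup>+y. ennreal (norm (unfold_odd g (s, y))) \<partial>ivl 0 1) \<le> (\<integral>\<^sup>+y. ennreal (norm (g (s, y))) \<partial>ivl 0 1)"
    proof (rule nn_integral_mono_AE)
      show "AE y in ivl 0 1. ennreal (norm (unfold_odd g (s, y))) \<le> ennreal (norm (g (s, y)))"
        using AE_ivl01 by eventually_elim (simp add: unfold_odd_def sg_pos tri_id)
    qed
    have "(\<integral>\<^sup>+y. ennreal (norm (unfold_odd g (s, y))) \<partial>circ) =
      (\<integral>\<^sup>+y. ennreal (norm (unfold_odd g (s, y))) \<partial>ivl (- 1) (- 0)) + (\<integral>\<^sup>+y. ennreal (norm (unfold_odd g (s, y))) \<partial>ivl 0 1)"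
      using nn_integral_ivl_combine[of "\<lambda>y. ennreal (norm (unfold_odd g (s, y)))" "-1" 0 1] by simp
    also have "(\<integral>\<^sup>+y. ennreal (norm (unfold_odd g (s, y))) \<partial>ivl (- 1) (- 0)) = (\<integral>\<^sup>+y. ennreal (norm (unfold_odd g (s, - y))) \<partial>ivl 0 1)"
      by (rule nn_integral_ivl_uminus[symmetric]) measurable
    also have "\<dots> = (\<integral>\<^sup>+y. ennreal (norm (unfold_odd g (s, y))) \<partial>ivl 0 1)"
      by (simp add: unfold_odd_def)
    finally show "(\<integral>\<^sup>+y. ennreal (norm (unfold_odd g (s, y))) \<partial>circ) \<le> 2 * (\<integral>\<^sup>+y. ennreal (norm (g (s, y))) \<partial>ivl 0 1)"
      using add_mono[OF le le] by (simp add: mult_2)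
  qed
  also have "\<dots> = 2 * (\<integral>\<^sup>+s. (\<integral>\<^sup>+y. ennreal (norm (g (s, y))) \<partial>ivl 0 1) \<partial>ivl 0 T)"
    by (rule nn_integral_cmult) (rule ivl.borel_measurable_nn_integral, measurable)
  also have "(\<integral>\<^sup>+s. (\<integral>\<^sup>+y. ennreal (norm (g (s, y))) \<partial>ivl 0 1) \<partial>ivl 0 T) = (\<integral>\<^sup>+z. ennreal (norm (g z)) \<partial>(ivl 0 T \<Otimes>\<^sub>M ivl 0 1))"
    by (rule ivl.nn_integral_fst) measurable
  also have "2 * \<dots> < \<infinity>"
    using g by (auto simp: integrable_iff_bounded ennreal_mult_less_top)
  finally show ?thesis unfolding integrable_iff_bounded by simp
qed

lemma unfold_odd_fourier:
  fixes g :: "real \<times> real \<Rightarrow> real"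
  assumes g: "integrable (ivl 0 1) (\<lambda>x. g (s, x))"
  shows "(\<integral>y. unfold_odd g (s, y) * cos (\<omega> * y + \<theta>) \<partial>circ) = - 2 * sin \<theta> * (\<integral>x. g (s, x) * sin (\<omega> * x) \<partial>ivl 0 1)"
proof -
  have "unfold_odd g (s, y) = unfold_pair (\<lambda>_. 0) (\<lambda>x. - g (s, x)) y" for y
    by (simp add: unfold_odd_def unfold_pair_def)
  moreover have "integrable (ivl 0 1) (\<lambda>x. - g (s, x))" using g by simp
  ultimately show ?thesis
    using unfold_pair_fourier[of "\<lambda>_. 0" "\<lambda>x. - g (s, x)" \<omega> \<theta>] by simp
qed

section \<open>From weak to mild solutions\<close>

text \<open>Borel versions at each time: \<open>w\<close> of z_x, \<open>u\<close> of z_t,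
  \<open>\<zeta>\<close> of z; \<open>v\<close> is a jointly measurable version of z_t for integrals
  over time. In \<open>velocity\<close> the pairing of z at time s is expressed through
  \<open>v\<close>, which makes the integrand measurable in s. \<open>w_bound\<close> is what
  dominates the limits under the time integral.\<close>

locale reduced_solution =
  fixes w u \<zeta> :: "real \<Rightarrow> real \<Rightarrow> real" and v g :: "real \<times> real \<Rightarrow> real"
  assumes w_int: "0 \<le> t \<Longrightarrow> integrable (ivl 0 1) (w t)" and u_int: "0 \<le> t \<Longrightarrow> integrable (ivl 0 1) (u t)"
    and v_int: "integrable (ivl 0 T \<Otimes>\<^sub>M ivl 0 1) v" and g_int: "integrable (ivl 0 T \<Otimes>\<^sub>M ivl 0 1) g"
    and \<zeta>: "0 \<le> t \<Longrightarrow> 0 \<le> x \<Longrightarrow> x \<le> 1 \<Longrightarrow> \<zeta> t x = integral\<^sup>L (ivl 0 x) (w t)"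
    and \<zeta>_borel: "\<zeta> t \<in> borel_measurable borel"
    and \<zeta>1: "0 \<le> t \<Longrightarrow> integral\<^sup>L (ivl 0 1) (w t) = 0"
    and position: "\<phi> \<in> test_functions \<Longrightarrow> 0 \<le> t \<Longrightarrow>
      (\<integral>x. \<zeta> t x * \<phi> x \<partial>ivl 0 1) = (\<integral>x. \<zeta> 0 x * \<phi> x \<partial>ivl 0 1) + (\<integral>s. (\<integral>x. v (s, x) * \<phi> x \<partial>ivl 0 1) \<partial>ivl 0 t)"
    and velocity: "\<phi> \<in> test_functions \<Longrightarrow> 0 \<le> t \<Longrightarrow>
      (\<integral>x. u t x * \<phi> x \<partial>ivl 0 1) = (\<integral>x. u 0 x * \<phi> x \<partial>ivl 0 1) +
        (\<integral>s. ((\<integral>x. \<zeta> 0 x * deriv (deriv \<phi>) x \<partial>ivl 0 1) + (\<integral>r. (\<integral>x. v (r, x) * deriv (deriv \<phi>) x \<partial>ivl 0 1) \<partial>ivl 0 s))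
           - (\<integral>x. g (s, x) * \<phi> x \<partial>ivl 0 1) \<partial>ivl 0 t)"
    and v_eq_u: "AE s in ivl 0 T. AE x in ivl 0 1. v (s, x) = u s x"
    and w_bound: "\<exists>B. AE s in ivl 0 T. (\<integral>x. \<bar>w s x\<bar> \<partial>ivl 0 1) \<le> B"
begin

lemma v_borel [measurable]: "v \<in> borel_measurable (borel \<Otimes>\<^sub>M borel)"
  using borel_measurable_integrable[OF v_int[of 0]] by simp

lemma g_borel [measurable]: "g \<in> borel_measurable (borel \<Otimes>\<^sub>M borel)"
  using borel_measurable_integrable[OF g_int[of 0]] by simp

lemma \<zeta>_int: "0 \<le> t \<Longrightarrow> integrable (ivl 0 1) (\<zeta> t)"
proof -
  assume t: "0 \<le> t"
  have "continuous_on {0..1} (\<zeta> t)"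
    by (rule continuous_on_eq[OF continuous_on_integral_ivl[OF w_int[OF t]]]) (use \<zeta>[OF t] in auto)
  then have "compact (\<zeta> t ` {0..1})" by (intro compact_continuous_image) auto
  then obtain B where "\<And>x. 0 \<le> x \<Longrightarrow> x \<le> 1 \<Longrightarrow> \<bar>\<zeta> t x\<bar> \<le> B"
    using compact_imp_bounded bounded_iff by (metis (no_types, lifting) atLeastAtMost_iff imageI real_norm_def)
  then show ?thesis using \<zeta>_borel by (intro integrable_ivl_bounded) auto
qed

lemma pair_mult_bounded:
  fixes h :: "real \<times> real \<Rightarrow> real"
  assumes h: "integrable (ivl 0 T \<Otimes>\<^sub>M ivl 0 1) h" and [measurable]: "\<phi> \<in> borel_measurable borel"
    and B: "\<And>x. 0 \<le> x \<Longrightarrow> x \<le> 1 \<Longrightarrow> \<bar>\<phi> x\<bar> \<le> B"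
  shows "integrable (ivl 0 T \<Otimes>\<^sub>M ivl 0 1) (\<lambda>(s, x). h (s, x) * \<phi> x)"
proof -
  have ae: "AE z in ivl 0 T \<Otimes>\<^sub>M ivl 0 1. \<bar>\<phi> (snd z)\<bar> \<le> B"
  proof (rule ivl2.AE_pair_measure)
    show "{z \<in> space (ivl 0 T \<Otimes>\<^sub>M ivl 0 1). \<bar>\<phi> (snd z)\<bar> \<le> B} \<in> sets (ivl 0 T \<Otimes>\<^sub>M ivl 0 1)" by measurable
    show "AE s in ivl 0 T. AE x in ivl 0 1. \<bar>\<phi> (snd (s, x))\<bar> \<le> B"
      unfolding AE_ivl using B by auto
  qed
  have "integrable (ivl 0 T \<Otimes>\<^sub>M ivl 0 1) (\<lambda>z. \<phi> (snd z) * h z)"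
    by (rule integrable_mult_AE_bounded[OF h _ ae]) measurable
  then show ?thesis by (simp add: case_prod_unfold mult.commute)
qed

text \<open>Two dominated convergences: in space for almost every time, then in time.\<close>

lemma time_integral_tendsto:
  fixes h :: "real \<times> real \<Rightarrow> real" and \<phi> :: "nat \<Rightarrow> real \<Rightarrow> real"
  assumes h: "integrable (ivl 0 T \<Otimes>\<^sub>M ivl 0 1) h" and \<phi>[measurable]: "\<And>n. \<phi> n \<in> borel_measurable borel" "\<phi>0 \<in> borel_measurable borel"
    and B: "\<And>n x. \<bar>\<phi> n x\<bar> \<le> B" and lim: "\<And>x. 0 < x \<Longrightarrow> x < 1 \<Longrightarrow> (\<lambda>n. \<phi> n x) \<longlonglongrightarrow> \<phi>0 x"
  shows "(\<lambda>n. \<integral>s. (\<integral>x. h (s, x) * \<phi> n x \<partial>ivl 0 1) \<partial>ivl 0 T) \<longlonglongrightarrow> (\<integral>s. (\<integral>x. h (s, x) * \<phi>0 x \<partial>ivl 0 1) \<partial>ivl 0 T)"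
proof (rule integral_dominated_convergence[where w="\<lambda>s. B * (\<integral>x. \<bar>h (s, x)\<bar> \<partial>ivl 0 1)"])
  have [measurable]: "h \<in> borel_measurable (borel \<Otimes>\<^sub>M borel)"
    using borel_measurable_integrable[OF h] by simp
  show "(\<lambda>s. \<integral>x. h (s, x) * \<phi>0 x \<partial>ivl 0 1) \<in> borel_measurable (ivl 0 T)"
    by (rule ivl.borel_measurable_lebesgue_integral) measurable
  show "(\<lambda>s. \<integral>x. h (s, x) * \<phi> n x \<partial>ivl 0 1) \<in> borel_measurable (ivl 0 T)" for n
    by (rule ivl.borel_measurable_lebesgue_integral) measurable
  have "integrable (ivl 0 T \<Otimes>\<^sub>M ivl 0 1) (\<lambda>(s, x). \<bar>h (s, x)\<bar>)" using h by (simp add: case_prod_unfold)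
  from ivl2.integrable_fst[OF this]
  show "integrable (ivl 0 T) (\<lambda>s. B * (\<integral>x. \<bar>h (s, x)\<bar> \<partial>ivl 0 1))" by simp
  have "AE s in ivl 0 T. integrable (ivl 0 1) (\<lambda>x. h (s, x))" by (rule ivl2.AE_integrable_fst'[OF h])
  then show "AE s in ivl 0 T. (\<lambda>n. \<integral>x. h (s, x) * \<phi> n x \<partial>ivl 0 1) \<longlonglongrightarrow> (\<integral>x. h (s, x) * \<phi>0 x \<partial>ivl 0 1)"
    by eventually_elim (rule integral_ivl_mult_tendsto[OF _ \<phi>(1) \<phi>(2) B lim])
  show "AE s in ivl 0 T. norm (\<integral>x. h (s, x) * \<phi> n x \<partial>ivl 0 1) \<le> B * (\<integral>x. \<bar>h (s, x)\<bar> \<partial>ivl 0 1)" for n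
    using \<open>AE s in ivl 0 T. integrable (ivl 0 1) (\<lambda>x. h (s, x))\<close>
  proof eventually_elim
    case (elim s)
    have "norm (\<integral>x. h (s, x) * \<phi> n x \<partial>ivl 0 1) \<le> (\<integral>x. \<bar>h (s, x) * \<phi> n x\<bar> \<partial>ivl 0 1)"
      by (simp add: integral_abs_bound)
    also have "\<dots> \<le> (\<integral>x. B * \<bar>h (s, x)\<bar> \<partial>ivl 0 1)"
    proof (rule integral_mono)
      show "integrable (ivl 0 1) (\<lambda>x. \<bar>h (s, x) * \<phi> n x\<bar>)"
        using integrable_ivl_mult_bounded[OF elim \<phi>(1), of n B] B by auto
      show "integrable (ivl 0 1) (\<lambda>x. B * \<bar>h (s, x)\<bar>)" using elim by simp
      fix x show "\<bar>h (s, x) * \<phi> n x\<bar> \<le> B * \<bar>h (s, x)\<bar>"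
        using mult_left_mono[OF B[of n x], of "\<bar>h (s, x)\<bar>"] by (simp add: abs_mult mult.commute)
    qed
    finally show ?case by simp
  qed
qed

text \<open>The sine coefficient of z, defined by its time integral and hence measurable on the
  whole line.\<close>

definition Zc :: "nat \<Rightarrow> real \<Rightarrow> real" where
  "Zc k t = (\<integral>x. \<zeta> 0 x * sin (real k * pi * x) \<partial>ivl 0 1) + (\<integral>s. (\<integral>x. v (s, x) * sin (real k * pi * x) \<partial>ivl 0 1) \<partial>ivl 0 t)"

lemma inner_borel [measurable]:
  fixes h :: "real \<times> real \<Rightarrow> real" and \<phi> :: "real \<Rightarrow> real"
  assumes [measurable]: "h \<in> borel_measurable (borel \<Otimes>\<^sub>M borel)" "\<phi> \<in> borel_measurable borel"
  shows "(\<lambda>s. \<integral>x. h (s, x) * \<phi> x \<partial>ivl 0 1) \<in> borel_measurable borel"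
  by (rule ivl.borel_measurable_lebesgue_integral) measurable

lemma Zc_borel [measurable]: "Zc k \<in> borel_measurable borel"
proof -
  have [measurable]: "(\<lambda>t. \<integral>s. (\<integral>x. v (s, x) * sin (real k * pi * x) \<partial>ivl 0 1) \<partial>ivl 0 t) \<in> borel_measurable borel"
    by (rule borel_measurable_integral_ivl) measurable
  show ?thesis unfolding Zc_def[abs_def] by measurable
qed

lemma position_sin:
  assumes "0 \<le> t" shows "(\<integral>x. \<zeta> t x * sin (real k * pi * x) \<partial>ivl 0 1) = Zc k t"
proof -
  obtain \<phi> C where \<phi>: "\<And>n::nat. \<phi> n \<in> test_functions" "\<And>n x. \<bar>\<phi> n x\<bar> \<le> 1"
    "\<And>n x. 0 \<le> x \<Longrightarrow> x \<le> 1 \<Longrightarrow> \<bar>deriv (\<phi> n) x\<bar> \<le> C"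
    "\<And>x. 0 < x \<Longrightarrow> x < 1 \<Longrightarrow> (\<lambda>n. \<phi> n x) \<longlonglongrightarrow> sin (real k * pi * x)"
    "\<And>x. 0 < x \<Longrightarrow> x < 1 \<Longrightarrow> (\<lambda>n. deriv (\<phi> n) x) \<longlonglongrightarrow> real k * pi * cos (real k * pi * x)"
    using approx_sin_test by blast
  note [measurable] = test_function_borel[OF \<phi>(1)]
  have l: "(\<lambda>n. \<integral>x. \<zeta> s x * \<phi> n x \<partial>ivl 0 1) \<longlonglongrightarrow> (\<integral>x. \<zeta> s x * sin (real k * pi * x) \<partial>ivl 0 1)" if "0 \<le> s" for s
    by (rule integral_ivl_mult_tendsto[OF \<zeta>_int[OF that], where B=1]) (use \<phi> in auto)
  have r: "(\<lambda>n. \<integral>s. (\<integral>x. v (s, x) * \<phi> n x \<partial>ivl 0 1) \<partial>ivl 0 t) \<longlonglongrightarrow> (\<integral>s. (\<integral>x. v (s, x) * sin (real k * pi * x) \<partial>ivl 0 1) \<partial>ivl 0 t)"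
    by (rule time_integral_tendsto[OF v_int, where B=1]) (use \<phi> in auto)
  have "(\<lambda>n. \<integral>x. \<zeta> t x * \<phi> n x \<partial>ivl 0 1) \<longlonglongrightarrow> Zc k t"
    unfolding Zc_def position[OF \<phi>(1) assms] by (intro tendsto_add l r) simp
  with l[OF assms] show ?thesis by (rule LIMSEQ_unique)
qed

text \<open>Integration by parts against the cosine. The boundary term at 1, where the cosine does
  not vanish, disappears with the mean of \<open>w\<close>.\<close>

lemma w_cos:
  assumes "0 \<le> t" shows "(\<integral>x. w t x * cos (real k * pi * x) \<partial>ivl 0 1) = real k * pi * Zc k t"
proof -
  let ?\<omega> = "real k * pi"
  have [measurable]: "w t \<in> borel_measurable borel" using borel_measurable_integrable_ivl[OF w_int[OF assms]] .
  have [measurable]: "(\<lambda>x. integral\<^sup>L (ivl 0 x) (w t)) \<in> borel_measurable borel" by (rule borel_measurable_integral_ivl) simp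
  have k: "integrable (ivl 0 1) (\<lambda>x. - ?\<omega> * sin (?\<omega> * x))"
    by (intro integrable_ivl_bounded[where B="?\<omega>"]) (auto simp: abs_mult mult_left_le)
  have c: "cos (?\<omega> * s) = 1 + (\<integral>x. - ?\<omega> * sin (?\<omega> * x) \<partial>ivl 0 s)" if "0 \<le> s" for s
  proof -
    have "(\<integral>x. - ?\<omega> * sin (?\<omega> * x) \<partial>ivl 0 s) = cos (?\<omega> * s) - cos (?\<omega> * 0)"
      by (rule integral_ivl_FTC[OF that]) (auto intro!: derivative_eq_intros continuous_intros)
    then show ?thesis by simp
  qed
  have "integral\<^sup>L (ivl 0 1) (w t) * cos (?\<omega> * 1) - 0 * 1 =
     (\<integral>x. integral\<^sup>L (ivl 0 x) (w t) * (- ?\<omega> * sin (?\<omega> * x)) \<partial>ivl 0 1) + (\<integral>x. cos (?\<omega> * x) * w t x \<partial>ivl 0 1)"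
    by (rule product_rule_primitive[OF w_int[OF assms] k]) (use c in auto)
  moreover have "(\<integral>x. integral\<^sup>L (ivl 0 x) (w t) * (- ?\<omega> * sin (?\<omega> * x)) \<partial>ivl 0 1) = (\<integral>x. - ?\<omega> * (\<zeta> t x * sin (?\<omega> * x)) \<partial>ivl 0 1)"
    using \<zeta>[OF assms] \<zeta>_borel[of t] by (intro integral_ivl_cong) auto
  ultimately show ?thesis using \<zeta>1[OF assms] position_sin[OF assms, of k] by (simp add: mult.commute)
qed

text \<open>The truncated sines have bounded first derivatives, but their second derivatives grow
  with the cutoff. One derivative is therefore moved onto z before the limit is taken.\<close>

lemma position_dderiv:
  assumes "0 \<le> s" and \<phi>: "\<phi> \<in> test_functions"
  shows "(\<integral>x. \<zeta> 0 x * deriv (deriv \<phi>) x \<partial>ivl 0 1) + (\<integral>r. (\<integral>x. v (r, x) * deriv (deriv \<phi>) x \<partial>ivl 0 1) \<partial>ivl 0 s)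
    = - (\<integral>x. w s x * deriv \<phi> x \<partial>ivl 0 1)"
proof -
  have t: "deriv \<phi> \<in> test_functions" "deriv (deriv \<phi>) \<in> test_functions" by (intro deriv_test_function \<phi>)+
  note [measurable] = test_function_borel[OF t(2)] \<zeta>_borel
  have [measurable]: "w s \<in> borel_measurable borel" using borel_measurable_integrable_ivl[OF w_int[OF assms(1)]] .
  have [measurable]: "(\<lambda>x. integral\<^sup>L (ivl 0 x) (w s)) \<in> borel_measurable borel" by (rule borel_measurable_integral_ivl) simp
  have "(\<integral>x. \<zeta> s x * deriv (deriv \<phi>) x \<partial>ivl 0 1) = (\<integral>x. integral\<^sup>L (ivl 0 x) (w s) * deriv (deriv \<phi>) x \<partial>ivl 0 1)"
    using \<zeta>[OF assms(1)] by (intro integral_ivl_cong) auto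
  then show ?thesis using position[OF t(2) assms(1)] test_function_parts[OF w_int[OF assms(1)] t(1)] by simp
qed

lemma velocity_sin:
  assumes "0 \<le> t"
  shows "(\<integral>x. u t x * sin (real k * pi * x) \<partial>ivl 0 1) = (\<integral>x. u 0 x * sin (real k * pi * x) \<partial>ivl 0 1) +
    (\<integral>s. - (real k * pi) * (real k * pi * Zc k s) - (\<integral>x. g (s, x) * sin (real k * pi * x) \<partial>ivl 0 1) \<partial>ivl 0 t)"
proof -
  let ?\<omega> = "real k * pi"
  obtain \<phi> C where \<phi>: "\<And>n::nat. \<phi> n \<in> test_functions" "\<And>n x. \<bar>\<phi> n x\<bar> \<le> 1"
    "\<And>n x. 0 \<le> x \<Longrightarrow> x \<le> 1 \<Longrightarrow> \<bar>deriv (\<phi> n) x\<bar> \<le> C"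
    "\<And>x. 0 < x \<Longrightarrow> x < 1 \<Longrightarrow> (\<lambda>n. \<phi> n x) \<longlonglongrightarrow> sin (real k * pi * x)"
    "\<And>x. 0 < x \<Longrightarrow> x < 1 \<Longrightarrow> (\<lambda>n. deriv (\<phi> n) x) \<longlonglongrightarrow> real k * pi * cos (real k * pi * x)"
    using approx_sin_test by blast
  note [measurable] = test_function_borel[OF \<phi>(1)] test_function_borel[OF deriv_test_function[OF \<phi>(1)]]
     test_function_borel[OF deriv_test_function[OF deriv_test_function[OF \<phi>(1)]]]
  have l: "(\<lambda>n. \<integral>x. u s x * \<phi> n x \<partial>ivl 0 1) \<longlonglongrightarrow> (\<integral>x. u s x * sin (?\<omega> * x) \<partial>ivl 0 1)" if "0 \<le> s" for s
    by (rule integral_ivl_mult_tendsto[OF u_int[OF that], where B=1]) (use \<phi> in auto)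
  \<comment> \<open>Written through \<open>v\<close> for measurability; for s \<ge> 0 it is a
    pairing with \<open>w\<close>, which yields both the bound \<open>C * B\<close> and the
    limit.\<close>
  define A where "A n s = (\<integral>x. \<zeta> 0 x * deriv (deriv (\<phi> n)) x \<partial>ivl 0 1) + (\<integral>r. (\<integral>x. v (r, x) * deriv (deriv (\<phi> n)) x \<partial>ivl 0 1) \<partial>ivl 0 s)" for n s
  have [measurable]: "A n \<in> borel_measurable borel" for n
  proof -
    have [measurable]: "(\<lambda>s. \<integral>r. (\<integral>x. v (r, x) * deriv (deriv (\<phi> n)) x \<partial>ivl 0 1) \<partial>ivl 0 s) \<in> borel_measurable borel"
      by (rule borel_measurable_integral_ivl) measurable
    show ?thesis unfolding A_def[abs_def] by measurable
  qed
  have A: "A n s = - (\<integral>x. w s x * deriv (\<phi> n) x \<partial>ivl 0 1)" if "0 \<le> s" for n s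
    unfolding A_def by (rule position_dderiv[OF that \<phi>(1)])
  obtain B where B: "AE s in ivl 0 t. (\<integral>x. \<bar>w s x\<bar> \<partial>ivl 0 1) \<le> B" using w_bound by blast
  have s0: "AE s in ivl 0 t. 0 \<le> s" by (auto simp: AE_ivl)
  have C0: "0 \<le> C" using \<phi>(3)[of 0 0] by linarith
  have Abound: "AE s in ivl 0 t. norm (A n s) \<le> C * B" for n
    using B s0
  proof eventually_elim
    case (elim s)
    have "norm (A n s) \<le> (\<integral>x. \<bar>w s x * deriv (\<phi> n) x\<bar> \<partial>ivl 0 1)"
      unfolding A[OF elim(2)] by (simp add: integral_abs_bound)
    also have "\<dots> \<le> (\<integral>x. C * \<bar>w s x\<bar> \<partial>ivl 0 1)"
    proof (rule integral_mono_AE)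
      show "integrable (ivl 0 1) (\<lambda>x. \<bar>w s x * deriv (\<phi> n) x\<bar>)"
        using integrable_mult_test[OF w_int[OF elim(2)] deriv_test_function[OF \<phi>(1)[of n]]] by simp
      show "integrable (ivl 0 1) (\<lambda>x. C * \<bar>w s x\<bar>)" using w_int[OF elim(2)] by simp
      show "AE x in ivl 0 1. \<bar>w s x * deriv (\<phi> n) x\<bar> \<le> C * \<bar>w s x\<bar>"
        unfolding AE_ivl
      proof (intro AE_I2 impI)
        fix x :: real assume "0 \<le> x \<and> x \<le> 1"
        then show "\<bar>w s x * deriv (\<phi> n) x\<bar> \<le> C * \<bar>w s x\<bar>"
          using mult_left_mono[OF \<phi>(3)[of x n], of "\<bar>w s x\<bar>"] by (simp add: abs_mult mult.commute)
      qed
    qed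
    also have "\<dots> \<le> C * B" using elim(1) C0 by (simp add: mult_left_mono)
    finally show ?case .
  qed
  have Alim: "AE s in ivl 0 t. (\<lambda>n. A n s) \<longlonglongrightarrow> - ?\<omega> * (?\<omega> * Zc k s)"
    using s0
  proof eventually_elim
    case (elim s)
    have "(\<lambda>n. \<integral>x. w s x * deriv (\<phi> n) x \<partial>ivl 0 1) \<longlonglongrightarrow> (\<integral>x. w s x * (?\<omega> * cos (?\<omega> * x)) \<partial>ivl 0 1)"
      by (rule integral_ivl_mult_tendsto[OF w_int[OF elim], where B=C]) (use \<phi> in auto)
    also have "(\<integral>x. w s x * (?\<omega> * cos (?\<omega> * x)) \<partial>ivl 0 1) = (\<integral>x. ?\<omega> * (w s x * cos (?\<omega> * x)) \<partial>ivl 0 1)"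
      by (intro Bochner_Integration.integral_cong) auto
    also have "\<dots> = ?\<omega> * (?\<omega> * Zc k s)" using w_cos[OF elim, of k] by simp
    finally have "(\<lambda>n. - (\<integral>x. w s x * deriv (\<phi> n) x \<partial>ivl 0 1)) \<longlonglongrightarrow> - (?\<omega> * (?\<omega> * Zc k s))" by (rule tendsto_minus)
    then show ?case unfolding A[OF elim] by simp
  qed
  have Aint: "integrable (ivl 0 t) (A n)" for n
    using Abound by (intro ivl.integrable_const_bound) auto
  have I1: "(\<lambda>n. integral\<^sup>L (ivl 0 t) (A n)) \<longlonglongrightarrow> (\<integral>s. - ?\<omega> * (?\<omega> * Zc k s) \<partial>ivl 0 t)"
    by (rule integral_dominated_convergence[where w="\<lambda>_. C * B", OF _ _ _ Alim Abound]) auto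
  have Zint: "integrable (ivl 0 t) (\<lambda>s. - ?\<omega> * (?\<omega> * Zc k s))"
    by (rule integrable_dominated_convergence[where w="\<lambda>_. C * B", OF _ _ _ Alim Abound]) auto
  have I2: "(\<lambda>n. \<integral>s. (\<integral>x. g (s, x) * \<phi> n x \<partial>ivl 0 1) \<partial>ivl 0 t) \<longlonglongrightarrow> (\<integral>s. (\<integral>x. g (s, x) * sin (?\<omega> * x) \<partial>ivl 0 1) \<partial>ivl 0 t)"
    by (rule time_integral_tendsto[OF g_int, where B=1]) (use \<phi> in auto)
  have gint: "integrable (ivl 0 t) (\<lambda>s. \<integral>x. g (s, x) * \<phi> n x \<partial>ivl 0 1)" for n
    using ivl2.integrable_fst[OF pair_mult_bounded[OF g_int, of "\<phi> n" 1]] \<phi>(2) by simp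
  have gsin: "integrable (ivl 0 t) (\<lambda>s. \<integral>x. g (s, x) * sin (?\<omega> * x) \<partial>ivl 0 1)"
    using ivl2.integrable_fst[OF pair_mult_bounded[OF g_int, of "\<lambda>x. sin (?\<omega> * x)" 1]] by simp
  have "(\<integral>x. u t x * \<phi> n x \<partial>ivl 0 1) = (\<integral>x. u 0 x * \<phi> n x \<partial>ivl 0 1) +
     (integral\<^sup>L (ivl 0 t) (A n) - (\<integral>s. (\<integral>x. g (s, x) * \<phi> n x \<partial>ivl 0 1) \<partial>ivl 0 t))" for n
    unfolding velocity[OF \<phi>(1) assms] A_def[symmetric] using Aint[of n] gint[of n] by simp
  moreover have "(\<lambda>n. (\<integral>x. u 0 x * \<phi> n x \<partial>ivl 0 1) +
     (integral\<^sup>L (ivl 0 t) (A n) - (\<integral>s. (\<integral>x. g (s, x) * \<phi> n x \<partial>ivl 0 1) \<partial>ivl 0 t))) \<longlonglongrightarrow>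
     (\<integral>x. u 0 x * sin (?\<omega> * x) \<partial>ivl 0 1) + ((\<integral>s. - ?\<omega> * (?\<omega> * Zc k s) \<partial>ivl 0 t) - (\<integral>s. (\<integral>x. g (s, x) * sin (?\<omega> * x) \<partial>ivl 0 1) \<partial>ivl 0 t))"
    by (intro tendsto_add tendsto_diff l I1 I2) simp
  ultimately have "(\<lambda>n. \<integral>x. u t x * \<phi> n x \<partial>ivl 0 1) \<longlonglongrightarrow>
     (\<integral>x. u 0 x * sin (?\<omega> * x) \<partial>ivl 0 1) + ((\<integral>s. - ?\<omega> * (?\<omega> * Zc k s) \<partial>ivl 0 t) - (\<integral>s. (\<integral>x. g (s, x) * sin (?\<omega> * x) \<partial>ivl 0 1) \<partial>ivl 0 t))"
    by simp
  with l[OF assms] have "(\<integral>x. u t x * sin (?\<omega> * x) \<partial>ivl 0 1) =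
     (\<integral>x. u 0 x * sin (?\<omega> * x) \<partial>ivl 0 1) + ((\<integral>s. - ?\<omega> * (?\<omega> * Zc k s) \<partial>ivl 0 t) - (\<integral>s. (\<integral>x. g (s, x) * sin (?\<omega> * x) \<partial>ivl 0 1) \<partial>ivl 0 t))"
    by (rule LIMSEQ_unique)
  then show ?thesis using Zint gsin by simp
qed

sublocale transport "unfold_pair (w 0) (u 0)" "unfold_odd g"
proof
  have [measurable]: "w 0 \<in> borel_measurable borel" "u 0 \<in> borel_measurable borel"
    using w_int[of 0] u_int[of 0] by (auto dest: borel_measurable_integrable_ivl)
  show "unfold_pair (w 0) (u 0) \<in> borel_measurable borel" "unfold_odd g \<in> borel_measurable (borel \<Otimes>\<^sub>M borel)" by measurable
  show "integrable circ (unfold_pair (w 0) (u 0))" by (intro unfold_pair_integrable w_int u_int) auto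
  show "integrable (ivl 0 T \<Otimes>\<^sub>M circ) (unfold_odd g)" for T by (rule unfold_odd_integrable[OF g_int])
  show "periodic2 (unfold_pair (w 0) (u 0))" "periodic2 (\<lambda>y. unfold_odd g (r, y))" for r
    using tri_periodic sg_periodic by (auto simp: periodic2_def unfold_pair_def unfold_odd_def)
qed (simp add: unfold_odd_def)

text \<open>Both sides have the same Fourier coefficients for all k and \<theta>: the coefficients
  of the weak solution obey \<open>oscillator\<close>, whose solution formula coincides with
  \<open>fourier_mild\<close>.\<close>

theorem mild_representation:
  assumes t: "0 \<le> t"
  shows "AE y in circ. U t y = unfold_pair (w t) (u t) y"
proof -
  have [measurable]: "w t \<in> borel_measurable borel" "u t \<in> borel_measurable borel"
    using w_int[OF t] u_int[OF t] by (auto dest: borel_measurable_integrable_ivl)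
  have i1: "integrable circ (U t)" by (rule integral_U(1)[OF t])
  have i2: "integrable circ (unfold_pair (w t) (u t))" by (intro unfold_pair_integrable w_int u_int t)
  have "AE y in circ. U t y - unfold_pair (w t) (u t) y = 0"
  proof (rule trig_complete)
    show "integrable circ (\<lambda>y. U t y - unfold_pair (w t) (u t) y)" using i1 i2 by simp
    fix k :: nat and \<theta> :: real
    let ?\<omega> = "real k * pi"
    have m1: "integrable circ (\<lambda>y. U t y * cos (?\<omega> * y + \<theta>))" by (rule integrable_ivl_mult_bounded[OF i1, where B=1]) auto
    have m2: "integrable circ (\<lambda>y. unfold_pair (w t) (u t) y * cos (?\<omega> * y + \<theta>))" by (rule integrable_ivl_mult_bounded[OF i2, where B=1]) auto
    define s where "s r = (\<integral>x. v (r, x) * sin (?\<omega> * x) \<partial>ivl 0 1)" for r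
    define f where "f r = (\<integral>x. g (r, x) * sin (?\<omega> * x) \<partial>ivl 0 1)" for r
    have si: "integrable (ivl 0 T) s" for T unfolding s_def
      using ivl2.integrable_fst[OF pair_mult_bounded[OF v_int, of "\<lambda>x. sin (?\<omega> * x)" 1]] by simp
    have fi: "integrable (ivl 0 T) f" for T unfolding f_def
      using ivl2.integrable_fst[OF pair_mult_bounded[OF g_int, of "\<lambda>x. sin (?\<omega> * x)" 1]] by simp
    \<comment> \<open>Equal to the sine coefficient of \<open>u r\<close> for r \<ge> 0 by
      \<open>velocity_sin\<close>, but measurable on the whole line.\<close>
    define S where "S r = (\<integral>x. u 0 x * sin (?\<omega> * x) \<partial>ivl 0 1) + (\<integral>x. - ?\<omega> * (?\<omega> * Zc k x) - f x \<partial>ivl 0 r)" for r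
    have fm: "f \<in> borel_measurable borel" using borel_measurable_integrable_ivl[OF fi] .
    note [measurable] = fm
    have Sm: "S \<in> borel_measurable borel"
    proof -
      have [measurable]: "(\<lambda>r. \<integral>x. - ?\<omega> * (?\<omega> * Zc k x) - f x \<partial>ivl 0 r) \<in> borel_measurable borel"
        by (rule borel_measurable_integral_ivl) measurable
      show ?thesis unfolding S_def[abs_def] by measurable
    qed
    have Su: "S r = (\<integral>x. u r x * sin (?\<omega> * x) \<partial>ivl 0 1)" if "0 \<le> r" for r
      unfolding S_def f_def using velocity_sin[OF that, of k] by simp
    have osc: "cos \<theta> * (?\<omega> * Zc k t) + sin \<theta> * S t = cos (\<theta> + ?\<omega> * t) * (?\<omega> * Zc k 0) + sin (\<theta> + ?\<omega> * t) * S 0 -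
       (\<integral>r. sin (\<theta> + ?\<omega> * (t - r)) * f r \<partial>ivl 0 t)"
    proof (rule oscillator[OF t si fi, where C="\<lambda>r. ?\<omega> * Zc k r"])
      show "(\<lambda>r. ?\<omega> * Zc k r) \<in> borel_measurable borel" by measurable
      have [measurable]: "s \<in> borel_measurable borel" using borel_measurable_integrable_ivl[OF si] .
      show "?\<omega> * Zc k r = ?\<omega> * Zc k 0 + (\<integral>x. ?\<omega> * s x \<partial>ivl 0 r)" for r
        unfolding Zc_def s_def[symmetric] by (simp add: integral_ivl_eq_0 distrib_left)
      show "S r = S 0 + (\<integral>x. - ?\<omega> * (?\<omega> * Zc k x) - f x \<partial>ivl 0 r)" for r
        unfolding S_def by (simp add: integral_ivl_eq_0)
      have "AE r in ivl 0 t. 0 \<le> r" by (auto simp: AE_ivl)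
      with v_eq_u[of t] show "AE r in ivl 0 t. s r = S r"
      proof eventually_elim
        case (elim r)
        have [measurable]: "u r \<in> borel_measurable borel" using borel_measurable_integrable_ivl[OF u_int[OF elim(2)]] .
        show ?case unfolding s_def Su[OF elim(2)]
          by (intro integral_cong_AE) (use elim(1) in \<open>auto elim!: AE_mp\<close>)
      qed
    qed (rule Sm)
    have C0: "(\<integral>x. w r x * cos (?\<omega> * x) \<partial>ivl 0 1) = ?\<omega> * Zc k r" if "0 \<le> r" for r by (rule w_cos[OF that])
    have "(\<integral>y. U t y * cos (?\<omega> * y + \<theta>) \<partial>circ) =
      (2 * cos (\<theta> + ?\<omega> * t) * (?\<omega> * Zc k 0) + 2 * sin (\<theta> + ?\<omega> * t) * S 0) + (\<integral>r. - 2 * (sin (\<theta> + ?\<omega> * (t - r)) * f r) \<partial>ivl 0 t)"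
    proof -
      have "(\<integral>r. (\<integral>y. unfold_odd g (r, y) * cos (?\<omega> * y + (\<theta> + ?\<omega> * (t - r))) \<partial>circ) \<partial>ivl 0 t) = (\<integral>r. - 2 * (sin (\<theta> + ?\<omega> * (t - r)) * f r) \<partial>ivl 0 t)"
      proof (rule integral_cong_AE)
        have "AE r in ivl 0 t. integrable (ivl 0 1) (\<lambda>x. g (r, x))" by (rule ivl2.AE_integrable_fst'[OF g_int])
        then show "AE r in ivl 0 t. (\<integral>y. unfold_odd g (r, y) * cos (?\<omega> * y + (\<theta> + ?\<omega> * (t - r))) \<partial>circ) = - 2 * (sin (\<theta> + ?\<omega> * (t - r)) * f r)"
          by eventually_elim (simp add: unfold_odd_fourier f_def)
        show "(\<lambda>r. \<integral>y. unfold_odd g (r, y) * cos (?\<omega> * y + (\<theta> + ?\<omega> * (t - r))) \<partial>circ) \<in> borel_measurable (ivl 0 t)"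
          by (rule ivl.borel_measurable_lebesgue_integral) measurable
      qed measurable
      then show ?thesis
        unfolding fourier_mild[OF t] using unfold_pair_fourier[OF w_int u_int, of 0 0 ?\<omega>] C0[of 0] Su[of 0] by simp
    qed
    also have "\<dots> = 2 * cos \<theta> * (?\<omega> * Zc k t) + 2 * sin \<theta> * S t"
    proof -
      define J where "J = (\<integral>r. sin (\<theta> + ?\<omega> * (t - r)) * f r \<partial>ivl 0 t)"
      have "(\<integral>r. - 2 * (sin (\<theta> + ?\<omega> * (t - r)) * f r) \<partial>ivl 0 t) = - 2 * J"
        unfolding J_def by (rule integral_mult_right_zero)
      moreover have "2 * (cos \<theta> * (?\<omega> * Zc k t) + sin \<theta> * S t) = 2 * (cos (\<theta> + ?\<omega> * t) * (?\<omega> * Zc k 0) + sin (\<theta> + ?\<omega> * t) * S 0 - J)"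
        using osc unfolding J_def by (simp only:)
      ultimately show ?thesis by (simp add: algebra_simps)
    qed
    also have "\<dots> = (\<integral>y. unfold_pair (w t) (u t) y * cos (?\<omega> * y + \<theta>) \<partial>circ)"
      using unfold_pair_fourier[OF w_int[OF t] u_int[OF t], of ?\<omega> \<theta>] C0[OF t] Su[OF t] by simp
    finally show "(\<integral>y. (U t y - unfold_pair (w t) (u t) y) * cos (?\<omega> * y + \<theta>) \<partial>circ) = 0"
      using m1 m2 by (simp add: left_diff_distrib)
  qed
  then show ?thesis by eventually_elim simp
qed

end

section \<open>Damping inequalities and L^p decay for reduced solutions\<close>

lemma AE_tri_sg: "AE y in circ. 0 < tri y \<and> tri y < 1 \<and> sg y * sg y = 1"
  by (rule AE_circ_fold) (use AE_ivl01 in \<open>auto simp: tri_id sg_pos elim!: AE_mp\<close>)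

lemma AE_circ_tri: "AE x in ivl 0 1. P x \<Longrightarrow> AE y in circ. P (tri y)"
proof (rule AE_circ_fold)
  assume P: "AE x in ivl 0 1. P x"
  then show "AE y in ivl 0 1. P (tri y)" "AE y in ivl 0 1. P (tri (- y))"
    using AE_ivl01 by (eventually_elim, simp add: tri_id)+
qed

text \<open>The order matters. The sign of \<sigma> alone gives F V \<ge> 0 and thus the maximum
  principle; only then is the velocity known to stay in [-R,R], where the linear bounds on \<sigma>
  are available.\<close>

lemma (in reduced_solution) damped:
  fixes a \<sigma> :: "real \<Rightarrow> real"
  assumes [measurable]: "a \<in> borel_measurable borel" and a: "\<And>x. 0 \<le> a x" "\<And>x. a x \<le> A"
    and a0: "\<And>x. c \<le> x \<Longrightarrow> x \<le> d \<Longrightarrow> a0 \<le> a x" "0 < a0" and cd: "0 \<le> c" "c < d" "d \<le> 1"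
    and g: "\<And>s x. 0 < x \<Longrightarrow> x < 1 \<Longrightarrow> g (s, x) = a x * \<sigma> (v (s, x))"
    and \<sigma>: "\<And>r. 0 \<le> \<sigma> r * r" "\<And>r. \<bar>r\<bar> \<le> R \<Longrightarrow> c0 * r^2 \<le> \<sigma> r * r" "\<And>r. \<bar>r\<bar> \<le> R \<Longrightarrow> \<bar>\<sigma> r\<bar> \<le> C0 * \<bar>r\<bar>"
    and init: "AE x in ivl 0 1. \<bar>w 0 x\<bar> + \<bar>u 0 x\<bar> \<le> R"
    and const: "0 < c0" "0 \<le> C0" "2 \<le> p"
  shows "damped_transport (unfold_pair (w 0) (u 0)) (unfold_odd g) (\<lambda>y. a (tri y)) a0 A c d c0 C0 R p"
proof -
  have V: "AE y in circ. V s y = sg y * u s (tri y)" if s: "0 \<le> s" for s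
  proof -
    have "AE y in circ. U s y = unfold_pair (w s) (u s) y" by (rule mild_representation[OF s])
    moreover from this have "AE y in circ. U s (- y) = unfold_pair (w s) (u s) (- y)"
      by (subst AE_circ_uminus[where P="\<lambda>y. U s y = unfold_pair (w s) (u s) y"])
    ultimately show ?thesis
      by eventually_elim (simp add: V_def unfold_pair_def)
  qed
  have F: "AE s in ivl 0 T. AE y in circ. 0 \<le> s \<and> V s y = sg y * v (s, tri y) \<and> sg y * sg y = 1 \<and>
      unfold_odd g (s, y) = sg y * (a (tri y) * \<sigma> (v (s, tri y)))" for T
  proof -
    have "AE s in ivl 0 T. 0 \<le> s" by (auto simp: AE_ivl)
    with v_eq_u[of T] show ?thesis
    proof eventually_elim
      case (elim s)
      from AE_circ_tri[OF elim(1)] V[OF elim(2)] AE_tri_sg show ?case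
        by eventually_elim (use elim(2) g in \<open>auto simp: unfold_odd_def\<close>)
    qed
  qed
  have FV: "unfold_odd g (s, y) * V s y = a (tri y) * (\<sigma> (v (s, tri y)) * v (s, tri y))"
    if "V s y = sg y * v (s, tri y)" "sg y * sg y = 1" "unfold_odd g (s, y) = sg y * (a (tri y) * \<sigma> (v (s, tri y)))" for s y
  proof -
    have "unfold_odd g (s, y) * V s y = (sg y * sg y) * (a (tri y) * (\<sigma> (v (s, tri y)) * v (s, tri y)))"
      unfolding that(1,3) by (simp only: mult_ac)
    then show ?thesis using that(2) by simp
  qed
  have pos: "AE s in ivl 0 T. AE y in circ. 0 \<le> unfold_odd g (s, y) * V s y" for T
    using F[of T]
  proof eventually_elim
    case (elim s)
    then show ?case
    proof eventually_elim
      case (elim y)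
      have "unfold_odd g (s, y) * V s y = a (tri y) * (\<sigma> (v (s, tri y)) * v (s, tri y))"
        by (rule FV) (use elim in auto)
      then show ?case using mult_nonneg_nonneg[OF a(1) \<sigma>(1)] by (simp only:)
    qed
  qed
  have "AE y in circ. \<bar>unfold_pair (w 0) (u 0) y\<bar> \<le> R"
    using AE_circ_tri[OF init] 
  proof eventually_elim
    case (elim y)
    have "\<bar>sg y * u 0 (tri y)\<bar> \<le> \<bar>u 0 (tri y)\<bar>" using sg_abs_le[of y] by (simp add: abs_mult mult_left_le_one_le)
    then show ?case using elim unfolding unfold_pair_def by linarith
  qed
  then have bounded: "AE y in circ. \<bar>U t y\<bar> \<le> R" if "0 \<le> t" for t
    by (rule max_principle[OF that _ pos])
  show ?thesis
  proof
    show "(\<lambda>y. a (tri y)) \<in> borel_measurable borel" by measurable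
    show "0 \<le> a (tri y)" "a (tri y) \<le> A" for y by (rule a)+
    show "a0 \<le> a (tri y)" if "c \<le> y" "y \<le> d" for y using a0(1)[OF that] that cd by (simp add: tri_id)
    show "AE y in circ. \<bar>U t y\<bar> \<le> R" if "0 \<le> t" for t by (rule bounded[OF that])
    show "integral\<^sup>L circ (unfold_pair (w 0) (u 0)) = 0"
      using unfold_pair_fourier[OF w_int u_int, of 0 0 0 0] \<zeta>1[of 0] by simp
    show "AE s in ivl 0 T. AE y in circ. c0 * a (tri y) * (V s y)\<^sup>2 \<le> unfold_odd g (s, y) * V s y \<and>
       \<bar>unfold_odd g (s, y)\<bar> \<le> C0 * a (tri y) * \<bar>V s y\<bar>" for T
    proof -
      have s0: "AE s in ivl 0 T. 0 \<le> s" by (auto simp: AE_ivl)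
      from F[of T] s0 show ?thesis
      proof eventually_elim
        case (elim s)
        have b: "AE y in circ. \<bar>U s y\<bar> \<le> R" by (rule bounded[OF elim(2)])
        then have "AE y in circ. \<bar>U s (- y)\<bar> \<le> R" by (subst AE_circ_uminus[where P="\<lambda>y. \<bar>U s y\<bar> \<le> R"])
        with b elim(1) show ?case
        proof eventually_elim
          case (elim y)
          let ?v = "v (s, tri y)"
          have sg1: "sg y * sg y = 1" using elim by simp
          then have sga: "\<bar>sg y\<bar> = 1" by (metis abs_mult_self_eq abs_of_nonneg abs_ge_zero real_sqrt_abs real_sqrt_mult_self real_sqrt_one abs_abs real_sqrt_eq_iff power2_eq_square)
          have v: "\<bar>?v\<bar> = \<bar>V s y\<bar>" using elim sga by (simp add: abs_mult)
          \<comment> \<open>\<open>V\<close> is half the difference of two values of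
            \<open>U\<close>, each bounded by \<open>R\<close>.\<close>
          have "\<bar>V s y\<bar> \<le> R" using elim by (simp add: V_def abs_le_iff)
          then have vR: "\<bar>?v\<bar> \<le> R" using v by simp
          have sq: "(V s y)^2 = ?v^2" using v by (metis power2_abs)
          have "c0 * a (tri y) * (V s y)\<^sup>2 = a (tri y) * (c0 * ?v^2)" unfolding sq by simp
          also have "\<dots> \<le> a (tri y) * (\<sigma> ?v * ?v)" by (intro mult_left_mono \<sigma>(2) vR a)
          also have "\<dots> = unfold_odd g (s, y) * V s y" by (rule FV[symmetric]) (use elim in auto)
          finally have 1: "c0 * a (tri y) * (V s y)\<^sup>2 \<le> unfold_odd g (s, y) * V s y" .
          have "\<bar>unfold_odd g (s, y)\<bar> = a (tri y) * \<bar>\<sigma> ?v\<bar>" using elim sga a(1) by (simp add: abs_mult)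
          also have "\<dots> \<le> a (tri y) * (C0 * \<bar>?v\<bar>)" by (intro mult_left_mono \<sigma>(3) vR a)
          finally show ?case using 1 v by (simp add: mult_ac)
        qed
      qed
    qed
  qed (use a0 cd const in auto)
qed

lemma unfold_pair_power:
  assumes [measurable]: "w \<in> borel_measurable borel" "u \<in> borel_measurable borel"
    and i: "integrable circ (\<lambda>y. \<bar>unfold_pair w u y\<bar> powr p)"
  shows "integrable (ivl 0 1) (\<lambda>x. \<bar>w x - u x\<bar> powr p)" "integrable (ivl 0 1) (\<lambda>x. \<bar>w x + u x\<bar> powr p)"
    "(\<integral>y. \<bar>unfold_pair w u y\<bar> powr p \<partial>circ) = (\<integral>x. \<bar>w x - u x\<bar> powr p \<partial>ivl 0 1) + (\<integral>x. \<bar>w x + u x\<bar> powr p \<partial>ivl 0 1)"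
proof -
  have 1: "AE x in ivl 0 1. \<bar>unfold_pair w u x\<bar> powr p = \<bar>w x - u x\<bar> powr p"
    using AE_ivl01 by eventually_elim (simp add: unfold_pair_pos)
  have 2: "AE x in ivl 0 1. \<bar>unfold_pair w u (- x)\<bar> powr p = \<bar>w x + u x\<bar> powr p"
    using AE_ivl01 by eventually_elim (simp add: unfold_pair_neg)
  note f = integral_circ_fold[OF i]
  show i1: "integrable (ivl 0 1) (\<lambda>x. \<bar>w x - u x\<bar> powr p)"
    by (rule integrable_cong_AE_imp[OF f(2)]) (use 1 in auto)
  show i2: "integrable (ivl 0 1) (\<lambda>x. \<bar>w x + u x\<bar> powr p)"
    by (rule integrable_cong_AE_imp[OF f(3)]) (use 2 in auto)
  have "(\<integral>y. \<bar>unfold_pair w u y\<bar> powr p \<partial>circ) = (\<integral>x. \<bar>w x - u x\<bar> powr p + \<bar>w x + u x\<bar> powr p \<partial>ivl 0 1)"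
    unfolding f(1) using 1 2 by (intro integral_cong_AE) auto
  then show "(\<integral>y. \<bar>unfold_pair w u y\<bar> powr p \<partial>circ) = (\<integral>x. \<bar>w x - u x\<bar> powr p \<partial>ivl 0 1) + (\<integral>x. \<bar>w x + u x\<bar> powr p \<partial>ivl 0 1)"
    using i1 i2 by simp
qed

definition Lq :: "real \<Rightarrow> (real \<Rightarrow> real) \<Rightarrow> real" where
  "Lq p f = (\<integral>x. \<bar>f x\<bar> powr p \<partial>ivl 0 1) powr (1 / p)"

lemma Lq_nonneg: "0 \<le> Lq p f" by (simp add: Lq_def)

lemma Lq_powr: "0 < p \<Longrightarrow> Lq p f powr p = (\<integral>x. \<bar>f x\<bar> powr p \<partial>ivl 0 1)"
  by (simp add: Lq_def powr_powr)

lemma Lq_sum_le_energy: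
  assumes [measurable]: "w \<in> borel_measurable borel" "u \<in> borel_measurable borel" and p: "1 \<le> p"
    and i: "integrable (ivl 0 1) (\<lambda>x. \<bar>w x - u x\<bar> powr p)" "integrable (ivl 0 1) (\<lambda>x. \<bar>w x + u x\<bar> powr p)"
  shows "Lq p w + Lq p u \<le> 2 * ((\<integral>x. \<bar>w x - u x\<bar> powr p \<partial>ivl 0 1) + (\<integral>x. \<bar>w x + u x\<bar> powr p \<partial>ivl 0 1)) powr (1 / p)"
proof -
  let ?I = "(\<integral>x. \<bar>w x - u x\<bar> powr p \<partial>ivl 0 1) + (\<integral>x. \<bar>w x + u x\<bar> powr p \<partial>ivl 0 1)"
  have *: "(\<integral>x. \<bar>f x\<bar> powr p \<partial>ivl 0 1) \<le> ?I"
    if [measurable]: "f \<in> borel_measurable borel" and f: "\<And>x. 2 * \<bar>f x\<bar> \<le> \<bar>w x - u x\<bar> + \<bar>w x + u x\<bar>" for f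
  proof -
    have le: "\<bar>f x\<bar> powr p \<le> \<bar>w x - u x\<bar> powr p + \<bar>w x + u x\<bar> powr p" for x
    proof -
      have "\<bar>f x\<bar> \<le> max \<bar>w x - u x\<bar> \<bar>w x + u x\<bar>" using f[of x] by linarith
      then have "\<bar>f x\<bar> powr p \<le> max \<bar>w x - u x\<bar> \<bar>w x + u x\<bar> powr p" using p by (intro powr_mono2) auto
      also have "\<dots> \<le> \<bar>w x - u x\<bar> powr p + \<bar>w x + u x\<bar> powr p" by (auto simp: max_def)
      finally show ?thesis .
    qed
    have "(\<integral>x. \<bar>f x\<bar> powr p \<partial>ivl 0 1) \<le> (\<integral>x. \<bar>w x - u x\<bar> powr p + \<bar>w x + u x\<bar> powr p \<partial>ivl 0 1)"
    proof (rule integral_mono)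
      show "integrable (ivl 0 1) (\<lambda>x. \<bar>f x\<bar> powr p)"
        by (rule Bochner_Integration.integrable_bound[of _ "\<lambda>x. \<bar>w x - u x\<bar> powr p + \<bar>w x + u x\<bar> powr p"])
          (use i le in auto)
    qed (use i le in auto)
    then show ?thesis using i by simp
  qed
  have "Lq p w \<le> ?I powr (1 / p)" "Lq p u \<le> ?I powr (1 / p)"
    unfolding Lq_def using p by (intro powr_mono2 *; auto)+
  then show ?thesis by simp
qed

lemma energy_le_Lq_sum:
  assumes [measurable]: "w \<in> borel_measurable borel" "u \<in> borel_measurable borel" and p: "1 \<le> p"
    and i: "integrable (ivl 0 1) (\<lambda>x. \<bar>w x\<bar> powr p)" "integrable (ivl 0 1) (\<lambda>x. \<bar>u x\<bar> powr p)"
  shows "(\<integral>x. \<bar>w x - u x\<bar> powr p \<partial>ivl 0 1) + (\<integral>x. \<bar>w x + u x\<bar> powr p \<partial>ivl 0 1) \<le> 4 * 2 powr p * (Lq p w + Lq p u) powr p"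
proof -
  let ?J = "(\<integral>x. \<bar>w x\<bar> powr p \<partial>ivl 0 1) + (\<integral>x. \<bar>u x\<bar> powr p \<partial>ivl 0 1)"
  have *: "(\<integral>x. \<bar>f x\<bar> powr p \<partial>ivl 0 1) \<le> 2 powr p * ?J"
    if [measurable]: "f \<in> borel_measurable borel" and f: "\<And>x. \<bar>f x\<bar> \<le> \<bar>w x\<bar> + \<bar>u x\<bar>" for f
  proof -
    have le: "\<bar>f x\<bar> powr p \<le> 2 powr p * (\<bar>w x\<bar> powr p + \<bar>u x\<bar> powr p)" for x
    proof -
      have "\<bar>f x\<bar> powr p \<le> (\<bar>w x\<bar> + \<bar>u x\<bar>) powr p" using p f by (intro powr_mono2) auto
      also have "\<dots> \<le> 2 powr p * (\<bar>w x\<bar> powr p + \<bar>u x\<bar> powr p)" by (rule powr_add2_le) (use p in auto)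
      finally show ?thesis .
    qed
    have "(\<integral>x. \<bar>f x\<bar> powr p \<partial>ivl 0 1) \<le> (\<integral>x. 2 powr p * (\<bar>w x\<bar> powr p + \<bar>u x\<bar> powr p) \<partial>ivl 0 1)"
    proof (rule integral_mono)
      show "integrable (ivl 0 1) (\<lambda>x. \<bar>f x\<bar> powr p)"
        by (rule Bochner_Integration.integrable_bound[of _ "\<lambda>x. 2 powr p * (\<bar>w x\<bar> powr p + \<bar>u x\<bar> powr p)"])
          (use i le in auto)
    qed (use i le in auto)
    then show ?thesis using i by simp
  qed
  have p0: "0 < p" using p by simp
  have "(\<integral>x. \<bar>w x - u x\<bar> powr p \<partial>ivl 0 1) + (\<integral>x. \<bar>w x + u x\<bar> powr p \<partial>ivl 0 1) \<le> 2 powr p * ?J + 2 powr p * ?J"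
    by (intro add_mono *) auto
  also have "?J = Lq p w powr p + Lq p u powr p" by (simp add: Lq_powr[OF p0])
  also have "Lq p w powr p + Lq p u powr p \<le> (Lq p w + Lq p u) powr p + (Lq p w + Lq p u) powr p"
    using p Lq_nonneg by (intro add_mono powr_mono2) auto
  finally show ?thesis by (simp add: mult_left_mono algebra_simps)
qed

text \<open>The 2 stems from \<open>Lq_sum_le_energy\<close>, the \<open>4 * 2 powr p\<close> from
  \<open>energy_le_Lq_sum\<close>, and 1/\<gamma> from the incomplete period; the last two pass
  through the p-th root.\<close>

definition decay_const :: "real \<Rightarrow> real \<Rightarrow> real" where
  "decay_const p \<gamma> = 2 * (4 * 2 powr p / \<gamma>) powr (1 / p)"

lemma (in reduced_solution) Lq_decay:
  assumes dt: "damped_transport (unfold_pair (w 0) (u 0)) (unfold_odd g) \<alpha> a0 A c d c0 C0 R p" and t: "0 \<le> t"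
    and i0: "integrable (ivl 0 1) (\<lambda>x. \<bar>w 0 x\<bar> powr p)" "integrable (ivl 0 1) (\<lambda>x. \<bar>u 0 x\<bar> powr p)"
  defines "\<gamma> \<equiv> decay_factor p c d a0 A c0 C0"
  shows "Lq p (w t) + Lq p (u t) \<le> decay_const p \<gamma> * exp (- (- ln \<gamma> / (2 * p)) * t) * (Lq p (w 0) + Lq p (u 0))"
proof -
  interpret T: damped_transport "unfold_pair (w 0) (u 0)" "unfold_odd g" \<alpha> a0 A c d c0 C0 R p by (rule dt)
  have p: "1 \<le> p" "0 < p" using T.p by auto
  have \<gamma>: "0 < \<gamma>" unfolding \<gamma>_def using decay_factor_bounds(1) T.cd T.a0 T.c0 T.p by blast
  have wb[measurable]: "0 \<le> s \<Longrightarrow> w s \<in> borel_measurable borel" "0 \<le> s \<Longrightarrow> u s \<in> borel_measurable borel" for s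
    using w_int[of s] u_int[of s] by (auto dest: borel_measurable_integrable_ivl)
  define I where "I s = (\<integral>x. \<bar>w s x - u s x\<bar> powr p \<partial>ivl 0 1) + (\<integral>x. \<bar>w s x + u s x\<bar> powr p \<partial>ivl 0 1)" for s
  have I: "integrable (ivl 0 1) (\<lambda>x. \<bar>w s x - u s x\<bar> powr p) \<and> integrable (ivl 0 1) (\<lambda>x. \<bar>w s x + u s x\<bar> powr p) \<and> T.E s = I s"
    if s: "0 \<le> s" for s
  proof -
    note [measurable] = wb[OF s]
    have ae: "AE y in circ. \<bar>U s y\<bar> powr p = \<bar>unfold_pair (w s) (u s) y\<bar> powr p"
      using mild_representation[OF s] by eventually_elim simp
    have i: "integrable circ (\<lambda>y. \<bar>unfold_pair (w s) (u s) y\<bar> powr p)"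
      by (rule integrable_cong_AE_imp[OF T.pow_integrable[OF s]]) (use ae in auto)
    have "T.E s = (\<integral>y. \<bar>unfold_pair (w s) (u s) y\<bar> powr p \<partial>circ)"
      unfolding T.E_def using ae by (intro integral_cong_AE) auto
    then show ?thesis using unfold_pair_power[OF wb[OF s] i] by (simp add: I_def)
  qed
  have I0: "0 \<le> I s" for s by (simp add: I_def)
  have "Lq p (w t) + Lq p (u t) \<le> 2 * I t powr (1 / p)"
    unfolding I_def using I[OF t] by (intro Lq_sum_le_energy wb t p) auto
  also have "I t \<le> (1 / \<gamma> * exp (ln \<gamma> / 2 * t)) * (4 * 2 powr p * (Lq p (w 0) + Lq p (u 0)) powr p)"
  proof -
    have "I t \<le> (1 / \<gamma> * exp (ln \<gamma> / 2 * t)) * I 0"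
      using T.exponential_decay[OF t] I[OF t] I[of 0] by (simp add: \<gamma>_def)
    also have "\<dots> \<le> (1 / \<gamma> * exp (ln \<gamma> / 2 * t)) * (4 * 2 powr p * (Lq p (w 0) + Lq p (u 0)) powr p)"
    proof (rule mult_left_mono)
      show "I 0 \<le> 4 * 2 powr p * (Lq p (w 0) + Lq p (u 0)) powr p"
        unfolding I_def using i0 by (intro energy_le_Lq_sum wb p) auto
    qed (use \<gamma> in auto)
    finally show ?thesis .
  qed
  then have "2 * I t powr (1 / p) \<le> 2 * ((1 / \<gamma> * exp (ln \<gamma> / 2 * t)) * (4 * 2 powr p * (Lq p (w 0) + Lq p (u 0)) powr p)) powr (1 / p)"
    using I0 p by (intro mult_left_mono powr_mono2) auto
  also have "(1 / \<gamma> * exp (ln \<gamma> / 2 * t)) * (4 * 2 powr p * (Lq p (w 0) + Lq p (u 0)) powr p) =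
      (4 * 2 powr p / \<gamma>) * exp (ln \<gamma> / 2 * t) * (Lq p (w 0) + Lq p (u 0)) powr p"
    by simp
  also have "2 * (\<dots>) powr (1 / p) = decay_const p \<gamma> * exp (ln \<gamma> / 2 * t) powr (1 / p) * (Lq p (w 0) + Lq p (u 0))"
  proof -
    have *: "(x * y * z powr p) powr (1 / p) = x powr (1 / p) * y powr (1 / p) * z"
      if "0 \<le> x" "0 \<le> y" "0 \<le> z" for x y z
      using that p by (simp add: powr_mult powr_powr)
    show ?thesis
      by (subst *) (use \<gamma> Lq_nonneg[of p "w 0"] Lq_nonneg[of p "u 0"] in \<open>auto simp: decay_const_def\<close>)
  qed
  \<comment> \<open>The p-th root divides the decay rate of the energy by p.\<close>
  also have "exp (ln \<gamma> / 2 * t) powr (1 / p) = exp (- (- ln \<gamma> / (2 * p)) * t)"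
    using p by (simp add: exp_powr_real)
  finally show ?thesis .
qed

lemma decay_const_pos: "0 < \<gamma> \<Longrightarrow> 0 < decay_const p \<gamma>"
  by (simp add: decay_const_def)

section \<open>Lebesgue measurable representatives\<close>

lemma borel_measurable_lebesgue_AE:
  fixes f f' :: "'a::euclidean_space \<Rightarrow> real"
  assumes f': "f' \<in> borel_measurable lebesgue" and ae: "AE x in lebesgue. f x = f' x"
  shows "f \<in> borel_measurable lebesgue"
proof (rule measurableI)
  fix A :: "real set" assume A: "A \<in> sets borel"
  show "f -` A \<inter> space lebesgue \<in> sets lebesgue"
  proof (rule completion.in_sets_AE)
    show "f' -` A \<inter> space lebesgue \<in> sets lebesgue" using measurable_sets[OF f' A] .
    show "AE x in lebesgue. x \<in> f' -` A \<inter> space lebesgue \<longleftrightarrow> x \<in> f -` A \<inter> space lebesgue"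
      using ae by eventually_elim auto
  qed auto
qed auto

lemma AE_lebesgue_on:
  fixes S :: "'a::euclidean_space set"
  assumes "S \<in> sets borel"
  shows "(AE x in lebesgue_on S. P x) \<longleftrightarrow> (AE x in lborel. x \<in> S \<longrightarrow> P x)"
  using assms by (subst AE_restrict_space_iff) (auto simp: AE_completion_iff)

text \<open>Completeness of Lebesgue measure makes \<open>f\<close> measurable because it agrees
  almost everywhere with a Borel function, whose integral then replaces that of
  \<open>f\<close>.\<close>

lemma lebesgue_on_AE_eq:
  fixes f f' :: "'a::euclidean_space \<Rightarrow> real"
  assumes [measurable]: "S \<in> sets borel" and f': "f' \<in> borel_measurable borel" and ae: "AE x in lborel. x \<in> S \<longrightarrow> f x = f' x"
  shows "f \<in> borel_measurable (lebesgue_on S)"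
    and "integrable (lebesgue_on S) f \<longleftrightarrow> integrable lborel (\<lambda>x. indicator S x * f' x)"
    and "integral\<^sup>L (lebesgue_on S) f = (\<integral>x. indicator S x * f' x \<partial>lborel)"
proof -
  have m: "(\<lambda>x. indicator S x * f' x) \<in> borel_measurable lborel" using f' by simp
  then have ml: "(\<lambda>x. indicator S x * f' x) \<in> borel_measurable lebesgue" by (rule measurable_completion)
  have ae': "AE x in lebesgue. indicator S x * f x = indicator S x * f' x"
    by (rule AE_completion) (use ae in \<open>eventually_elim, auto simp: indicator_def\<close>)
  have mf: "(\<lambda>x. indicator S x * f x) \<in> borel_measurable lebesgue"
    by (rule borel_measurable_lebesgue_AE[OF ml ae'])
  have S: "S \<inter> space lebesgue \<in> sets lebesgue" by simp
  show "f \<in> borel_measurable (lebesgue_on S)"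
    using mf by (subst borel_measurable_restrict_space_iff[OF S]) simp
  have "integrable (lebesgue_on S) f \<longleftrightarrow> integrable lebesgue (\<lambda>x. indicator S x * f x)"
    by (subst integrable_restrict_space[OF S]) simp
  also have "\<dots> \<longleftrightarrow> integrable lebesgue (\<lambda>x. indicator S x * f' x)"
    by (rule integrable_cong_AE[OF mf ml ae'])
  also have "\<dots> \<longleftrightarrow> integrable lborel (\<lambda>x. indicator S x * f' x)"
    by (rule integrable_completion[OF m])
  finally show "integrable (lebesgue_on S) f \<longleftrightarrow> integrable lborel (\<lambda>x. indicator S x * f' x)" .
  have "integral\<^sup>L (lebesgue_on S) f = (\<integral>x. indicator S x * f x \<partial>lebesgue)"
    by (subst integral_restrict_space[OF S]) simp
  also have "\<dots> = (\<integral>x. indicator S x * f' x \<partial>lebesgue)" by (rule integral_cong_AE[OF mf ml ae'])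
  also have "\<dots> = (\<integral>x. indicator S x * f' x \<partial>lborel)" by (rule integral_completion[OF m])
  finally show "integral\<^sup>L (lebesgue_on S) f = (\<integral>x. indicator S x * f' x \<partial>lborel)" .
qed

lemma lebesgue_on_borel_rep:
  fixes f :: "'a::euclidean_space \<Rightarrow> real"
  assumes [measurable]: "S \<in> sets borel" and f: "f \<in> borel_measurable (lebesgue_on S)"
  obtains f' where "f' \<in> borel_measurable borel" "AE x in lborel. x \<in> S \<longrightarrow> f x = f' x"
proof -
  have S: "S \<inter> space lebesgue \<in> sets lebesgue" by simp
  have "(\<lambda>x. indicator S x * f x) \<in> borel_measurable lebesgue"
    using f by (subst (asm) borel_measurable_restrict_space_iff[OF S]) simp
  from completion_ex_borel_measurable_real[OF this] obtain f' where
    f': "f' \<in> borel_measurable lborel" "AE x in lborel. indicator S x * f x = f' x" by auto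
  show thesis
  proof (rule that)
    show "f' \<in> borel_measurable borel" using f'(1) by simp
    show "AE x in lborel. x \<in> S \<longrightarrow> f x = f' x" using f'(2) by eventually_elim (auto simp: indicator_def)
  qed
qed

lemma AE_ivl01_open: "(AE x in ivl 0 1. P x) \<longleftrightarrow> (AE x in lborel. x \<in> {0<..<1} \<longrightarrow> P x)"
proof
  assume "AE x in lborel. x \<in> {0<..<1} \<longrightarrow> P x"
  moreover have "AE x in lborel. x \<noteq> (0::real)" "AE x in lborel. x \<noteq> (1::real)" by (rule AE_lborel_singleton)+
  ultimately show "AE x in ivl 0 1. P x" unfolding AE_ivl by eventually_elim auto
qed (auto simp: AE_ivl elim!: AE_mp)

lemma AE_leb01: "(AE x in leb01. P x) \<longleftrightarrow> (AE x in ivl 0 1. P x)"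
  unfolding AE_ivl01_open by (rule AE_lebesgue_on) simp

lemma integral_indicator_open:
  fixes f :: "real \<Rightarrow> real"
  assumes [measurable]: "f \<in> borel_measurable borel"
  shows "integrable lborel (\<lambda>x. indicator {0<..<1} x * f x) \<longleftrightarrow> integrable (ivl 0 1) f"
    "(\<integral>x. indicator {0<..<1} x * f x \<partial>lborel) = integral\<^sup>L (ivl 0 1) f"
proof -
  have "AE x in lborel. x \<noteq> (0::real)" "AE x in lborel. x \<noteq> (1::real)" by (rule AE_lborel_singleton)+
  then have ae: "AE x in lborel. indicator {0<..<1} x * f x = indicator {0..1} x * f x"
    by eventually_elim (auto simp: indicator_def)
  show "integrable lborel (\<lambda>x. indicator {0<..<1} x * f x) \<longleftrightarrow> integrable (ivl 0 1) f"
    unfolding integrable_ivl[OF assms] using ae by (intro integrable_cong_AE) auto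
  show "(\<integral>x. indicator {0<..<1} x * f x \<partial>lborel) = integral\<^sup>L (ivl 0 1) f"
    unfolding integral_ivl[OF assms] using ae by (intro integral_cong_AE) auto
qed

text \<open>The function spaces consist of Lebesgue measurable functions on the open interval, while
  the estimates are made for Borel functions on the line; every quantity passes between the two
  through such a representative.\<close>

definition rep :: "(real \<Rightarrow> real) \<Rightarrow> (real \<Rightarrow> real) \<Rightarrow> bool" where
  "rep f f' \<longleftrightarrow> f' \<in> borel_measurable borel \<and> (AE x in ivl 0 1. f x = f' x)"

lemma rep_borel: "rep f f' \<Longrightarrow> f' \<in> borel_measurable borel" by (simp add: rep_def)

lemma rep_AE: "rep f f' \<Longrightarrow> AE x in ivl 0 1. f x = f' x" by (simp add: rep_def)

lemma rep_exists: "f \<in> borel_measurable leb01 \<Longrightarrow> \<exists>f'. rep f f'"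
proof -
  assume f: "f \<in> borel_measurable leb01"
  show ?thesis
  proof (rule lebesgue_on_borel_rep[of "{0<..<1}" f])
    show "{0<..<1} \<in> sets (borel :: real measure)" by simp
    show "f \<in> borel_measurable leb01" by (rule f)
    fix f' assume "f' \<in> borel_measurable borel" "AE x in lborel. x \<in> {0<..<1} \<longrightarrow> f x = f' x"
    then have "rep f f'" unfolding rep_def AE_ivl01_open by (rule conjI)
    then show "\<exists>f'. rep f f'" by (rule exI[of "rep f" f'])
  qed
qed

lemma rep_leb01:
  assumes "rep f f'"
  shows "f \<in> borel_measurable leb01" "integrable leb01 f \<longleftrightarrow> integrable (ivl 0 1) f'" "integral\<^sup>L leb01 f = integral\<^sup>L (ivl 0 1) f'"
  using lebesgue_on_AE_eq[of "{0<..<1}" f' f] integral_indicator_open[of f'] assms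
  unfolding rep_def AE_ivl01_open by auto

lemma rep_comp:
  assumes "rep f f'" "h \<in> borel_measurable borel" shows "rep (\<lambda>x. h (f x)) (\<lambda>x. h (f' x))"
  using assms unfolding rep_def by (auto elim!: AE_mp)

lemma rep_comp2:
  assumes f: "rep f f'" and g: "rep g g'" and [measurable]: "case_prod h \<in> borel_measurable (borel \<Otimes>\<^sub>M borel)"
  shows "rep (\<lambda>x. h (f x) (g x)) (\<lambda>x. h (f' x) (g' x))"
proof -
  note [measurable] = rep_borel[OF f] rep_borel[OF g]
  have "(\<lambda>x. case_prod h (f' x, g' x)) \<in> borel_measurable borel" by measurable
  moreover have "AE x in ivl 0 1. h (f x) (g x) = h (f' x) (g' x)"
    using rep_AE[OF f] rep_AE[OF g] by eventually_elim simp
  ultimately show ?thesis by (simp add: rep_def)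
qed

lemma rep_mult: "rep f f' \<Longrightarrow> rep g g' \<Longrightarrow> rep (\<lambda>x. f x * g x) (\<lambda>x. f' x * g' x)"
  by (rule rep_comp2[where h="(*)"]) measurable

lemma rep_diff: "rep f f' \<Longrightarrow> rep g g' \<Longrightarrow> rep (\<lambda>x. f x - g x) (\<lambda>x. f' x - g' x)"
  by (rule rep_comp2[where h="(-)"]) measurable

lemma rep_self: "f \<in> borel_measurable borel \<Longrightarrow> rep f f" by (simp add: rep_def)

lemma rep_AE_eq: "rep f f' \<Longrightarrow> rep g g' \<Longrightarrow> (AE x in ivl 0 1. f x = g x) \<longleftrightarrow> (AE x in ivl 0 1. f' x = g' x)"
  by (auto simp: rep_def elim!: AE_mp)

lemma pairing_rep:
  assumes "rep f f'" "g \<in> borel_measurable borel"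
  shows "pairing f g = (\<integral>x. f' x * g x \<partial>ivl 0 1)"
  unfolding pairing_def using rep_mult[OF assms(1) rep_self[OF assms(2)]] by (rule rep_leb01(3))

lemma Lp_norm_rep:
  assumes "rep f f'" shows "Lp_norm (ereal p) f = Lq p f'"
proof -
  have "rep (\<lambda>x. \<bar>f x\<bar> powr p) (\<lambda>x. \<bar>f' x\<bar> powr p)"
    by (rule rep_comp[OF assms, where h="\<lambda>x. \<bar>x\<bar> powr p"]) measurable
  from rep_leb01(3)[OF this] show ?thesis by (simp add: Lp_norm_def Lq_def)
qed

lemma Lp_space_measurable: "f \<in> Lp_space p \<Longrightarrow> f \<in> borel_measurable leb01"
  by (simp add: Lp_space_def)

lemma Lp_space_rep:
  assumes "rep f f'" shows "f \<in> Lp_space (ereal p) \<longleftrightarrow> integrable (ivl 0 1) (\<lambda>x. \<bar>f' x\<bar> powr p)"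
proof -
  have "rep (\<lambda>x. \<bar>f x\<bar> powr p) (\<lambda>x. \<bar>f' x\<bar> powr p)"
    by (rule rep_comp[OF assms, where h="\<lambda>x. \<bar>x\<bar> powr p"]) measurable
  from rep_leb01(2)[OF this] rep_leb01(1)[OF assms] show ?thesis by (simp add: Lp_space_def)
qed

lemma Lp_space_1_rep: "rep f f' \<Longrightarrow> f \<in> Lp_space 1 \<longleftrightarrow> integrable (ivl 0 1) f'"
  using Lp_space_rep[of f f' 1] rep_borel[of f f'] by (simp add: one_ereal_def integrable_abs_iff)

lemma leb01_emeasure: "emeasure leb01 (space leb01) \<noteq> 0"
  by (simp add: emeasure_restrict_space)

lemma Linf_norm_AE:
  assumes f: "f \<in> Lp_space \<infinity>"
  shows "AE x in ivl 0 1. \<bar>f x\<bar> \<le> Lp_norm \<infinity> f" "0 \<le> Lp_norm \<infinity> f"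
proof -
  let ?e = "esssup leb01 (\<lambda>x. ereal \<bar>f x\<bar>)"
  have fm: "f \<in> borel_measurable leb01" and fin: "?e < \<infinity>" using f by (auto simp: Lp_space_def)
  have "esssup leb01 (\<lambda>x. 0 :: ereal) \<le> ?e" using fm by (intro esssup_mono) auto
  \<comment> \<open>Nonnegativity excludes the value minus infinity, for which
    \<open>real_of_ereal\<close> would return a default.\<close>
  then have nn: "0 \<le> ?e" using esssup_const[OF leb01_emeasure, of "0 :: ereal"] by simp
  then have e: "?e = ereal (Lp_norm \<infinity> f)" using fin by (simp add: Lp_norm_def ereal_real)
  show "0 \<le> Lp_norm \<infinity> f" using nn by (simp add: Lp_norm_def real_of_ereal_pos)
  have "AE x in leb01. ereal \<bar>f x\<bar> \<le> ?e" by (rule esssup_AE)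
  then show "AE x in ivl 0 1. \<bar>f x\<bar> \<le> Lp_norm \<infinity> f" unfolding e AE_leb01 by simp
qed

lemma rep_bounded_integrable:
  assumes "rep f f'" "AE x in ivl 0 1. \<bar>f x\<bar> \<le> B" and p: "0 \<le> p"
  shows "integrable (ivl 0 1) (\<lambda>x. \<bar>f' x\<bar> powr p)"
proof (rule ivl.integrable_const_bound)
  show "AE x in ivl 0 1. norm (\<bar>f' x\<bar> powr p) \<le> B powr p"
    using rep_AE[OF assms(1)] assms(2) by eventually_elim (use p in \<open>auto intro!: powr_mono2\<close>)
  show "(\<lambda>x. \<bar>f' x\<bar> powr p) \<in> borel_measurable (ivl 0 1)" using rep_borel[OF assms(1)] by simp
qed

lemma Linf_Lp:
  assumes "f \<in> Lp_space \<infinity>" "0 \<le> p" shows "f \<in> Lp_space (ereal p)"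
proof -
  obtain f' where f': "rep f f'" using rep_exists[OF Lp_space_measurable[OF assms(1)]] by blast
  show ?thesis unfolding Lp_space_rep[OF f']
    by (rule rep_bounded_integrable[OF f' Linf_norm_AE(1)[OF assms(1)] assms(2)])
qed

lemma Lp_L1:
  assumes "f \<in> Lp_space p" "p = \<infinity> \<or> (\<exists>r. p = ereal r \<and> 1 \<le> r)" shows "f \<in> Lp_space 1"
  using assms(2)
proof
  assume "p = \<infinity>"
  then show ?thesis using Linf_Lp[of f 1] assms(1) by (simp add: one_ereal_def)
next
  assume "\<exists>r. p = ereal r \<and> 1 \<le> r"
  then obtain r where r: "p = ereal r" "1 \<le> r" by blast
  obtain f' where f': "rep f f'" using rep_exists[OF Lp_space_measurable[OF assms(1)]] by blast
  have "integrable (ivl 0 1) (\<lambda>x. \<bar>f' x\<bar> powr r)" using assms(1) r Lp_space_rep[OF f'] by simp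
  then show ?thesis unfolding Lp_space_1_rep[OF f']
    using r rep_borel[OF f'] by (intro ivl.integrable_powr_imp_integrable[of f' 0 1 r]) auto
qed

lemma Lq_1_le:
  assumes [measurable]: "f \<in> borel_measurable borel" and f: "integrable (ivl 0 1) (\<lambda>x. \<bar>f x\<bar> powr p)" and p: "1 \<le> p"
  shows "(\<integral>x. \<bar>f x\<bar> \<partial>ivl 0 1) \<le> Lq p f"
proof -
  have "(\<integral>x. \<bar>f x\<bar> \<partial>ivl 0 1) powr p \<le> (\<integral>x. \<bar>f x\<bar> powr p \<partial>ivl 0 1)"
    using ivl.jensen_powr[OF _ f p] by (simp add: measure_ivl)
  then have "((\<integral>x. \<bar>f x\<bar> \<partial>ivl 0 1) powr p) powr (1 / p) \<le> Lq p f"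
    unfolding Lq_def using p by (intro powr_mono2) auto
  then show ?thesis using p by (simp add: powr_powr)
qed

section \<open>Weak derivatives\<close>

lemma weak_deriv_rep:
  assumes "rep f f'" "rep g g'"
  shows "is_weak_deriv f g \<longleftrightarrow> (\<forall>\<phi>\<in>test_functions. (\<integral>x. f' x * deriv \<phi> x \<partial>ivl 0 1) = - (\<integral>x. g' x * \<phi> x \<partial>ivl 0 1))"
  unfolding is_weak_deriv_def
  using pairing_rep[OF assms(1)] pairing_rep[OF assms(2)] test_function_borel deriv_test_function by simp

lemma weak_deriv_unique:
  assumes g: "g \<in> Lp_space 1" "is_weak_deriv f g" and h: "h \<in> Lp_space 1" "is_weak_deriv f h"
  shows "AE x in ivl 0 1. g x = h x"
proof -
  obtain g' where g': "rep g g'" using rep_exists[OF Lp_space_measurable[OF g(1)]] by blast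
  obtain h' where h': "rep h h'" using rep_exists[OF Lp_space_measurable[OF h(1)]] by blast
  have ig: "integrable (ivl 0 1) g'" and ih: "integrable (ivl 0 1) h'"
    using g(1) h(1) Lp_space_1_rep[OF g'] Lp_space_1_rep[OF h'] by auto
  have "AE x in ivl 0 1. g' x - h' x = 0"
  proof (rule du_bois_reymond)
    fix \<phi> assume \<phi>: "\<phi> \<in> test_functions"
    have "- pairing g \<phi> = - pairing h \<phi>" using g(2) h(2) \<phi> by (simp add: is_weak_deriv_def)
    then have "(\<integral>x. g' x * \<phi> x \<partial>ivl 0 1) = (\<integral>x. h' x * \<phi> x \<partial>ivl 0 1)"
      using pairing_rep[OF g' test_function_borel[OF \<phi>]] pairing_rep[OF h' test_function_borel[OF \<phi>]] by simp
    then show "(\<integral>x. (g' x - h' x) * \<phi> x \<partial>ivl 0 1) = 0"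
      using integrable_mult_test[OF ig \<phi>] integrable_mult_test[OF ih \<phi>] by (simp add: left_diff_distrib)
  qed (use ig ih in simp)
  then have "AE x in ivl 0 1. g' x = h' x" by eventually_elim simp
  then show ?thesis using rep_AE_eq[OF g' h'] by blast
qed

lemma wderiv_AE_eq:
  assumes "g \<in> Lp_space 1" "is_weak_deriv f g"
  shows "wderiv f \<in> Lp_space 1" "is_weak_deriv f (wderiv f)" "AE x in ivl 0 1. wderiv f x = g x"
proof -
  have "wderiv f \<in> Lp_space 1 \<and> is_weak_deriv f (wderiv f)"
    unfolding wderiv_def by (rule someI[of _ g]) (use assms in simp)
  then show *: "wderiv f \<in> Lp_space 1" "is_weak_deriv f (wderiv f)" by auto
  show "AE x in ivl 0 1. wderiv f x = g x" by (rule weak_deriv_unique[OF * assms])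
qed

lemma Lp_space_AE_cong:
  assumes f: "f \<in> Lp_space p" and ae: "AE x in ivl 0 1. g x = f x"
  shows "g \<in> Lp_space p" "Lp_norm p g = Lp_norm p f"
proof -
  obtain f' where f': "rep f f'" using rep_exists[OF Lp_space_measurable[OF f]] by blast
  have g': "rep g f'" using f' ae by (auto simp: rep_def elim!: AE_mp)
  have m: "f \<in> borel_measurable leb01" "g \<in> borel_measurable leb01" using rep_leb01(1) f' g' by auto
  have ess: "esssup leb01 (\<lambda>x. ereal \<bar>g x\<bar>) = esssup leb01 (\<lambda>x. ereal \<bar>f x\<bar>)"
    using ae unfolding AE_leb01[symmetric] by (intro esssup_AE_cong) (use m in \<open>auto elim!: AE_mp\<close>)
  have int: "integrable leb01 (\<lambda>x. \<bar>g x\<bar> powr q) \<longleftrightarrow> integrable leb01 (\<lambda>x. \<bar>f x\<bar> powr q)"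
    "(LINT x|leb01. \<bar>g x\<bar> powr q) = (LINT x|leb01. \<bar>f x\<bar> powr q)" for q
  proof -
    have g: "rep (\<lambda>x. \<bar>g x\<bar> powr q) (\<lambda>x. \<bar>f' x\<bar> powr q)"
      by (rule rep_comp[OF g', where h="\<lambda>x. \<bar>x\<bar> powr q"]) measurable
    have f: "rep (\<lambda>x. \<bar>f x\<bar> powr q) (\<lambda>x. \<bar>f' x\<bar> powr q)"
      by (rule rep_comp[OF f', where h="\<lambda>x. \<bar>x\<bar> powr q"]) measurable
    show "integrable leb01 (\<lambda>x. \<bar>g x\<bar> powr q) \<longleftrightarrow> integrable leb01 (\<lambda>x. \<bar>f x\<bar> powr q)"
      unfolding rep_leb01(2)[OF g] rep_leb01(2)[OF f] ..
    show "(LINT x|leb01. \<bar>g x\<bar> powr q) = (LINT x|leb01. \<bar>f x\<bar> powr q)"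
      unfolding rep_leb01(3)[OF g] rep_leb01(3)[OF f] ..
  qed
  have "g \<in> Lp_space p \<longleftrightarrow> f \<in> Lp_space p"
    unfolding Lp_space_def mem_Collect_eq ess int(1) using m by (simp only:)
  then show "g \<in> Lp_space p" using f by simp
  show "Lp_norm p g = Lp_norm p f" unfolding Lp_norm_def ess int ..
qed

text \<open>Exponents for which L^p on the interval embeds into L^1, so that \<open>wderiv\<close>,
  chosen among integrable functions, agrees almost everywhere with the derivative in L^p.\<close>

definition admissible :: "ereal \<Rightarrow> bool" where
  "admissible p \<longleftrightarrow> p = \<infinity> \<or> (\<exists>r. p = ereal r \<and> 1 \<le> r)"

lemma W1p_wderiv:
  assumes "f \<in> W1p p" "admissible p"
  shows "f \<in> Lp_space p" "wderiv f \<in> Lp_space p" "wderiv f \<in> Lp_space 1" "is_weak_deriv f (wderiv f)" "f \<in> Lp_space 1"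
proof -
  show f: "f \<in> Lp_space p" using assms by (simp add: W1p_def)
  obtain g where g: "g \<in> Lp_space p" "is_weak_deriv f g" using assms by (auto simp: W1p_def)
  have g1: "g \<in> Lp_space 1" using Lp_L1[OF g(1)] assms(2) by (simp add: admissible_def)
  note w = wderiv_AE_eq[OF g1 g(2)]
  show "wderiv f \<in> Lp_space p" by (rule Lp_space_AE_cong(1)[OF g(1) w(3)])
  show "wderiv f \<in> Lp_space 1" "is_weak_deriv f (wderiv f)" by (rule w)+
  show "f \<in> Lp_space 1" using Lp_L1[OF f] assms(2) by (simp add: admissible_def)
qed

text \<open>A nonempty open set is not negligible, so the function vanishes inside; continuity
  extends this to the end points, where boundary values are read off.\<close>

lemma continuous_AE_zero:
  fixes f :: "real \<Rightarrow> real"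
  assumes f: "continuous_on {0..1} f" and ae: "AE x in ivl 0 1. f x = 0" and x: "0 \<le> x" "x \<le> 1"
  shows "f x = 0"
proof -
  have "open ({0<..<1} \<inter> f -` (- {0}))"
    by (rule continuous_open_preimage[OF continuous_on_subset[OF f]]) auto
  moreover have "negligible ({0<..<1} \<inter> f -` (- {0}))"
  proof -
    have "AE x in lborel. x \<notin> {0<..<1} \<inter> f -` (- {0})"
      using ae unfolding AE_ivl01_open by eventually_elim auto
    then have "AE x in lebesgue. x \<notin> {0<..<1} \<inter> f -` (- {0})" by (rule AE_completion)
    moreover have "{x \<in> space lebesgue. \<not> x \<notin> {0<..<1} \<inter> f -` (- {0})} = {0<..<1} \<inter> f -` (- {0})" by auto
    ultimately show ?thesis
      unfolding negligible_iff_null_sets completion.AE_iff_null_sets by (simp only:)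
  qed
  ultimately have "{0<..<1} \<inter> f -` (- {0}) = {}" using open_not_negligible by blast
  then have "f y = 0" if "y \<in> {0<..<1}" for y using that by auto
  then show ?thesis
    using continuous_constant_on_closure[of "{0<..<1}" f 0 x] f x by auto
qed

lemma W1p_primitive:
  assumes f: "f \<in> W1p p" "admissible p" and w: "rep (wderiv f) w"
  obtains \<kappa> where "AE x in ivl 0 1. f x = \<kappa> + integral\<^sup>L (ivl 0 x) w" "integrable (ivl 0 1) w"
proof -
  note W = W1p_wderiv[OF f]
  obtain f' where f': "rep f f'" using rep_exists[OF Lp_space_measurable[OF W(1)]] by blast
  have if': "integrable (ivl 0 1) f'" using W(5) Lp_space_1_rep[OF f'] by simp
  have iw: "integrable (ivl 0 1) w" using W(3) Lp_space_1_rep[OF w] by simp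
  obtain \<kappa> where \<kappa>: "AE x in ivl 0 1. f' x = \<kappa> + integral\<^sup>L (ivl 0 x) w"
    by (rule weak_deriv_primitive[OF if' iw]) (use W(4) weak_deriv_rep[OF f' w] in auto)
  have "AE x in ivl 0 1. f x = \<kappa> + integral\<^sup>L (ivl 0 x) w"
    using \<kappa> rep_AE[OF f'] by eventually_elim simp
  then show thesis using iw by (rule that)
qed

text \<open>The boundary value at 0 removes the constant of integration, and the one at 1 says that
  the derivative has mean zero.\<close>

lemma W01p_primitive:
  assumes f: "f \<in> W01p p" "admissible p" and w: "rep (wderiv f) w"
  shows "integrable (ivl 0 1) w" "\<And>x. 0 \<le> x \<Longrightarrow> x \<le> 1 \<Longrightarrow> f x = integral\<^sup>L (ivl 0 x) w" "integral\<^sup>L (ivl 0 1) w = 0"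
proof -
  have f1: "f \<in> W1p p" "continuous_on {0..1} f" "f 0 = 0" "f 1 = 0" using f(1) by (auto simp: W01p_def)
  obtain \<kappa> where \<kappa>: "AE x in ivl 0 1. f x = \<kappa> + integral\<^sup>L (ivl 0 x) w" and iw: "integrable (ivl 0 1) w"
    by (rule W1p_primitive[OF f1(1) f(2) w])
  have "f x - (\<kappa> + integral\<^sup>L (ivl 0 x) w) = 0" if "0 \<le> x" "x \<le> 1" for x
  proof (rule continuous_AE_zero[OF _ _ that])
    show "continuous_on {0..1} (\<lambda>x. f x - (\<kappa> + integral\<^sup>L (ivl 0 x) w))"
      by (intro continuous_intros continuous_on_integral_ivl iw f1)
    show "AE x in ivl 0 1. f x - (\<kappa> + integral\<^sup>L (ivl 0 x) w) = 0" using \<kappa> by eventually_elim simp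
  qed
  then have eq: "f x = \<kappa> + integral\<^sup>L (ivl 0 x) w" if "0 \<le> x" "x \<le> 1" for x using that by fastforce
  have "\<kappa> = 0" using eq[of 0] f1(3) borel_measurable_integrable_ivl[OF iw] by (simp add: integral_ivl_eq_0)
  with eq show "\<And>x. 0 \<le> x \<Longrightarrow> x \<le> 1 \<Longrightarrow> f x = integral\<^sup>L (ivl 0 x) w" by simp
  from this[of 1] show "integral\<^sup>L (ivl 0 1) w = 0" using f1(4) by simp
  show "integrable (ivl 0 1) w" by (rule iw)
qed

lemma weak_deriv_diff:
  assumes f: "f \<in> W1p p" "admissible p" and g: "g \<in> W1p p"
    and fw: "rep (wderiv f) fw" and gw: "rep (wderiv g) gw"
  shows "rep (wderiv (\<lambda>x. f x - g x)) (\<lambda>x. fw x - gw x)"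
proof -
  note F = W1p_wderiv[OF f] and G = W1p_wderiv[OF g f(2)]
  obtain f' where f': "rep f f'" using rep_exists[OF Lp_space_measurable[OF F(1)]] by blast
  obtain g' where g': "rep g g'" using rep_exists[OF Lp_space_measurable[OF G(1)]] by blast
  have i: "integrable (ivl 0 1) f'" "integrable (ivl 0 1) g'" "integrable (ivl 0 1) fw" "integrable (ivl 0 1) gw"
    using F(3,5) G(3,5) Lp_space_1_rep f' g' fw gw by auto
  have r: "rep (\<lambda>x. fw x - gw x) (\<lambda>x. fw x - gw x)"
    using rep_borel[OF fw] rep_borel[OF gw] by (intro rep_self) auto
  have "is_weak_deriv (\<lambda>x. f x - g x) (\<lambda>x. fw x - gw x)"
    unfolding weak_deriv_rep[OF rep_diff[OF f' g'] r]
  proof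
    fix \<phi> assume \<phi>: "\<phi> \<in> test_functions"
    have "(\<integral>x. f' x * deriv \<phi> x \<partial>ivl 0 1) = - (\<integral>x. fw x * \<phi> x \<partial>ivl 0 1)" "(\<integral>x. g' x * deriv \<phi> x \<partial>ivl 0 1) = - (\<integral>x. gw x * \<phi> x \<partial>ivl 0 1)"
      using F(4) G(4) weak_deriv_rep[OF f' fw] weak_deriv_rep[OF g' gw] \<phi> by auto
    then show "(\<integral>x. (f' x - g' x) * deriv \<phi> x \<partial>ivl 0 1) = - (\<integral>x. (fw x - gw x) * \<phi> x \<partial>ivl 0 1)"
      using integrable_mult_test[OF _ \<phi>] integrable_mult_test[OF _ deriv_test_function[OF \<phi>]] i
      by (simp add: left_diff_distrib)
  qed
  moreover have "(\<lambda>x. fw x - gw x) \<in> Lp_space 1" unfolding Lp_space_1_rep[OF r] using i by simp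
  ultimately have "AE x in ivl 0 1. wderiv (\<lambda>x. f x - g x) x = fw x - gw x" by (intro wderiv_AE_eq(3))
  then show ?thesis using rep_borel[OF fw] rep_borel[OF gw] by (simp add: rep_def)
qed

section \<open>Continuous curves in the space of integrable functions\<close>

locale L1_curve =
  fixes u :: "real \<Rightarrow> real \<Rightarrow> real"
  assumes int: "0 \<le> t \<Longrightarrow> integrable (ivl 0 1) (u t)"
    and cont: "0 \<le> t \<Longrightarrow> ((\<lambda>s. \<integral>x. \<bar>u s x - u t x\<bar> \<partial>ivl 0 1) \<longlongrightarrow> 0) (at t within {0..})"
begin

definition dL1 :: "real \<Rightarrow> real \<Rightarrow> real" where "dL1 s t = (\<integral>x. \<bar>u s x - u t x\<bar> \<partial>ivl 0 1)"

lemma dL1_triangle: "0 \<le> r \<Longrightarrow> 0 \<le> s \<Longrightarrow> 0 \<le> t \<Longrightarrow> dL1 r t \<le> dL1 r s + dL1 s t"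
proof -
  assume *: "0 \<le> r" "0 \<le> s" "0 \<le> t"
  have "dL1 r t \<le> (\<integral>x. \<bar>u r x - u s x\<bar> + \<bar>u s x - u t x\<bar> \<partial>ivl 0 1)"
    unfolding dL1_def using int[OF *(1)] int[OF *(2)] int[OF *(3)] by (intro integral_mono) auto
  then show ?thesis unfolding dL1_def using int[OF *(1)] int[OF *(2)] int[OF *(3)] by simp
qed

lemma dL1_commute: "dL1 s t = dL1 t s" by (simp add: dL1_def abs_minus_commute)

lemma dL1_self [simp]: "dL1 t t = 0" by (simp add: dL1_def)

lemma dL1_nonneg: "0 \<le> dL1 s t" by (simp add: dL1_def)

lemma dL1_small:
  assumes "0 \<le> t" "0 < e"
  obtains \<delta> where "0 < \<delta>" "\<And>s. 0 \<le> s \<Longrightarrow> \<bar>s - t\<bar> < \<delta> \<Longrightarrow> dL1 s t < e"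
proof -
  from cont[OF assms(1)] assms(2) obtain \<delta> where \<delta>: "0 < \<delta>"
    "\<And>s. s \<in> {0..} \<Longrightarrow> 0 < dist s t \<Longrightarrow> dist s t < \<delta> \<Longrightarrow> dist (\<integral>x. \<bar>u s x - u t x\<bar> \<partial>ivl 0 1) 0 < e"
    unfolding Lim_within by blast
  show thesis
  proof (rule that[OF \<delta>(1)])
    fix s assume "0 \<le> s" "\<bar>s - t\<bar> < \<delta>"
    then show "dL1 s t < e"
      using \<delta>(2)[of s] assms(2) by (cases "s = t") (auto simp: dL1_def dist_real_def)
  qed
qed

text \<open>The distance is a continuous function of two times, hence uniformly continuous on a
  compact square; it is compared with its value zero on the diagonal.\<close>

lemma dL1_uniform:
  assumes "0 < e"
  obtains \<delta> where "0 < \<delta>" "\<And>s t. 0 \<le> s \<Longrightarrow> s \<le> T \<Longrightarrow> 0 \<le> t \<Longrightarrow> t \<le> T \<Longrightarrow> \<bar>s - t\<bar> < \<delta> \<Longrightarrow> dL1 s t < e"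
proof -
  let ?S = "{0..T} \<times> {0..T}"
  have "continuous_on ?S (\<lambda>q. dL1 (fst q) (snd q))"
    unfolding continuous_on_iff
  proof (intro ballI allI impI)
    fix q and e :: real assume q: "q \<in> ?S" and e: "0 < e"
    obtain s t where st: "q = (s, t)" "0 \<le> s" "0 \<le> t" using q by auto
    obtain d1 where d1: "0 < d1" "\<And>s'. 0 \<le> s' \<Longrightarrow> \<bar>s' - s\<bar> < d1 \<Longrightarrow> dL1 s' s < e / 2"
      using dL1_small[OF st(2), of "e / 2"] e by auto
    obtain d2 where d2: "0 < d2" "\<And>s'. 0 \<le> s' \<Longrightarrow> \<bar>s' - t\<bar> < d2 \<Longrightarrow> dL1 s' t < e / 2"
      using dL1_small[OF st(3), of "e / 2"] e by auto
    show "\<exists>d>0. \<forall>x'\<in>?S. dist x' q < d \<longrightarrow> dist (dL1 (fst x') (snd x')) (dL1 (fst q) (snd q)) < e"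
    proof (intro exI[of _ "min d1 d2"] conjI ballI impI)
      fix x' assume x': "x' \<in> ?S" "dist x' q < min d1 d2"
      obtain s' t' where s't': "x' = (s', t')" "0 \<le> s'" "0 \<le> t'" using x' by auto
      have "\<bar>s' - s\<bar> < d1" "\<bar>t' - t\<bar> < d2"
        using x'(2) dist_fst_le[of x' q] dist_snd_le[of x' q] by (auto simp: s't' st dist_real_def)
      then have "dL1 s' s < e / 2" "dL1 t' t < e / 2" using d1 d2 s't' by auto
      moreover have "dL1 s' t' \<le> dL1 s' s + (dL1 s t + dL1 t t')" "dL1 s t \<le> dL1 s s' + (dL1 s' t' + dL1 t' t)"
        using dL1_triangle[of s' s t'] dL1_triangle[of s t t'] dL1_triangle[of s s' t] dL1_triangle[of s' t' t] st s't' by auto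
      ultimately show "dist (dL1 (fst x') (snd x')) (dL1 (fst q) (snd q)) < e"
        by (auto simp: s't' st dist_real_def dL1_commute[of s s'] dL1_commute[of t t'] abs_less_iff)
    qed (use d1 d2 in auto)
  qed
  then have "uniformly_continuous_on ?S (\<lambda>q. dL1 (fst q) (snd q))"
    by (rule compact_uniformly_continuous) (intro compact_Times compact_Icc)
  then obtain \<delta> where \<delta>: "0 < \<delta>" "\<And>q q'. q \<in> ?S \<Longrightarrow> q' \<in> ?S \<Longrightarrow> dist q' q < \<delta> \<Longrightarrow> dist (dL1 (fst q') (snd q')) (dL1 (fst q) (snd q)) < e"
    using assms unfolding uniformly_continuous_on_def by meson
  show thesis
  proof (rule that[OF \<delta>(1)])
    fix s t assume *: "0 \<le> s" "s \<le> T" "0 \<le> t" "t \<le> T" "\<bar>s - t\<bar> < \<delta>"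
    then have "dist (dL1 (fst (s, t)) (snd (s, t))) (dL1 (fst (t, t)) (snd (t, t))) < e"
      by (intro \<delta>(2)) (auto simp: dist_Pair_Pair dist_real_def)
    then show "dL1 s t < e" using dL1_nonneg[of s t] by (simp add: dist_real_def)
  qed
qed

lemma L1_bounded: "\<exists>B. \<forall>t. 0 \<le> t \<longrightarrow> t \<le> T \<longrightarrow> (\<integral>x. \<bar>u t x\<bar> \<partial>ivl 0 1) \<le> B"
proof -
  have "continuous_on {0..T} (\<lambda>t. \<integral>x. \<bar>u t x\<bar> \<partial>ivl 0 1)"
    unfolding continuous_on_iff
  proof (intro ballI allI impI)
    fix t e :: real assume t: "t \<in> {0..T}" and e: "0 < e"
    obtain d where d: "0 < d" "\<And>s. 0 \<le> s \<Longrightarrow> \<bar>s - t\<bar> < d \<Longrightarrow> dL1 s t < e"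
      using dL1_small[of t e] t e by auto
    have "dist (\<integral>x. \<bar>u s x\<bar> \<partial>ivl 0 1) (\<integral>x. \<bar>u t x\<bar> \<partial>ivl 0 1) < e" if s: "s \<in> {0..T}" "dist s t < d" for s
    proof -
      have i: "integrable (ivl 0 1) (u s)" "integrable (ivl 0 1) (u t)" using int s t by auto
      have "\<bar>(\<integral>x. \<bar>u s x\<bar> \<partial>ivl 0 1) - (\<integral>x. \<bar>u t x\<bar> \<partial>ivl 0 1)\<bar> = \<bar>\<integral>x. \<bar>u s x\<bar> - \<bar>u t x\<bar> \<partial>ivl 0 1\<bar>" using i by simp
      also have "\<dots> \<le> (\<integral>x. \<bar>\<bar>u s x\<bar> - \<bar>u t x\<bar>\<bar> \<partial>ivl 0 1)" by (rule integral_abs_bound)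
      also have "\<dots> \<le> dL1 s t" unfolding dL1_def using i by (intro integral_mono) auto
      also have "\<dots> < e" using d s by (auto simp: dist_real_def)
      finally show ?thesis by (simp add: dist_real_def)
    qed
    then show "\<exists>d>0. \<forall>x'\<in>{0..T}. dist x' t < d \<longrightarrow> dist (\<integral>x. \<bar>u x' x\<bar> \<partial>ivl 0 1) (\<integral>x. \<bar>u t x\<bar> \<partial>ivl 0 1) < e"
      using d(1) by blast
  qed
  then have "compact ((\<lambda>t. \<integral>x. \<bar>u t x\<bar> \<partial>ivl 0 1) ` {0..T})" by (intro compact_continuous_image) auto
  then have "bounded ((\<lambda>t. \<integral>x. \<bar>u t x\<bar> \<partial>ivl 0 1) ` {0..T})" by (rule compact_imp_bounded)
  then obtain B where "\<forall>x\<in>(\<lambda>t. \<integral>x. \<bar>u t x\<bar> \<partial>ivl 0 1) ` {0..T}. norm x \<le> B" unfolding bounded_iff by blast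
  then have "\<forall>t. 0 \<le> t \<longrightarrow> t \<le> T \<longrightarrow> (\<integral>x. \<bar>u t x\<bar> \<partial>ivl 0 1) \<le> B" by fastforce
  then show ?thesis by blast
qed

text \<open>
  The curve is approximated by step functions of time, uniformly with errors \<open>2\<^sup>-\<^sup>k\<close>; these are
  summable, so the step functions converge almost everywhere in space at every time.
\<close>

lemma joint_version:
  obtains v where "v \<in> borel_measurable (borel \<Otimes>\<^sub>M borel)" "\<And>t. 0 \<le> t \<Longrightarrow> AE x in ivl 0 1. v (t, x) = u t x"
proof -
  \<comment> \<open>The sampling time is the left grid point of mesh 1/n, so it does not exceed t
    and stays in the range [0,k] of uniform continuity.\<close>
  have "\<exists>n::nat. 0 < n \<and> (\<forall>t. 0 \<le> t \<longrightarrow> t \<le> real k \<longrightarrow> dL1 (real (nat \<lfloor>real n * t\<rfloor>) / real n) t < (1 / 2) ^ k)" for k :: nat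
  proof -
    obtain \<delta> where \<delta>: "0 < \<delta>" "\<And>s t. 0 \<le> s \<Longrightarrow> s \<le> real k \<Longrightarrow> 0 \<le> t \<Longrightarrow> t \<le> real k \<Longrightarrow> \<bar>s - t\<bar> < \<delta> \<Longrightarrow> dL1 s t < (1 / 2) ^ k"
      using dL1_uniform[of "(1 / 2) ^ k" "real k"] by auto
    obtain n :: nat where n: "1 / \<delta> < real n" using reals_Archimedean2 by blast
    have "0 < 1 / \<delta>" using \<delta>(1) by simp
    with n have n0: "0 < real n" by linarith
    have n1: "1 / real n < \<delta>" using n n0 \<delta>(1) by (simp add: field_simps)
    have "dL1 (real (nat \<lfloor>real n * t\<rfloor>) / real n) t < (1 / 2) ^ k" if t: "0 \<le> t" "t \<le> real k" for t
    proof -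
      define m where "m = real (nat \<lfloor>real n * t\<rfloor>)"
      have "0 \<le> real n * t" using t n0 by simp
      then have m: "m \<le> real n * t" "real n * t < m + 1" unfolding m_def by linarith+
      have le: "m / real n \<le> t" using m(1) n0 by (simp add: divide_le_eq mult.commute)
      have "t < m / real n + 1 / real n" using m(2) n0 by (simp add: field_simps)
      then show ?thesis unfolding m_def[symmetric] using le n1 t by (intro \<delta>(2)) (auto simp: m_def)
    qed
    then show ?thesis using n0 by auto
  qed
  then obtain n :: "nat \<Rightarrow> nat" where n: "\<And>k. 0 < n k"
    "\<And>k t. 0 \<le> t \<Longrightarrow> t \<le> real k \<Longrightarrow> dL1 (real (nat \<lfloor>real (n k) * t\<rfloor>) / real (n k)) t < (1 / 2) ^ k"
    by metis
  define U where "U k q = u (real (nat \<lfloor>real (n k) * fst q\<rfloor>) / real (n k)) (snd q)" for k and q :: "real \<times> real"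
  have um: "u (real i / real (n k)) \<in> borel_measurable borel" for i k
    using borel_measurable_integrable_ivl[OF int[of "real i / real (n k)"]] by simp
  have Um: "U k \<in> borel_measurable (borel \<Otimes>\<^sub>M borel)" for k
    unfolding U_def
  proof (rule measurable_compose_countable[where f="\<lambda>i q. u (real i / real (n k)) (snd q)" and g="\<lambda>q. nat \<lfloor>real (n k) * fst q\<rfloor>"])
    show "(\<lambda>q. u (real i / real (n k)) (snd q)) \<in> borel_measurable (borel \<Otimes>\<^sub>M borel)" for i
      by (rule measurable_compose[OF _ um]) measurable
    show "(\<lambda>q. nat \<lfloor>real (n k) * fst q\<rfloor>) \<in> borel \<Otimes>\<^sub>M borel \<rightarrow>\<^sub>M count_space UNIV" by measurable
  qed
  \<comment> \<open>Where the sequence diverges \<open>lim\<close> takes an unspecified value; at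
    each time t \<ge> 0 this concerns only a null set of positions.\<close>
  define v where "v q = lim (\<lambda>k. U k q)" for q
  show thesis
  proof (rule that)
    show "v \<in> borel_measurable (borel \<Otimes>\<^sub>M borel)" unfolding v_def by (rule borel_measurable_lim_metric) (rule Um)
    fix t :: real assume t: "0 \<le> t"
    \<comment> \<open>The error estimate of step k is valid for t \<le> k, hence the summation
      starts at \<open>K\<close>.\<close>
    obtain K :: nat where K: "t \<le> real K" using real_arch_simple by blast
    define \<tau> where "\<tau> k = real (nat \<lfloor>real (n k) * t\<rfloor>) / real (n k)" for k
    have \<tau>: "0 \<le> \<tau> k" for k by (simp add: \<tau>_def)
    have [measurable]: "u t \<in> borel_measurable borel" "u (\<tau> k) \<in> borel_measurable borel" for k
      using int[OF t] int[OF \<tau>] by (auto dest: borel_measurable_integrable_ivl)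
    have le: "(\<integral>\<^sup>+x. ennreal \<bar>u (\<tau> (k + K)) x - u t x\<bar> \<partial>ivl 0 1) \<le> ennreal ((1 / 2) ^ k)" for k
    proof -
      have "(\<integral>\<^sup>+x. ennreal \<bar>u (\<tau> (k + K)) x - u t x\<bar> \<partial>ivl 0 1) = ennreal (dL1 (\<tau> (k + K)) t)"
        unfolding dL1_def using int[OF t] int[OF \<tau>] by (intro nn_integral_eq_integral) auto
      also have "\<dots> \<le> ennreal ((1 / 2) ^ (k + K))"
        using n(2)[of t "k + K"] t K unfolding \<tau>_def by (intro ennreal_leI) simp
      also have "\<dots> \<le> ennreal ((1 / 2) ^ k)" by (intro ennreal_leI power_decreasing) auto
      finally show ?thesis .
    qed
    have "(\<integral>\<^sup>+x. (\<Sum>k. ennreal \<bar>u (\<tau> (k + K)) x - u t x\<bar>) \<partial>ivl 0 1) = (\<Sum>k. \<integral>\<^sup>+x. ennreal \<bar>u (\<tau> (k + K)) x - u t x\<bar> \<partial>ivl 0 1)"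
      by (rule nn_integral_suminf) measurable
    also have "\<dots> \<le> (\<Sum>k. ennreal ((1 / 2) ^ k))" by (intro suminf_le le) auto
    also have "\<dots> = ennreal (\<Sum>k. (1 / 2) ^ k)" by (intro suminf_ennreal2) auto
    finally have "(\<integral>\<^sup>+x. (\<Sum>k. ennreal \<bar>u (\<tau> (k + K)) x - u t x\<bar>) \<partial>ivl 0 1) \<noteq> \<infinity>"
      by (auto simp: top_unique)
    then have "AE x in ivl 0 1. (\<Sum>k. ennreal \<bar>u (\<tau> (k + K)) x - u t x\<bar>) \<noteq> \<infinity>"
      by (intro nn_integral_PInf_AE) measurable
    then show "AE x in ivl 0 1. v (t, x) = u t x"
    proof eventually_elim
      case (elim x)
      have "summable (\<lambda>k. \<bar>u (\<tau> (k + K)) x - u t x\<bar>)"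
        by (rule summable_suminf_not_top) (use elim in auto)
      then have "(\<lambda>k. \<bar>u (\<tau> (k + K)) x - u t x\<bar>) \<longlonglongrightarrow> 0" by (rule summable_LIMSEQ_zero)
      then have "(\<lambda>k. u (\<tau> (k + K)) x - u t x) \<longlonglongrightarrow> 0" by (simp add: tendsto_rabs_zero_iff)
      then have "(\<lambda>k. u (\<tau> (k + K)) x) \<longlonglongrightarrow> u t x" by (simp add: LIM_zero_iff)
      then have "(\<lambda>k. u (\<tau> k) x) \<longlonglongrightarrow> u t x" by (rule LIMSEQ_offset)
      then have "(\<lambda>k. U k (t, x)) \<longlonglongrightarrow> u t x" by (simp add: U_def \<tau>_def)
      then show ?case unfolding v_def by (rule limI)
    qed
  qed
qed

end

lemma integrable_pair_bounded:
  fixes f :: "real \<times> real \<Rightarrow> real"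
  assumes "f \<in> borel_measurable (borel \<Otimes>\<^sub>M borel)" "\<And>q. \<bar>f q\<bar> \<le> B"
  shows "integrable (ivl a b \<Otimes>\<^sub>M ivl c d) f"
proof (rule finite_measure.integrable_const_bound)
  show "finite_measure (ivl a b \<Otimes>\<^sub>M ivl c d)"
    by (rule finite_measure_pair_measure) (rule finite_measure_ivl)+
  show "AE x in ivl a b \<Otimes>\<^sub>M ivl c d. norm (f x) \<le> B" using assms(2) by simp
  show "f \<in> borel_measurable (ivl a b \<Otimes>\<^sub>M ivl c d)" using assms(1) by simp
qed

section \<open>Reduction of weak solutions\<close>

lemma borel_continuous_Icc:
  fixes f :: "real \<Rightarrow> real"
  assumes "continuous_on {0..1} f" shows "(\<lambda>x. indicator {0..1} x * f x) \<in> borel_measurable borel"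
  using borel_measurable_continuous_on_indicator[OF _ assms] by simp

text \<open>\<open>v\<close> is an input because its construction differs in the two solution
  classes. The bound on the derivative is required for every representative, since \<open>w\<close>
  is chosen only in the proof.\<close>

lemma reduce_solution:
  fixes a \<sigma> :: "real \<Rightarrow> real"
  assumes p: "admissible p" and a: "continuous_on {0..1} a" and \<sigma>: "continuous_on UNIV \<sigma>"
    and H: "\<And>t. 0 \<le> t \<Longrightarrow> (z t, zt t) \<in> H_space p"
    and v_int: "\<And>T. integrable (ivl 0 T \<Otimes>\<^sub>M ivl 0 1) v"
    and g_int: "\<And>T. integrable (ivl 0 T \<Otimes>\<^sub>M ivl 0 1) (\<lambda>(s, x). indicator {0..1} x * a x * \<sigma> (v (s, x)))"
    and v_eq: "\<And>T. AE s in ivl 0 T. AE x in ivl 0 1. zt s x = v (s, x)"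
    and pos: "\<And>\<phi> t. \<phi> \<in> test_functions \<Longrightarrow> 0 \<le> t \<Longrightarrow> pairing (z t) \<phi> = pairing (z 0) \<phi> + (\<integral>s. (\<integral>x. v (s, x) * \<phi> x \<partial>ivl 0 1) \<partial>ivl 0 t)"
    and weak: "weak_wave_eq a \<sigma> z zt"
    and bound: "\<And>T. \<exists>B. AE s in ivl 0 T. \<forall>w. rep (wderiv (z s)) w \<longrightarrow> (\<integral>x. \<bar>w x\<bar> \<partial>ivl 0 1) \<le> B"
  obtains w u \<zeta> where "\<And>t. 0 \<le> t \<Longrightarrow> rep (wderiv (z t)) (w t)" "\<And>t. 0 \<le> t \<Longrightarrow> rep (zt t) (u t)"
    "reduced_solution w u \<zeta> v (\<lambda>(s, x). indicator {0..1} x * a x * \<sigma> (v (s, x)))"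
proof -
  let ?g = "\<lambda>(s, x). indicator {0..1} x * a x * \<sigma> (v (s, x))"
  have zW: "z t \<in> W01p p" "zt t \<in> Lp_space p" if "0 \<le> t" for t using H[OF that] by (auto simp: H_space_def)
  then have zW1: "z t \<in> W1p p" if "0 \<le> t" for t using that by (auto simp: W01p_def)
  have "\<exists>w. rep (wderiv (z t)) w" if "0 \<le> t" for t
    using rep_exists[OF Lp_space_measurable[OF W1p_wderiv(2)[OF zW1[OF that] p]]] .
  then obtain w where w: "\<And>t. 0 \<le> t \<Longrightarrow> rep (wderiv (z t)) (w t)" by metis
  have "\<exists>u. rep (zt t) u" if "0 \<le> t" for t using rep_exists[OF Lp_space_measurable[OF zW(2)[OF that]]] .
  then obtain u where u: "\<And>t. 0 \<le> t \<Longrightarrow> rep (zt t) (u t)" by metis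
  \<comment> \<open>Continuity of z at time t is known on [0,1] and for t \<ge> 0; setting it to
    zero elsewhere gives a Borel function at every time.\<close>
  define \<zeta> where "\<zeta> t x = (if 0 \<le> t then indicator {0..1} x * z t x else 0)" for t x
  have \<zeta>_borel: "\<zeta> t \<in> borel_measurable borel" for t
    unfolding \<zeta>_def using zW(1)[of t] borel_continuous_Icc[of "z t"] by (cases "0 \<le> t") (auto simp: W01p_def)
  have \<zeta>: "rep (z t) (\<zeta> t)" if "0 \<le> t" for t
    unfolding rep_def using \<zeta>_borel that by (auto simp: AE_ivl \<zeta>_def)
  have [measurable]: "v \<in> borel_measurable (borel \<Otimes>\<^sub>M borel)" using borel_measurable_integrable[OF v_int[of 0]] by simp
  have gm[measurable]: "?g \<in> borel_measurable (borel \<Otimes>\<^sub>M borel)" using borel_measurable_integrable[OF g_int[of 0]] by simp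
  have [measurable]: "\<sigma> \<in> borel_measurable borel" by (rule borel_measurable_continuous_onI[OF \<sigma>])
  have [measurable]: "(\<lambda>x. indicator {0..1} x * a x) \<in> borel_measurable borel" by (rule borel_continuous_Icc[OF a])
  have pz: "pairing (z t) \<phi> = (\<integral>x. \<zeta> t x * \<phi> x \<partial>ivl 0 1)" if "0 \<le> t" "\<phi> \<in> test_functions" for t \<phi>
    by (rule pairing_rep[OF \<zeta>[OF that(1)] test_function_borel[OF that(2)]])
  have pzt: "pairing (zt t) \<phi> = (\<integral>x. u t x * \<phi> x \<partial>ivl 0 1)" if "0 \<le> t" "\<phi> \<in> test_functions" for t \<phi>
    by (rule pairing_rep[OF u[OF that(1)] test_function_borel[OF that(2)]])
  have inner: "(\<lambda>s. \<integral>x. h (s, x) * \<phi> x \<partial>ivl 0 1) \<in> borel_measurable borel"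
    if [measurable]: "h \<in> borel_measurable (borel \<Otimes>\<^sub>M borel)" "\<phi> \<in> borel_measurable borel" for h \<phi> :: "_ \<Rightarrow> real"
    by (rule ivl.borel_measurable_lebesgue_integral) measurable
  have "reduced_solution w u \<zeta> v ?g"
  proof
    note prim = W01p_primitive[OF zW(1) p w]
    show "integrable (ivl 0 1) (w t)" if "0 \<le> t" for t by (rule prim(1)[OF that that])
    show "\<zeta> t x = integral\<^sup>L (ivl 0 x) (w t)" if "0 \<le> t" "0 \<le> x" "x \<le> 1" for t x
      using prim(2)[OF that(1,1,2,3)] that by (simp add: \<zeta>_def)
    show "integral\<^sup>L (ivl 0 1) (w t) = 0" if "0 \<le> t" for t by (rule prim(3)[OF that that])
    show "integrable (ivl 0 1) (u t)" if "0 \<le> t" for t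
      using Lp_L1[OF zW(2)[OF that]] p Lp_space_1_rep[OF u[OF that]] by (simp add: admissible_def)
    show "AE s in ivl 0 T. AE x in ivl 0 1. v (s, x) = u s x" for T
    proof -
      have "AE s in ivl 0 T. 0 \<le> s" by (auto simp: AE_ivl)
      with v_eq[of T] show ?thesis
      proof eventually_elim
        case (elim s)
        from elim(1) rep_AE[OF u[OF elim(2)]] show ?case by eventually_elim simp
      qed
    qed
    show "\<exists>B. AE s in ivl 0 T. (\<integral>x. \<bar>w s x\<bar> \<partial>ivl 0 1) \<le> B" for T
    proof -
      obtain B where B: "AE s in ivl 0 T. \<forall>w. rep (wderiv (z s)) w \<longrightarrow> (\<integral>x. \<bar>w x\<bar> \<partial>ivl 0 1) \<le> B" using bound by blast
      have "AE s in ivl 0 T. 0 \<le> s" by (auto simp: AE_ivl)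
      with B have "AE s in ivl 0 T. (\<integral>x. \<bar>w s x\<bar> \<partial>ivl 0 1) \<le> B" by eventually_elim (use w in blast)
      then show ?thesis by blast
    qed
    show position: "(\<integral>x. \<zeta> t x * \<phi> x \<partial>ivl 0 1) = (\<integral>x. \<zeta> 0 x * \<phi> x \<partial>ivl 0 1) + (\<integral>s. (\<integral>x. v (s, x) * \<phi> x \<partial>ivl 0 1) \<partial>ivl 0 t)"
      if "\<phi> \<in> test_functions" "0 \<le> t" for \<phi> t
      using pos[OF that] unfolding pz[OF that(2,1)] pz[OF order_refl that(1)] .
    show "(\<integral>x. u t x * \<phi> x \<partial>ivl 0 1) = (\<integral>x. u 0 x * \<phi> x \<partial>ivl 0 1) +
        (\<integral>s. ((\<integral>x. \<zeta> 0 x * deriv (deriv \<phi>) x \<partial>ivl 0 1) + (\<integral>r. (\<integral>x. v (r, x) * deriv (deriv \<phi>) x \<partial>ivl 0 1) \<partial>ivl 0 s))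
           - (\<integral>x. ?g (s, x) * \<phi> x \<partial>ivl 0 1) \<partial>ivl 0 t)"
      if \<phi>: "\<phi> \<in> test_functions" and t: "0 \<le> t" for \<phi> t
    proof -
      let ?dd = "deriv (deriv \<phi>)"
      have dd: "?dd \<in> test_functions" by (intro deriv_test_function \<phi>)
      note [measurable] = test_function_borel[OF \<phi>] test_function_borel[OF dd]
      define f' where "f' s = ((\<integral>x. \<zeta> 0 x * ?dd x \<partial>ivl 0 1) + (\<integral>r. (\<integral>x. v (r, x) * ?dd x \<partial>ivl 0 1) \<partial>ivl 0 s))
           - (\<integral>x. ?g (s, x) * \<phi> x \<partial>ivl 0 1)" for s
      have [measurable]: "(\<lambda>s. \<integral>r. (\<integral>x. v (r, x) * ?dd x \<partial>ivl 0 1) \<partial>ivl 0 s) \<in> borel_measurable borel"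
        by (rule borel_measurable_integral_ivl) (rule inner; measurable)
      have [measurable]: "(\<lambda>s. \<integral>x. ?g (s, x) * \<phi> x \<partial>ivl 0 1) \<in> borel_measurable borel" by (rule inner[OF gm]) measurable
      have f'm: "f' \<in> borel_measurable borel" unfolding f'_def by measurable
      have "AE s in ivl 0 t. 0 \<le> s" by (auto simp: AE_ivl)
      with v_eq[of t] have ae: "AE s in ivl 0 t. pairing (z s) ?dd - pairing (\<lambda>x. a x * \<sigma> (zt s x)) \<phi> = f' s"
      proof eventually_elim
        case (elim s)
        have "rep (\<lambda>x. a x * \<sigma> (zt s x)) (\<lambda>x. ?g (s, x))"
          unfolding rep_def
        proof
          show "(\<lambda>x. ?g (s, x)) \<in> borel_measurable borel" by measurable
          show "AE x in ivl 0 1. a x * \<sigma> (zt s x) = ?g (s, x)"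
            using elim(1) AE_ivl01 by eventually_elim auto
        qed
        then have "pairing (\<lambda>x. a x * \<sigma> (zt s x)) \<phi> = (\<integral>x. ?g (s, x) * \<phi> x \<partial>ivl 0 1)"
          by (rule pairing_rep) measurable
        then show ?case unfolding f'_def position[OF dd elim(2), symmetric] pz[OF elim(2) dd] by simp
      qed
      have "(LINT s|lebesgue_on {0..t}. pairing (z s) ?dd - pairing (\<lambda>x. a x * \<sigma> (zt s x)) \<phi>) = integral\<^sup>L (ivl 0 t) f'"
        using lebesgue_on_AE_eq(3)[of "{0..t}" f' "\<lambda>s. pairing (z s) ?dd - pairing (\<lambda>x. a x * \<sigma> (zt s x)) \<phi>"] ae f'm
        by (simp add: AE_ivl integral_ivl)
      moreover have "pairing (zt t) \<phi> = pairing (zt 0) \<phi> + (LINT s|lebesgue_on {0..t}. pairing (z s) ?dd - pairing (\<lambda>x. a x * \<sigma> (zt s x)) \<phi>)"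
        using weak \<phi> t unfolding weak_wave_eq_def by blast
      ultimately have "(\<integral>x. u t x * \<phi> x \<partial>ivl 0 1) = (\<integral>x. u 0 x * \<phi> x \<partial>ivl 0 1) + integral\<^sup>L (ivl 0 t) f'"
        unfolding pzt[OF t \<phi>] pzt[OF order_refl \<phi>] by (simp only:)
      then show ?thesis unfolding f'_def .
    qed
  qed (use v_int g_int \<zeta>_borel in auto)
  note red = this
  show thesis by (rule that[of w u \<zeta>]) (erule w, erule u, rule red)
qed

text \<open>Hides the representatives, so that both solution classes enter the decay estimate in the
  same way.\<close>

definition reduces :: "(real \<Rightarrow> real) \<Rightarrow> (real \<Rightarrow> real) \<Rightarrow> (real \<Rightarrow> real \<Rightarrow> real) \<Rightarrow> (real \<Rightarrow> real \<Rightarrow> real) \<Rightarrow> bool" where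
  "reduces a \<sigma> z zt \<longleftrightarrow> (\<exists>w u \<zeta> v. (\<forall>t\<ge>0. rep (wderiv (z t)) (w t) \<and> rep (zt t) (u t)) \<and>
     reduced_solution w u \<zeta> v (\<lambda>(s, x). indicator {0..1} x * a x * \<sigma> (v (s, x))))"

lemma reducesI:
  fixes a \<sigma> :: "real \<Rightarrow> real"
  assumes "admissible p" "continuous_on {0..1} a" "continuous_on UNIV \<sigma>"
    and "\<And>t. 0 \<le> t \<Longrightarrow> (z t, zt t) \<in> H_space p"
    and "\<And>T. integrable (ivl 0 T \<Otimes>\<^sub>M ivl 0 1) v"
    and "\<And>T. integrable (ivl 0 T \<Otimes>\<^sub>M ivl 0 1) (\<lambda>(s, x). indicator {0..1} x * a x * \<sigma> (v (s, x)))"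
    and "\<And>T. AE s in ivl 0 T. AE x in ivl 0 1. zt s x = v (s, x)"
    and "\<And>\<phi> t. \<phi> \<in> test_functions \<Longrightarrow> 0 \<le> t \<Longrightarrow> pairing (z t) \<phi> = pairing (z 0) \<phi> + (\<integral>s. (\<integral>x. v (s, x) * \<phi> x \<partial>ivl 0 1) \<partial>ivl 0 t)"
    and "weak_wave_eq a \<sigma> z zt"
    and "\<And>T. \<exists>B. AE s in ivl 0 T. \<forall>w. rep (wderiv (z s)) w \<longrightarrow> (\<integral>x. \<bar>w x\<bar> \<partial>ivl 0 1) \<le> B"
  shows "reduces a \<sigma> z zt"
  by (rule reduce_solution[OF assms]) (auto simp: reduces_def)

section \<open>Reduction of the two classes of solutions\<close>

lemma a_ext_bounds:
  fixes a :: "real \<Rightarrow> real"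
  assumes "\<forall>x\<in>{0..1}. 0 \<le> a x \<and> a x \<le> A" "0 < A"
  shows "0 \<le> indicator {0..1} x * a x" "indicator {0..1} x * a x \<le> A"
  using assms by (auto simp: indicator_def)

text \<open>Joint measurability is part of this solution class; by Fubini a Borel version agrees
  with z_t on almost every time slice.\<close>

lemma solution_inf_reduces:
  fixes a \<sigma> :: "real \<Rightarrow> real"
  assumes a: "continuous_on {0..1} a" "\<forall>x\<in>{0..1}. 0 \<le> a x \<and> a x \<le> A" "0 < A" and \<sigma>: "continuous_on UNIV \<sigma>"
    and sol: "wave_solution \<infinity> a \<sigma> z0 z1 z zt"
  shows "reduces a \<sigma> z zt"
proof -
  have z: "z \<in> Linf_W1inf" and W: "W1inf_Linf_deriv z zt" and H: "\<And>t. 0 \<le> t \<Longrightarrow> (z t, zt t) \<in> H_space \<infinity>" and weak: "weak_wave_eq a \<sigma> z zt"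
    using sol by (auto simp: wave_solution_def)
  have zt: "zt \<in> Linf_Linf" using W by (simp add: W1inf_Linf_deriv_def)
  let ?S = "{0..} \<times> {0<..<1} :: (real \<times> real) set"
  have meas: "(\<lambda>(t, x). zt t x) \<in> borel_measurable (lebesgue_on ?S)" using zt by (simp add: Linf_Linf_def)
  obtain M where M: "AE t in lebesgue_on {0..}. zt t \<in> Lp_space \<infinity> \<and> Lp_norm \<infinity> (zt t) \<le> M"
    using zt by (auto simp: Linf_Linf_def)
  have S: "?S \<in> sets borel" by (intro borel_Times) auto
  obtain h where hb: "h \<in> borel_measurable borel" and h: "AE q in lborel. q \<in> ?S \<longrightarrow> (case q of (t, x) \<Rightarrow> zt t x) = h q"
    by (rule lebesgue_on_borel_rep[OF S meas])
  have hm[measurable]: "h \<in> borel_measurable (borel \<Otimes>\<^sub>M borel)" using hb by (simp add: borel_prod)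
  have "AE q in lborel \<Otimes>\<^sub>M lborel. q \<in> ?S \<longrightarrow> (case q of (t, x) \<Rightarrow> zt t x) = h q" 
    unfolding lborel_prod by (rule h)
  from lborel_pair.AE_pair[OF this]
  have h2: "AE t in lborel. AE x in lborel. (t, x) \<in> ?S \<longrightarrow> zt t x = h (t, x)" by simp
  \<comment> \<open>The truncation makes \<open>v\<close> bounded everywhere; since z_t is bounded
    by \<open>M\<close> at almost every time, it changes the function only on a null set.\<close>
  define v where "v q = max (- \<bar>M\<bar>) (min \<bar>M\<bar> (h q))" for q
  have [measurable]: "v \<in> borel_measurable (borel \<Otimes>\<^sub>M borel)" unfolding v_def by measurable
  have vb: "\<bar>v q\<bar> \<le> \<bar>M\<bar>" for q by (auto simp: v_def)
  have [measurable]: "\<sigma> \<in> borel_measurable borel" by (rule borel_measurable_continuous_onI[OF \<sigma>])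
  have [measurable]: "(\<lambda>x. indicator {0..1} x * a x) \<in> borel_measurable borel" by (rule borel_continuous_Icc[OF a(1)])
  have "compact (\<sigma> ` {-\<bar>M\<bar>..\<bar>M\<bar>})" by (intro compact_continuous_image continuous_on_subset[OF \<sigma>]) auto
  then have "bounded (\<sigma> ` {-\<bar>M\<bar>..\<bar>M\<bar>})" by (rule compact_imp_bounded)
  then obtain B where "\<forall>y\<in>\<sigma> ` {-\<bar>M\<bar>..\<bar>M\<bar>}. norm y \<le> B" unfolding bounded_iff by blast
  then have B: "\<bar>\<sigma> (v q)\<bar> \<le> B" for q using vb[of q] by (auto simp: abs_le_iff)
  have v_eq: "AE s in ivl 0 T. AE x in ivl 0 1. zt s x = v (s, x)" for T
  proof -
    have M': "AE t in lborel. t \<in> {0..} \<longrightarrow> zt t \<in> Lp_space \<infinity> \<and> Lp_norm \<infinity> (zt t) \<le> M"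
      using M by (subst (asm) AE_lebesgue_on) auto
    from h2 M' show ?thesis
      unfolding AE_ivl[of _ 0 T]
    proof eventually_elim
      case (elim s)
      show ?case
      proof
        assume s: "0 \<le> s \<and> s \<le> T"
        have "AE x in ivl 0 1. zt s x = h (s, x)"
          unfolding AE_ivl01_open using elim(1) by eventually_elim (use s in auto)
        moreover have "AE x in ivl 0 1. \<bar>zt s x\<bar> \<le> M"
          using Linf_norm_AE(1)[of "zt s"] elim(2) s by (auto elim!: AE_mp)
        ultimately show "AE x in ivl 0 1. zt s x = v (s, x)"
          by eventually_elim (auto simp: v_def)
      qed
    qed
  qed
  show ?thesis
  proof (rule reducesI[OF _ a(1) \<sigma> H _ _ v_eq _ weak])
    show "admissible \<infinity>" by (simp add: admissible_def)
    show "integrable (ivl 0 T \<Otimes>\<^sub>M ivl 0 1) v" for T by (rule integrable_pair_bounded[OF _ vb]) simp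
    show "integrable (ivl 0 T \<Otimes>\<^sub>M ivl 0 1) (\<lambda>(s, x). indicator {0..1} x * a x * \<sigma> (v (s, x)))" for T
    proof (rule integrable_pair_bounded)
      show "(\<lambda>(s, x). indicator {0..1} x * a x * \<sigma> (v (s, x))) \<in> borel_measurable (borel \<Otimes>\<^sub>M borel)"
        unfolding split_beta by measurable
      fix q :: "real \<times> real"
      have "\<bar>indicator {0..1} (snd q) * a (snd q)\<bar> \<le> A" using a_ext_bounds[OF a(2,3), of "snd q"] by simp
      then have "\<bar>indicator {0..1} (snd q) * a (snd q)\<bar> * \<bar>\<sigma> (v q)\<bar> \<le> A * B" using B[of q] a(3) by (intro mult_mono) auto
      then show "\<bar>case q of (s, x) \<Rightarrow> indicator {0..1} x * a x * \<sigma> (v (s, x))\<bar> \<le> A * B"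
        by (simp add: split_beta abs_mult)
    qed
    show "pairing (z t) \<phi> = pairing (z 0) \<phi> + (\<integral>s. (\<integral>x. v (s, x) * \<phi> x \<partial>ivl 0 1) \<partial>ivl 0 t)"
      if \<phi>: "\<phi> \<in> test_functions" and t: "0 \<le> t" for \<phi> t
    proof -
      note [measurable] = test_function_borel[OF \<phi>]
      have m: "(\<lambda>s. \<integral>x. v (s, x) * \<phi> x \<partial>ivl 0 1) \<in> borel_measurable borel"
        by (rule ivl.borel_measurable_lebesgue_integral) measurable
      have "AE s in ivl 0 t. pairing (zt s) \<phi> = (\<integral>x. v (s, x) * \<phi> x \<partial>ivl 0 1)"
        using v_eq[of t]
      proof eventually_elim
        case (elim s)
        then have "rep (zt s) (\<lambda>x. v (s, x))" by (simp add: rep_def)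
        then show ?case by (rule pairing_rep) measurable
      qed
      then have "(LINT s|lebesgue_on {0..t}. pairing (zt s) \<phi>) = (\<integral>s. (\<integral>x. v (s, x) * \<phi> x \<partial>ivl 0 1) \<partial>ivl 0 t)"
        using lebesgue_on_AE_eq(3)[OF _ m, of "{0..t}" "\<lambda>s. pairing (zt s) \<phi>"] m
        by (simp add: AE_ivl integral_ivl)
      moreover have "pairing (z t) \<phi> = pairing (z 0) \<phi> + (LINT s|lebesgue_on {0..t}. pairing (zt s) \<phi>)"
        using W \<phi> t unfolding W1inf_Linf_deriv_def by blast
      ultimately show ?thesis by (simp only:)
    qed
    show "\<exists>B. AE s in ivl 0 T. \<forall>w. rep (wderiv (z s)) w \<longrightarrow> (\<integral>x. \<bar>w x\<bar> \<partial>ivl 0 1) \<le> B" for T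
    proof -
      obtain N where "AE t in lebesgue_on {0..}. z t \<in> W1p \<infinity> \<and> W1p_norm \<infinity> (z t) \<le> N"
        using z by (auto simp: Linf_W1inf_def)
      then have N: "AE t in lborel. t \<in> {0..} \<longrightarrow> z t \<in> W1p \<infinity> \<and> W1p_norm \<infinity> (z t) \<le> N"
        by (subst (asm) AE_lebesgue_on) auto
      have "AE s in ivl 0 T. \<forall>w. rep (wderiv (z s)) w \<longrightarrow> (\<integral>x. \<bar>w x\<bar> \<partial>ivl 0 1) \<le> N"
        unfolding AE_ivl[of _ 0 T] using N
      proof eventually_elim
        case (elim s)
        show ?case
        proof (intro impI allI)
          fix w assume s: "0 \<le> s \<and> s \<le> T" and w: "rep (wderiv (z s)) w"
          have zs: "z s \<in> W1p \<infinity>" "W1p_norm \<infinity> (z s) \<le> N" using elim s by auto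
          have ad: "admissible \<infinity>" by (simp add: admissible_def)
          note L = Linf_norm_AE[OF W1p_wderiv(2)[OF zs(1) ad]]
          have "0 \<le> Lp_norm \<infinity> (z s)" by (rule Linf_norm_AE(2)[OF W1p_wderiv(1)[OF zs(1) ad]])
          then have le: "Lp_norm \<infinity> (wderiv (z s)) \<le> N" using zs(2) by (simp add: W1p_norm_def)
          have [measurable]: "w \<in> borel_measurable borel" by (rule rep_borel[OF w])
          have iw: "integrable (ivl 0 1) w" using W1p_wderiv(3)[OF zs(1) ad] Lp_space_1_rep[OF w] by simp
          have "(\<integral>x. \<bar>w x\<bar> \<partial>ivl 0 1) \<le> (\<integral>x. N \<partial>ivl 0 1)"
          proof (rule integral_mono_AE)
            show "AE x in ivl 0 1. \<bar>w x\<bar> \<le> N" using L(1) rep_AE[OF w] by eventually_elim (use le in auto)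
          qed (use iw in auto)
          then show "(\<integral>x. \<bar>w x\<bar> \<partial>ivl 0 1) \<le> N" by (simp add: measure_ivl)
        qed
      qed
      then show ?thesis by blast
    qed
  qed
qed

lemma integrable_powr_diff:
  fixes f g :: "real \<Rightarrow> real"
  assumes [measurable]: "f \<in> borel_measurable borel" "g \<in> borel_measurable borel" and r: "1 \<le> r"
    and i: "integrable (ivl 0 1) (\<lambda>x. \<bar>f x\<bar> powr r)" "integrable (ivl 0 1) (\<lambda>x. \<bar>g x\<bar> powr r)"
  shows "integrable (ivl 0 1) (\<lambda>x. \<bar>f x - g x\<bar> powr r)"
proof (rule Bochner_Integration.integrable_bound)
  show "integrable (ivl 0 1) (\<lambda>x. 2 powr r * (\<bar>f x\<bar> powr r + \<bar>g x\<bar> powr r))" using i by simp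
  show "AE x in ivl 0 1. norm (\<bar>f x - g x\<bar> powr r) \<le> norm (2 powr r * (\<bar>f x\<bar> powr r + \<bar>g x\<bar> powr r))"
  proof (rule AE_I2)
    fix x
    have "\<bar>f x - g x\<bar> powr r \<le> (\<bar>f x\<bar> + \<bar>g x\<bar>) powr r" using r by (intro powr_mono2) auto
    also have "\<dots> \<le> 2 powr r * (\<bar>f x\<bar> powr r + \<bar>g x\<bar> powr r)" by (rule powr_add2_le) (use r in auto)
    finally show "norm (\<bar>f x - g x\<bar> powr r) \<le> norm (2 powr r * (\<bar>f x\<bar> powr r + \<bar>g x\<bar> powr r))" by simp
  qed
qed simp

lemma C0_Lp_curve:
  assumes C: "f \<in> C0_Lp (ereal r)" and r: "1 \<le> r" and f': "\<And>t. 0 \<le> t \<Longrightarrow> rep (f t) (f' t)"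
  shows "L1_curve f'"
proof
  have i: "integrable (ivl 0 1) (\<lambda>x. \<bar>f' t x\<bar> powr r)" if "0 \<le> t" for t
    using C that Lp_space_rep[OF f'[OF that]] by (auto simp: C0_Lp_def)
  show "integrable (ivl 0 1) (f' t)" if "0 \<le> t" for t
    by (rule ivl.integrable_powr_imp_integrable[OF _ i[OF that] r]) (use rep_borel[OF f'[OF that]] in simp)
  show "((\<lambda>s. \<integral>x. \<bar>f' s x - f' t x\<bar> \<partial>ivl 0 1) \<longlongrightarrow> 0) (at t within {0..})" if t: "0 \<le> t" for t
  proof (rule Lim_null_comparison)
    show "((\<lambda>s. Lp_norm (ereal r) (\<lambda>x. f s x - f t x)) \<longlongrightarrow> 0) (at t within {0..})"
      using C t by (simp add: C0_Lp_def)
    show "\<forall>\<^sub>F s in at t within {0..}. norm (\<integral>x. \<bar>f' s x - f' t x\<bar> \<partial>ivl 0 1) \<le> Lp_norm (ereal r) (\<lambda>x. f s x - f t x)"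
      unfolding eventually_at_filter
    proof (intro always_eventually allI impI)
      fix s :: real assume "s \<in> {0..}"
      then have s: "0 \<le> s" by simp
      note b = rep_borel[OF f'[OF s]] rep_borel[OF f'[OF t]]
      have "(\<integral>x. \<bar>f' s x - f' t x\<bar> \<partial>ivl 0 1) \<le> Lq r (\<lambda>x. f' s x - f' t x)"
        by (rule Lq_1_le[OF _ integrable_powr_diff[OF b r i[OF s] i[OF t]] r]) (use b in measurable)
      also have "\<dots> = Lp_norm (ereal r) (\<lambda>x. f s x - f t x)"
        by (rule Lp_norm_rep[OF rep_diff[OF f'[OF s] f'[OF t]], symmetric])
      finally show "norm (\<integral>x. \<bar>f' s x - f' t x\<bar> \<partial>ivl 0 1) \<le> Lp_norm (ereal r) (\<lambda>x. f s x - f t x)" by simp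
    qed
  qed
qed

lemma Lp_norm_nonneg: "0 \<le> Lp_norm (ereal r) f"
  by (simp add: Lp_norm_def)

lemma C0_W1p_curve:
  assumes C: "z \<in> C0_W1p (ereal r)" and r: "1 \<le> r" and w: "\<And>t. 0 \<le> t \<Longrightarrow> rep (wderiv (z t)) (w t)"
  shows "L1_curve w"
proof
  have ad: "admissible (ereal r)" using r by (auto simp: admissible_def)
  have zW: "z t \<in> W1p (ereal r)" if "0 \<le> t" for t using C that by (simp add: C0_W1p_def)
  have i: "integrable (ivl 0 1) (\<lambda>x. \<bar>w t x\<bar> powr r)" if "0 \<le> t" for t
    using W1p_wderiv(2)[OF zW[OF that] ad] Lp_space_rep[OF w[OF that]] by simp
  show "integrable (ivl 0 1) (w t)" if "0 \<le> t" for t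
    by (rule ivl.integrable_powr_imp_integrable[OF _ i[OF that] r]) (use rep_borel[OF w[OF that]] in simp)
  show "((\<lambda>s. \<integral>x. \<bar>w s x - w t x\<bar> \<partial>ivl 0 1) \<longlongrightarrow> 0) (at t within {0..})" if t: "0 \<le> t" for t
  proof (rule Lim_null_comparison)
    show "((\<lambda>s. W1p_norm (ereal r) (\<lambda>x. z s x - z t x)) \<longlongrightarrow> 0) (at t within {0..})"
      using C t by (simp add: C0_W1p_def)
    show "\<forall>\<^sub>F s in at t within {0..}. norm (\<integral>x. \<bar>w s x - w t x\<bar> \<partial>ivl 0 1) \<le> W1p_norm (ereal r) (\<lambda>x. z s x - z t x)"
      unfolding eventually_at_filter
    proof (intro always_eventually allI impI)
      fix s :: real assume "s \<in> {0..}"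
      then have s: "0 \<le> s" by simp
      note b = rep_borel[OF w[OF s]] rep_borel[OF w[OF t]]
      have "(\<integral>x. \<bar>w s x - w t x\<bar> \<partial>ivl 0 1) \<le> Lq r (\<lambda>x. w s x - w t x)"
        by (rule Lq_1_le[OF _ integrable_powr_diff[OF b r i[OF s] i[OF t]] r]) (use b in measurable)
      also have "\<dots> = Lp_norm (ereal r) (wderiv (\<lambda>x. z s x - z t x))"
        by (rule Lp_norm_rep[OF weak_deriv_diff[OF zW[OF s] ad zW[OF t] w[OF s] w[OF t]], symmetric])
      also have "\<dots> \<le> W1p_norm (ereal r) (\<lambda>x. z s x - z t x)"
        using Lp_norm_nonneg by (simp add: W1p_norm_def)
      finally show "norm (\<integral>x. \<bar>w s x - w t x\<bar> \<partial>ivl 0 1) \<le> W1p_norm (ereal r) (\<lambda>x. z s x - z t x)" by simp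
    qed
  qed
qed

text \<open>z_t is given as a continuous curve in L^p, from which \<open>joint_version\<close> makes
  \<open>v\<close>. The position identity is the fundamental theorem of calculus for the pairing
  with a test function, and the linear growth of \<sigma> makes the damping term integrable.\<close>

lemma solution_p_reduces:
  fixes a \<sigma> :: "real \<Rightarrow> real"
  assumes a: "continuous_on {0..1} a" "\<forall>x\<in>{0..1}. 0 \<le> a x \<and> a x \<le> A" "0 < A" and \<sigma>: "continuous_on UNIV \<sigma>"
    and m: "0 < m" "\<forall>s. \<bar>\<sigma> s\<bar> \<le> m * \<bar>s\<bar>" and r: "1 \<le> r"
    and sol: "wave_solution (ereal r) a \<sigma> z0 z1 z zt"
  shows "reduces a \<sigma> z zt"
proof -
  have z: "z \<in> C0_W1p (ereal r)" and C1: "C1_Lp_deriv (ereal r) z zt" and H: "\<And>t. 0 \<le> t \<Longrightarrow> (z t, zt t) \<in> H_space (ereal r)"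
    and weak: "weak_wave_eq a \<sigma> z zt"
    using sol by (auto simp: wave_solution_def)
  have ad: "admissible (ereal r)" using r by (auto simp: admissible_def)
  have zC: "z \<in> C0_Lp (ereal r)" and ztC: "zt \<in> C0_Lp (ereal r)" using C1 by (auto simp: C1_Lp_deriv_def)
  have zLp: "z t \<in> Lp_space (ereal r)" "zt t \<in> Lp_space (ereal r)" if "0 \<le> t" for t
    using zC ztC that by (auto simp: C0_Lp_def)
  have "\<exists>u. rep (zt t) u" if "0 \<le> t" for t using rep_exists[OF Lp_space_measurable[OF zLp(2)[OF that]]] .
  then obtain u where u: "\<And>t. 0 \<le> t \<Longrightarrow> rep (zt t) (u t)" by metis
  have "\<exists>u. rep (z t) u" if "0 \<le> t" for t using rep_exists[OF Lp_space_measurable[OF zLp(1)[OF that]]] .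
  then obtain y where y: "\<And>t. 0 \<le> t \<Longrightarrow> rep (z t) (y t)" by metis
  have zW1: "z t \<in> W1p (ereal r)" if "0 \<le> t" for t using z that by (simp add: C0_W1p_def)
  have "\<exists>w. rep (wderiv (z t)) w" if "0 \<le> t" for t
    using rep_exists[OF Lp_space_measurable[OF W1p_wderiv(2)[OF zW1[OF that] ad]]] .
  then obtain w where w: "\<And>t. 0 \<le> t \<Longrightarrow> rep (wderiv (z t)) (w t)" by metis
  interpret u: L1_curve u by (rule C0_Lp_curve[OF ztC r u])
  interpret w: L1_curve w by (rule C0_W1p_curve[OF z r w])
  interpret y: L1_curve y by (rule C0_Lp_curve[OF zC r y])
  obtain v where vm[measurable]: "v \<in> borel_measurable (borel \<Otimes>\<^sub>M borel)" and v: "\<And>t. 0 \<le> t \<Longrightarrow> AE x in ivl 0 1. v (t, x) = u t x"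
    by (rule u.joint_version) blast
  have ub: "0 \<le> t \<Longrightarrow> u t \<in> borel_measurable borel" "0 \<le> t \<Longrightarrow> y t \<in> borel_measurable borel" for t
    using u y rep_borel by auto
  have v_int: "integrable (ivl 0 T \<Otimes>\<^sub>M ivl 0 1) v" for T
  proof -
    obtain B where B: "\<forall>t. 0 \<le> t \<longrightarrow> t \<le> T \<longrightarrow> (\<integral>x. \<bar>u t x\<bar> \<partial>ivl 0 1) \<le> B" using u.L1_bounded[of T] by blast
    have "(\<integral>\<^sup>+q. ennreal (norm (v q)) \<partial>(ivl 0 T \<Otimes>\<^sub>M ivl 0 1)) = (\<integral>\<^sup>+s. (\<integral>\<^sup>+x. ennreal \<bar>v (s, x)\<bar> \<partial>ivl 0 1) \<partial>ivl 0 T)"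
      by (simp add: ivl.nn_integral_fst[symmetric])
    also have "\<dots> \<le> (\<integral>\<^sup>+s. ennreal B \<partial>ivl 0 T)"
    proof (rule nn_integral_mono_AE)
      have "(\<integral>\<^sup>+x. ennreal \<bar>v (s, x)\<bar> \<partial>ivl 0 1) \<le> ennreal B" if s: "0 \<le> s" "s \<le> T" for s
      proof -
        have "(\<integral>\<^sup>+x. ennreal \<bar>v (s, x)\<bar> \<partial>ivl 0 1) = (\<integral>\<^sup>+x. ennreal \<bar>u s x\<bar> \<partial>ivl 0 1)"
          using v[OF s(1)] by (intro nn_integral_cong_AE) (auto elim!: AE_mp)
        also have "\<dots> = ennreal (\<integral>x. \<bar>u s x\<bar> \<partial>ivl 0 1)"
          using u.int[OF s(1)] by (intro nn_integral_eq_integral) auto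
        also have "\<dots> \<le> ennreal B" using B s by (intro ennreal_leI) auto
        finally show ?thesis .
      qed
      then show "AE s in ivl 0 T. (\<integral>\<^sup>+x. ennreal \<bar>v (s, x)\<bar> \<partial>ivl 0 1) \<le> ennreal B" by (auto simp: AE_ivl)
    qed
    also have "\<dots> < \<infinity>" by (simp add: emeasure_ivl ennreal_mult_less_top emeasure_lborel_Icc_eq)
    finally show ?thesis unfolding integrable_iff_bounded by simp
  qed
  have [measurable]: "\<sigma> \<in> borel_measurable borel" by (rule borel_measurable_continuous_onI[OF \<sigma>])
  have [measurable]: "(\<lambda>x. indicator {0..1} x * a x) \<in> borel_measurable borel" by (rule borel_continuous_Icc[OF a(1)])
  have pv: "pairing (zt s) \<phi> = (\<integral>x. v (s, x) * \<phi> x \<partial>ivl 0 1)" "(\<integral>x. v (s, x) * \<phi> x \<partial>ivl 0 1) = (\<integral>x. u s x * \<phi> x \<partial>ivl 0 1)"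
    if \<phi>: "\<phi> \<in> test_functions" and s: "0 \<le> s" for \<phi> s
  proof -
    note [measurable] = test_function_borel[OF \<phi>] ub(1)[OF s]
    show "(\<integral>x. v (s, x) * \<phi> x \<partial>ivl 0 1) = (\<integral>x. u s x * \<phi> x \<partial>ivl 0 1)"
      using v[OF s] by (intro integral_cong_AE) (auto elim!: AE_mp)
    with pairing_rep[OF u[OF s] test_function_borel[OF \<phi>]]
    show "pairing (zt s) \<phi> = (\<integral>x. v (s, x) * \<phi> x \<partial>ivl 0 1)" by simp
  qed
  have pos: "pairing (z t) \<phi> = pairing (z 0) \<phi> + (\<integral>s. (\<integral>x. v (s, x) * \<phi> x \<partial>ivl 0 1) \<partial>ivl 0 t)"
    if \<phi>: "\<phi> \<in> test_functions" and t: "0 \<le> t" for \<phi> t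
  proof -
    note [measurable] = test_function_borel[OF \<phi>]
    obtain B where B: "\<And>x. \<bar>\<phi> x\<bar> \<le> B" using test_function_bounded[OF \<phi>] by blast
    have bound: "\<bar>\<integral>x. f x * \<phi> x \<partial>ivl 0 1\<bar> \<le> B * (\<integral>x. \<bar>f x\<bar> \<partial>ivl 0 1)" if f: "integrable (ivl 0 1) f" for f
    proof -
      have "\<bar>\<integral>x. f x * \<phi> x \<partial>ivl 0 1\<bar> \<le> (\<integral>x. \<bar>f x * \<phi> x\<bar> \<partial>ivl 0 1)" by (rule integral_abs_bound)
      also have "\<dots> \<le> (\<integral>x. B * \<bar>f x\<bar> \<partial>ivl 0 1)"
      proof (rule integral_mono)
        show "\<bar>f x * \<phi> x\<bar> \<le> B * \<bar>f x\<bar>" for x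
          using mult_left_mono[OF B[of x], of "\<bar>f x\<bar>"] by (simp add: abs_mult mult.commute)
      qed (use integrable_mult_test[OF f \<phi>] f in auto)
      finally show ?thesis by simp
    qed
    have py: "pairing (z s) \<phi> = (\<integral>x. y s x * \<phi> x \<partial>ivl 0 1)" if "0 \<le> s" for s
      by (rule pairing_rep[OF y[OF that] test_function_borel[OF \<phi>]])
    \<comment> \<open>Pairing with a bounded function is controlled by the L^1 norm, hence by the
      L^p norm in which the difference quotients converge.\<close>
    have deriv: "((\<lambda>s. \<integral>x. y s x * \<phi> x \<partial>ivl 0 1) has_real_derivative (\<integral>x. u s x * \<phi> x \<partial>ivl 0 1)) (at s within {0..})"
      if s: "0 \<le> s" for s
      unfolding has_field_derivative_iff
    proof (rule LIM_zero_cancel, rule Lim_null_comparison)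
      let ?q = "\<lambda>s'. Lp_norm (ereal r) (\<lambda>x. (z s' x - z s x) / (s' - s) - zt s x)"
      have "(?q \<longlongrightarrow> 0) (at s within {0..})"
        using C1 s by (simp add: C1_Lp_deriv_def)
      from tendsto_mult_left[OF this, of B]
      show "((\<lambda>s'. B * ?q s') \<longlongrightarrow> 0) (at s within {0..})" by simp
      show "\<forall>\<^sub>F s' in at s within {0..}. norm (((\<integral>x. y s' x * \<phi> x \<partial>ivl 0 1) - (\<integral>x. y s x * \<phi> x \<partial>ivl 0 1)) / (s' - s) - (\<integral>x. u s x * \<phi> x \<partial>ivl 0 1)) \<le> B * ?q s'"
        unfolding eventually_at_filter
      proof (intro always_eventually allI impI)
        fix s' assume "s' \<noteq> s" and "s' \<in> {0..}"
        then have s': "0 \<le> s'" by simp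
        define k where "k x = (y s' x - y s x) / (s' - s) - u s x" for x
        note b[measurable] = ub(2)[OF s'] ub(2)[OF s] ub(1)[OF s]
        have km[measurable]: "k \<in> borel_measurable borel" unfolding k_def by measurable
        have iy: "integrable (ivl 0 1) (\<lambda>x. \<bar>y t x\<bar> powr r)" if "0 \<le> t" for t
          using zLp(1)[OF that] Lp_space_rep[OF y[OF that]] by simp
        have iu: "integrable (ivl 0 1) (\<lambda>x. \<bar>u s x\<bar> powr r)"
          using zLp(2)[OF s] Lp_space_rep[OF u[OF s]] by simp
        have "integrable (ivl 0 1) (\<lambda>x. (1 / \<bar>s' - s\<bar>) powr r * \<bar>y s' x - y s x\<bar> powr r)"
          using integrable_powr_diff[OF b(1,2) r iy[OF s'] iy[OF s]] by simp
        moreover have "(1 / \<bar>s' - s\<bar>) powr r * \<bar>y s' x - y s x\<bar> powr r = \<bar>(y s' x - y s x) / (s' - s)\<bar> powr r" for x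
          by (simp add: powr_mult[symmetric] abs_divide)
        ultimately have "integrable (ivl 0 1) (\<lambda>x. \<bar>(y s' x - y s x) / (s' - s)\<bar> powr r)" by simp
        then have ik: "integrable (ivl 0 1) (\<lambda>x. \<bar>k x\<bar> powr r)"
          unfolding k_def by (intro integrable_powr_diff r iu) measurable
        have ik1: "integrable (ivl 0 1) k" unfolding k_def using y.int[OF s'] y.int[OF s] u.int[OF s] by simp
        have rk: "rep (\<lambda>x. (z s' x - z s x) / (s' - s) - zt s x) k"
          unfolding k_def by (rule rep_diff[OF rep_comp[OF rep_diff[OF y[OF s'] y[OF s]], where h="\<lambda>d. d / (s' - s)"] u[OF s]]) measurable
        have "((\<integral>x. y s' x * \<phi> x \<partial>ivl 0 1) - (\<integral>x. y s x * \<phi> x \<partial>ivl 0 1)) / (s' - s) - (\<integral>x. u s x * \<phi> x \<partial>ivl 0 1) = (\<integral>x. k x * \<phi> x \<partial>ivl 0 1)"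
        proof -
          have "(\<integral>x. k x * \<phi> x \<partial>ivl 0 1) = (\<integral>x. (y s' x * \<phi> x - y s x * \<phi> x) / (s' - s) - u s x * \<phi> x \<partial>ivl 0 1)"
            by (intro Bochner_Integration.integral_cong) (simp_all add: k_def left_diff_distrib diff_divide_distrib)
          then show ?thesis
            using integrable_mult_test[OF y.int[OF s'] \<phi>] integrable_mult_test[OF y.int[OF s] \<phi>] integrable_mult_test[OF u.int[OF s] \<phi>] by simp
        qed
        moreover have "\<bar>\<integral>x. k x * \<phi> x \<partial>ivl 0 1\<bar> \<le> B * (\<integral>x. \<bar>k x\<bar> \<partial>ivl 0 1)" by (rule bound[OF ik1])
        moreover have "B * (\<integral>x. \<bar>k x\<bar> \<partial>ivl 0 1) \<le> B * ?q s'"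
        proof (rule mult_left_mono)
          show "(\<integral>x. \<bar>k x\<bar> \<partial>ivl 0 1) \<le> ?q s'" using Lq_1_le[OF km ik r] Lp_norm_rep[OF rk, of r] by simp
          show "0 \<le> B" using B[of 0] by linarith
        qed
        ultimately show "norm (((\<integral>x. y s' x * \<phi> x \<partial>ivl 0 1) - (\<integral>x. y s x * \<phi> x \<partial>ivl 0 1)) / (s' - s) - (\<integral>x. u s x * \<phi> x \<partial>ivl 0 1)) \<le> B * ?q s'" by simp
      qed
    qed
    \<comment> \<open>At each fixed time \<open>v\<close> agrees almost everywhere with the
      continuous curve \<open>u\<close>, so its pairings depend continuously on time.\<close>
    have cont: "continuous_on {0..t} (\<lambda>s. \<integral>x. v (s, x) * \<phi> x \<partial>ivl 0 1)"
      unfolding continuous_on_def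
    proof
      fix s assume "s \<in> {0..t}"
      then have s: "0 \<le> s" by simp
      have "((\<lambda>s. \<integral>x. v (s, x) * \<phi> x \<partial>ivl 0 1) \<longlongrightarrow> (\<integral>x. v (s, x) * \<phi> x \<partial>ivl 0 1)) (at s within {0..})"
      proof (rule LIM_zero_cancel, rule Lim_null_comparison)
        from tendsto_mult_left[OF u.cont[OF s], of B]
        show "((\<lambda>s'. B * (\<integral>x. \<bar>u s' x - u s x\<bar> \<partial>ivl 0 1)) \<longlongrightarrow> 0) (at s within {0..})" by simp
        show "\<forall>\<^sub>F s' in at s within {0..}. norm ((\<integral>x. v (s', x) * \<phi> x \<partial>ivl 0 1) - (\<integral>x. v (s, x) * \<phi> x \<partial>ivl 0 1)) \<le> B * (\<integral>x. \<bar>u s' x - u s x\<bar> \<partial>ivl 0 1)"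
          unfolding eventually_at_filter
        proof (intro always_eventually allI impI)
          fix s' :: real assume "s' \<in> {0..}"
          then have s': "0 \<le> s'" by simp
          have "(\<integral>x. v (s', x) * \<phi> x \<partial>ivl 0 1) - (\<integral>x. v (s, x) * \<phi> x \<partial>ivl 0 1) = (\<integral>x. (u s' x - u s x) * \<phi> x \<partial>ivl 0 1)"
            unfolding pv(2)[OF \<phi> s] pv(2)[OF \<phi> s'] left_diff_distrib
            using integrable_mult_test[OF u.int[OF s'] \<phi>] integrable_mult_test[OF u.int[OF s] \<phi>] by simp
          then show "norm ((\<integral>x. v (s', x) * \<phi> x \<partial>ivl 0 1) - (\<integral>x. v (s, x) * \<phi> x \<partial>ivl 0 1)) \<le> B * (\<integral>x. \<bar>u s' x - u s x\<bar> \<partial>ivl 0 1)"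
            using bound[of "\<lambda>x. u s' x - u s x"] u.int[OF s'] u.int[OF s] by simp
        qed
      qed
      then show "((\<lambda>s. \<integral>x. v (s, x) * \<phi> x \<partial>ivl 0 1) \<longlongrightarrow> (\<integral>x. v (s, x) * \<phi> x \<partial>ivl 0 1)) (at s within {0..t})"
        by (rule tendsto_within_subset) auto
    qed
    have "(\<integral>s. (\<integral>x. v (s, x) * \<phi> x \<partial>ivl 0 1) \<partial>ivl 0 t) = (\<integral>x. y t x * \<phi> x \<partial>ivl 0 1) - (\<integral>x. y 0 x * \<phi> x \<partial>ivl 0 1)"
    proof (rule integral_ivl_FTC[OF t _ cont])
      show "(\<lambda>s. \<integral>x. v (s, x) * \<phi> x \<partial>ivl 0 1) \<in> borel_measurable borel"
        by (rule ivl.borel_measurable_lebesgue_integral) measurable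
      show "((\<lambda>s. \<integral>x. y s x * \<phi> x \<partial>ivl 0 1) has_real_derivative (\<integral>x. v (s, x) * \<phi> x \<partial>ivl 0 1)) (at s within {0..t})"
        if "0 \<le> s" "s \<le> t" for s
        unfolding pv(2)[OF \<phi> that(1)] by (rule DERIV_subset[OF deriv[OF that(1)]]) auto
    qed
    then show ?thesis using py[OF t] py[of 0] by simp
  qed
  show ?thesis
  proof (rule reducesI[OF ad a(1) \<sigma> H v_int _ _ pos weak])
    show "integrable (ivl 0 T \<Otimes>\<^sub>M ivl 0 1) (\<lambda>(s, x). indicator {0..1} x * a x * \<sigma> (v (s, x)))" for T
    proof (rule Bochner_Integration.integrable_bound)
      show "integrable (ivl 0 T \<Otimes>\<^sub>M ivl 0 1) (\<lambda>q. (A * m) * \<bar>v q\<bar>)" using v_int by simp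
      show "(\<lambda>(s, x). indicator {0..1} x * a x * \<sigma> (v (s, x))) \<in> borel_measurable (ivl 0 T \<Otimes>\<^sub>M ivl 0 1)"
        unfolding split_beta by measurable
      show "AE q in ivl 0 T \<Otimes>\<^sub>M ivl 0 1. norm (case q of (s, x) \<Rightarrow> indicator {0..1} x * a x * \<sigma> (v (s, x))) \<le> norm ((A * m) * \<bar>v q\<bar>)"
      proof (rule AE_I2)
        fix q :: "real \<times> real"
        have "\<bar>indicator {0..1} (snd q) * a (snd q)\<bar> \<le> A" using a_ext_bounds[OF a(2,3), of "snd q"] by simp
        then have "\<bar>indicator {0..1} (snd q) * a (snd q)\<bar> * \<bar>\<sigma> (v q)\<bar> \<le> A * (m * \<bar>v q\<bar>)" using m a(3) by (intro mult_mono) auto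
        then show "norm (case q of (s, x) \<Rightarrow> indicator {0..1} x * a x * \<sigma> (v (s, x))) \<le> norm ((A * m) * \<bar>v q\<bar>)"
          using m a(3) by (simp add: split_beta abs_mult mult.assoc)
      qed
    qed
    show "AE s in ivl 0 T. AE x in ivl 0 1. zt s x = v (s, x)" for T
    proof -
      have "AE x in ivl 0 1. zt s x = v (s, x)" if "0 \<le> s" for s
        using v[OF that] rep_AE[OF u[OF that]] by eventually_elim simp
      then show ?thesis unfolding AE_ivl[of _ 0 T] by (intro AE_I2) auto
    qed
    show "\<exists>B. AE s in ivl 0 T. \<forall>w. rep (wderiv (z s)) w \<longrightarrow> (\<integral>x. \<bar>w x\<bar> \<partial>ivl 0 1) \<le> B" for T
    proof -
      obtain B where B: "\<forall>t. 0 \<le> t \<longrightarrow> t \<le> T \<longrightarrow> (\<integral>x. \<bar>w t x\<bar> \<partial>ivl 0 1) \<le> B" using w.L1_bounded[of T] by blast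
      have "(\<integral>x. \<bar>w' x\<bar> \<partial>ivl 0 1) \<le> B" if s: "0 \<le> s" "s \<le> T" and w': "rep (wderiv (z s)) w'" for s w'
      proof -
        note [measurable] = rep_borel[OF w'] rep_borel[OF w[OF s(1)]]
        have "AE x in ivl 0 1. w' x = w s x" using rep_AE[OF w'] rep_AE[OF w[OF s(1)]] by eventually_elim simp
        then have "(\<integral>x. \<bar>w' x\<bar> \<partial>ivl 0 1) = (\<integral>x. \<bar>w s x\<bar> \<partial>ivl 0 1)"
          by (intro integral_cong_AE) (auto elim!: AE_mp)
        then show ?thesis using B s by simp
      qed
      then have "AE s in ivl 0 T. \<forall>w. rep (wderiv (z s)) w \<longrightarrow> (\<integral>x. \<bar>w x\<bar> \<partial>ivl 0 1) \<le> B" by (auto simp: AE_ivl)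
      then show ?thesis by blast
    qed
  qed
qed

section \<open>Exponential stability\<close>

lemma damping_continuous:
  assumes "nonlinear_damping \<sigma>" shows "continuous_on UNIV \<sigma>"
  unfolding continuous_on_eq_continuous_at[OF open_UNIV]
proof
  fix x :: real
  obtain u L where u: "0 < u" "L-lipschitz_on (cball x u) \<sigma>" using assms unfolding nonlinear_damping_def by blast
  have "continuous_on (ball x u) \<sigma>"
    by (rule continuous_on_subset[OF lipschitz_on_continuous_on[OF u(2)]]) auto
  then show "isCont \<sigma> x" using u(1) by (simp add: continuous_on_eq_continuous_at)
qed

lemma damping_sign: "nonlinear_damping \<sigma> \<Longrightarrow> 0 \<le> \<sigma> r * r"
  unfolding nonlinear_damping_def by (cases "r = 0") (auto intro: less_imp_le)

text \<open>The quotient \<sigma>(r)/r, completed by the derivative at 0, is continuous and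
  positive; its extrema on the compact interval are the constants.\<close>

lemma damping_linear_bounds:
  assumes \<sigma>: "nonlinear_damping \<sigma>" and R: "0 < R"
  obtains c0 C0 where "0 < c0" "0 \<le> C0" "\<And>r. \<bar>r\<bar> \<le> R \<Longrightarrow> c0 * r^2 \<le> \<sigma> r * r" "\<And>r. \<bar>r\<bar> \<le> R \<Longrightarrow> \<bar>\<sigma> r\<bar> \<le> C0 * \<bar>r\<bar>"
proof -
  have \<sigma>0: "\<sigma> 0 = 0"
  proof -
    have "\<sigma> (- 0) = - \<sigma> 0" using \<sigma> unfolding nonlinear_damping_def by blast
    then show ?thesis by simp
  qed
  obtain C1 where C1: "0 < C1" "(\<sigma> has_real_derivative C1) (at 0)" using \<sigma> unfolding nonlinear_damping_def by blast
  define k where "k r = (if r = 0 then C1 else \<sigma> r / r)" for r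
  have pos: "0 < k r" for r
  proof (cases "r = 0")
    case False
    then have "0 < \<sigma> r * r" using \<sigma> unfolding nonlinear_damping_def by blast
    then show ?thesis using False by (simp add: k_def zero_less_divide_iff zero_less_mult_iff)
  qed (use C1 in \<open>simp add: k_def\<close>)
  have \<sigma>k: "\<sigma> r = k r * r" for r using \<sigma>0 by (simp add: k_def)
  have "isCont k r" for r
  proof (cases "r = 0")
    case True
    have "((\<lambda>h. \<sigma> h / h) \<longlongrightarrow> C1) (at 0)" using C1(2) \<sigma>0 by (simp add: DERIV_def)
    then have "(k \<longlongrightarrow> C1) (at 0)"
      by (rule Lim_transform_eventually) (auto simp: k_def eventually_at_filter)
    then show ?thesis using True by (simp add: isCont_def k_def)
  next
    case False
    have "isCont \<sigma> r" using damping_continuous[OF \<sigma>] by (simp add: continuous_on_eq_continuous_at)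
    then have "isCont (\<lambda>r. \<sigma> r / r) r" using False by (intro continuous_intros)
    moreover have "\<forall>\<^sub>F x in nhds r. x \<noteq> 0" using False by (intro t1_space_nhds)
    then have "\<forall>\<^sub>F x in nhds r. \<sigma> x / x = k x" by eventually_elim (simp add: k_def)
    ultimately show ?thesis using isCont_cong[of "\<lambda>r. \<sigma> r / r" k r] by simp
  qed
  then have ck: "continuous_on {-R..R} k" by (simp add: continuous_at_imp_continuous_on)
  have ne: "{-R..R} \<noteq> {}" using R by simp
  obtain x1 where x1: "\<And>r. r \<in> {-R..R} \<Longrightarrow> k x1 \<le> k r" using continuous_attains_inf[OF compact_Icc ne ck] by blast
  obtain x2 where x2: "\<And>r. r \<in> {-R..R} \<Longrightarrow> k r \<le> k x2" using continuous_attains_sup[OF compact_Icc ne ck] by blast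
  show thesis
  proof (rule that[of "k x1" "k x2"])
    fix r assume "\<bar>r\<bar> \<le> R"
    then have r: "r \<in> {-R..R}" by auto
    show "k x1 * r^2 \<le> \<sigma> r * r"
      unfolding \<sigma>k[of r] using mult_right_mono[OF x1[OF r], of "r^2"] by (simp add: power2_eq_square mult.assoc)
    show "\<bar>\<sigma> r\<bar> \<le> k x2 * \<bar>r\<bar>"
      unfolding \<sigma>k[of r] using mult_right_mono[OF x2[OF r], of "\<bar>r\<bar>"] pos[of r] by (simp add: abs_mult)
  qed (use pos in \<open>auto intro: less_imp_le\<close>)
qed

lemma positive_on_subinterval:
  fixes a :: "real \<Rightarrow> real"
  assumes a: "continuous_on {0..1} a" and pos: "\<forall>x\<in>{0..1}. 0 \<le> a x" and ex: "\<exists>x\<in>{0..1}. a x \<noteq> 0"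
  obtains c d a0 where "0 \<le> c" "c < d" "d \<le> 1" "0 < a0" "\<And>x. c \<le> x \<Longrightarrow> x \<le> d \<Longrightarrow> a0 \<le> a x"
proof -
  obtain x0 where x0: "x0 \<in> {0..1}" "a x0 \<noteq> 0" using ex by blast
  have ax: "0 < a x0" using pos x0 by force
  obtain e where e: "0 < e" "\<And>x. x \<in> {0..1} \<Longrightarrow> dist x x0 < e \<Longrightarrow> dist (a x) (a x0) < a x0 / 2"
    using a x0(1) ax unfolding continuous_on_iff by (metis half_gt_zero)
  \<comment> \<open>Half the radius keeps the closed interval inside the open ball of continuity,
    and the cuts at 0 and 1 keep it in the domain.\<close>
  show thesis
  proof (rule that[of "max 0 (x0 - e / 2)" "min 1 (x0 + e / 2)" "a x0 / 2"])
    show "max 0 (x0 - e / 2) < min 1 (x0 + e / 2)" using x0(1) e(1) by auto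
    fix x assume x: "max 0 (x0 - e / 2) \<le> x" "x \<le> min 1 (x0 + e / 2)"
    then have "dist (a x) (a x0) < a x0 / 2" using e by (intro e(2)) (auto simp: dist_real_def abs_less_iff)
    then show "a x0 / 2 \<le> a x" unfolding dist_real_def by linarith
  qed (use ax in auto)
qed

lemma H_norm_rep:
  "rep (wderiv f) w \<Longrightarrow> rep g u \<Longrightarrow> H_norm (ereal p) (f, g) = Lq p w + Lq p u"
  by (simp add: H_norm_def Lp_norm_rep)

text \<open>A true equality of functions and not merely almost everywhere: \<open>wderiv\<close> is
  a choice from a predicate determined by the pairings, and these coincide.\<close>

lemma wderiv_cong: "(\<And>x. x \<in> {0..1} \<Longrightarrow> f x = g x) \<Longrightarrow> wderiv f = wderiv g"
proof -
  assume fg: "\<And>x. x \<in> {0..1} \<Longrightarrow> f x = g x"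
  have "pairing f \<phi> = pairing g \<phi>" for \<phi>
    unfolding pairing_def by (intro Bochner_Integration.integral_cong) (use fg in auto)
  then show ?thesis by (simp add: wderiv_def is_weak_deriv_def)
qed

lemma reduces_decay:
  fixes a \<sigma> :: "real \<Rightarrow> real"
  assumes a: "continuous_on {0..1} a" "\<forall>x\<in>{0..1}. 0 \<le> a x \<and> a x \<le> A" "0 < A"
    and low: "0 \<le> c" "c < d" "d \<le> 1" "0 < a0" "\<And>x. c \<le> x \<Longrightarrow> x \<le> d \<Longrightarrow> a0 \<le> a x"
    and \<sigma>: "\<And>r. 0 \<le> \<sigma> r * r" "\<And>r. \<bar>r\<bar> \<le> R \<Longrightarrow> c0 * r^2 \<le> \<sigma> r * r" "\<And>r. \<bar>r\<bar> \<le> R \<Longrightarrow> \<bar>\<sigma> r\<bar> \<le> C0 * \<bar>r\<bar>"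
    and const: "0 < c0" "0 \<le> C0" "2 \<le> p"
    and sol: "wave_solution P a \<sigma> z0 z1 z zt" and red: "reduces a \<sigma> z zt"
    and init: "AE x in ivl 0 1. \<bar>wderiv z0 x\<bar> + \<bar>z1 x\<bar> \<le> R" and t: "0 \<le> t"
  defines "\<gamma> \<equiv> decay_factor p c d a0 A c0 C0"
  shows "H_norm (ereal p) (z t, zt t) \<le> decay_const p \<gamma> * exp (- (- ln \<gamma> / (2 * p)) * t) * H_norm (ereal p) (z0, z1)"
proof -
  obtain w u \<zeta> v where wu: "\<And>t. 0 \<le> t \<Longrightarrow> rep (wderiv (z t)) (w t)" "\<And>t. 0 \<le> t \<Longrightarrow> rep (zt t) (u t)"
    and rs: "reduced_solution w u \<zeta> v (\<lambda>(s, x). indicator {0..1} x * a x * \<sigma> (v (s, x)))"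
    using red unfolding reduces_def by blast
  interpret reduced_solution w u \<zeta> v "\<lambda>(s, x). indicator {0..1} x * a x * \<sigma> (v (s, x))" by (rule rs)
  have "wderiv z0 = wderiv (z 0)" using sol by (intro wderiv_cong) (auto simp: wave_solution_def)
  then have w0: "rep (wderiv z0) (w 0)" using wu(1)[of 0] by simp
  have "AE x in ivl 0 1. zt 0 x = z1 x" using sol unfolding wave_solution_def AE_leb01 by blast
  then have "AE x in ivl 0 1. z1 x = u 0 x" using rep_AE[OF wu(2)[OF order_refl]] by eventually_elim simp
  then have u0: "rep z1 (u 0)" using rep_borel[OF wu(2)[OF order_refl]] by (simp add: rep_def)
  have init': "AE x in ivl 0 1. \<bar>w 0 x\<bar> + \<bar>u 0 x\<bar> \<le> R"
    using init rep_AE[OF w0] rep_AE[OF u0] by eventually_elim simp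
  have "damped_transport (unfold_pair (w 0) (u 0)) (unfold_odd (\<lambda>(s, x). indicator {0..1} x * a x * \<sigma> (v (s, x))))
    (\<lambda>y. indicator {0..1} (tri y) * a (tri y)) a0 A c d c0 C0 R p"
  proof (rule damped[where a="\<lambda>x. indicator {0..1} x * a x" and \<sigma>=\<sigma>])
    show "(\<lambda>x. indicator {0..1} x * a x) \<in> borel_measurable borel" by (rule borel_continuous_Icc[OF a(1)])
    show "a0 \<le> indicator {0..1} x * a x" if "c \<le> x" "x \<le> d" for x using low that by (simp add: indicator_def)
  qed (use a_ext_bounds[OF a(2,3)] low \<sigma> init' const in auto)
  moreover have "integrable (ivl 0 1) (\<lambda>x. \<bar>w 0 x\<bar> powr p)"
    by (rule rep_bounded_integrable[OF rep_self[OF rep_borel[OF w0]], where B=R]) (use init' const in \<open>auto elim!: AE_mp\<close>)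
  moreover have "integrable (ivl 0 1) (\<lambda>x. \<bar>u 0 x\<bar> powr p)"
    by (rule rep_bounded_integrable[OF rep_self[OF rep_borel[OF u0]], where B=R]) (use init' const in \<open>auto elim!: AE_mp\<close>)
  ultimately have "Lq p (w t) + Lq p (u t) \<le> decay_const p \<gamma> * exp (- (- ln \<gamma> / (2 * p)) * t) * (Lq p (w 0) + Lq p (u 0))"
    unfolding \<gamma>_def by (rule Lq_decay[OF _ t])
  then show ?thesis unfolding H_norm_rep[OF wu(1)[OF t] wu(2)[OF t]] H_norm_rep[OF w0 u0] .
qed

lemma H_inf_init:
  assumes "(z0, z1) \<in> H_space \<infinity>"
  shows "AE x in ivl 0 1. \<bar>wderiv z0 x\<bar> + \<bar>z1 x\<bar> \<le> H_norm \<infinity> (z0, z1)"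
proof -
  have z: "z0 \<in> W1p \<infinity>" "z1 \<in> Lp_space \<infinity>" using assms by (auto simp: H_space_def W01p_def)
  have "wderiv z0 \<in> Lp_space \<infinity>" by (rule W1p_wderiv(2)[OF z(1)]) (simp add: admissible_def)
  from Linf_norm_AE(1)[OF this] Linf_norm_AE(1)[OF z(2)]
  show ?thesis unfolding H_norm_def fst_conv snd_conv by eventually_elim linarith
qed

text \<open>A function of mean zero is bounded by its oscillation, and one vanishing at 0 by its
  variation. Both are at most the L^1 norm of the derivative, which the L^2 norm dominates on an
  interval of length 1. The derivative of \<open>z0\<close> has mean zero by the boundary
  conditions; the embedding constant is 1, so the same \<open>R\<close> serves.\<close>

lemma D_2_init:
  assumes "(z0, z1) \<in> D_space 2"
  shows "AE x in ivl 0 1. \<bar>wderiv z0 x\<bar> + \<bar>z1 x\<bar> \<le> D_norm 2 (z0, z1)"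
proof -
  have two: "(2::ereal) = ereal 2" by simp
  have ad: "admissible 2" unfolding two admissible_def by auto
  have z0: "z0 \<in> W01p 2" "wderiv z0 \<in> W1p 2" and z1: "z1 \<in> W01p 2" "z1 \<in> W1p 2"
    using assms by (auto simp: D_space_def W2p_def W01p_def)
  have rep_w: "\<exists>w. rep (wderiv f) w" if "f \<in> W1p 2" for f
    using rep_exists[OF Lp_space_measurable[OF W1p_wderiv(2)[OF that ad]]] .
  have L1: "(\<integral>x. \<bar>w x\<bar> \<partial>ivl 0 1) \<le> Lp_norm 2 (wderiv f)" if "f \<in> W1p 2" "rep (wderiv f) w" for f w
  proof -
    have "integrable (ivl 0 1) (\<lambda>x. \<bar>w x\<bar> powr 2)"
      using W1p_wderiv(2)[OF that(1) ad] Lp_space_rep[OF that(2), of 2] by simp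
    then have "(\<integral>x. \<bar>w x\<bar> \<partial>ivl 0 1) \<le> Lq 2 w" by (intro Lq_1_le rep_borel[OF that(2)]) auto
    then show ?thesis using Lp_norm_rep[OF that(2), of 2] by simp
  qed
  have prim: "\<bar>integral\<^sup>L (ivl 0 x) w - integral\<^sup>L (ivl 0 y) w\<bar> \<le> (\<integral>x. \<bar>w x\<bar> \<partial>ivl 0 1)"
    if w: "integrable (ivl 0 1) w" and xy: "0 \<le> x" "x \<le> 1" "0 \<le> y" "y \<le> 1" for w :: "real \<Rightarrow> real" and x y
  proof -
    have *: "\<bar>integral\<^sup>L (ivl 0 y) w - integral\<^sup>L (ivl 0 x) w\<bar> \<le> (\<integral>x. \<bar>w x\<bar> \<partial>ivl 0 1)" if "0 \<le> x" "x \<le> y" "y \<le> 1" for x y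
    proof -
      have "integral\<^sup>L (ivl 0 y) w - integral\<^sup>L (ivl 0 x) w = integral\<^sup>L (ivl x y) w"
        using integral_ivl_combine[of 0 y w x] integrable_ivl_subset[OF w, of 0 y] that by simp
      moreover have "\<bar>integral\<^sup>L (ivl x y) w\<bar> \<le> (\<integral>x. \<bar>w x\<bar> \<partial>ivl x y)" by (rule integral_abs_bound)
      moreover have "(\<integral>x. \<bar>w x\<bar> \<partial>ivl x y) \<le> (\<integral>x. \<bar>w x\<bar> \<partial>ivl 0 1)"
        using w that by (intro integral_ivl_nonneg_mono) auto
      ultimately show ?thesis by linarith
    qed
    show ?thesis using *[of x y] *[of y x] xy by (cases "x \<le> y") auto
  qed
  obtain w0 where w0: "rep (wderiv z0) w0" using rep_w z0(1) by (auto simp: W01p_def)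
  obtain w2 where w2: "rep (wderiv (wderiv z0)) w2" using rep_w[OF z0(2)] by blast
  obtain w1 where w1: "rep (wderiv z1) w1" using rep_w[OF z1(2)] by blast
  obtain \<kappa> where \<kappa>: "AE x in ivl 0 1. wderiv z0 x = \<kappa> + integral\<^sup>L (ivl 0 x) w2" and iw2: "integrable (ivl 0 1) w2"
    by (rule W1p_primitive[OF z0(2) ad w2])
  define h where "h x = \<kappa> + integral\<^sup>L (ivl 0 x) w2" for x
  have [measurable]: "w0 \<in> borel_measurable borel" "w2 \<in> borel_measurable borel" by (rule rep_borel[OF w0] rep_borel[OF w2])+
  have hm[measurable]: "h \<in> borel_measurable borel"
  proof -
    have [measurable]: "(\<lambda>x. integral\<^sup>L (ivl 0 x) w2) \<in> borel_measurable borel" by (rule borel_measurable_integral_ivl) simp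
    show ?thesis unfolding h_def[abs_def] by measurable
  qed
  have hdiff: "\<bar>h x - h y\<bar> \<le> Lp_norm 2 (wderiv (wderiv z0))" if "0 \<le> x" "x \<le> 1" "0 \<le> y" "y \<le> 1" for x y
    using prim[OF iw2 that] L1[OF z0(2) w2] by (simp add: h_def)
  have wh: "AE x in ivl 0 1. w0 x = h x" using \<kappa> rep_AE[OF w0] by eventually_elim (simp add: h_def)
  have ih: "integrable (ivl 0 1) h"
    by (rule integrable_cong_AE_imp[OF W01p_primitive(1)[OF z0(1) ad w0]]) (use wh in auto)
  have "integral\<^sup>L (ivl 0 1) h = integral\<^sup>L (ivl 0 1) w0" using wh by (intro integral_cong_AE) auto
  then have h0: "integral\<^sup>L (ivl 0 1) h = 0" using W01p_primitive(3)[OF z0(1) ad w0] by simp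
  have hb: "\<bar>h x\<bar> \<le> Lp_norm 2 (wderiv (wderiv z0))" if x: "0 \<le> x" "x \<le> 1" for x
  proof -
    \<comment> \<open>Subtracting the zero mean writes \<open>h x\<close> as the average of its
      differences.\<close>
    have "h x = (\<integral>y. h x - h y \<partial>ivl 0 1)" using ih h0 by (simp add: measure_ivl)
    then have "\<bar>h x\<bar> = \<bar>\<integral>y. h x - h y \<partial>ivl 0 1\<bar>" by simp
    also have "\<dots> \<le> (\<integral>y. \<bar>h x - h y\<bar> \<partial>ivl 0 1)" by (rule integral_abs_bound)
    also have "\<dots> \<le> (\<integral>y. Lp_norm 2 (wderiv (wderiv z0)) \<partial>ivl 0 1)"
    proof (rule integral_mono_AE)
      show "AE y in ivl 0 1. \<bar>h x - h y\<bar> \<le> Lp_norm 2 (wderiv (wderiv z0))"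
        unfolding AE_ivl using hdiff[OF x] by auto
    qed (use ih in auto)
    finally show ?thesis by (simp add: measure_ivl)
  qed
  have z1b: "\<bar>z1 x\<bar> \<le> Lp_norm 2 (wderiv z1)" if x: "0 \<le> x" "x \<le> 1" for x
  proof -
    have "z1 x = integral\<^sup>L (ivl 0 x) w1" by (rule W01p_primitive(2)[OF z1(1) ad w1 x])
    moreover have iw1: "integrable (ivl 0 1) w1" by (rule W01p_primitive(1)[OF z1(1) ad w1])
    moreover have "integral\<^sup>L (ivl 0 0) w1 = 0" by (rule integral_ivl_eq_0[OF order_refl borel_measurable_integrable_ivl[OF iw1]])
    ultimately show ?thesis using prim[of w1 x 0] L1[OF z1(2) w1] x by simp
  qed
  have "AE x in ivl 0 1. 0 \<le> x \<and> x \<le> 1" by (simp add: AE_ivl)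
  then show ?thesis
    using \<kappa> unfolding D_norm_def fst_conv snd_conv
  proof eventually_elim
    case (elim x)
    then show ?case using hb[of x] z1b[of x] by (simp add: h_def)
  qed
qed

theorem theorem2:
  fixes a \<sigma> :: "real \<Rightarrow> real" and a_inf :: real
  assumes "continuous_on {0..1} a"
    and "\<exists>x\<in>{0..1}. a x \<noteq> 0"
    and "a_inf > 0"
    and "\<forall>x\<in>{0..1}. 0 \<le> a x \<and> a x \<le> a_inf"
    and "nonlinear_damping \<sigma>"
  shows
    "(\<forall>R::real. R > 0 \<longrightarrow> (\<forall>p::real. 2 \<le> p \<longrightarrow>
        (\<exists>K \<beta> :: real. K > 0 \<and> \<beta> > 0 \<and>
          (\<forall>z0 z1 z zt. (z0, z1) \<in> H_space \<infinity> \<and> H_norm \<infinity> (z0, z1) \<le> R \<and>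
             wave_solution \<infinity> a \<sigma> z0 z1 z zt \<longrightarrow>
             (\<forall>t\<ge>0. H_norm (ereal p) (z t, zt t)
                    \<le> K * exp (- \<beta> * t) * H_norm (ereal p) (z0, z1))))))
     \<and>
     (\<forall>p R :: real. 2 < p \<and> R > 0 \<and>
        (\<forall>s1 s2. (\<sigma> s1 - \<sigma> s2) * (s1 - s2) \<ge> 0) \<and>
        (\<exists>m>0. \<forall>s. \<bar>\<sigma> s\<bar> \<le> m * \<bar>s\<bar>) \<longrightarrow>
        (\<forall>q::real. 2 \<le> q \<and> q < p \<longrightarrow>
          (\<exists>K \<beta> :: real. K > 0 \<and> \<beta> > 0 \<and>
            (\<forall>z0 z1 z zt. (z0, z1) \<in> H_space (ereal p) \<inter> D_space 2 \<and> D_norm 2 (z0, z1) \<le> R \<and>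
               wave_solution (ereal p) a \<sigma> z0 z1 z zt \<longrightarrow>
               (\<forall>t\<ge>0. H_norm (ereal q) (z t, zt t)
                      \<le> K * exp (- \<beta> * t) * H_norm (ereal q) (z0, z1))))))"
proof -
  have a: "continuous_on {0..1} a" "\<forall>x\<in>{0..1}. 0 \<le> a x \<and> a x \<le> a_inf" "0 < a_inf" using assms by auto
  have \<sigma>: "continuous_on UNIV \<sigma>" by (rule damping_continuous[OF assms(5)])
  obtain c d a0 where low: "0 \<le> c" "c < d" "d \<le> 1" "0 < a0" "\<And>x. c \<le> x \<Longrightarrow> x \<le> d \<Longrightarrow> a0 \<le> a x"
    using positive_on_subinterval[OF assms(1) _ assms(2)] assms(4) by blast
  \<comment> \<open>One statement for both parts: \<open>K\<close> and \<open>\<beta>\<close> are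
    fixed by \<open>R\<close> and the exponent before any solution is considered. Each part then
    only has to bound its initial data by \<open>R\<close> and to reduce its solutions.\<close>
  have decay: "\<exists>K \<beta> :: real. K > 0 \<and> \<beta> > 0 \<and>
      (\<forall>P z0 z1 z zt t. wave_solution P a \<sigma> z0 z1 z zt \<longrightarrow> reduces a \<sigma> z zt \<longrightarrow>
         (AE x in ivl 0 1. \<bar>wderiv z0 x\<bar> + \<bar>z1 x\<bar> \<le> R) \<longrightarrow> 0 \<le> t \<longrightarrow>
         H_norm (ereal p) (z t, zt t) \<le> K * exp (- \<beta> * t) * H_norm (ereal p) (z0, z1))"
    if R: "0 < R" and p: "2 \<le> p" for R p :: real
  proof -
    obtain c0 C0 where const: "0 < c0" "0 \<le> C0" "\<And>r. \<bar>r\<bar> \<le> R \<Longrightarrow> c0 * r^2 \<le> \<sigma> r * r" "\<And>r. \<bar>r\<bar> \<le> R \<Longrightarrow> \<bar>\<sigma> r\<bar> \<le> C0 * \<bar>r\<bar>"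
      by (rule damping_linear_bounds[OF assms(5) R]) blast
    define \<gamma> where "\<gamma> = decay_factor p c d a0 a_inf c0 C0"
    have \<gamma>: "0 < \<gamma>" "\<gamma> < 1" unfolding \<gamma>_def using decay_factor_bounds[OF low(2,4) const(1) p] by auto
    show ?thesis
    proof (intro exI conjI allI impI)
      show "0 < decay_const p \<gamma>" by (rule decay_const_pos[OF \<gamma>(1)])
      show "0 < - ln \<gamma> / (2 * p)" using \<gamma> p by (simp add: divide_neg_pos)
    next
      fix P z0 z1 z zt and t :: real
      assume "wave_solution P a \<sigma> z0 z1 z zt" "reduces a \<sigma> z zt"
        "AE x in ivl 0 1. \<bar>wderiv z0 x\<bar> + \<bar>z1 x\<bar> \<le> R" "0 \<le> t"
      then show "H_norm (ereal p) (z t, zt t) \<le> decay_const p \<gamma> * exp (- (- ln \<gamma> / (2 * p)) * t) * H_norm (ereal p) (z0, z1)"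
        unfolding \<gamma>_def by (intro reduces_decay[OF a low damping_sign[OF assms(5)] const(3,4,1,2) p])
    qed
  qed
  show ?thesis
  proof (intro conjI allI impI)
    fix R p :: real assume R: "0 < R" and p: "2 \<le> p"
    obtain K \<beta> where K: "0 < K" "0 < \<beta>" "\<And>P z0 z1 z zt t. wave_solution P a \<sigma> z0 z1 z zt \<Longrightarrow> reduces a \<sigma> z zt \<Longrightarrow>
         (AE x in ivl 0 1. \<bar>wderiv z0 x\<bar> + \<bar>z1 x\<bar> \<le> R) \<Longrightarrow> 0 \<le> t \<Longrightarrow>
         H_norm (ereal p) (z t, zt t) \<le> K * exp (- \<beta> * t) * H_norm (ereal p) (z0, z1)"
      using decay[OF R p] by blast
    show "\<exists>K \<beta>. 0 < K \<and> 0 < \<beta> \<and> (\<forall>z0 z1 z zt. (z0, z1) \<in> H_space \<infinity> \<and> H_norm \<infinity> (z0, z1) \<le> R \<and> wave_solution \<infinity> a \<sigma> z0 z1 z zt \<longrightarrow>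
             (\<forall>t\<ge>0. H_norm (ereal p) (z t, zt t) \<le> K * exp (- \<beta> * t) * H_norm (ereal p) (z0, z1)))"
    proof (intro exI conjI allI impI)
      fix z0 z1 z zt and t :: real
      assume *: "(z0, z1) \<in> H_space \<infinity> \<and> H_norm \<infinity> (z0, z1) \<le> R \<and> wave_solution \<infinity> a \<sigma> z0 z1 z zt" and t: "0 \<le> t"
      then have sol: "wave_solution \<infinity> a \<sigma> z0 z1 z zt" by simp
      have "AE x in ivl 0 1. \<bar>wderiv z0 x\<bar> + \<bar>z1 x\<bar> \<le> R"
        using H_inf_init[of z0 z1] * by (auto elim!: AE_mp)
      from K(3)[OF sol solution_inf_reduces[OF a \<sigma> sol] this t]
      show "H_norm (ereal p) (z t, zt t) \<le> K * exp (- \<beta> * t) * H_norm (ereal p) (z0, z1)" .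
    qed (rule K)+
  next
    fix p R q :: real
    assume A: "2 < p \<and> R > 0 \<and> (\<forall>s1 s2. (\<sigma> s1 - \<sigma> s2) * (s1 - s2) \<ge> 0) \<and> (\<exists>m>0. \<forall>s. \<bar>\<sigma> s\<bar> \<le> m * \<bar>s\<bar>)"
      and q: "2 \<le> q \<and> q < p"
    then obtain m where m: "0 < m" "\<forall>s. \<bar>\<sigma> s\<bar> \<le> m * \<bar>s\<bar>" by blast
    have p1: "1 \<le> p" and R: "0 < R" and q2: "2 \<le> q" using A q by auto
    obtain K \<beta> where K: "0 < K" "0 < \<beta>" "\<And>P z0 z1 z zt t. wave_solution P a \<sigma> z0 z1 z zt \<Longrightarrow> reduces a \<sigma> z zt \<Longrightarrow>
         (AE x in ivl 0 1. \<bar>wderiv z0 x\<bar> + \<bar>z1 x\<bar> \<le> R) \<Longrightarrow> 0 \<le> t \<Longrightarrow>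
         H_norm (ereal q) (z t, zt t) \<le> K * exp (- \<beta> * t) * H_norm (ereal q) (z0, z1)"
      using decay[OF R q2] by blast
    show "\<exists>K \<beta>. 0 < K \<and> 0 < \<beta> \<and> (\<forall>z0 z1 z zt. (z0, z1) \<in> H_space (ereal p) \<inter> D_space 2 \<and> D_norm 2 (z0, z1) \<le> R \<and> wave_solution (ereal p) a \<sigma> z0 z1 z zt \<longrightarrow>
             (\<forall>t\<ge>0. H_norm (ereal q) (z t, zt t) \<le> K * exp (- \<beta> * t) * H_norm (ereal q) (z0, z1)))"
    proof (intro exI conjI allI impI)
      fix z0 z1 z zt and t :: real
      assume *: "(z0, z1) \<in> H_space (ereal p) \<inter> D_space 2 \<and> D_norm 2 (z0, z1) \<le> R \<and> wave_solution (ereal p) a \<sigma> z0 z1 z zt" and t: "0 \<le> t"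
      then have sol: "wave_solution (ereal p) a \<sigma> z0 z1 z zt" by simp
      have "AE x in ivl 0 1. \<bar>wderiv z0 x\<bar> + \<bar>z1 x\<bar> \<le> R"
        using D_2_init[of z0 z1] * by (auto elim!: AE_mp)
      from K(3)[OF sol solution_p_reduces[OF a \<sigma> m p1 sol] this t]
      show "H_norm (ereal q) (z t, zt t) \<le> K * exp (- \<beta> * t) * H_norm (ereal q) (z0, z1)" .
    qed (rule K)+
  qed
qed

end
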